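(* Let $\Sigma$ be a sofic approximation to $G$. For any $G$-systems $(X,\mu,T)$ and $(Y,\nu,S)$, $$\mathrm h^{\mathrm{dq}}_\Sigma(\mu\times\nu,T\times S)\le\mathrm h^{\mathrm{dq}}_\Sigma(\mu,T)+\mathrm h^{\mathrm{dq}}_\Sigma(\nu,S),$$ and similarly with $\mathrm h^{\mathrm{dq}}_\Sigma$ replaced by $\mathrm h^{\mathrm q}_\Sigma$. If $\mathrm h^{\mathrm{dq}}_\Sigma(\nu,S)=\underline{\mathrm h}^{\mathrm{dq}}_\Sigma(\nu,S)$, then in fact $$\mathrm h^{\mathrm{dq}}_\Sigma(\mu\times\nu,T\times S)=\mathrm h^{\mathrm{dq}}_\Sigma(\mu,T)+\mathrm h^{\mathrm{dq}}_\Sigma(\nu,S),$$ where the right-hand side is interpreted as $-\infty$ if either of its terms is $-\infty$. If $\mu\times\nu$ is ergodic, then the analogous result holds with $\mathrm h^{\mathrm{dq}}_\Sigma$ and $\underline{\mathrm h}^{\mathrm{dq}}_\Sigma$ replaced by $\mathrm h^{\mathrm q}_\Sigma$ and $\underline{\mathrm h}^{\mathrm q}_\Sigma$ throughout: if $\mathrm h^{\mathrm{q}}_\Sigma(\nu,S)=\underline{\mathrm h}^{\mathrm{q}}_\Sigma(\nu,S)$, then $\mathrm h^{\mathrm{q}}_\Sigma(\mu\times\nu,T\times S)=\mathrm h^{\mathrm{q}}_\Sigma(\mu,T)+\mathrm h^{\mathrm{q}}_\Sigma(\nu,S)$. In particular, this is the case if both $\mu$ and $\nu$ are ergodic and one of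 them is weakly mixing.
   Context: $G$ is a countable discrete sofic group. A sofic approximation $\Sigma=(\sigma_n)_{n\ge1}$ to $G$ is a sequence of nonempty finite sets $V_n$ and maps $\sigma_n:G\to\mathrm{Sym}(V_n)$, $g\mapsto\sigma_n^g$ (not necessarily homomorphisms), such that for all $g,h\in G$ the proportion of $v\in V_n$ with $\sigma_n^g(\sigma_n^h(v))=\sigma_n^{gh}(v)$ tends to $1$, and for all $g\ne e$ the proportion of $v\in V_n$ with $\sigma_n^g(v)\neq v$ tends to $1$. A $G$-system $(X,\mu,T)$ is a standard probability space with a measurable $\mu$-preserving action $T$ of $G$. A metric $G$-process $(\mathcal{X}^G,\mu,S,d)$ consists of a standard measurable space $\mathcal{X}$, a compact metric $d$ on $\mathcal X$ whose Borel $\sigma$-algebra is that of $\mathcal X$, the right-shift action $S^g((x_h)_{h})=(x_{hg})_{h}$, and an $S$-invariant probability measure $\mu$ on $\mathcal{X}^G$. $\mathcal{X}^G$ has the product topology from $d$, and $\mathrm{Prob}(\mathcal X^G)$ the resulting weak$^\ast$ topology. For a finite set $V$, a map $\sigma:G\to\mathrm{Sym}(V)$, $\mathbf{x}\in\mathcal{X}^V$, $v\in V$: $\Pi^\sigma_v(\mathbf{x})=(x_{\sigma^g(v)})_{g\in G}\in\mathcal{X}^G$; $P^\sigma_{\mathbf x}=\frac1{|V|}\sum_{v}\delta_{\Pi^\sigma_v(\mathbf x)}$; $\Omega(\mathcal O,\sigma)=\{\mathbf x\in\mathcal X^V: P^\sigma_{\mathbf x}\in\mathcal O\}$ for $\mathcal{O}\subseteq\mathrm{Prob}(\mathcal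 X^G)$; $d^{(V)}(\mathbf x,\mathbf x')=\frac1{|V|}\sum_v d(x_v,x'_v)$. For a Borel probability $\nu$ on a metric space $(Y,d_Y)$, $\mathrm{cov}_{\varepsilon,\delta}(\nu,d_Y)=\min\{|F|: F\subseteq Y,\ \nu(B_\delta(F))>1-\varepsilon\}$, with $B_\delta(F)$ the $\delta$-neighbourhood of $F$. A sequence $\mu_i\in\mathrm{Prob}(\mathcal X^{V_{n_i}})$ quenched converges to $\mu$ over $(\sigma_{n_i})_{i\ge1}$ if for every weak$^\ast$ neighbourhood $\mathcal O$ of $\mu$ the proportion of $v\in V_{n_i}$ with $(\Pi^{\sigma_{n_i}}_v)_\ast\mu_i\in\mathcal O$ tends to $1$ and $\mu_i(\Omega(\mathcal O,\sigma_{n_i}))\to1$. It doubly-quenched converges to $\mu$ if $\mu_i\times\mu_i\in\mathrm{Prob}((\mathcal X\times\mathcal X)^{V_{n_i}})$ quenched converges to $\mu\times\mu$ (on $(\mathcal X\times\mathcal X)^G$, with the average of the two copies of $d$). Model-measure sofic entropies of a metric $G$-process: $$\mathrm h^{\mathrm q}_\Sigma(\mu)=\sup\Big\{\sup_{\delta,\varepsilon>0}\limsup_{i\to\infty}\tfrac1{|V_{n_i}|}\log\mathrm{cov}_{\varepsilon,\delta}(\mu_i,d^{(V_{n_i})})\Big\},$$ the outer supremum being over all subsequences $n_i\uparrow\infty$ and all sequences $(\mu_i)$ quenched converging to $\mu$ over $(\sigma_{n_i})_{i\ge1}$; $\mathrm h^{\mathrm{dq}}_\Sigma(\mu)$ is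 defined identically with doubly-quenched convergence. Further $$\underline{\mathrm h}^{\mathrm{dq}}_\Sigma(\mu)=\sup\Big\{\sup_{\delta,\varepsilon>0}\liminf_{n\to\infty}\tfrac1{|V_n|}\log\mathrm{cov}_{\varepsilon,\delta}(\mu_n,d^{(V_n)})\Big\},$$ the outer supremum being over all sequences $\mu_n\in\mathrm{Prob}(\mathcal X^{V_n})$ doubly-quenched converging to $\mu$ over the whole of $\Sigma$; $\underline{\mathrm h}^{\mathrm q}_\Sigma(\mu)$ is defined identically with quenched convergence. Always $\sup\emptyset=-\infty$. These quantities do not depend on $d$ and are isomorphism invariants of the underlying system. Every $G$-system is isomorphic to a $G$-process (via $x\mapsto(T^hx)_{h\in G}\in X^G$), and the quantities for $(X,\mu,T)$ are defined as those of any isomorphic metric $G$-process. A sum with a term equal to $-\infty$ is interpreted as $-\infty$. *)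

theory Defs
  imports "HOL-Probability.Probability" "HOL-Algebra.Group"
begin

section \<open>Sofic approximations\<close>

text \<open>The finite sets are \<open>V n\<close>, and \<open>\<sigma> n g\<close> is the permutation of \<open>V n\<close> attached to \<open>g\<close>;
  its values off \<open>V n\<close> are irrelevant.\<close>

definition sofic_approximation ::
  "('g, 'm) monoid_scheme \<Rightarrow> (nat \<Rightarrow> 'v set) \<Rightarrow> (nat \<Rightarrow> 'g \<Rightarrow> 'v \<Rightarrow> 'v) \<Rightarrow> bool" where
  "sofic_approximation G V \<sigma> \<longleftrightarrow>
     (\<forall>n. finite (V n) \<and> V n \<noteq> {}) \<and>
     (\<forall>n. \<forall>g\<in>carrier G. bij_betw (\<sigma> n g) (V n) (V n)) \<and>
     (\<forall>g\<in>carrier G. \<forall>h\<in>carrier G.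
        (\<lambda>n. real (card {v \<in> V n. \<sigma> n g (\<sigma> n h v) = \<sigma> n (g \<otimes>\<^bsub>G\<^esub> h) v}) / real (card (V n)))
          \<longlonglongrightarrow> 1) \<and>
     (\<forall>g\<in>carrier G. g \<noteq> \<one>\<^bsub>G\<^esub> \<longrightarrow>
        (\<lambda>n. real (card {v \<in> V n. \<sigma> n g v \<noteq> v}) / real (card (V n))) \<longlonglongrightarrow> 1)"

section \<open>Measure-preserving systems\<close>

definition standard_measurable_space :: "'a measure \<Rightarrow> bool" where
  "standard_measurable_space M \<longleftrightarrow>
     (\<exists>\<T>. completely_metrizable_space \<T> \<and> second_countable \<T> \<and> topspace \<T> = space M \<and>
          sets M = sigma_sets (topspace \<T>) {U. openin \<T> U})"

definition G_system :: "('g, 'm) monoid_scheme \<Rightarrow> 'a measure \<Rightarrow> ('g \<Rightarrow> 'a \<Rightarrow> 'a) \<Rightarrow> bool" where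
  "G_system G M T \<longleftrightarrow>
     prob_space M \<and> standard_measurable_space M \<and>
     (\<forall>g\<in>carrier G. T g \<in> M \<rightarrow>\<^sub>M M \<and> distr M M (T g) = M) \<and>
     (\<forall>x\<in>space M. T \<one>\<^bsub>G\<^esub> x = x) \<and>
     (\<forall>g\<in>carrier G. \<forall>h\<in>carrier G. \<forall>x\<in>space M. T (g \<otimes>\<^bsub>G\<^esub> h) x = T g (T h x))"

definition prod_action :: "('g \<Rightarrow> 'a \<Rightarrow> 'a) \<Rightarrow> ('g \<Rightarrow> 'b \<Rightarrow> 'b) \<Rightarrow> 'g \<Rightarrow> 'a \<times> 'b \<Rightarrow> 'a \<times> 'b" where
  "prod_action T S g = (\<lambda>(x, y). (T g x, S g y))"

definition ergodic :: "('g, 'm) monoid_scheme \<Rightarrow> 'a measure \<Rightarrow> ('g \<Rightarrow> 'a \<Rightarrow> 'a) \<Rightarrow> bool" where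
  "ergodic G M T \<longleftrightarrow>
     (\<forall>A\<in>sets M. (\<forall>g\<in>carrier G. T g -` A \<inter> space M = A) \<longrightarrow> measure M A = 0 \<or> measure M A = 1)"

definition weakly_mixing :: "('g, 'm) monoid_scheme \<Rightarrow> 'a measure \<Rightarrow> ('g \<Rightarrow> 'a \<Rightarrow> 'a) \<Rightarrow> bool" where
  "weakly_mixing G M T \<longleftrightarrow> ergodic G (M \<Otimes>\<^sub>M M) (prod_action T T)"

text \<open>Isomorphism is understood modulo null sets.\<close>

definition isomorphic_systems ::
  "('g, 'm) monoid_scheme \<Rightarrow> 'a measure \<Rightarrow> ('g \<Rightarrow> 'a \<Rightarrow> 'a) \<Rightarrow> 'b measure \<Rightarrow> ('g \<Rightarrow> 'b \<Rightarrow> 'b) \<Rightarrow> bool"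
where
  "isomorphic_systems G M T N S \<longleftrightarrow>
     (\<exists>\<Phi> \<Psi>. \<Phi> \<in> M \<rightarrow>\<^sub>M N \<and> \<Psi> \<in> N \<rightarrow>\<^sub>M M \<and> distr M N \<Phi> = N \<and> distr N M \<Psi> = M \<and>
        (AE x in M. \<Psi> (\<Phi> x) = x) \<and> (AE y in N. \<Phi> (\<Psi> y) = y) \<and>
        (\<forall>g\<in>carrier G. AE x in M. \<Phi> (T g x) = S g (\<Phi> x)))"

section \<open>Metric processes\<close>

definition metric_borel :: "'a set \<Rightarrow> ('a \<Rightarrow> 'a \<Rightarrow> real) \<Rightarrow> 'a measure" where
  "metric_borel K d = sigma K {U. openin (Metric_space.mtopology K d) U}"

text \<open>The measurable space of configurations indexed by \<open>I\<close>, with \<open>I\<close> the group or a finite set.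
  Its elements are the functions in \<open>PiE I (\<lambda>_. K)\<close>, undefined off \<open>I\<close>.\<close>

abbreviation config :: "'i set \<Rightarrow> 'a set \<Rightarrow> ('a \<Rightarrow> 'a \<Rightarrow> real) \<Rightarrow> ('i \<Rightarrow> 'a) measure" where
  "config I K d \<equiv> PiM I (\<lambda>_. metric_borel K d)"

definition shift :: "('g, 'm) monoid_scheme \<Rightarrow> 'g \<Rightarrow> ('g \<Rightarrow> 'a) \<Rightarrow> 'g \<Rightarrow> 'a" where
  "shift G g x = (\<lambda>h\<in>carrier G. x (h \<otimes>\<^bsub>G\<^esub> g))"

text \<open>The state space is \<open>K\<close> with the Borel sigma-algebra of the compact metric \<open>d\<close>; it is
  automatically standard.\<close>

definition metric_process ::
  "('g, 'm) monoid_scheme \<Rightarrow> 'a set \<Rightarrow> ('a \<Rightarrow> 'a \<Rightarrow> real) \<Rightarrow> ('g \<Rightarrow> 'a) measure \<Rightarrow> bool" where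
  "metric_process G K d \<mu> \<longleftrightarrow>
     Metric_space K d \<and> compact_space (Metric_space.mtopology K d) \<and>
     \<mu> \<in> space (prob_algebra (config (carrier G) K d)) \<and>
     (\<forall>g\<in>carrier G. distr \<mu> \<mu> (shift G g) = \<mu>)"

text \<open>For a compact space continuous functions are bounded, so no boundedness is imposed on the
  test functions.\<close>

definition weak_star :: "'b measure \<Rightarrow> 'b topology \<Rightarrow> 'b measure topology" where
  "weak_star M \<T> = topology_generated_by
     {{\<mu> \<in> space (prob_algebra M). (\<integral>x. f x \<partial>\<mu>) \<in> U} | f U.
        continuous_map \<T> euclideanreal f \<and> open U}"

definition process_topology ::
  "('g, 'm) monoid_scheme \<Rightarrow> 'a set \<Rightarrow> ('a \<Rightarrow> 'a \<Rightarrow> real) \<Rightarrow> ('g \<Rightarrow> 'a) measure topology" where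
  "process_topology G K d =
     weak_star (config (carrier G) K d)
       (product_topology (\<lambda>_. Metric_space.mtopology K d) (carrier G))"

section \<open>Empirical distributions and good models\<close>

definition pullback_name ::
  "('g, 'm) monoid_scheme \<Rightarrow> ('g \<Rightarrow> 'v \<Rightarrow> 'v) \<Rightarrow> 'v \<Rightarrow> ('v \<Rightarrow> 'a) \<Rightarrow> 'g \<Rightarrow> 'a" where
  "pullback_name G s v x = (\<lambda>g\<in>carrier G. x (s g v))"

text \<open>Pushing the uniform measure on \<open>V\<close> forward along \<open>v \<mapsto> pullback_name G s v x\<close> gives the
  average of the point masses at the pullback names.\<close>

definition empirical ::
  "('g, 'm) monoid_scheme \<Rightarrow> 'a set \<Rightarrow> ('a \<Rightarrow> 'a \<Rightarrow> real) \<Rightarrow> 'v set \<Rightarrow> ('g \<Rightarrow> 'v \<Rightarrow> 'v) \<Rightarrow>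
    ('v \<Rightarrow> 'a) \<Rightarrow> ('g \<Rightarrow> 'a) measure" where
  "empirical G K d V s x =
     distr (uniform_count_measure V) (config (carrier G) K d) (\<lambda>v. pullback_name G s v x)"

definition good_models ::
  "('g, 'm) monoid_scheme \<Rightarrow> 'a set \<Rightarrow> ('a \<Rightarrow> 'a \<Rightarrow> real) \<Rightarrow> 'v set \<Rightarrow> ('g \<Rightarrow> 'v \<Rightarrow> 'v) \<Rightarrow>
    ('g \<Rightarrow> 'a) measure set \<Rightarrow> ('v \<Rightarrow> 'a) set" where
  "good_models G K d V s \<O> = {x \<in> PiE V (\<lambda>_. K). empirical G K d V s x \<in> \<O>}"

definition avg_metric :: "'v set \<Rightarrow> ('a \<Rightarrow> 'a \<Rightarrow> real) \<Rightarrow> ('v \<Rightarrow> 'a) \<Rightarrow> ('v \<Rightarrow> 'a) \<Rightarrow> real" where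
  "avg_metric V d x y = (\<Sum>v\<in>V. d (x v) (y v)) / real (card V)"

text \<open>In a totally bounded space, such as every space to which this is applied, the set whose
  least element is taken is nonempty.\<close>

definition cov :: "real \<Rightarrow> real \<Rightarrow> 'b set \<Rightarrow> ('b \<Rightarrow> 'b \<Rightarrow> real) \<Rightarrow> 'b measure \<Rightarrow> nat" where
  "cov \<epsilon> \<delta> Y d \<nu> =
     (LEAST k. \<exists>F. F \<subseteq> Y \<and> finite F \<and> card F = k \<and>
                   measure \<nu> {y \<in> Y. \<exists>x\<in>F. d x y < \<delta>} > 1 - \<epsilon>)"

section \<open>Convergence of measures on model spaces\<close>

definition quenched_converges ::
  "('g, 'm) monoid_scheme \<Rightarrow> 'a set \<Rightarrow> ('a \<Rightarrow> 'a \<Rightarrow> real) \<Rightarrow>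
    (nat \<Rightarrow> 'v set) \<Rightarrow> (nat \<Rightarrow> 'g \<Rightarrow> 'v \<Rightarrow> 'v) \<Rightarrow>
    (nat \<Rightarrow> ('v \<Rightarrow> 'a) measure) \<Rightarrow> ('g \<Rightarrow> 'a) measure \<Rightarrow> bool" where
  "quenched_converges G K d V \<sigma> m \<mu> \<longleftrightarrow>
     (\<forall>i. m i \<in> space (prob_algebra (config (V i) K d))) \<and>
     (\<forall>\<O>. openin (process_topology G K d) \<O> \<and> \<mu> \<in> \<O> \<longrightarrow>
        (\<lambda>i. real (card {v \<in> V i.
               distr (m i) (config (carrier G) K d) (pullback_name G (\<sigma> i) v) \<in> \<O>}) / real (card (V i)))
          \<longlonglongrightarrow> 1 \<and>
        (\<lambda>i. measure (m i) (good_models G K d (V i) (\<sigma> i) \<O>)) \<longlonglongrightarrow> 1)"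

definition avg_prod_metric ::
  "('a \<Rightarrow> 'a \<Rightarrow> real) \<Rightarrow> 'a \<times> 'a \<Rightarrow> 'a \<times> 'a \<Rightarrow> real" where
  "avg_prod_metric d = (\<lambda>(x, x') (y, y'). (d x y + d x' y') / 2)"

text \<open>The square of a measure on \<open>K\<close>-valued configurations, regarded as a measure on
  \<open>(K \<times> K)\<close>-valued configurations.\<close>

definition config_square ::
  "'i set \<Rightarrow> 'a set \<Rightarrow> ('a \<Rightarrow> 'a \<Rightarrow> real) \<Rightarrow> ('i \<Rightarrow> 'a) measure \<Rightarrow> ('i \<Rightarrow> 'a \<times> 'a) measure" where
  "config_square I K d \<mu> =
     distr (\<mu> \<Otimes>\<^sub>M \<mu>) (config I (K \<times> K) (avg_prod_metric d)) (\<lambda>(x, y). \<lambda>i\<in>I. (x i, y i))"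

definition doubly_quenched_converges ::
  "('g, 'm) monoid_scheme \<Rightarrow> 'a set \<Rightarrow> ('a \<Rightarrow> 'a \<Rightarrow> real) \<Rightarrow>
    (nat \<Rightarrow> 'v set) \<Rightarrow> (nat \<Rightarrow> 'g \<Rightarrow> 'v \<Rightarrow> 'v) \<Rightarrow>
    (nat \<Rightarrow> ('v \<Rightarrow> 'a) measure) \<Rightarrow> ('g \<Rightarrow> 'a) measure \<Rightarrow> bool" where
  "doubly_quenched_converges G K d V \<sigma> m \<mu> \<longleftrightarrow>
     (\<forall>i. m i \<in> space (prob_algebra (config (V i) K d))) \<and>
     quenched_converges G (K \<times> K) (avg_prod_metric d) V \<sigma>
       (\<lambda>i. config_square (V i) K d (m i)) (config_square (carrier G) K d \<mu>)"

section \<open>Model-measure sofic entropies\<close>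

text \<open>The logarithm with \<open>log 0 = -\<infinity>\<close>; the library's \<open>ln 0\<close> is \<open>0\<close>.\<close>

definition log_nat :: "nat \<Rightarrow> ereal" where
  "log_nat k = (if k = 0 then -\<infinity> else ereal (ln (real k)))"

definition cov_rate ::
  "((nat \<Rightarrow> ereal) \<Rightarrow> ereal) \<Rightarrow> 'a set \<Rightarrow> ('a \<Rightarrow> 'a \<Rightarrow> real) \<Rightarrow> (nat \<Rightarrow> 'v set) \<Rightarrow>
    (nat \<Rightarrow> ('v \<Rightarrow> 'a) measure) \<Rightarrow> ereal" where
  "cov_rate L K d V m =
     (SUP \<delta>\<in>{0<..}. SUP \<epsilon>\<in>{0<..}.
        L (\<lambda>i. log_nat (cov \<epsilon> \<delta> (PiE (V i) (\<lambda>_. K)) (avg_metric (V i) d) (m i))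
                 / ereal (real (card (V i)))))"

text \<open>The supremum of the empty set of extended reals is \<open>-\<infinity>\<close>.\<close>

definition h_q ::
  "('g, 'm) monoid_scheme \<Rightarrow> (nat \<Rightarrow> 'v set) \<Rightarrow> (nat \<Rightarrow> 'g \<Rightarrow> 'v \<Rightarrow> 'v) \<Rightarrow>
    'a set \<Rightarrow> ('a \<Rightarrow> 'a \<Rightarrow> real) \<Rightarrow> ('g \<Rightarrow> 'a) measure \<Rightarrow> ereal" where
  "h_q G V \<sigma> K d \<mu> =
     Sup {cov_rate limsup K d (V \<circ> r) m | r m.
            strict_mono r \<and> quenched_converges G K d (V \<circ> r) (\<sigma> \<circ> r) m \<mu>}"

definition h_dq ::
  "('g, 'm) monoid_scheme \<Rightarrow> (nat \<Rightarrow> 'v set) \<Rightarrow> (nat \<Rightarrow> 'g \<Rightarrow> 'v \<Rightarrow> 'v) \<Rightarrow>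
    'a set \<Rightarrow> ('a \<Rightarrow> 'a \<Rightarrow> real) \<Rightarrow> ('g \<Rightarrow> 'a) measure \<Rightarrow> ereal" where
  "h_dq G V \<sigma> K d \<mu> =
     Sup {cov_rate limsup K d (V \<circ> r) m | r m.
            strict_mono r \<and> doubly_quenched_converges G K d (V \<circ> r) (\<sigma> \<circ> r) m \<mu>}"

definition lower_h_q ::
  "('g, 'm) monoid_scheme \<Rightarrow> (nat \<Rightarrow> 'v set) \<Rightarrow> (nat \<Rightarrow> 'g \<Rightarrow> 'v \<Rightarrow> 'v) \<Rightarrow>
    'a set \<Rightarrow> ('a \<Rightarrow> 'a \<Rightarrow> real) \<Rightarrow> ('g \<Rightarrow> 'a) measure \<Rightarrow> ereal" where
  "lower_h_q G V \<sigma> K d \<mu> =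
     Sup {cov_rate liminf K d V m | m. quenched_converges G K d V \<sigma> m \<mu>}"

definition lower_h_dq ::
  "('g, 'm) monoid_scheme \<Rightarrow> (nat \<Rightarrow> 'v set) \<Rightarrow> (nat \<Rightarrow> 'g \<Rightarrow> 'v \<Rightarrow> 'v) \<Rightarrow>
    'a set \<Rightarrow> ('a \<Rightarrow> 'a \<Rightarrow> real) \<Rightarrow> ('g \<Rightarrow> 'a) measure \<Rightarrow> ereal" where
  "lower_h_dq G V \<sigma> K d \<mu> =
     Sup {cov_rate liminf K d V m | m. doubly_quenched_converges G K d V \<sigma> m \<mu>}"

text \<open>Entropies of a system are those of any metric process isomorphic to it.\<close>

definition represents_system ::
  "('g, 'm) monoid_scheme \<Rightarrow> 'a set \<Rightarrow> ('a \<Rightarrow> 'a \<Rightarrow> real) \<Rightarrow> ('g \<Rightarrow> 'a) measure \<Rightarrow>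
    'b measure \<Rightarrow> ('g \<Rightarrow> 'b \<Rightarrow> 'b) \<Rightarrow> bool" where
  "represents_system G K d \<mu> M T \<longleftrightarrow>
     metric_process G K d \<mu> \<and> isomorphic_systems G M T \<mu> (shift G)"

text \<open>Addition with \<open>-\<infinity>\<close> absorbing; the library has \<open>\<infinity> + (-\<infinity>) = \<infinity>\<close>.\<close>

definition plus_minf :: "ereal \<Rightarrow> ereal \<Rightarrow> ereal" (infixl "\<oplus>\<^sub>-" 65) where
  "a \<oplus>\<^sub>- b = (if a = -\<infinity> \<or> b = -\<infinity> then -\<infinity> else a + b)"

end

theory Submission
  imports Defs
begin

text \<open>
  The entropies in the theorem are computed from one metric process for each system, and the process of the
  product system is an arbitrary one. The proof therefore compares good models of that process with
  pairs of good models of the factors.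

  Weak-star neighbourhoods are first replaced by moments. Countably many separating continuous functions on a
  compact state space generate a dense algebra of polynomials in the coordinates of a name, so quenched
  convergence says two things about every monomial: its expectation at most vertices is close to the limit moment,
  and its average over the vertices concentrates (\<open>quenched_moments\<close>, \<open>quenched_of_moments\<close>). Doubly quenched
  convergence replaces concentration by decorrelation at most pairs of vertices
  (\<open>doubly_quenched_moments\<close>, \<open>doubly_quenched_of_moments\<close>).

  Let now \<open>P i\<close> be probability measures carrying arrays \<open>X j\<close>, indexed by the vertices, whose local moments converge to
  those of observables \<open>c j\<close> on a system \<open>\<Omega>\<close>, and suppose that the translates of the observables generate the
  measurable sets of \<open>\<Omega>\<close> up to null sets. Polynomials in the translates are then dense in \<open>L\<^sup>1\<close>
  (\<open>polynomials_dense\<close>), and evaluating the same polynomials on the arrays gives an isometric correspondence between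
  bounded functions on \<open>\<Omega>\<close> and arrays modulo vanishing mean distance (\<open>tracks\<close>, \<open>tracks_adist\<close>). It has two
  consequences. Every measurable map from \<open>\<Omega>\<close> to a compact metric space is tracked by a field over the models
  (\<open>tracking_field\<close>), and the law of that field converges to the law of the corresponding process
  (\<open>conv_field\<close>). Conversely, a tracking field is a uniformly continuous function of any tracking family
  whose observables generate, up to small measure and small mean distance (\<open>asymptotically_determined\<close>).

  For the upper bound this is applied to models of the process of the product. The fields that track the two factors
  are models of the factors and together determine the given models, so the covering numbers are submultiplicative
  (\<open>factor_models\<close>). For the lower bound it is applied to products of models of the factors. Independence
  gives the local moments of the product system, and both coordinates are determined by a field that tracks the product, so the
  covering numbers of that field are at least the product of those of the factors by a packing argument
  (\<open>product_models\<close>, \<open>cov_product_lower\<close>). The field is a model of the product because decorrelation is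
  inherited by products (\<open>pair_conv_ten\<close>) in the doubly quenched case. In the quenched case
  concentration is supplied by ergodicity: vertex averages are unchanged by translation, and suitable averages of translates of
  a function are close to its mean (\<open>ergodic_mean_conv\<close>).

  The models of the two factors must live over the same subsequence of the sofic approximation, which is why the lower
  entropy of one factor appears (\<open>cov_rates_add\<close>). The ergodicity of a product with a weakly mixing factor is
  \<open>ergodic_product\<close>.
\<close>

section \<open>Coordinates on compact spaces\<close>

lemma continuous_map_into_reals_of_coordinates:
  fixes C :: "'j \<Rightarrow> 'a \<Rightarrow> real"
  assumes "\<And>j. continuous_map X euclideanreal (C j)"
  shows "continuous_map X euclidean (\<lambda>x j. C j x)"
  using assms continuous_map_componentwise_UNIV[of X "\<lambda>_. euclideanreal" "\<lambda>x j. C j x"]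
  by (simp add: euclidean_product_topology)

lemma separating_coordinates_homeomorphic_map:
  fixes C :: "'j \<Rightarrow> 'a \<Rightarrow> real"
  assumes "compact_space X" and cont: "\<And>j. continuous_map X euclideanreal (C j)"
    and sep: "\<And>x y. x \<in> topspace X \<Longrightarrow> y \<in> topspace X \<Longrightarrow> x \<noteq> y \<Longrightarrow> \<exists>j. C j x \<noteq> C j y"
  shows "homeomorphic_map X (top_of_set ((\<lambda>x j. C j x) ` topspace X)) (\<lambda>x j. C j x)"
proof (rule continuous_imp_homeomorphic_map)
  show "continuous_map X (top_of_set ((\<lambda>x j. C j x) ` topspace X)) (\<lambda>x j. C j x)"
    using continuous_map_into_reals_of_coordinates[OF cont] by (simp add: continuous_map_in_subtopology)
  show "Hausdorff_space (top_of_set ((\<lambda>x j. C j x) ` topspace X))"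
    by (intro Hausdorff_space_subtopology) (simp add: euclidean_product_topology[symmetric] Hausdorff_space_product_topology)
  show "inj_on (\<lambda>x j. C j x) (topspace X)"
    using sep by (intro inj_onI) (metis (no_types))
qed (use assms in auto)

text \<open>A continuous injection of a compact space into a Hausdorff space is an embedding. This is what turns open sets of an
  abstract topology into open sets of real families.\<close>

lemma openin_iff_coordinates:
  fixes C :: "'j \<Rightarrow> 'a \<Rightarrow> real"
  assumes "compact_space X" and cont: "\<And>j. continuous_map X euclideanreal (C j)"
    and sep: "\<And>x y. x \<in> topspace X \<Longrightarrow> y \<in> topspace X \<Longrightarrow> x \<noteq> y \<Longrightarrow> \<exists>j. C j x \<noteq> C j y"
    and U: "openin X U"
  obtains W where "open W" "U = {x \<in> topspace X. (\<lambda>j. C j x) \<in> W}"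
proof -
  let ?e = "\<lambda>x j. C j x"
  have h: "homeomorphic_map X (top_of_set (?e ` topspace X)) ?e"
    by (rule separating_coordinates_homeomorphic_map[OF assms(1) cont sep])
  have sub: "U \<subseteq> topspace X" using U by (rule openin_subset)
  have "openin (top_of_set (?e ` topspace X)) (?e ` U)"
    using homeomorphic_map_openness[OF h sub] U by blast
  then obtain W where W: "open W" "?e ` U = (?e ` topspace X) \<inter> W"
    by (auto simp: openin_open)
  have inj: "inj_on ?e (topspace X)" using h by (simp add: homeomorphic_eq_everything_map)
  have "U = {x \<in> topspace X. ?e x \<in> W}"
  proof safe
    fix x assume "x \<in> U" then show "x \<in> topspace X" "?e x \<in> W" using sub W by blast+
  next
    fix x assume x: "x \<in> topspace X" "?e x \<in> W"
    then have "?e x \<in> ?e ` U" using W by blast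
    then show "x \<in> U" using inj sub x by (meson inj_on_image_mem_iff)
  qed
  with W show ?thesis using that by blast
qed

text \<open>The theorem of Stone and Weierstrass on the compact image of the coordinate embedding, transported back to the
  abstract topology.\<close>

lemma Stone_Weierstrass_coordinates:
  fixes C :: "'j::countable \<Rightarrow> 'a \<Rightarrow> real"
  assumes "compact_space X" and cont: "\<And>j. continuous_map X euclideanreal (C j)"
    and sep: "\<And>x y. x \<in> topspace X \<Longrightarrow> y \<in> topspace X \<Longrightarrow> x \<noteq> y \<Longrightarrow> \<exists>j. C j x \<noteq> C j y"
    and R: "\<And>j. C j \<in> R" "\<And>c. (\<lambda>_. c) \<in> R"
      "\<And>f g. f \<in> R \<Longrightarrow> g \<in> R \<Longrightarrow> (\<lambda>x. f x + g x) \<in> R"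
      "\<And>f g. f \<in> R \<Longrightarrow> g \<in> R \<Longrightarrow> (\<lambda>x. f x * g x) \<in> R"
    and f: "continuous_map X euclideanreal f" and "\<epsilon> > 0"
  obtains g where "g \<in> R" "\<And>x. x \<in> topspace X \<Longrightarrow> \<bar>f x - g x\<bar> < \<epsilon>"
proof -
  let ?e = "\<lambda>x j. C j x"
  define S where "S = ?e ` topspace X"
  have h: "homeomorphic_map X (top_of_set S) ?e"
    unfolding S_def by (rule separating_coordinates_homeomorphic_map[OF assms(1) cont sep])
  have inj: "inj_on ?e (topspace X)" using h by (simp add: homeomorphic_eq_everything_map)
  have compS: "compact S"
    using image_compactin[OF _ continuous_map_into_reals_of_coordinates[OF cont], of "topspace X"] assms(1)
    by (simp add: S_def compact_space_def)
  define R' where "R' = {F :: ('j \<Rightarrow> real) \<Rightarrow> real. continuous_on S F \<and> (\<lambda>x. F (?e x)) \<in> R}"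
  interpret function_ring_on R' S
  proof
    fix x y assume xy: "x \<in> S" "y \<in> S" "x \<noteq> y"
    then obtain j where j: "x j \<noteq> y j" by blast
    have "(\<lambda>x. x j) \<in> R'" unfolding R'_def using R(1)[of j]
      by (auto intro: continuous_on_product_coordinates continuous_on_subset)
    with j show "\<exists>f\<in>R'. f x \<noteq> f y" by (intro bexI[of _ "\<lambda>x. x j"]) simp_all
  next
    show "compact S" by (rule compS)
    show "continuous_on S f" if "f \<in> R'" for f using that by (simp add: R'_def)
    show "(\<lambda>x. f x + g x) \<in> R'" if "f \<in> R'" "g \<in> R'" for f g
      using that R(3)[of "\<lambda>x. f (?e x)" "\<lambda>x. g (?e x)"] by (simp add: R'_def continuous_on_add)
    show "(\<lambda>x. f x * g x) \<in> R'" if "f \<in> R'" "g \<in> R'" for f g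
      using that R(4)[of "\<lambda>x. f (?e x)" "\<lambda>x. g (?e x)"] by (simp add: R'_def continuous_on_mult)
    show "(\<lambda>_. c) \<in> R'" for c using R(2) by (simp add: R'_def)
  qed
  define F0 where "F0 = f \<circ> inv_into (topspace X) ?e"
  have F0e: "F0 (?e x) = f x" if "x \<in> topspace X" for x
    unfolding F0_def comp_def using inv_into_f_f[OF inj that] by simp
  have "continuous_map (top_of_set S) euclideanreal F0"
    unfolding continuous_map_def
  proof safe
    fix U :: "real set" assume "openin euclideanreal U"
    then have o: "openin X {x \<in> topspace X. f x \<in> U}" using f by (simp add: continuous_map_def)
    have "openin (top_of_set S) (?e ` {x \<in> topspace X. f x \<in> U})"
      using homeomorphic_map_openness[OF h openin_subset[OF o]] o by blast
    also have "?e ` {x \<in> topspace X. f x \<in> U} = {s \<in> topspace (top_of_set S). F0 s \<in> U}"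
      using F0e by (auto simp: S_def)
    finally show "openin (top_of_set S) {s \<in> topspace (top_of_set S). F0 s \<in> U}" .
  qed auto
  then have "continuous_on S F0" by simp
  from Stone_Weierstrass[OF this] obtain F where F: "\<And>n. F n \<in> R'" "uniform_limit S F F0 sequentially"
    by blast
  then obtain n where n: "\<forall>x\<in>S. dist (F n x) (F0 x) < \<epsilon>"
    using \<open>\<epsilon> > 0\<close> unfolding uniform_limit_iff eventually_sequentially by blast
  show ?thesis
  proof (rule that[of "\<lambda>x. F n (?e x)"])
    show "(\<lambda>x. F n (?e x)) \<in> R" using F(1)[of n] by (simp add: R'_def)
    fix x assume x: "x \<in> topspace X"
    then have "dist (F n (?e x)) (F0 (?e x)) < \<epsilon>" using n by (auto simp: S_def)
    then show "\<bar>f x - F n (?e x)\<bar> < \<epsilon>" using F0e[OF x] by (simp add: dist_real_def abs_minus_commute)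
  qed
qed

section \<open>Polynomials in countably many variables\<close>

text \<open>Monomials are lists of variables and polynomials are lists of coefficients with monomials, so that products and
  substitutions are operations on lists.\<close>

definition mval :: "('z \<Rightarrow> real) \<Rightarrow> 'z list \<Rightarrow> real" where
  "mval \<rho> t = (\<Prod>z\<leftarrow>t. \<rho> z)"

definition pval :: "('z \<Rightarrow> real) \<Rightarrow> (real \<times> 'z list) list \<Rightarrow> real" where
  "pval \<rho> p = (\<Sum>(c, t)\<leftarrow>p. c * mval \<rho> t)"

definition pmul :: "(real \<times> 'z list) list \<Rightarrow> (real \<times> 'z list) list \<Rightarrow> (real \<times> 'z list) list" where
  "pmul p q = concat (map (\<lambda>(c, s). map (\<lambda>(e, t). (c * e, s @ t)) q) p)"

lemma mval_simps [simp]: "mval \<rho> [] = 1" "mval \<rho> (z # t) = \<rho> z * mval \<rho> t"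
  by (simp_all add: mval_def)

lemma mval_append: "mval \<rho> (s @ t) = mval \<rho> s * mval \<rho> t"
  by (simp add: mval_def)

lemma mval_map: "mval \<rho> (map f t) = mval (\<lambda>z. \<rho> (f z)) t"
  by (induction t) simp_all

lemma pval_simps [simp]: "pval \<rho> [] = 0" "pval \<rho> ((c, t) # p) = c * mval \<rho> t + pval \<rho> p"
  by (simp_all add: pval_def)

lemma pval_append: "pval \<rho> (p @ q) = pval \<rho> p + pval \<rho> q"
  by (simp add: pval_def)

lemma pval_pmul: "pval \<rho> (pmul p q) = pval \<rho> p * pval \<rho> q"
proof (induction p)
  case Nil then show ?case by (simp add: pmul_def)
next
  case (Cons a p)
  obtain c s where a: "a = (c, s)" by (cases a)
  have "pval \<rho> (map (\<lambda>(e, t). (c * e, s @ t)) q) = c * mval \<rho> s * pval \<rho> q"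
    by (induction q) (auto simp: mval_append algebra_simps)
  moreover have "pmul (a # p) q = map (\<lambda>(e, t). (c * e, s @ t)) q @ pmul p q"
    by (simp add: pmul_def a)
  ultimately show ?case using Cons by (simp add: pval_append a algebra_simps)
qed

definition pvars :: "(real \<times> 'z list) list \<Rightarrow> 'z set" where
  "pvars p = (\<Union>(c, t)\<in>set p. set t)"

abbreviation over :: "('g, 'm) monoid_scheme \<Rightarrow> ('g \<times> 'j) list \<Rightarrow> bool" where
  "over G t \<equiv> fst ` set t \<subseteq> carrier G"

abbreviation pover :: "('g, 'm) monoid_scheme \<Rightarrow> (real \<times> ('g \<times> 'j) list) list \<Rightarrow> bool" where
  "pover G p \<equiv> fst ` pvars p \<subseteq> carrier G"

lemma pvars_simps [simp]: "pvars [] = {}" "pvars ((c, t) # p) = set t \<union> pvars p"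
  "pvars (p @ q) = pvars p \<union> pvars q"
  by (auto simp: pvars_def)

lemma pvars_pmul: "pvars (pmul p q) \<subseteq> pvars p \<union> pvars q"
  by (fastforce simp: pvars_def pmul_def)

lemma mval_cong: "(\<And>z. z \<in> set t \<Longrightarrow> \<rho> z = \<rho>' z) \<Longrightarrow> mval \<rho> t = mval \<rho>' t"
  by (induction t) auto

lemma mval_bounded:
  assumes "\<And>z. z \<in> set t \<Longrightarrow> \<exists>B. \<forall>x\<in>X. \<bar>\<rho> x z\<bar> \<le> B"
  shows "\<exists>B. \<forall>x\<in>X. \<bar>mval (\<rho> x) t\<bar> \<le> (B::real)"
  using assms
proof (induction t)
  case Nil then show ?case by auto
next
  case (Cons z t)
  then obtain B B' where "\<forall>x\<in>X. \<bar>\<rho> x z\<bar> \<le> B" "\<forall>x\<in>X. \<bar>mval (\<rho> x) t\<bar> \<le> B'" by (meson list.set_intros)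
  then have "\<bar>mval (\<rho> x) (z # t)\<bar> \<le> \<bar>B\<bar> * \<bar>B'\<bar>" if "x \<in> X" for x
    unfolding mval_simps abs_mult using that by (intro mult_mono) force+
  then show ?case by blast
qed

lemma mval_measurable:
  assumes "\<And>z. z \<in> set t \<Longrightarrow> (\<lambda>x. \<rho> x z) \<in> borel_measurable M"
  shows "(\<lambda>x. mval (\<rho> x) t) \<in> borel_measurable M"
  using assms by (induction t) auto

lemma mval_continuous_map:
  assumes "\<And>z. z \<in> set t \<Longrightarrow> continuous_map X euclideanreal (\<lambda>x. \<rho> x z)"
  shows "continuous_map X euclideanreal (\<lambda>x. mval (\<rho> x) t)"
  using assms by (induction t) (auto intro!: continuous_map_real_mult)

section \<open>Moments and the weak-star topology\<close>

text \<open>Countably many separating functions describe both the topology and the Borel sets of a compact metric space. Keeping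
  them abstract makes the arguments below available for the square of the space as well.\<close>

locale coordinates =
  fixes K :: "'a set" and d :: "'a \<Rightarrow> 'a \<Rightarrow> real" and C :: "'j::countable \<Rightarrow> 'a \<Rightarrow> real"
  assumes metric: "Metric_space K d"
    and compact: "compact_space (Metric_space.mtopology K d)"
    and cont: "\<And>j. continuous_map (Metric_space.mtopology K d) euclideanreal (C j)"
    and separating: "\<And>x y. x \<in> K \<Longrightarrow> y \<in> K \<Longrightarrow> x \<noteq> y \<Longrightarrow> \<exists>j. C j x \<noteq> C j y"
begin

lemma topspace_K [simp]: "topspace (Metric_space.mtopology K d) = K"
  using Metric_space.topspace_mtopology[OF metric] .

lemma space_metric_borel [simp]: "space (metric_borel K d) = K"
  by (simp add: metric_borel_def space_measure_of_conv)

lemma sets_metric_borel: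
  "sets (metric_borel K d) = sigma_sets K {U. openin (Metric_space.mtopology K d) U}"
  unfolding metric_borel_def
  by (rule sets_measure_of) (use openin_subset[of "Metric_space.mtopology K d"] in auto)

lemma space_config: "space (config I K d) = PiE I (\<lambda>_. K)"
  by (simp add: space_PiM)

lemma coordinate_measurable: "C j \<in> borel_measurable (metric_borel K d)"
proof (rule borel_measurableI)
  fix S :: "real set" assume "open S"
  then have "openin (Metric_space.mtopology K d) {x \<in> K. C j x \<in> S}"
    using cont[of j] by (simp add: continuous_map_def)
  moreover have "C j -` S \<inter> space (metric_borel K d) = {x \<in> K. C j x \<in> S}" by auto
  ultimately show "C j -` S \<inter> space (metric_borel K d) \<in> sets (metric_borel K d)"
    by (auto simp: sets_metric_borel)
qed

lemma config_coordinate_measurable: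
  "i \<in> I \<Longrightarrow> (\<lambda>x. C j (x i)) \<in> borel_measurable (config I K d)"
  by (rule measurable_compose[OF _ coordinate_measurable]) (rule measurable_component_singleton)

lemma measurable_metric_borelI:
  assumes "\<And>z. z \<in> space N \<Longrightarrow> f z \<in> K"
    and "\<And>j. (\<lambda>z. C j (f z)) \<in> borel_measurable N"
  shows "f \<in> N \<rightarrow>\<^sub>M metric_borel K d"
  unfolding metric_borel_def
proof (rule measurable_measure_of)
  show "{U. openin (Metric_space.mtopology K d) U} \<subseteq> Pow K"
    using openin_subset[of "Metric_space.mtopology K d"] by auto
  show "f \<in> space N \<rightarrow> K" using assms(1) by auto
  fix U assume "U \<in> {U. openin (Metric_space.mtopology K d) U}"
  then obtain W where W: "open W" "U = {x \<in> K. (\<lambda>j. C j x) \<in> W}"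
    using openin_iff_coordinates[where C=C, OF compact cont _ , of U] separating by auto
  have "(\<lambda>z j. C j (f z)) \<in> borel_measurable N"
    using assms(2) by (intro measurable_coordinatewise_then_product)
  then have "(\<lambda>z j. C j (f z)) -` W \<inter> space N \<in> sets N"
    using W(1) by (auto intro: measurable_sets)
  also have "(\<lambda>z j. C j (f z)) -` W \<inter> space N = f -` U \<inter> space N"
    using assms(1) W(2) by auto
  finally show "f -` U \<inter> space N \<in> sets N" .
qed

lemma coordinate_bounded: "\<exists>B. \<forall>x\<in>K. \<bar>C j x\<bar> \<le> B"
proof -
  have "compactin euclideanreal (C j ` K)"
    using image_compactin[OF _ cont, of K] compact by (simp add: compact_space_def)
  then have "bounded (C j ` K)" by (simp add: compact_imp_bounded)
  then show ?thesis by (auto simp: bounded_iff)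
qed

end

locale process_coordinates = coordinates K d C
  for K :: "'a set" and d :: "'a \<Rightarrow> 'a \<Rightarrow> real" and C :: "'j::countable \<Rightarrow> 'a \<Rightarrow> real" +
  fixes G :: "('g, 'm) monoid_scheme"
  assumes group: "group G" and countable: "countable (carrier G)"
begin

abbreviation X where "X \<equiv> product_topology (\<lambda>_. Metric_space.mtopology K d) (carrier G)"
abbreviation names where "names \<equiv> config (carrier G) K d"

definition el :: "nat \<Rightarrow> 'g" where "el = from_nat_into (carrier G)"

lemma carrier_nonempty: "carrier G \<noteq> {}"
  using group group.is_monoid monoid.carrier_not_empty by blast

lemma el_carrier [simp]: "el n \<in> carrier G"
  unfolding el_def by (rule from_nat_into[OF carrier_nonempty])

lemma el_surj: "g \<in> carrier G \<Longrightarrow> \<exists>n. el n = g"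
  unfolding el_def using from_nat_into_surj[OF countable] by blast

definition coord :: "'g \<times> 'j \<Rightarrow> ('g \<Rightarrow> 'a) \<Rightarrow> real" where
  "coord z x = C (snd z) (x (fst z))"

text \<open>Products of lines are second countable only over a countable index type, which the type of the group elements need not be.\<close>

definition ncoord :: "nat \<times> 'j \<Rightarrow> ('g \<Rightarrow> 'a) \<Rightarrow> real" where
  "ncoord z x = C (snd z) (x (el (fst z)))"

lemma X_compact: "compact_space X"
  using compact by (simp add: compact_space_product_topology)

lemma coord_continuous: "fst z \<in> carrier G \<Longrightarrow> continuous_map X euclideanreal (coord z)"
  unfolding coord_def
  using continuous_map_compose[OF continuous_map_product_projection[of "fst z" "carrier G"] cont[of "snd z"]]
  by (simp add: comp_def)

lemma ncoord_coord: "ncoord z = coord (apfst el z)"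
  by (auto simp: ncoord_def coord_def)

lemma ncoord_continuous: "continuous_map X euclideanreal (ncoord z)"
  unfolding ncoord_coord by (rule coord_continuous) simp

lemma ncoord_separating:
  assumes "x \<in> topspace X" "y \<in> topspace X" "x \<noteq> y" shows "\<exists>z. ncoord z x \<noteq> ncoord z y"
proof -
  obtain g where g: "g \<in> carrier G" "x g \<noteq> y g"
    using assms PiE_ext[of x "carrier G" "\<lambda>_. K" y] by auto
  obtain n where "el n = g" using el_surj g by blast
  moreover obtain j where "C j (x g) \<noteq> C j (y g)" using g assms separating[of "x g" "y g"] by auto
  ultimately show ?thesis by (intro exI[of _ "(n, j)"]) (simp add: ncoord_def)
qed

lemma continuous_measurable:
  assumes "continuous_map X euclideanreal f" shows "f \<in> borel_measurable names"
proof (rule borel_measurableI)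
  fix S :: "real set" assume "open S"
  then have U: "openin X {x \<in> topspace X. f x \<in> S}" using assms by (simp add: continuous_map_def)
  obtain W where W: "open W" "{x \<in> topspace X. f x \<in> S} = {x \<in> topspace X. (\<lambda>z. ncoord z x) \<in> W}"
    by (rule openin_iff_coordinates[where C = ncoord and X = X, OF X_compact ncoord_continuous _ U])
      (rule ncoord_separating)
  have "(\<lambda>x z. ncoord z x) \<in> borel_measurable names"
    by (intro measurable_coordinatewise_then_product)
      (auto simp: ncoord_def intro: config_coordinate_measurable)
  then have "(\<lambda>x z. ncoord z x) -` W \<inter> space names \<in> sets names"
    using W(1) by (auto intro: measurable_sets)
  also have "(\<lambda>x z. ncoord z x) -` W \<inter> space names = f -` S \<inter> space names"
    using W(2) by (auto simp: space_config)
  finally show "f -` S \<inter> space names \<in> sets names" .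
qed

lemma continuous_bounded:
  assumes "continuous_map X euclideanreal f" shows "\<exists>B. \<forall>x\<in>space names. \<bar>f x\<bar> \<le> B"
proof -
  have "compactin euclideanreal (f ` topspace X)"
    using image_compactin[OF _ assms, of "topspace X"] X_compact by (simp add: compact_space_def)
  then have "bounded (f ` topspace X)" by (simp add: compact_imp_bounded)
  then show ?thesis by (auto simp: bounded_iff space_config)
qed

lemma mval_coord_continuous:
  assumes "over G t"
  shows "continuous_map X euclideanreal (\<lambda>x. mval (\<lambda>z. coord z x) t)"
  using assms by (intro mval_continuous_map coord_continuous) auto

lemma mval_ncoord_continuous: "continuous_map X euclideanreal (\<lambda>x. mval (\<lambda>z. ncoord z x) t)"
  by (intro mval_continuous_map ncoord_continuous)

lemma continuous_integrable:
  assumes "continuous_map X euclideanreal f" "\<mu>' \<in> space (prob_algebra names)"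
  shows "integrable \<mu>' f"
proof -
  have p: "prob_space \<mu>'" "sets \<mu>' = sets names" using assms(2) by (auto simp: space_prob_algebra)
  then interpret prob_space \<mu>' by simp
  obtain B where "\<forall>x\<in>space names. \<bar>f x\<bar> \<le> B" using continuous_bounded[OF assms(1)] by blast
  moreover have "f \<in> borel_measurable \<mu>'"
    using continuous_measurable[OF assms(1)] measurable_cong_sets[OF p(2) refl] by blast
  ultimately show ?thesis using sets_eq_imp_space_eq[OF p(2)]
    by (intro integrable_const_bound[of _ B]) auto
qed

lemma openin_process_topology_integral:
  assumes "continuous_map X euclideanreal f" "open U"
  shows "openin (process_topology G K d) {\<mu>' \<in> space (prob_algebra names). (\<integral>x. f x \<partial>\<mu>') \<in> U}"
  unfolding process_topology_def weak_star_def using assms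
  by (intro topology_generated_by_Basis) blast

lemma polynomial_approximation:
  assumes "continuous_map X euclideanreal f" "\<epsilon> > 0"
  obtains p where "\<And>x. x \<in> space names \<Longrightarrow> \<bar>f x - pval (\<lambda>z. ncoord z x) p\<bar> < \<epsilon>"
proof -
  let ?R = "range (\<lambda>p x. pval (\<lambda>z. ncoord z x) p)"
  have "\<exists>g\<in>?R. \<forall>x\<in>topspace X. \<bar>f x - g x\<bar> < \<epsilon>"
  proof (rule Stone_Weierstrass_coordinates[where C = ncoord and X = X, OF X_compact ncoord_continuous ncoord_separating _ _ _ _ assms, of ?R])
    show "ncoord j \<in> ?R" for j
      by (intro image_eqI[of _ _ "[(1, [j])]"]) auto
    show "(\<lambda>_. c) \<in> ?R" for c
      by (intro image_eqI[of _ _ "[(c, [])]"]) auto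
    show "(\<lambda>x. f x + g x) \<in> ?R" if fg: "f \<in> ?R" "g \<in> ?R" for f g
    proof -
      obtain p q where "f = (\<lambda>x. pval (\<lambda>z. ncoord z x) p)" "g = (\<lambda>x. pval (\<lambda>z. ncoord z x) q)"
        using fg by auto
      then show ?thesis by (intro image_eqI[of _ _ "p @ q"]) (auto simp: pval_append)
    qed
    show "(\<lambda>x. f x * g x) \<in> ?R" if fg: "f \<in> ?R" "g \<in> ?R" for f g
    proof -
      obtain p q where "f = (\<lambda>x. pval (\<lambda>z. ncoord z x) p)" "g = (\<lambda>x. pval (\<lambda>z. ncoord z x) q)"
        using fg by auto
      then show ?thesis by (intro image_eqI[of _ _ "pmul p q"]) (auto simp: pval_pmul)
    qed
  qed auto
  then show ?thesis using that by (auto simp: space_config)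
qed

lemma continuous_pval: "continuous_map X euclideanreal (\<lambda>x. pval (\<lambda>z. ncoord z x) p)"
proof (induction p)
  case (Cons a p)
  then show ?case
    by (cases a) (auto intro!: continuous_map_add continuous_map_real_mult mval_ncoord_continuous)
qed auto

definition lin :: "(real \<times> 't) list \<Rightarrow> ('t \<Rightarrow> real) \<Rightarrow> real" where
  "lin p y = (\<Sum>(c, t)\<leftarrow>p. c * y t)"

lemma continuous_lin: "continuous_on UNIV (lin p)"
  unfolding lin_def
  by (induction p) (auto intro!: continuous_intros continuous_on_product_coordinates)

lemma integral_pval:
  assumes "\<mu>' \<in> space (prob_algebra names)"
  shows "(\<integral>x. pval (\<lambda>z. ncoord z x) p \<partial>\<mu>') = lin p (\<lambda>t. \<integral>x. mval (\<lambda>z. ncoord z x) t \<partial>\<mu>')"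
proof (induction p)
  case (Cons a p)
  obtain c t where a: "a = (c, t)" by (cases a)
  have "integrable \<mu>' (\<lambda>x. c * mval (\<lambda>z. ncoord z x) t)"
    by (intro integrable_mult_right continuous_integrable[OF mval_ncoord_continuous assms])
  then show ?case using Cons continuous_integrable[OF continuous_pval assms, of p]
    by (simp add: a lin_def)
qed (simp add: lin_def)

text \<open>A continuous function is uniformly close to a polynomial, so a basic neighbourhood of a measure contains all
  measures with nearby values of finitely many moments. Open sets of measures thus become open sets of
  real families with a countable index.\<close>

lemma process_topology_open_moments:
  assumes "openin (process_topology G K d) \<O>"
  obtains U where "open U"
    "\<And>\<mu>'. \<mu>' \<in> space (prob_algebra names) \<Longrightarrow>
       \<mu>' \<in> \<O> \<longleftrightarrow> (\<lambda>t. \<integral>x. mval (\<lambda>z. ncoord z x) t \<partial>\<mu>') \<in> U"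
proof -
  let ?P = "space (prob_algebra names)"
  let ?m = "\<lambda>\<mu>' t. \<integral>x. mval (\<lambda>z. ncoord z x) t \<partial>\<mu>'"
  have "generate_topology_on {{\<mu> \<in> ?P. (\<integral>x. f x \<partial>\<mu>) \<in> U} |f U. continuous_map X euclideanreal f \<and> open U} \<O>"
    using assms unfolding process_topology_def weak_star_def openin_topology_generated_by_iff by simp
  then have "\<exists>U. open U \<and> (\<forall>\<mu>'\<in>?P. \<mu>' \<in> \<O> \<longleftrightarrow> ?m \<mu>' \<in> U)"
  proof (induction rule: generate_topology_on.induct)
    case Empty then show ?case by (intro exI[of _ "{}"]) auto
  next
    case (Int a b)
    then obtain U U' where "open U" "\<forall>\<mu>'\<in>?P. \<mu>' \<in> a \<longleftrightarrow> ?m \<mu>' \<in> U"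
      "open U'" "\<forall>\<mu>'\<in>?P. \<mu>' \<in> b \<longleftrightarrow> ?m \<mu>' \<in> U'" by auto
    then show ?case by (intro exI[of _ "U \<inter> U'"]) auto
  next
    case (UN A)
    have "\<exists>U. \<forall>k\<in>A. open (U k) \<and> (\<forall>\<mu>'\<in>?P. \<mu>' \<in> k \<longleftrightarrow> ?m \<mu>' \<in> U k)"
      by (rule bchoice) (use UN.IH in simp)
    then obtain U where "\<And>k. k \<in> A \<Longrightarrow> open (U k) \<and> (\<forall>\<mu>'\<in>?P. \<mu>' \<in> k \<longleftrightarrow> ?m \<mu>' \<in> U k)" by auto
    then show ?case by (intro exI[of _ "\<Union>k\<in>A. U k"]) auto
  next
    case (Basis s)
    then obtain f W where f: "continuous_map X euclideanreal f" and W: "open W"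
      and s: "s = {\<mu> \<in> ?P. (\<integral>x. f x \<partial>\<mu>) \<in> W}" by auto
    have "\<exists>U. open U \<and> ?m \<mu>' \<in> U \<and> (\<forall>\<mu>''\<in>?P. ?m \<mu>'' \<in> U \<longrightarrow> \<mu>'' \<in> s)" if \<mu>': "\<mu>' \<in> s" for \<mu>'
    proof -
      have \<mu>'P: "\<mu>' \<in> ?P" "(\<integral>x. f x \<partial>\<mu>') \<in> W" using \<mu>' s by auto
      then obtain e where e: "e > 0" "\<And>y. \<bar>y - (\<integral>x. f x \<partial>\<mu>')\<bar> < e \<Longrightarrow> y \<in> W"
        using W unfolding open_dist dist_real_def by blast
      obtain p where p: "\<And>x. x \<in> space names \<Longrightarrow> \<bar>f x - pval (\<lambda>z. ncoord z x) p\<bar> < e / 3"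
        using polynomial_approximation[OF f, of "e / 3"] e(1) by auto
      have close: "\<bar>(\<integral>x. f x \<partial>\<mu>'') - lin p (?m \<mu>'')\<bar> \<le> e / 3" if "\<mu>'' \<in> ?P" for \<mu>''
      proof -
        have sp: "prob_space \<mu>''" "space \<mu>'' = space names"
          using that sets_eq_imp_space_eq by (auto simp: space_prob_algebra)
        then interpret prob_space \<mu>'' by simp
        have i: "integrable \<mu>'' f" "integrable \<mu>'' (\<lambda>x. pval (\<lambda>z. ncoord z x) p)"
          using continuous_integrable that f continuous_pval by blast+
        have "\<bar>\<integral>x. (f x - pval (\<lambda>z. ncoord z x) p) \<partial>\<mu>''\<bar> \<le> (\<integral>x. \<bar>f x - pval (\<lambda>z. ncoord z x) p\<bar> \<partial>\<mu>'')"
          by (rule integral_abs_bound)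
        also have "\<dots> \<le> (\<integral>x. e / 3 \<partial>\<mu>'')"
          using i p sp by (intro integral_mono) (auto intro: less_imp_le)
        finally show ?thesis using i by (simp add: integral_pval[OF that] prob_space)
      qed
      define U where "U = {y. \<bar>lin p y - lin p (?m \<mu>')\<bar> < e / 3}"
      have "open U" unfolding U_def
        using continuous_lin by (intro open_Collect_less continuous_intros) auto
      moreover have "?m \<mu>' \<in> U" using e by (simp add: U_def)
      moreover have "\<mu>'' \<in> s" if "\<mu>'' \<in> ?P" "?m \<mu>'' \<in> U" for \<mu>''
      proof -
        have "\<bar>(\<integral>x. f x \<partial>\<mu>'') - (\<integral>x. f x \<partial>\<mu>')\<bar> < e"
          using close[OF that(1)] close[OF \<mu>'P(1)] that(2)
          unfolding U_def mem_Collect_eq by linarith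
        then show ?thesis using e(2) that(1) s by blast
      qed
      ultimately show ?thesis by blast
    qed
    then have "\<exists>U. \<forall>\<mu>'\<in>s. open (U \<mu>') \<and> ?m \<mu>' \<in> U \<mu>' \<and> (\<forall>\<mu>''\<in>?P. ?m \<mu>'' \<in> U \<mu>' \<longrightarrow> \<mu>'' \<in> s)"
      by (intro bchoice ballI) simp
    then obtain U where U: "\<And>\<mu>'. \<mu>' \<in> s \<Longrightarrow> open (U \<mu>') \<and> ?m \<mu>' \<in> U \<mu>' \<and> (\<forall>\<mu>''\<in>?P. ?m \<mu>'' \<in> U \<mu>' \<longrightarrow> \<mu>'' \<in> s)"
      by auto
    show ?case
    proof (intro exI conjI ballI iffI)
      show "open (\<Union>\<mu>'\<in>s. U \<mu>')" using U by auto
    next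
      fix \<mu>'' assume "\<mu>'' \<in> ?P" "?m \<mu>'' \<in> (\<Union>\<mu>'\<in>s. U \<mu>')" then show "\<mu>'' \<in> s" using U by auto
    qed (use U in auto)
  qed
  then show ?thesis using that by blast
qed

end

section \<open>Averages over vertices and bounded arrays\<close>

definition avg :: "'v set \<Rightarrow> ('v \<Rightarrow> real) \<Rightarrow> real" where
  "avg V f = (\<Sum>v\<in>V. f v) / real (card V)"

lemma avg_add: "avg V (\<lambda>v. f v + g v) = avg V f + avg V g"
  by (simp add: avg_def sum.distrib add_divide_distrib)

lemma avg_diff: "avg V (\<lambda>v. f v - g v) = avg V f - avg V g"
  by (simp add: avg_def sum_subtractf diff_divide_distrib)

lemma avg_cmult: "avg V (\<lambda>v. c * f v) = c * avg V f"
  by (simp add: avg_def sum_distrib_left)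

lemma avg_multc: "avg V (\<lambda>v. f v * c) = avg V f * c"
  by (simp add: avg_def sum_distrib_right)

lemma avg_const: "finite V \<Longrightarrow> V \<noteq> {} \<Longrightarrow> avg V (\<lambda>v. c) = c"
  by (simp add: avg_def)

lemma avg_mono: "(\<And>v. v \<in> V \<Longrightarrow> f v \<le> g v) \<Longrightarrow> avg V f \<le> avg V g"
  by (simp add: avg_def divide_right_mono sum_mono)

lemma avg_cong: "(\<And>v. v \<in> V \<Longrightarrow> f v = g v) \<Longrightarrow> avg V f = avg V g"
  by (simp add: avg_def)

lemma avg_nonneg: "(\<And>v. v \<in> V \<Longrightarrow> 0 \<le> f v) \<Longrightarrow> 0 \<le> avg V f"
  by (simp add: avg_def sum_nonneg)

lemma avg_abs: "\<bar>avg V f\<bar> \<le> avg V (\<lambda>v. \<bar>f v\<bar>)"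
  by (simp add: avg_def abs_divide divide_right_mono sum_abs)

lemma avg_reindex: "bij_betw \<pi> V V \<Longrightarrow> avg V (\<lambda>v. f (\<pi> v)) = avg V f"
  by (simp add: avg_def sum.reindex_bij_betw)

lemma avg_le_const: "finite V \<Longrightarrow> V \<noteq> {} \<Longrightarrow> (\<And>v. v \<in> V \<Longrightarrow> f v \<le> B) \<Longrightarrow> avg V f \<le> B"
  using avg_mono[of V f "\<lambda>_. B"] by (simp add: avg_const)

lemma avg_sum: "avg V (\<lambda>v. \<Sum>j\<in>J. f j v) = (\<Sum>j\<in>J. avg V (f j))"
  unfolding avg_def sum_divide_distrib by (rule sum.swap)

lemma avg_swap: "avg V (\<lambda>v. avg W (f v)) = avg W (\<lambda>w. avg V (\<lambda>v. f v w))"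
  unfolding avg_def sum_divide_distrib by (rule sum.swap[THEN trans]) (simp add: mult.commute)

lemma avg_Jensen:
  assumes "finite V" "V \<noteq> {}" shows "(avg V f)\<^sup>2 \<le> avg V (\<lambda>v. (f v)\<^sup>2)"
proof -
  have "0 \<le> avg V (\<lambda>v. (f v - avg V f)\<^sup>2)" by (intro avg_nonneg) simp
  also have "\<dots> = avg V (\<lambda>v. ((f v)\<^sup>2 - 2 * avg V f * f v) + (avg V f)\<^sup>2)"
    by (intro avg_cong) (simp add: power2_eq_square algebra_simps)
  also have "\<dots> = avg V (\<lambda>v. (f v)\<^sup>2) - (avg V f)\<^sup>2"
    unfolding avg_add avg_diff avg_cmult using assms by (simp add: avg_const power2_eq_square)
  finally show ?thesis by simp
qed

lemma avg_measurable:
  "(\<And>v. v \<in> V \<Longrightarrow> f v \<in> borel_measurable M) \<Longrightarrow> (\<lambda>x. avg V (\<lambda>v. f v x)) \<in> borel_measurable M"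
  unfolding avg_def by (intro borel_measurable_divide borel_measurable_sum) auto

lemma avg_integrable:
  "(\<And>v. v \<in> V \<Longrightarrow> integrable M (f v)) \<Longrightarrow> integrable M (\<lambda>x. avg V (\<lambda>v. f v x))"
  unfolding avg_def by (intro integrable_divide integrable_sum) auto

lemma integral_avg:
  "(\<And>v. v \<in> V \<Longrightarrow> integrable M (f v)) \<Longrightarrow> (\<integral>x. avg V (\<lambda>v. f v x) \<partial>M) = avg V (\<lambda>v. \<integral>x. f v x \<partial>M)"
  unfolding avg_def by (simp add: integral_sum)

lemma tendsto_0_le:
  fixes f :: "nat \<Rightarrow> real"
  assumes "\<And>i. 0 \<le> f i" "\<And>i. f i \<le> g i" "g \<longlonglongrightarrow> 0" shows "f \<longlonglongrightarrow> 0"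
  using tendsto_sandwich[of "\<lambda>_. 0" f sequentially g 0] assms by auto

text \<open>Two ways for a matrix of covariances to be small: at most pairs of vertices, or only on average over all pairs. The former
  is what doubly quenched convergence gives; together with local convergence, the latter amounts to concentration of vertex averages.\<close>

definition nrm :: "bool \<Rightarrow> 'v set \<Rightarrow> ('v \<Rightarrow> 'v \<Rightarrow> real) \<Rightarrow> real" where
  "nrm b V A = (if b then avg V (\<lambda>v. avg V (\<lambda>w. \<bar>A v w\<bar>)) else \<bar>avg V (\<lambda>v. avg V (A v))\<bar>)"

lemma nrm_nonneg: "0 \<le> nrm b V A"
  by (simp add: nrm_def avg_nonneg)

lemma nrm_le_avg: "nrm b V A \<le> avg V (\<lambda>v. avg V (\<lambda>w. \<bar>A v w\<bar>))"
  unfolding nrm_def using order_trans[OF avg_abs avg_mono[OF avg_abs]] by auto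

lemma nrm_add: "nrm b V (\<lambda>v w. A v w + B v w) \<le> nrm b V A + nrm b V B"
proof (cases b)
  case True
  have "avg V (\<lambda>v. avg V (\<lambda>w. \<bar>A v w + B v w\<bar>)) \<le> avg V (\<lambda>v. avg V (\<lambda>w. \<bar>A v w\<bar> + \<bar>B v w\<bar>))"
    by (intro avg_mono abs_triangle_ineq)
  then show ?thesis using True by (simp add: nrm_def avg_add)
qed (simp add: nrm_def avg_add)

lemma nrm_cmult: "nrm b V (\<lambda>v w. c * A v w) = \<bar>c\<bar> * nrm b V A"
  by (simp add: nrm_def abs_mult avg_cmult)

lemma nrm_cong: "(\<And>v w. v \<in> V \<Longrightarrow> w \<in> V \<Longrightarrow> A v w = B v w) \<Longrightarrow> nrm b V A = nrm b V B"
  unfolding nrm_def by (simp cong: avg_cong)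

lemma product_difference: "\<bar>a * b - c * e\<bar> \<le> B * \<bar>b - e\<bar> + \<bar>e\<bar> * \<bar>a - c\<bar>" if "\<bar>a\<bar> \<le> B" for a b c e B :: real
proof -
  have "a * b - c * e = a * (b - e) + e * (a - c)" by (simp add: algebra_simps)
  then have "\<bar>a * b - c * e\<bar> \<le> \<bar>a\<bar> * \<bar>b - e\<bar> + \<bar>e\<bar> * \<bar>a - c\<bar>"
    using abs_triangle_ineq[of "a * (b - e)" "e * (a - c)"] by (simp add: abs_mult)
  also have "\<dots> \<le> B * \<bar>b - e\<bar> + \<bar>e\<bar> * \<bar>a - c\<bar>" using that by (intro add_mono mult_right_mono) auto
  finally show ?thesis .
qed

locale models =
  fixes V :: "nat \<Rightarrow> 'v set" and P :: "nat \<Rightarrow> 'w measure"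
  assumes V: "finite (V i)" "V i \<noteq> {}" and P: "prob_space (P i)"
begin

definition arr :: "(nat \<Rightarrow> 'v \<Rightarrow> 'w \<Rightarrow> real) \<Rightarrow> bool" where
  "arr F \<longleftrightarrow> (\<forall>i. \<forall>v\<in>V i. F i v \<in> borel_measurable (P i)) \<and>
     (\<exists>B. \<forall>i. \<forall>v\<in>V i. \<forall>x\<in>space (P i). \<bar>F i v x\<bar> \<le> B)"

lemma arr_measurable: "arr F \<Longrightarrow> v \<in> V i \<Longrightarrow> F i v \<in> borel_measurable (P i)"
  by (simp add: arr_def)

lemma arr_bounded:
  assumes "arr F"
  obtains B where "B > 0" "\<And>i v x. v \<in> V i \<Longrightarrow> x \<in> space (P i) \<Longrightarrow> \<bar>F i v x\<bar> \<le> B"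
proof -
  obtain B where "\<forall>i. \<forall>v\<in>V i. \<forall>x\<in>space (P i). \<bar>F i v x\<bar> \<le> B" using assms by (auto simp: arr_def)
  then have "\<And>i v x. v \<in> V i \<Longrightarrow> x \<in> space (P i) \<Longrightarrow> \<bar>F i v x\<bar> \<le> max B 1" by (meson max.coboundedI1)
  then show ?thesis using that[of "max B 1"] by simp
qed

lemma arrI:
  assumes "\<And>i v. v \<in> V i \<Longrightarrow> F i v \<in> borel_measurable (P i)"
    and "\<And>i v x. v \<in> V i \<Longrightarrow> x \<in> space (P i) \<Longrightarrow> \<bar>F i v x\<bar> \<le> B"
  shows "arr F"
  using assms unfolding arr_def by blast

lemma arr_const: "arr (\<lambda>i v x. c)"
  by (rule arrI[where B = "\<bar>c\<bar>"]) auto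

lemma arr_add: assumes F: "arr F" and F': "arr F'" shows "arr (\<lambda>i v x. F i v x + F' i v x)"
proof -
  obtain B where B: "0 < B" "\<And>i v x. v \<in> V i \<Longrightarrow> x \<in> space (P i) \<Longrightarrow> \<bar>F i v x\<bar> \<le> B"
    using arr_bounded[OF F] by blast
  obtain B' where B': "0 < B'" "\<And>i v x. v \<in> V i \<Longrightarrow> x \<in> space (P i) \<Longrightarrow> \<bar>F' i v x\<bar> \<le> B'"
    using arr_bounded[OF F'] by blast
  show ?thesis
  proof (rule arrI[where B = "B + B'"])
    fix i v x assume "v \<in> V i" "x \<in> space (P i)"
    then show "\<bar>F i v x + F' i v x\<bar> \<le> B + B'"
      using B(2)[of v i x] B'(2)[of v i x] by linarith
  qed (intro borel_measurable_add arr_measurable F F')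
qed

lemma arr_mult: assumes F: "arr F" and F': "arr F'" shows "arr (\<lambda>i v x. F i v x * F' i v x)"
proof -
  obtain B where B: "0 < B" "\<And>i v x. v \<in> V i \<Longrightarrow> x \<in> space (P i) \<Longrightarrow> \<bar>F i v x\<bar> \<le> B"
    using arr_bounded[OF F] by blast
  obtain B' where B': "0 < B'" "\<And>i v x. v \<in> V i \<Longrightarrow> x \<in> space (P i) \<Longrightarrow> \<bar>F' i v x\<bar> \<le> B'"
    using arr_bounded[OF F'] by blast
  show ?thesis
  proof (rule arrI[where B = "B * B'"])
    fix i v x assume "v \<in> V i" "x \<in> space (P i)"
    then show "\<bar>F i v x * F' i v x\<bar> \<le> B * B'"
      unfolding abs_mult using B B' by (intro mult_mono) auto
  qed (intro borel_measurable_times arr_measurable F F')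
qed

lemma arr_abs: assumes "arr F" shows "arr (\<lambda>i v x. \<bar>F i v x\<bar>)"
proof -
  obtain B where B: "0 < B" "\<And>i v x. v \<in> V i \<Longrightarrow> x \<in> space (P i) \<Longrightarrow> \<bar>F i v x\<bar> \<le> B"
    using arr_bounded[OF assms] by blast
  show ?thesis
  proof (rule arrI[where B = B])
    fix i v x assume "v \<in> V i" "x \<in> space (P i)"
    then show "\<bar>\<bar>F i v x\<bar>\<bar> \<le> B" using B(2)[of v i x] by simp
  qed (intro borel_measurable_abs arr_measurable assms)
qed

lemma arr_cmult: "arr F \<Longrightarrow> arr (\<lambda>i v x. c * F i v x)"
  by (rule arr_mult[OF arr_const])

lemma arr_diff: "arr F \<Longrightarrow> arr F' \<Longrightarrow> arr (\<lambda>i v x. F i v x - F' i v x)"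
  using arr_add[of F "\<lambda>i v x. -1 * F' i v x"] arr_cmult[of F' "-1"] by simp

lemma bounded_integrable:
  fixes f :: "'w \<Rightarrow> real"
  assumes "f \<in> borel_measurable (P i)" "\<And>x. x \<in> space (P i) \<Longrightarrow> \<bar>f x\<bar> \<le> B"
  shows "integrable (P i) f"
  using assms by (intro finite_measure.integrable_const_bound[OF prob_space.finite_measure[OF P], of _ B]) auto

lemma arr_integrable: assumes "arr F" "v \<in> V i" shows "integrable (P i) (F i v)"
proof -
  obtain B where B: "0 < B" "\<And>i v x. v \<in> V i \<Longrightarrow> x \<in> space (P i) \<Longrightarrow> \<bar>F i v x\<bar> \<le> B"
    using arr_bounded[OF assms(1)] by blast
  show ?thesis by (rule bounded_integrable[OF arr_measurable[OF assms], of B]) (rule B(2)[OF assms(2)])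
qed

lemma arr_integrable_mult:
  assumes "arr F" "arr F'" "v \<in> V i" "w \<in> V i" shows "integrable (P i) (\<lambda>x. F i v x * F' i w x)"
proof -
  obtain B where B: "0 < B" "\<And>i v x. v \<in> V i \<Longrightarrow> x \<in> space (P i) \<Longrightarrow> \<bar>F i v x\<bar> \<le> B"
    using arr_bounded[OF assms(1)] by blast
  have "x \<in> space (P i) \<Longrightarrow> \<bar>F i v x * F' i w x\<bar> \<le> \<bar>B * F' i w x\<bar>" for x
    using B(2)[OF assms(3), of x] B(1) unfolding abs_mult by (intro mult_right_mono) auto
  then show ?thesis
  proof (intro Bochner_Integration.integrable_bound[of _ "\<lambda>x. B * F' i w x" "\<lambda>x. F i v x * F' i w x"])
    show "integrable (P i) (\<lambda>x. B * F' i w x)" using arr_integrable[OF assms(2,4)] by simp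
    show "(\<lambda>x. F i v x * F' i w x) \<in> borel_measurable (P i)"
      by (intro borel_measurable_times arr_measurable assms)
  qed auto
qed

lemma arr_avg_bounded:
  assumes "arr F"
  obtains B where "B > 0" "\<And>i x. x \<in> space (P i) \<Longrightarrow> \<bar>avg (V i) (\<lambda>v. F i v x)\<bar> \<le> B"
proof -
  obtain B where B: "0 < B" "\<And>i v x. v \<in> V i \<Longrightarrow> x \<in> space (P i) \<Longrightarrow> \<bar>F i v x\<bar> \<le> B"
    using arr_bounded[OF assms] by blast
  have "\<bar>avg (V i) (\<lambda>v. F i v x)\<bar> \<le> B" if "x \<in> space (P i)" for i x
  proof (rule order_trans[OF avg_abs])
    show "avg (V i) (\<lambda>v. \<bar>F i v x\<bar>) \<le> B" by (rule avg_le_const[OF V]) (rule B(2)[OF _ that])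
  qed
  then show ?thesis by (rule that[OF B(1)])
qed

lemma arr_avg_measurable:
  "arr F \<Longrightarrow> (\<lambda>x. avg (V i) (\<lambda>v. F i v x)) \<in> borel_measurable (P i)"
  by (intro avg_measurable arr_measurable)

lemma integral_le_const:
  fixes f :: "'w \<Rightarrow> real"
  assumes "\<And>x. x \<in> space (P i) \<Longrightarrow> f x \<le> c" "integrable (P i) f" shows "(\<integral>x. f x \<partial>P i) \<le> c"
proof -
  interpret prob_space "P i" by (rule P)
  show ?thesis using assms by (intro integral_le_const) auto
qed

subsection \<open>Convergence in mean and in probability\<close>

lemma L1_of_probability:
  fixes f :: "nat \<Rightarrow> 'w \<Rightarrow> real"
  assumes m: "\<And>i. f i \<in> borel_measurable (P i)" and B: "\<And>i x. x \<in> space (P i) \<Longrightarrow> \<bar>f i x\<bar> \<le> B"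
    and lim: "\<And>e. e > 0 \<Longrightarrow> (\<lambda>i. measure (P i) {x \<in> space (P i). \<bar>f i x\<bar> < e}) \<longlonglongrightarrow> 1"
  shows "(\<lambda>i. \<integral>x. \<bar>f i x\<bar> \<partial>P i) \<longlonglongrightarrow> 0"
proof -
  have bd: "(\<integral>x. \<bar>f i x\<bar> \<partial>P i) \<le> e + \<bar>B\<bar> * (1 - measure (P i) {x \<in> space (P i). \<bar>f i x\<bar> < e})" if "e > 0" for i e
  proof -
    interpret prob_space "P i" by (rule P)
    let ?A = "{x \<in> space (P i). \<bar>f i x\<bar> < e}"
    have [measurable]: "f i \<in> borel_measurable (P i)" by (rule m)
    have i: "integrable (P i) (\<lambda>x. e + \<bar>B\<bar> * (1 - indicator ?A x))"
      by (intro integrable_const_bound[where B = "e + \<bar>B\<bar>"]) (use that in \<open>auto simp: indicator_def\<close>)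
    have "(\<integral>x. \<bar>f i x\<bar> \<partial>P i) \<le> (\<integral>x. e + \<bar>B\<bar> * (1 - indicator ?A x) \<partial>P i)"
    proof (rule integral_mono[OF _ i])
      show "integrable (P i) (\<lambda>x. \<bar>f i x\<bar>)" using bounded_integrable[OF m B] by auto
      fix x assume "x \<in> space (P i)"
      then show "\<bar>f i x\<bar> \<le> e + \<bar>B\<bar> * (1 - indicator ?A x)"
        using B[of x i] that by (auto simp: indicator_def)
    qed
    also have "\<dots> = e + \<bar>B\<bar> * (1 - prob ?A)"
    proof -
      have A: "?A \<in> events" by measurable
      have "integrable (P i) (indicator ?A :: 'w \<Rightarrow> real)"
        by (intro integrable_real_indicator A) (simp add: emeasure_eq_measure)
      then show ?thesis using A by (simp add: prob_space)
    qed
    finally show ?thesis .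
  qed
  show ?thesis
  proof (rule LIMSEQ_I)
    fix r :: real assume r: "r > 0"
    have "(\<lambda>i. r / 2 + \<bar>B\<bar> * (1 - measure (P i) {x \<in> space (P i). \<bar>f i x\<bar> < r / 2})) \<longlonglongrightarrow> r / 2 + \<bar>B\<bar> * (1 - 1)"
      using r by (intro tendsto_intros lim) auto
    then have "\<forall>\<^sub>F i in sequentially. r / 2 + \<bar>B\<bar> * (1 - measure (P i) {x \<in> space (P i). \<bar>f i x\<bar> < r / 2}) < r"
      by (rule order_tendstoD(2)) (use r in simp)
    then have "\<forall>\<^sub>F i in sequentially. norm ((\<integral>x. \<bar>f i x\<bar> \<partial>P i) - 0) < r"
    proof eventually_elim
      case (elim i)
      have "0 \<le> (\<integral>x. \<bar>f i x\<bar> \<partial>P i)" by simp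
      then show ?case using bd[of "r / 2" i] r elim unfolding real_norm_def by linarith
    qed
    then show "\<exists>no. \<forall>n\<ge>no. norm ((\<integral>x. \<bar>f n x\<bar> \<partial>P n) - 0) < r" by (simp add: eventually_sequentially)
  qed
qed

lemma Markov:
  fixes f :: "'w \<Rightarrow> real"
  assumes "integrable (P i) f" "e > 0"
  shows "measure (P i) {x \<in> space (P i). e \<le> \<bar>f x\<bar>} \<le> (\<integral>x. \<bar>f x\<bar> \<partial>P i) / e"
proof -
  interpret prob_space "P i" by (rule P)
  let ?A = "{x \<in> space (P i). e \<le> \<bar>f x\<bar>}"
  have [measurable]: "f \<in> borel_measurable (P i)" using assms by auto
  have "e * prob ?A = (\<integral>x. e * indicator ?A x \<partial>P i)" by simp
  also have "\<dots> \<le> (\<integral>x. \<bar>f x\<bar> \<partial>P i)"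
  proof (rule integral_mono)
    show "integrable (P i) (\<lambda>x. e * indicator ?A x)"
      by (intro integrable_mult_right integrable_real_indicator) (measurable, simp add: emeasure_eq_measure)
  qed (use assms in \<open>auto simp: indicator_def\<close>)
  finally show ?thesis using assms(2) by (simp add: field_simps)
qed

text \<open>A basic open set of the product constrains finitely many coordinates, so a union bound over the Markov inequalities
  for these coordinates suffices.\<close>

lemma probability_open_set:
  fixes Y :: "nat \<Rightarrow> 't::countable \<Rightarrow> 'w \<Rightarrow> real"
  assumes int: "\<And>i t. integrable (P i) (Y i t)"
    and lim: "\<And>t. (\<lambda>i. \<integral>x. \<bar>Y i t x - y t\<bar> \<partial>P i) \<longlonglongrightarrow> 0"
    and U: "open U" "y \<in> U"
  shows "(\<lambda>i. measure (P i) {x \<in> space (P i). (\<lambda>t. Y i t x) \<in> U}) \<longlonglongrightarrow> 1"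
proof -
  obtain X where X: "y \<in> PiE UNIV X" "\<And>t. open (X t)" "finite {t. X t \<noteq> UNIV}" "PiE UNIV X \<subseteq> U"
    using product_topology_open_contains_basis[of "\<lambda>_. euclideanreal" UNIV U y] U
    by (auto simp: euclidean_product_topology)
  define T where "T = {t. X t \<noteq> UNIV}"
  have "\<exists>e>0. \<forall>r. \<bar>r - y t\<bar> < e \<longrightarrow> r \<in> X t" for t
    using X(1) X(2)[of t] by (auto simp: open_dist dist_real_def)
  then obtain e where e: "\<And>t. e t > 0" "\<And>t r. \<bar>r - y t\<bar> < e t \<Longrightarrow> r \<in> X t" by metis
  have int': "integrable (P i) (\<lambda>x. Y i t x - y t)" for i t
  proof -
    interpret prob_space "P i" by (rule P)
    show ?thesis using int by auto
  qed
  have lower: "1 - (\<Sum>t\<in>T. (\<integral>x. \<bar>Y i t x - y t\<bar> \<partial>P i) / e t) \<le> measure (P i) {x \<in> space (P i). (\<lambda>t. Y i t x) \<in> U}" for i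
  proof -
    interpret prob_space "P i" by (rule P)
    have [measurable]: "Y i t \<in> borel_measurable (P i)" for t using int by auto
    let ?G = "{x \<in> space (P i). (\<lambda>t. Y i t x) \<in> U}"
    let ?B = "\<lambda>t. {x \<in> space (P i). e t \<le> \<bar>Y i t x - y t\<bar>}"
    have "(\<lambda>x t. Y i t x) \<in> borel_measurable (P i)"
      by (intro measurable_coordinatewise_then_product) simp
    then have "(\<lambda>x t. Y i t x) -` U \<inter> space (P i) \<in> sets (P i)" using U(1) by (auto intro: measurable_sets)
    also have "(\<lambda>x t. Y i t x) -` U \<inter> space (P i) = ?G" by auto
    finally have G: "?G \<in> events" .
    have "space (P i) - ?G \<subseteq> (\<Union>t\<in>T. ?B t)"
    proof
      fix x assume x: "x \<in> space (P i) - ?G"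
      then have "(\<lambda>t. Y i t x) \<notin> PiE UNIV X" using X(4) by auto
      then obtain t where t: "Y i t x \<notin> X t" by auto
      then have "t \<in> T" by (auto simp: T_def)
      moreover have "e t \<le> \<bar>Y i t x - y t\<bar>" using e(2)[of "Y i t x" t] t by fastforce
      ultimately show "x \<in> (\<Union>t\<in>T. ?B t)" using x by auto
    qed
    then have "prob (space (P i) - ?G) \<le> prob (\<Union>t\<in>T. ?B t)"
      using X(3) by (intro finite_measure_mono) (auto simp: T_def)
    also have "\<dots> \<le> (\<Sum>t\<in>T. prob (?B t))"
      using X(3) by (intro finite_measure_subadditive_finite) (auto simp: T_def)
    also have "\<dots> \<le> (\<Sum>t\<in>T. (\<integral>x. \<bar>Y i t x - y t\<bar> \<partial>P i) / e t)"
      using int' e(1) by (intro sum_mono Markov) auto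
    finally show ?thesis using prob_compl[OF G] by simp
  qed
  show ?thesis
  proof (rule tendsto_sandwich)
    show "\<forall>\<^sub>F i in sequentially. 1 - (\<Sum>t\<in>T. (\<integral>x. \<bar>Y i t x - y t\<bar> \<partial>P i) / e t) \<le> measure (P i) {x \<in> space (P i). (\<lambda>t. Y i t x) \<in> U}"
      using lower by simp
    show "\<forall>\<^sub>F i in sequentially. measure (P i) {x \<in> space (P i). (\<lambda>t. Y i t x) \<in> U} \<le> 1"
      using prob_space.prob_le_1[OF P] by simp
    have "(\<lambda>i. 1 - (\<Sum>t\<in>T. (\<integral>x. \<bar>Y i t x - y t\<bar> \<partial>P i) / e t)) \<longlonglongrightarrow> 1 - (\<Sum>t\<in>T. 0 / e t)"
      using e(1) by (intro tendsto_intros lim) (metis less_irrefl)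
    then show "(\<lambda>i. 1 - (\<Sum>t\<in>T. (\<integral>x. \<bar>Y i t x - y t\<bar> \<partial>P i) / e t)) \<longlonglongrightarrow> 1" by simp
  qed simp
qed

subsection \<open>First and second moments\<close>

definition local_conv :: "(nat \<Rightarrow> 'v \<Rightarrow> 'w \<Rightarrow> real) \<Rightarrow> real \<Rightarrow> bool" where
  "local_conv F c \<longleftrightarrow> (\<lambda>i. avg (V i) (\<lambda>v. \<bar>(\<integral>x. F i v x \<partial>P i) - c\<bar>)) \<longlonglongrightarrow> 0"

definition mean_conv :: "(nat \<Rightarrow> 'v \<Rightarrow> 'w \<Rightarrow> real) \<Rightarrow> real \<Rightarrow> bool" where
  "mean_conv F c \<longleftrightarrow> (\<lambda>i. \<integral>x. \<bar>avg (V i) (\<lambda>v. F i v x) - c\<bar> \<partial>P i) \<longlonglongrightarrow> 0"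

definition pair_conv :: "bool \<Rightarrow> (nat \<Rightarrow> 'v \<Rightarrow> 'w \<Rightarrow> real) \<Rightarrow> real \<Rightarrow> (nat \<Rightarrow> 'v \<Rightarrow> 'w \<Rightarrow> real) \<Rightarrow> real \<Rightarrow> bool" where
  "pair_conv b F c F' c' \<longleftrightarrow>
     (\<lambda>i. nrm b (V i) (\<lambda>v w. (\<integral>x. F i v x * F' i w x \<partial>P i) - c * c')) \<longlonglongrightarrow> 0"

lemma local_conv_avg:
  assumes "arr F" "local_conv F c"
  shows "(\<lambda>i. \<integral>x. avg (V i) (\<lambda>v. F i v x) \<partial>P i) \<longlonglongrightarrow> c"
proof -
  have "\<bar>(\<integral>x. avg (V i) (\<lambda>v. F i v x) \<partial>P i) - c\<bar> \<le> avg (V i) (\<lambda>v. \<bar>(\<integral>x. F i v x \<partial>P i) - c\<bar>)" for i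
    using avg_abs[of "V i" "\<lambda>v. (\<integral>x. F i v x \<partial>P i) - c"] V[of i]
    by (simp add: integral_avg arr_integrable[OF assms(1)] avg_diff avg_const)
  then have "(\<lambda>i. \<bar>(\<integral>x. avg (V i) (\<lambda>v. F i v x) \<partial>P i) - c\<bar>) \<longlonglongrightarrow> 0"
    using assms(2) unfolding local_conv_def by (intro tendsto_0_le[where f = "\<lambda>i. \<bar>_ i\<bar>"]) auto
  then show ?thesis by (simp add: tendsto_rabs_zero_iff LIM_zero_iff)
qed

lemma avg_avg_integral_mult:
  assumes "arr F" "arr F'"
  shows "avg (V i) (\<lambda>v. avg (V i) (\<lambda>w. \<integral>x. F i v x * F' i w x \<partial>P i)) =
    (\<integral>x. avg (V i) (\<lambda>v. F i v x) * avg (V i) (\<lambda>v. F' i v x) \<partial>P i)"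
proof -
  have "(\<integral>x. avg (V i) (\<lambda>v. avg (V i) (\<lambda>w. F i v x * F' i w x)) \<partial>P i) =
     avg (V i) (\<lambda>v. avg (V i) (\<lambda>w. \<integral>x. F i v x * F' i w x \<partial>P i))"
    by (subst integral_avg; intro avg_integrable avg_cong integral_avg arr_integrable_mult assms; assumption?)
  then show ?thesis by (simp add: avg_cmult avg_multc)
qed

lemma pair_conv_False_iff:
  assumes "arr F" "arr F'"
  shows "pair_conv False F c F' c' \<longleftrightarrow>
    (\<lambda>i. \<integral>x. avg (V i) (\<lambda>v. F i v x) * avg (V i) (\<lambda>v. F' i v x) \<partial>P i) \<longlonglongrightarrow> c * c'"
  using V by (simp add: pair_conv_def nrm_def avg_diff avg_const avg_avg_integral_mult[OF assms]
      tendsto_rabs_zero_iff LIM_zero_iff)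

lemma avg_pair_integrable:
  assumes "arr F" "arr F'"
  shows "integrable (P i) (\<lambda>x. avg (V i) (\<lambda>v. F i v x) * avg (V i) (\<lambda>v. F' i v x))"
proof -
  have "integrable (P i) (\<lambda>x. avg (V i) (\<lambda>v. avg (V i) (\<lambda>w. F i v x * F' i w x)))"
    by (intro avg_integrable arr_integrable_mult assms)
  then show ?thesis by (simp add: avg_cmult avg_multc)
qed

lemma mean_conv_pair:
  assumes F: "arr F" "arr F'" and "mean_conv F c" "mean_conv F' c'"
  shows "pair_conv False F c F' c'"
proof -
  let ?a = "\<lambda>i x. avg (V i) (\<lambda>v. F i v x)" and ?b = "\<lambda>i x. avg (V i) (\<lambda>v. F' i v x)"
  obtain B where B: "0 < B" "\<And>i x. x \<in> space (P i) \<Longrightarrow> \<bar>?a i x\<bar> \<le> B" using arr_avg_bounded[OF F(1)] by blast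
  have ia: "integrable (P i) (?a i)" and ib: "integrable (P i) (?b i)" for i
    by (intro avg_integrable arr_integrable F; assumption)+
  have "\<bar>(\<integral>x. ?a i x * ?b i x \<partial>P i) - c * c'\<bar> \<le> B * (\<integral>x. \<bar>?b i x - c'\<bar> \<partial>P i) + \<bar>c'\<bar> * (\<integral>x. \<bar>?a i x - c\<bar> \<partial>P i)" for i
  proof -
    interpret prob_space "P i" by (rule P)
    have "(\<integral>x. ?a i x * ?b i x \<partial>P i) - c * c' = (\<integral>x. ?a i x * ?b i x - c * c' \<partial>P i)"
      using avg_pair_integrable[OF F] by (simp add: prob_space)
    also have "\<bar>\<dots>\<bar> \<le> (\<integral>x. \<bar>?a i x * ?b i x - c * c'\<bar> \<partial>P i)" by (rule integral_abs_bound)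
    also have "\<dots> \<le> (\<integral>x. B * \<bar>?b i x - c'\<bar> + \<bar>c'\<bar> * \<bar>?a i x - c\<bar> \<partial>P i)"
    proof (rule integral_mono)
      fix x assume x: "x \<in> space (P i)"
      have "?a i x * ?b i x - c * c' = ?a i x * (?b i x - c') + c' * (?a i x - c)" by (simp add: algebra_simps)
      also have "\<bar>\<dots>\<bar> \<le> \<bar>?a i x\<bar> * \<bar>?b i x - c'\<bar> + \<bar>c'\<bar> * \<bar>?a i x - c\<bar>"
        using abs_triangle_ineq by (simp flip: abs_mult)
      also have "\<dots> \<le> B * \<bar>?b i x - c'\<bar> + \<bar>c'\<bar> * \<bar>?a i x - c\<bar>"
        using B(2)[OF x] by (intro add_mono mult_right_mono) auto
      finally show "\<bar>?a i x * ?b i x - c * c'\<bar> \<le> B * \<bar>?b i x - c'\<bar> + \<bar>c'\<bar> * \<bar>?a i x - c\<bar>" .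
    qed (use ia ib avg_pair_integrable[OF F] in \<open>auto\<close>)
    also have "\<dots> = B * (\<integral>x. \<bar>?b i x - c'\<bar> \<partial>P i) + \<bar>c'\<bar> * (\<integral>x. \<bar>?a i x - c\<bar> \<partial>P i)"
      using ia ib by (subst Bochner_Integration.integral_add) auto
    finally show ?thesis .
  qed
  moreover have "(\<lambda>i. B * (\<integral>x. \<bar>?b i x - c'\<bar> \<partial>P i) + \<bar>c'\<bar> * (\<integral>x. \<bar>?a i x - c\<bar> \<partial>P i)) \<longlonglongrightarrow> B * 0 + \<bar>c'\<bar> * 0"
    using assms unfolding mean_conv_def by (intro tendsto_intros) auto
  ultimately have "(\<lambda>i. \<bar>(\<integral>x. ?a i x * ?b i x \<partial>P i) - c * c'\<bar>) \<longlonglongrightarrow> 0"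
    by (intro tendsto_0_le[where f = "\<lambda>i. \<bar>_ i\<bar>"]) auto
  then show ?thesis by (simp add: pair_conv_False_iff[OF F] tendsto_rabs_zero_iff LIM_zero_iff)
qed

lemma integral_abs_le_sqrt:
  assumes "f \<in> borel_measurable (P i)" "\<And>x. x \<in> space (P i) \<Longrightarrow> \<bar>f x\<bar> \<le> B"
  shows "(\<integral>x. \<bar>f x\<bar> \<partial>P i) \<le> sqrt (\<integral>x. (f x)\<^sup>2 \<partial>P i)"
proof -
  interpret prob_space "P i" by (rule P)
  have i: "integrable (P i) (\<lambda>x. \<bar>f x\<bar>)" using bounded_integrable[OF assms] by auto
  have "(f x)\<^sup>2 \<le> \<bar>B\<bar>\<^sup>2" if "x \<in> space (P i)" for x
    using assms(2)[OF that] by (metis abs_ge_zero abs_le_square_iff abs_of_nonneg order_trans abs_ge_self power2_abs)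
  then have i2: "integrable (P i) (\<lambda>x. \<bar>f x\<bar>\<^sup>2)" using assms(1)
    by (intro bounded_integrable[of _ _ "\<bar>B\<bar>\<^sup>2"]) auto
  have "0 \<le> variance (\<lambda>x. \<bar>f x\<bar>)" by (rule variance_positive)
  then have "(\<integral>x. \<bar>f x\<bar> \<partial>P i)\<^sup>2 \<le> (\<integral>x. (f x)\<^sup>2 \<partial>P i)"
    using variance_eq[OF i i2] by simp
  then show ?thesis by (rule real_le_rsqrt)
qed

text \<open>The variance of a vertex average is an average over pairs of vertices, and it bounds the mean deviation.\<close>

lemma mean_conv_of_pair:
  assumes F: "arr F" and l: "local_conv F c" and p: "pair_conv False F c F c"
  shows "mean_conv F c"
proof -
  let ?a = "\<lambda>i x. avg (V i) (\<lambda>v. F i v x)"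
  obtain B where B: "0 < B" "\<And>i x. x \<in> space (P i) \<Longrightarrow> \<bar>?a i x\<bar> \<le> B" using arr_avg_bounded[OF F] by blast
  have ia: "integrable (P i) (?a i)" for i by (intro avg_integrable arr_integrable F; assumption)
  have sq: "(\<integral>x. (?a i x - c)\<^sup>2 \<partial>P i) = (\<integral>x. ?a i x * ?a i x \<partial>P i) - 2 * c * (\<integral>x. ?a i x \<partial>P i) + c * c" for i
  proof -
    interpret prob_space "P i" by (rule P)
    have "(\<integral>x. (?a i x - c)\<^sup>2 \<partial>P i) = (\<integral>x. ?a i x * ?a i x - 2 * c * ?a i x + c * c \<partial>P i)"
      by (simp add: power2_eq_square algebra_simps)
    also have "\<dots> = (\<integral>x. ?a i x * ?a i x \<partial>P i) - 2 * c * (\<integral>x. ?a i x \<partial>P i) + c * c"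
      using ia avg_pair_integrable[OF F F] by (simp add: prob_space)
    finally show ?thesis .
  qed
  have "(\<lambda>i. (\<integral>x. ?a i x * ?a i x \<partial>P i) - 2 * c * (\<integral>x. ?a i x \<partial>P i) + c * c) \<longlonglongrightarrow> c * c - 2 * c * c + c * c"
    using p local_conv_avg[OF F l] unfolding pair_conv_False_iff[OF F F] by (intro tendsto_intros)
  then have "(\<lambda>i. sqrt (\<integral>x. (?a i x - c)\<^sup>2 \<partial>P i)) \<longlonglongrightarrow> sqrt 0"
    unfolding sq by (intro tendsto_real_sqrt) simp
  moreover have "(\<integral>x. \<bar>?a i x - c\<bar> \<partial>P i) \<le> sqrt (\<integral>x. (?a i x - c)\<^sup>2 \<partial>P i)" for i
  proof (rule integral_abs_le_sqrt)
    show "(\<lambda>x. ?a i x - c) \<in> borel_measurable (P i)" using arr_avg_measurable[OF F] by auto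
    show "\<bar>?a i x - c\<bar> \<le> B + \<bar>c\<bar>" if "x \<in> space (P i)" for x using B(2)[OF that] by linarith
  qed
  ultimately show ?thesis unfolding mean_conv_def by (intro tendsto_0_le[where f = "\<lambda>i. \<integral>x. _ i x \<partial>P i"]) auto
qed

end

section \<open>Quenched convergence through moments\<close>

lemma integral_pair_mult:
  fixes f :: "'a \<Rightarrow> real" and g :: "'b \<Rightarrow> real"
  assumes "prob_space M" "prob_space N" and f: "f \<in> borel_measurable M" and g: "g \<in> borel_measurable N"
    and B: "\<And>x. x \<in> space M \<Longrightarrow> \<bar>f x\<bar> \<le> B" and B': "\<And>y. y \<in> space N \<Longrightarrow> \<bar>g y\<bar> \<le> B'"
  shows "(\<integral>z. f (fst z) * g (snd z) \<partial>(M \<Otimes>\<^sub>M N)) = (\<integral>x. f x \<partial>M) * (\<integral>y. g y \<partial>N)"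
proof -
  interpret M: prob_space M by fact
  interpret N: prob_space N by fact
  interpret pair_prob_space M N ..
  note [measurable] = f g
  have "integrable (M \<Otimes>\<^sub>M N) (\<lambda>z. f (fst z) * g (snd z))"
  proof (rule integrable_const_bound[where B = "B * B'"])
    show "AE z in M \<Otimes>\<^sub>M N. norm (f (fst z) * g (snd z)) \<le> B * B'"
    proof (rule AE_I2)
      fix z assume "z \<in> space (M \<Otimes>\<^sub>M N)"
      then have z: "\<bar>f (fst z)\<bar> \<le> B" "\<bar>g (snd z)\<bar> \<le> B'" using B B' by (auto simp: space_pair_measure)
      show "norm (f (fst z) * g (snd z)) \<le> B * B'"
        unfolding real_norm_def abs_mult using z abs_ge_zero[of "f (fst z)"] by (intro mult_mono) auto
    qed
  qed measurable
  then have "(\<integral>x. \<integral>y. f x * g y \<partial>N \<partial>M) = (\<integral>z. f (fst z) * g (snd z) \<partial>(M \<Otimes>\<^sub>M N))"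
    using integral_fst'[of "\<lambda>z. f (fst z) * g (snd z)"] by simp
  then show ?thesis by simp
qed

definition site_mval ::
  "('j \<Rightarrow> 'a \<Rightarrow> real) \<Rightarrow> (nat \<Rightarrow> 'g \<Rightarrow> 'v \<Rightarrow> 'v) \<Rightarrow> ('g \<times> 'j) list \<Rightarrow> nat \<Rightarrow> 'v \<Rightarrow> ('v \<Rightarrow> 'a) \<Rightarrow> real" where
  "site_mval C \<sigma> t i v x = mval (\<lambda>z. C (snd z) (x (\<sigma> i (fst z) v))) t"

lemma prob_space_square:
  assumes "\<mu>' \<in> space (prob_algebra (config I K d))" shows "prob_space \<mu>'" "sets \<mu>' = sets (config I K d)"
    "space \<mu>' = space (config I K d)"
  using assms sets_eq_imp_space_eq by (auto simp: space_prob_algebra)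

locale process_models = process_coordinates K d C G
  for K :: "'a set" and d :: "'a \<Rightarrow> 'a \<Rightarrow> real" and C :: "'j::countable \<Rightarrow> 'a \<Rightarrow> real"
    and G :: "('g, 'm) monoid_scheme" +
  fixes V :: "nat \<Rightarrow> 'v set" and \<sigma> :: "nat \<Rightarrow> 'g \<Rightarrow> 'v \<Rightarrow> 'v"
    and m :: "nat \<Rightarrow> ('v \<Rightarrow> 'a) measure" and \<mu> :: "('g \<Rightarrow> 'a) measure"
  assumes V: "\<And>i. finite (V i)" "\<And>i. V i \<noteq> {}"
    and \<sigma>: "\<And>i g v. g \<in> carrier G \<Longrightarrow> v \<in> V i \<Longrightarrow> \<sigma> i g v \<in> V i"
    and m: "\<And>i. m i \<in> space (prob_algebra (config (V i) K d))"
    and \<mu>: "\<mu> \<in> space (prob_algebra names)"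
begin

lemma m_prob: "prob_space (m i)" "sets (m i) = sets (config (V i) K d)" "space (m i) = PiE (V i) (\<lambda>_. K)"
  using prob_space_square[OF m[of i]] by (auto simp: space_config)

sublocale models V m
  by (rule models.intro) (simp_all add: V m_prob(1))

sublocale U: models V "\<lambda>i. uniform_count_measure (V i)"
  by (rule models.intro) (simp_all add: V prob_space_uniform_count_measure)

abbreviation A where "A \<equiv> site_mval C \<sigma>"

definition moment :: "('g \<times> 'j) list \<Rightarrow> real" where
  "moment t = (\<integral>x. mval (\<lambda>z. coord z x) t \<partial>\<mu>)"

lemma A_measurable:
  assumes "over G t" "v \<in> V i"
  shows "A t i v \<in> borel_measurable (config (V i) K d)"
  unfolding site_mval_def using assms \<sigma>
  by (intro mval_measurable config_coordinate_measurable) auto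

lemma A_arr: assumes t: "over G t" shows "arr (A t)"
proof -
  let ?X = "{(i, v, x). v \<in> V i \<and> x \<in> space (m i)}"
  have "\<exists>B. \<forall>y\<in>?X. \<bar>mval ((\<lambda>(i, v, x) z. C (snd z) (x (\<sigma> i (fst z) v))) y) t\<bar> \<le> B"
  proof (rule mval_bounded)
    fix z assume z: "z \<in> set t"
    obtain B where "\<forall>x\<in>K. \<bar>C (snd z) x\<bar> \<le> B" using coordinate_bounded by blast
    then show "\<exists>B. \<forall>y\<in>?X. \<bar>(\<lambda>(i, v, x) z. C (snd z) (x (\<sigma> i (fst z) v))) y z\<bar> \<le> B"
    proof (intro exI[of _ B] ballI)
      fix y assume "y \<in> ?X"
      then obtain i v x where y: "y = (i, v, x)" "v \<in> V i" "x \<in> PiE (V i) (\<lambda>_. K)" using m_prob(3) by auto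
      have "\<sigma> i (fst z) v \<in> V i" using \<sigma> y(2) t z by auto
      then have "x (\<sigma> i (fst z) v) \<in> K" using y(3) by auto
      then show "\<bar>(\<lambda>(i, v, x) z. C (snd z) (x (\<sigma> i (fst z) v))) y z\<bar> \<le> B" using \<open>\<forall>x\<in>K. _ x\<close> y(1) by simp
    qed
  qed
  then obtain B where "\<And>i v x. v \<in> V i \<Longrightarrow> x \<in> space (m i) \<Longrightarrow> \<bar>A t i v x\<bar> \<le> B"
    unfolding site_mval_def by fastforce
  moreover have "A t i v \<in> borel_measurable (m i)" if "v \<in> V i" for i v
    using A_measurable[OF t that] measurable_cong_sets[OF m_prob(2) refl] by blast
  ultimately show ?thesis by (rule arrI[rotated])
qed

lemma pullback_measurable:
  "v \<in> V i \<Longrightarrow> pullback_name G (\<sigma> i) v \<in> config (V i) K d \<rightarrow>\<^sub>M names"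
  unfolding pullback_name_def using \<sigma>
  by (intro measurable_restrict measurable_component_singleton) auto

lemma pullback_space:
  "v \<in> V i \<Longrightarrow> x \<in> PiE (V i) (\<lambda>_. K) \<Longrightarrow> pullback_name G (\<sigma> i) v x \<in> space names"
  using measurable_space[OF pullback_measurable] by (auto simp: space_config)

lemma mval_pullback:
  assumes "over G t"
  shows "mval (\<lambda>z. coord z (pullback_name G (\<sigma> i) v x)) t = A t i v x"
  unfolding site_mval_def using assms by (intro mval_cong) (auto simp: coord_def pullback_name_def)

lemma distr_pullback:
  assumes v: "v \<in> V i"
  shows "distr (m i) names (pullback_name G (\<sigma> i) v) \<in> space (prob_algebra names)"
    and "(f :: _ \<Rightarrow> real) \<in> borel_measurable names \<Longrightarrow>
      (\<integral>x. f x \<partial>distr (m i) names (pullback_name G (\<sigma> i) v)) = (\<integral>x. f (pullback_name G (\<sigma> i) v x) \<partial>m i)"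
proof -
  have meas: "pullback_name G (\<sigma> i) v \<in> m i \<rightarrow>\<^sub>M names"
    using pullback_measurable[OF v] measurable_cong_sets[OF m_prob(2) refl] by blast
  show "distr (m i) names (pullback_name G (\<sigma> i) v) \<in> space (prob_algebra names)"
    using prob_space.prob_space_distr[OF m_prob(1) meas] by (simp add: space_prob_algebra)
  show "f \<in> borel_measurable names \<Longrightarrow>
      (\<integral>x. f x \<partial>distr (m i) names (pullback_name G (\<sigma> i) v)) = (\<integral>x. f (pullback_name G (\<sigma> i) v x) \<partial>m i)"
    by (rule integral_distr[OF meas])
qed

lemma empirical:
  assumes x: "x \<in> PiE (V i) (\<lambda>_. K)"
  shows "empirical G K d (V i) (\<sigma> i) x \<in> space (prob_algebra names)"
    and "f \<in> borel_measurable names \<Longrightarrow>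
      (\<integral>y. f y \<partial>empirical G K d (V i) (\<sigma> i) x) = avg (V i) (\<lambda>v. f (pullback_name G (\<sigma> i) v x))"
proof -
  have meas: "(\<lambda>v. pullback_name G (\<sigma> i) v x) \<in> uniform_count_measure (V i) \<rightarrow>\<^sub>M names"
    using pullback_space[OF _ x] by (auto simp: measurable_def space_uniform_count_measure sets_uniform_count_measure)
  show "empirical G K d (V i) (\<sigma> i) x \<in> space (prob_algebra names)"
    unfolding empirical_def using prob_space.prob_space_distr[OF U.P meas] by (simp add: space_prob_algebra)
  show "f \<in> borel_measurable names \<Longrightarrow>
      (\<integral>y. f y \<partial>empirical G K d (V i) (\<sigma> i) x) = avg (V i) (\<lambda>v. f (pullback_name G (\<sigma> i) v x))"
    unfolding empirical_def using V
    by (simp add: integral_distr[OF meas] integral_uniform_count_measure avg_def)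
qed

lemma vertex_integral: "(\<integral>v. f v \<partial>uniform_count_measure (V i)) = avg (V i) f" for f :: "'v \<Rightarrow> real"
  using V by (simp add: integral_uniform_count_measure avg_def)

lemma vertex_measure: "measure (uniform_count_measure (V i)) {v \<in> V i. Q v} = real (card {v \<in> V i. Q v}) / real (card (V i))"
  using V by (intro measure_uniform_count_measure) auto

lemma vertex_measurable: "f \<in> borel_measurable (uniform_count_measure (V i))"
  by (auto simp: measurable_def sets_uniform_count_measure space_uniform_count_measure)

lemma vertex_integrable: "integrable (uniform_count_measure (V i)) (f :: 'v \<Rightarrow> real)"
proof -
  have "finite (f ` V i)" using V by auto
  then have "\<forall>v\<in>V i. \<bar>f v\<bar> \<le> Max (abs ` f ` V i)" by auto
  then show ?thesis
    by (intro U.bounded_integrable[where B = "Max (abs ` f ` V i)"] vertex_measurable) (auto simp: space_uniform_count_measure)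
qed

lemma mval_coord_measurable:
  "over G t \<Longrightarrow> (\<lambda>x. mval (\<lambda>z. coord z x) t) \<in> borel_measurable names"
  by (intro continuous_measurable mval_coord_continuous)

lemma moment_pullback:
  assumes "over G t" "v \<in> V i"
  shows "(\<integral>x. mval (\<lambda>z. coord z x) t \<partial>distr (m i) names (pullback_name G (\<sigma> i) v)) = (\<integral>x. A t i v x \<partial>m i)"
  using assms by (simp add: distr_pullback mval_coord_measurable mval_pullback)

lemma moment_empirical:
  assumes "over G t" "x \<in> PiE (V i) (\<lambda>_. K)"
  shows "(\<integral>y. mval (\<lambda>z. coord z y) t \<partial>empirical G K d (V i) (\<sigma> i) x) = avg (V i) (\<lambda>v. A t i v x)"
  using assms by (simp add: empirical mval_coord_measurable mval_pullback)

text \<open>The two conditions in the definition are tested on neighbourhoods that restrict a single moment. As everything is bounded,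
  convergence in measure is convergence in mean.\<close>

lemma quenched_moments:
  assumes q: "quenched_converges G K d V \<sigma> m \<mu>" and t: "over G t"
  shows "local_conv (A t) (moment t)" "mean_conv (A t) (moment t)"
proof -
  let ?f = "\<lambda>x. mval (\<lambda>z. coord z x) t"
  define \<O> where "\<O> e = {\<mu>' \<in> space (prob_algebra names). (\<integral>x. ?f x \<partial>\<mu>') \<in> {r. \<bar>r - moment t\<bar> < e}}" for e
  have o: "openin (process_topology G K d) (\<O> e)" for e
    unfolding \<O>_def
    by (rule openin_process_topology_integral[OF mval_coord_continuous[OF t]]) (intro open_Collect_less continuous_intros)
  have in\<O>: "\<mu> \<in> \<O> e" if "e > 0" for e using that \<mu> by (simp add: \<O>_def moment_def)
  obtain B where B: "0 < B" "\<And>i v u. v \<in> V i \<Longrightarrow> u \<in> space (m i) \<Longrightarrow> \<bar>A t i v u\<bar> \<le> B"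
    using arr_bounded[OF A_arr[OF t]] by blast
  obtain B' where B': "0 < B'" "\<And>i u. u \<in> space (m i) \<Longrightarrow> \<bar>avg (V i) (\<lambda>v. A t i v u)\<bar> \<le> B'"
    using arr_avg_bounded[OF A_arr[OF t]] by blast
  have "(\<lambda>i. \<integral>v. \<bar>(\<integral>x. A t i v x \<partial>m i) - moment t\<bar> \<partial>uniform_count_measure (V i)) \<longlonglongrightarrow> 0"
  proof (rule U.L1_of_probability[where B = "B + \<bar>moment t\<bar>"])
    fix i v assume "v \<in> space (uniform_count_measure (V i))"
    then have v: "v \<in> V i" by (simp add: space_uniform_count_measure)
    have "\<bar>\<integral>x. A t i v x \<partial>m i\<bar> \<le> (\<integral>x. \<bar>A t i v x\<bar> \<partial>m i)" by (rule integral_abs_bound)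
    also have "\<dots> \<le> B" using B(2)[OF v] arr_integrable[OF A_arr[OF t] v] by (intro integral_le_const) auto
    finally show "\<bar>(\<integral>x. A t i v x \<partial>m i) - moment t\<bar> \<le> B + \<bar>moment t\<bar>" by linarith
  next
    fix e :: real assume e: "e > 0"
    have "{v \<in> V i. distr (m i) names (pullback_name G (\<sigma> i) v) \<in> \<O> e} =
        {v \<in> V i. \<bar>(\<integral>x. A t i v x \<partial>m i) - moment t\<bar> < e}" for i
      using distr_pullback(1) moment_pullback[OF t] by (auto simp: \<O>_def)
    moreover have "(\<lambda>i. real (card {v \<in> V i. distr (m i) names (pullback_name G (\<sigma> i) v) \<in> \<O> e}) / real (card (V i))) \<longlonglongrightarrow> 1"
      using q o in\<O>[OF e] unfolding quenched_converges_def by blast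
    ultimately show "(\<lambda>i. measure (uniform_count_measure (V i))
        {v \<in> space (uniform_count_measure (V i)). \<bar>(\<integral>x. A t i v x \<partial>m i) - moment t\<bar> < e}) \<longlonglongrightarrow> 1"
      by (simp add: space_uniform_count_measure vertex_measure)
  qed (rule vertex_measurable)
  then show "local_conv (A t) (moment t)" by (simp add: local_conv_def vertex_integral)
  show "mean_conv (A t) (moment t)"
    unfolding mean_conv_def
  proof (rule L1_of_probability[where B = "B' + \<bar>moment t\<bar>"])
    show "(\<lambda>u. avg (V i) (\<lambda>v. A t i v u) - moment t) \<in> borel_measurable (m i)" for i
      using arr_avg_measurable[OF A_arr[OF t]] by auto
    show "\<bar>avg (V i) (\<lambda>v. A t i v u) - moment t\<bar> \<le> B' + \<bar>moment t\<bar>" if "u \<in> space (m i)" for i u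
      using B'(2)[OF that] by linarith
    fix e :: real assume e: "e > 0"
    have "good_models G K d (V i) (\<sigma> i) (\<O> e) = {u \<in> space (m i). \<bar>avg (V i) (\<lambda>v. A t i v u) - moment t\<bar> < e}" for i
      unfolding good_models_def m_prob(3) using empirical(1) moment_empirical[OF t] by (auto simp: \<O>_def)
    moreover have "(\<lambda>i. measure (m i) (good_models G K d (V i) (\<sigma> i) (\<O> e))) \<longlonglongrightarrow> 1"
      using q o in\<O>[OF e] unfolding quenched_converges_def by blast
    ultimately show "(\<lambda>i. measure (m i) {u \<in> space (m i). \<bar>avg (V i) (\<lambda>v. A t i v u) - moment t\<bar> < e}) \<longlonglongrightarrow> 1"
      by simp
  qed
qed

text \<open>The uniform measure on the vertices and the model measure play the same role in the two conditions: in both cases the moments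
  are a random point of a countable product that converges in mean in each coordinate.\<close>

lemma quenched_of_moments:
  assumes l: "\<And>t. over G t \<Longrightarrow> local_conv (A t) (moment t)"
    and mc: "\<And>t. over G t \<Longrightarrow> mean_conv (A t) (moment t)"
  shows "quenched_converges G K d V \<sigma> m \<mu>"
  unfolding quenched_converges_def
proof (intro conjI allI impI m)
  fix \<O> assume "openin (process_topology G K d) \<O> \<and> \<mu> \<in> \<O>"
  then have \<O>: "openin (process_topology G K d) \<O>" "\<mu> \<in> \<O>" by auto
  let ?n = "\<lambda>t. map (apfst el) t :: ('g \<times> 'j) list"
  have n: "fst ` set (?n t) \<subseteq> carrier G" for t :: "(nat \<times> 'j) list" by auto
  have nm: "mval (\<lambda>z. ncoord z x) t = mval (\<lambda>z. coord z x) (?n t)" for t x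
    by (simp add: mval_map ncoord_coord)
  obtain U where U: "open U" "\<And>\<mu>'. \<mu>' \<in> space (prob_algebra names) \<Longrightarrow>
       \<mu>' \<in> \<O> \<longleftrightarrow> (\<lambda>t. \<integral>x. mval (\<lambda>z. coord z x) (?n t) \<partial>\<mu>') \<in> U"
    using process_topology_open_moments[OF \<O>(1)] unfolding nm by blast
  have \<mu>U: "(\<lambda>t. moment (?n t)) \<in> U" using U(2)[OF \<mu>] \<O>(2) unfolding moment_def by simp
  have "(\<lambda>i. measure (uniform_count_measure (V i)) {v \<in> space (uniform_count_measure (V i)). (\<lambda>t. \<integral>x. A (?n t) i v x \<partial>m i) \<in> U}) \<longlonglongrightarrow> 1"
    using l[OF n] unfolding local_conv_def
    by (intro U.probability_open_set[OF vertex_integrable _ U(1) \<mu>U]) (simp add: vertex_integral)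
  moreover have "{v \<in> V i. distr (m i) names (pullback_name G (\<sigma> i) v) \<in> \<O>} = {v \<in> V i. (\<lambda>t. \<integral>x. A (?n t) i v x \<partial>m i) \<in> U}" for i
    using U(2)[OF distr_pullback(1)] moment_pullback[OF n] by auto
  ultimately show "(\<lambda>i. real (card {v \<in> V i. distr (m i) names (pullback_name G (\<sigma> i) v) \<in> \<O>}) / real (card (V i))) \<longlonglongrightarrow> 1"
    by (simp add: space_uniform_count_measure vertex_measure)
  have "(\<lambda>i. measure (m i) {u \<in> space (m i). (\<lambda>t. avg (V i) (\<lambda>v. A (?n t) i v u)) \<in> U}) \<longlonglongrightarrow> 1"
    using mc[OF n] unfolding mean_conv_def
    by (intro probability_open_set[OF _ _ U(1) \<mu>U] avg_integrable arr_integrable A_arr n) auto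
  moreover have "good_models G K d (V i) (\<sigma> i) \<O> = {u \<in> space (m i). (\<lambda>t. avg (V i) (\<lambda>v. A (?n t) i v u)) \<in> U}" for i
    unfolding good_models_def m_prob(3) using U(2)[OF empirical(1)] moment_empirical[OF n] by auto
  ultimately show "(\<lambda>i. measure (m i) (good_models G K d (V i) (\<sigma> i) \<O>)) \<longlonglongrightarrow> 1" by simp
qed

end

section \<open>Doubly quenched convergence through moments\<close>

definition pair_coordinate :: "('j \<Rightarrow> 'a \<Rightarrow> real) \<Rightarrow> 'j + 'j \<Rightarrow> 'a \<times> 'a \<Rightarrow> real" where
  "pair_coordinate C s z = (case s of Inl j \<Rightarrow> C j (fst z) | Inr j \<Rightarrow> C j (snd z))"

lemma pair_coordinate_simps [simp]:
  "pair_coordinate C (Inl j) = (\<lambda>z. C j (fst z))" "pair_coordinate C (Inr j) = (\<lambda>z. C j (snd z))"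
  by (simp_all add: pair_coordinate_def fun_eq_iff)

lemma Metric_space_avg_prod:
  assumes "Metric_space K d" shows "Metric_space (K \<times> K) (avg_prod_metric d)"
proof -
  interpret Metric_space K d by fact
  show ?thesis
  proof
    fix x y z
    show "0 \<le> avg_prod_metric d x y" by (auto simp: avg_prod_metric_def split: prod.splits)
    show "avg_prod_metric d x y = avg_prod_metric d y x" by (auto simp: avg_prod_metric_def commute split: prod.splits)
    assume xy: "x \<in> K \<times> K" "y \<in> K \<times> K"
    have "d (fst x) (fst y) + d (snd x) (snd y) = 0 \<longleftrightarrow> d (fst x) (fst y) = 0 \<and> d (snd x) (snd y) = 0"
      by (rule add_nonneg_eq_0_iff) (rule nonneg)+
    then show "avg_prod_metric d x y = 0 \<longleftrightarrow> x = y"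
      using xy by (auto simp: avg_prod_metric_def split: prod.splits)
    assume z: "z \<in> K \<times> K"
    show "avg_prod_metric d x z \<le> avg_prod_metric d x y + avg_prod_metric d y z"
      using xy z triangle[of "fst x" "fst y" "fst z"] triangle[of "snd x" "snd y" "snd z"]
      by (auto simp: avg_prod_metric_def divide_simps split: prod.splits)
  qed
qed

lemma compact_avg_prod:
  assumes M: "Metric_space K d" and c: "compact_space (Metric_space.mtopology K d)"
  shows "compact_space (Metric_space.mtopology (K \<times> K) (avg_prod_metric d))"
proof -
  interpret Metric_space K d by fact
  interpret PM: Metric_space "K \<times> K" "avg_prod_metric d" by (rule Metric_space_avg_prod[OF M])
  let ?X = "prod_topology mtopology mtopology"
  have "continuous_map ?X PM.mtopology (\<lambda>z. z)"
    unfolding PM.continuous_map_to_metric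
  proof (intro ballI allI impI)
    fix z and e :: real assume z: "z \<in> topspace ?X" and e: "0 < e"
    show "\<exists>U. openin ?X U \<and> z \<in> U \<and> (\<forall>y\<in>U. y \<in> PM.mball z e)"
    proof (intro exI conjI ballI)
      show "openin ?X (mball (fst z) e \<times> mball (snd z) e)" by (simp add: openin_prod_Times_iff)
      show "z \<in> mball (fst z) e \<times> mball (snd z) e" using z e by (cases z) auto
      fix y assume "y \<in> mball (fst z) e \<times> mball (snd z) e"
      then have "avg_prod_metric d z y < e" "y \<in> K \<times> K" "z \<in> K \<times> K"
        using z by (cases z; cases y; auto simp: in_mball avg_prod_metric_def)+
      then show "y \<in> PM.mball z e" unfolding PM.in_mball by blast
    qed
  qed
  moreover have "compactin ?X (topspace ?X)"
    unfolding compact_space_def[symmetric] using c by (simp add: compact_space_prod_topology)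
  ultimately have "compactin PM.mtopology ((\<lambda>z. z) ` topspace ?X)" by (intro image_compactin)
  then show ?thesis by (simp add: compact_space_def)
qed

lemma continuous_avg_prod:
  assumes M: "Metric_space K d"
  shows "continuous_map (Metric_space.mtopology (K \<times> K) (avg_prod_metric d)) (Metric_space.mtopology K d) fst \<and>
    continuous_map (Metric_space.mtopology (K \<times> K) (avg_prod_metric d)) (Metric_space.mtopology K d) snd"
proof -
  interpret Metric_space K d by fact
  interpret PM: Metric_space "K \<times> K" "avg_prod_metric d" by (rule Metric_space_avg_prod[OF M])
  have *: "d (fst z) (fst y) < e" "d (snd z) (snd y) < e" if "avg_prod_metric d z y < e / 2" for z y e
  proof -
    have "d (fst z) (fst y) + d (snd z) (snd y) < e" using that by (simp add: avg_prod_metric_def split: prod.splits)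
    then show "d (fst z) (fst y) < e" "d (snd z) (snd y) < e"
      using nonneg[of "fst z" "fst y"] nonneg[of "snd z" "snd y"] by linarith+
  qed
  have U: "openin PM.mtopology (PM.mball z (e / 2)) \<and> z \<in> PM.mball z (e / 2) \<and>
      (\<forall>y\<in>PM.mball z (e / 2). fst y \<in> mball (fst z) e \<and> snd y \<in> mball (snd z) e)"
    if "z \<in> topspace PM.mtopology" "0 < e" for z e
    using that *[of z _ e] by (auto simp: PM.in_mball in_mball mem_Times_iff)
  show ?thesis
    unfolding continuous_map_to_metric using U by blast
qed

lemma (in coordinates) coordinates_square:
  "coordinates (K \<times> K) (avg_prod_metric d) (pair_coordinate C)"
proof (rule coordinates.intro)
  show "Metric_space (K \<times> K) (avg_prod_metric d)" by (rule Metric_space_avg_prod[OF metric])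
  show "compact_space (Metric_space.mtopology (K \<times> K) (avg_prod_metric d))" by (rule compact_avg_prod[OF metric compact])
  show "continuous_map (Metric_space.mtopology (K \<times> K) (avg_prod_metric d)) euclideanreal (pair_coordinate C j)" for j
    using continuous_map_compose[OF continuous_avg_prod[OF metric, THEN conjunct1] cont]
      continuous_map_compose[OF continuous_avg_prod[OF metric, THEN conjunct2] cont]
    by (cases j) (simp_all add: comp_def)
  fix x y assume "x \<in> K \<times> K" "y \<in> K \<times> K" "x \<noteq> y"
  then have xy: "fst x \<in> K" "snd x \<in> K" "fst y \<in> K" "snd y \<in> K" "x \<noteq> y" by (simp_all add: mem_Times_iff)
  then consider "fst x \<noteq> fst y" | "snd x \<noteq> snd y" by (auto simp: prod_eq_iff)
  then show "\<exists>j. pair_coordinate C j x \<noteq> pair_coordinate C j y"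
  proof cases
    case 1
    then obtain j where "C j (fst x) \<noteq> C j (fst y)" using separating[OF xy(1,3) 1] by blast
    then show ?thesis by (intro exI[of _ "Inl j"]) (simp add: pair_coordinate_def)
  next
    case 2
    then obtain j where "C j (snd x) \<noteq> C j (snd y)" using separating[OF xy(2,4) 2] by blast
    then show ?thesis by (intro exI[of _ "Inr j"]) (simp add: pair_coordinate_def)
  qed
qed

text \<open>A monomial in the coordinates of pairs is a monomial in the first entries times a monomial in the second entries.\<close>

definition lefts :: "('g \<times> ('j + 'j)) list \<Rightarrow> ('g \<times> 'j) list" where
  "lefts t = concat (map (\<lambda>(g, s). case s of Inl j \<Rightarrow> [(g, j)] | Inr j \<Rightarrow> []) t)"

definition rights :: "('g \<times> ('j + 'j)) list \<Rightarrow> ('g \<times> 'j) list" where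
  "rights t = concat (map (\<lambda>(g, s). case s of Inl j \<Rightarrow> [] | Inr j \<Rightarrow> [(g, j)]) t)"

lemma lefts_simps [simp]: "lefts [] = []" "lefts ((g, Inl j) # t) = (g, j) # lefts t" "lefts ((g, Inr j) # t) = lefts t"
  by (simp_all add: lefts_def)

lemma rights_simps [simp]: "rights [] = []" "rights ((g, Inl j) # t) = rights t" "rights ((g, Inr j) # t) = (g, j) # rights t"
  by (simp_all add: rights_def)

lemma carrier_lefts_rights:
  "fst ` set t \<subseteq> \<Gamma> \<Longrightarrow> fst ` set (lefts t) \<subseteq> \<Gamma>" "fst ` set t \<subseteq> \<Gamma> \<Longrightarrow> fst ` set (rights t) \<subseteq> \<Gamma>"
  by (auto simp: lefts_def rights_def split: sum.splits)

lemma lefts_append: "lefts (s @ t) = lefts s @ lefts t" and rights_append: "rights (s @ t) = rights s @ rights t"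
  by (simp_all add: lefts_def rights_def)

lemma lefts_map: "lefts (map (apsnd Inl) t) = t" "lefts (map (apsnd Inr) t) = []"
  "rights (map (apsnd Inl) t) = []" "rights (map (apsnd Inr) t) = t"
  by (induction t) auto

lemma mval_pair_coordinate:
  "mval (\<lambda>z. pair_coordinate C (snd z) (\<rho> (fst z))) t =
     mval (\<lambda>z. C (snd z) (fst (\<rho> (fst z)))) (lefts t) * mval (\<lambda>z. C (snd z) (snd (\<rho> (fst z)))) (rights t)"
proof (induction t)
  case (Cons a t)
  obtain g s where "a = (g, s)" by (cases a)
  then show ?case using Cons by (cases s) (simp_all add: pair_coordinate_def)
qed simp

lemma (in coordinates) square_map_measurable:
  "(\<lambda>(x, y). \<lambda>i\<in>I. (x i, y i)) \<in> config I K d \<Otimes>\<^sub>M config I K d \<rightarrow>\<^sub>M config I (K \<times> K) (avg_prod_metric d)"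
proof -
  interpret sq: coordinates "K \<times> K" "avg_prod_metric d" "pair_coordinate C" by (rule coordinates_square)
  let ?N = "config I K d \<Otimes>\<^sub>M config I K d"
  have "(\<lambda>z. \<lambda>i\<in>I. (fst z i, snd z i)) \<in> ?N \<rightarrow>\<^sub>M config I (K \<times> K) (avg_prod_metric d)"
  proof (rule measurable_restrict, rule sq.measurable_metric_borelI)
    fix i j assume i: "i \<in> I"
    show "(fst z i, snd z i) \<in> K \<times> K" if "z \<in> space ?N" for z
      using that i by (auto simp: space_pair_measure space_config)
    show "(\<lambda>z. pair_coordinate C j (fst z i, snd z i)) \<in> borel_measurable ?N"
      using measurable_compose[OF measurable_fst config_coordinate_measurable[OF i]]
        measurable_compose[OF measurable_snd config_coordinate_measurable[OF i]]
      by (cases j) (simp_all add: pair_coordinate_def)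
  qed
  then show ?thesis by (simp add: case_prod_unfold)
qed

lemma (in coordinates) config_square:
  assumes m: "m \<in> space (prob_algebra (config I K d))"
  shows "config_square I K d m \<in> space (prob_algebra (config I (K \<times> K) (avg_prod_metric d)))"
    and "\<And>f g h :: _ \<Rightarrow> real. f \<in> borel_measurable (config I K d) \<Longrightarrow> g \<in> borel_measurable (config I K d) \<Longrightarrow>
      h \<in> borel_measurable (config I (K \<times> K) (avg_prod_metric d)) \<Longrightarrow>
      (\<And>x. x \<in> PiE I (\<lambda>_. K) \<Longrightarrow> \<bar>f x\<bar> \<le> B) \<Longrightarrow> (\<And>x. x \<in> PiE I (\<lambda>_. K) \<Longrightarrow> \<bar>g x\<bar> \<le> B') \<Longrightarrow>
      (\<And>x y. x \<in> PiE I (\<lambda>_. K) \<Longrightarrow> y \<in> PiE I (\<lambda>_. K) \<Longrightarrow> h (\<lambda>i\<in>I. (x i, y i)) = f x * g y) \<Longrightarrow>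
      (\<integral>z. h z \<partial>config_square I K d m) = (\<integral>x. f x \<partial>m) * (\<integral>x. g x \<partial>m)"
proof -
  have mp: "prob_space m" "sets m = sets (config I K d)" "space m = PiE I (\<lambda>_. K)"
    using prob_space_square[OF m] by (auto simp: space_config)
  interpret m: prob_space m by (rule mp)
  interpret mm: pair_prob_space m m ..
  have meas: "(\<lambda>(x, y). \<lambda>i\<in>I. (x i, y i)) \<in> m \<Otimes>\<^sub>M m \<rightarrow>\<^sub>M config I (K \<times> K) (avg_prod_metric d)"
    using square_map_measurable measurable_cong_sets[OF sets_pair_measure_cong[OF mp(2) mp(2)] refl] by blast
  show "config_square I K d m \<in> space (prob_algebra (config I (K \<times> K) (avg_prod_metric d)))"
    unfolding config_square_def using mm.prob_space_distr[OF meas] by (simp add: space_prob_algebra)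
  fix f g h :: "_ \<Rightarrow> real"
  assume f: "f \<in> borel_measurable (config I K d)" and g: "g \<in> borel_measurable (config I K d)"
    and h: "h \<in> borel_measurable (config I (K \<times> K) (avg_prod_metric d))"
    and B: "\<And>x. x \<in> PiE I (\<lambda>_. K) \<Longrightarrow> \<bar>f x\<bar> \<le> B" "\<And>x. x \<in> PiE I (\<lambda>_. K) \<Longrightarrow> \<bar>g x\<bar> \<le> B'"
    and eq: "\<And>x y. x \<in> PiE I (\<lambda>_. K) \<Longrightarrow> y \<in> PiE I (\<lambda>_. K) \<Longrightarrow> h (\<lambda>i\<in>I. (x i, y i)) = f x * g y"
  have "(\<integral>z. h z \<partial>config_square I K d m) = (\<integral>z. h (case z of (x, y) \<Rightarrow> \<lambda>i\<in>I. (x i, y i)) \<partial>(m \<Otimes>\<^sub>M m))"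
    unfolding config_square_def by (rule integral_distr[OF meas h])
  also have "\<dots> = (\<integral>z. f (fst z) * g (snd z) \<partial>(m \<Otimes>\<^sub>M m))"
    by (intro Bochner_Integration.integral_cong refl) (auto simp: space_pair_measure mp(3) eq)
  also have "\<dots> = (\<integral>x. f x \<partial>m) * (\<integral>x. g x \<partial>m)"
  proof (rule integral_pair_mult[OF mp(1) mp(1)])
    show "f \<in> borel_measurable m" "g \<in> borel_measurable m"
      using f g measurable_cong_sets[OF mp(2) refl] by blast+
  qed (use B mp(3) in auto)
  finally show "(\<integral>z. h z \<partial>config_square I K d m) = (\<integral>x. f x \<partial>m) * (\<integral>x. g x \<partial>m)" .
qed

context models
begin

lemma mean_conv_add:
  assumes "arr F" "arr F'" "mean_conv F c" "mean_conv F' c'"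
  shows "mean_conv (\<lambda>i v x. F i v x + F' i v x) (c + c')"
  unfolding mean_conv_def
proof (rule tendsto_0_le)
  let ?a = "\<lambda>i x. avg (V i) (\<lambda>v. F i v x)" and ?b = "\<lambda>i x. avg (V i) (\<lambda>v. F' i v x)"
  have ia: "integrable (P i) (?a i)" and ib: "integrable (P i) (?b i)" for i
    by (intro avg_integrable arr_integrable assms; assumption)+
  fix i
  interpret prob_space "P i" by (rule P)
  have "(\<integral>x. \<bar>avg (V i) (\<lambda>v. F i v x + F' i v x) - (c + c')\<bar> \<partial>P i) \<le> (\<integral>x. \<bar>?a i x - c\<bar> + \<bar>?b i x - c'\<bar> \<partial>P i)"
    using ia ib by (intro integral_mono) (auto simp: avg_add)
  then show "(\<integral>x. \<bar>avg (V i) (\<lambda>v. F i v x + F' i v x) - (c + c')\<bar> \<partial>P i)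
      \<le> (\<integral>x. \<bar>?a i x - c\<bar> \<partial>P i) + (\<integral>x. \<bar>?b i x - c'\<bar> \<partial>P i)"
    using ia ib by simp
next
  show "(\<lambda>i. (\<integral>x. \<bar>avg (V i) (\<lambda>v. F i v x) - c\<bar> \<partial>P i) + (\<integral>x. \<bar>avg (V i) (\<lambda>v. F' i v x) - c'\<bar> \<partial>P i)) \<longlonglongrightarrow> 0"
    using tendsto_add[OF assms(3,4)[unfolded mean_conv_def]] by simp
qed simp

lemma mean_conv_cmult:
  assumes "mean_conv F c" shows "mean_conv (\<lambda>i v x. a * F i v x) (a * c)"
proof -
  have "(\<integral>x. \<bar>avg (V i) (\<lambda>v. a * F i v x) - a * c\<bar> \<partial>P i) = \<bar>a\<bar> * (\<integral>x. \<bar>avg (V i) (\<lambda>v. F i v x) - c\<bar> \<partial>P i)" for i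
    by (simp add: avg_cmult abs_mult flip: right_diff_distrib)
  then show ?thesis using tendsto_mult_left[OF assms[unfolded mean_conv_def], of "\<bar>a\<bar>"] by (simp add: mean_conv_def)
qed

lemma mean_conv_const: "mean_conv (\<lambda>i v x. c) c"
  using V by (simp add: mean_conv_def avg_const)

lemma arr_integral_bounded:
  assumes "v \<in> V i" "integrable (P i) f" "\<And>x. x \<in> space (P i) \<Longrightarrow> \<bar>f x\<bar> \<le> B"
  shows "\<bar>\<integral>x. f x \<partial>P i\<bar> \<le> (B :: real)"
proof -
  have "\<bar>\<integral>x. f x \<partial>P i\<bar> \<le> (\<integral>x. \<bar>f x\<bar> \<partial>P i)" by (rule integral_abs_bound)
  also have "\<dots> \<le> B" using assms by (intro integral_le_const) auto
  finally show ?thesis .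
qed

end

locale double_models = process_models K d C G V \<sigma> m \<mu>
  for K :: "'a set" and d :: "'a \<Rightarrow> 'a \<Rightarrow> real" and C :: "'j::countable \<Rightarrow> 'a \<Rightarrow> real"
    and G :: "('g, 'm) monoid_scheme" and V :: "nat \<Rightarrow> 'v set" and \<sigma> m \<mu>
begin

abbreviation m2 where "m2 \<equiv> \<lambda>i. config_square (V i) K d (m i)"

sublocale sq: process_models "K \<times> K" "avg_prod_metric d" "pair_coordinate C" G V \<sigma> m2 "config_square (carrier G) K d \<mu>"
proof (intro process_models.intro process_coordinates.intro coordinates_square process_coordinates_axioms.intro
    process_models_axioms.intro)
  show "m2 i \<in> space (prob_algebra (config (V i) (K \<times> K) (avg_prod_metric d)))" for i by (rule config_square(1)[OF m])
  show "config_square (carrier G) K d \<mu> \<in> space (prob_algebra (config (carrier G) (K \<times> K) (avg_prod_metric d)))"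
    by (rule config_square(1)[OF \<mu>])
qed (use group countable V \<sigma> in auto)

lemma square_moment:
  assumes t: "over G t"
  shows "sq.moment t = moment (lefts t) * moment (rights t)"
proof -
  let ?f = "\<lambda>t x. mval (\<lambda>z. coord z x) t"
  note lr = carrier_lefts_rights[OF t]
  obtain B where B: "\<forall>x\<in>space names. \<bar>?f (lefts t) x\<bar> \<le> B" using continuous_bounded[OF mval_coord_continuous[OF lr(1)]] by blast
  obtain B' where B': "\<forall>x\<in>space names. \<bar>?f (rights t) x\<bar> \<le> B'" using continuous_bounded[OF mval_coord_continuous[OF lr(2)]] by blast
  show ?thesis unfolding sq.moment_def moment_def
  proof (rule config_square(2)[OF \<mu> mval_coord_measurable[OF lr(1)] mval_coord_measurable[OF lr(2)] sq.mval_coord_measurable[OF t]])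
    fix x y
    show "mval (\<lambda>z. sq.coord z (\<lambda>i\<in>carrier G. (x i, y i))) t = ?f (lefts t) x * ?f (rights t) y"
      using lr mval_pair_coordinate[of C "\<lambda>g. (\<lambda>i\<in>carrier G. (x i, y i)) g" t]
      by (simp add: sq.coord_def coord_def) (intro arg_cong2[where f = "(*)"] mval_cong; auto)
  qed (use B B' in \<open>auto simp: space_config\<close>)
qed

lemma square_A_zip:
  assumes t: "over G t" and v: "v \<in> V i"
  shows "sq.A t i v (\<lambda>u\<in>V i. (x u, y u)) = A (lefts t) i v x * A (rights t) i v y"
  using carrier_lefts_rights[OF t] \<sigma> v mval_pair_coordinate[of C "\<lambda>g. (\<lambda>u\<in>V i. (x u, y u)) (\<sigma> i g v)" t]
  by (simp add: site_mval_def) (intro arg_cong2[where f = "(*)"] mval_cong; auto)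

lemma A_Nil: "A [] i v x = 1" by (simp add: site_mval_def)

lemma moment_Nil: "moment [] = 1"
  using prob_space_square(1)[OF \<mu>] by (simp add: moment_def prob_space.prob_space)

lemma A_mult_measurable:
  assumes "over G s" "over G t" "v \<in> V i" "w \<in> V i"
  shows "(\<lambda>x. A s i v x * A t i w x) \<in> borel_measurable (config (V i) K d)"
  by (intro borel_measurable_times A_measurable assms)

lemma square_integral_mult:
  assumes s: "over G s" and t: "over G t" and vw: "v \<in> V i" "w \<in> V i"
  shows "(\<integral>z. sq.A s i v z * sq.A t i w z \<partial>m2 i) =
    (\<integral>x. A (lefts s) i v x * A (lefts t) i w x \<partial>m i) * (\<integral>x. A (rights s) i v x * A (rights t) i w x \<partial>m i)"
proof -
  note ls = carrier_lefts_rights[OF s] and lt = carrier_lefts_rights[OF t]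
  have bd: "\<exists>B. \<forall>x\<in>PiE (V i) (\<lambda>_. K). \<bar>A s' i v x * A t' i w x\<bar> \<le> B"
    if s': "over G s'" and t': "over G t'" for s' t'
  proof -
    obtain B where B: "0 < B" "\<And>i v u. v \<in> V i \<Longrightarrow> u \<in> space (m i) \<Longrightarrow> \<bar>A s' i v u\<bar> \<le> B"
      using arr_bounded[OF A_arr[OF s']] by blast
    obtain B' where B': "0 < B'" "\<And>i v u. v \<in> V i \<Longrightarrow> u \<in> space (m i) \<Longrightarrow> \<bar>A t' i v u\<bar> \<le> B'"
      using arr_bounded[OF A_arr[OF t']] by blast
    have "\<bar>A s' i v x * A t' i w x\<bar> \<le> B * B'" if "x \<in> PiE (V i) (\<lambda>_. K)" for x
      unfolding abs_mult using B(1) B(2)[OF vw(1)] B'(2)[OF vw(2)] that m_prob(3) by (intro mult_mono) auto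
    then show ?thesis by blast
  qed
  obtain B where B: "\<forall>x\<in>PiE (V i) (\<lambda>_. K). \<bar>A (lefts s) i v x * A (lefts t) i w x\<bar> \<le> B" using bd[OF ls(1) lt(1)] by blast
  obtain B' where B': "\<forall>x\<in>PiE (V i) (\<lambda>_. K). \<bar>A (rights s) i v x * A (rights t) i w x\<bar> \<le> B'" using bd[OF ls(2) lt(2)] by blast
  show ?thesis
  proof (rule config_square(2)[OF m A_mult_measurable[OF ls(1) lt(1) vw] A_mult_measurable[OF ls(2) lt(2) vw]])
    show "(\<lambda>z. sq.A s i v z * sq.A t i w z) \<in> borel_measurable (config (V i) (K \<times> K) (avg_prod_metric d))"
      by (intro borel_measurable_times sq.A_measurable s t vw)
  qed (use B B' square_A_zip[OF s vw(1)] square_A_zip[OF t vw(2)] in \<open>auto simp: mult_ac\<close>)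
qed

lemma square_integral:
  assumes t: "over G t" and v: "v \<in> V i"
  shows "(\<integral>z. sq.A t i v z \<partial>m2 i) = (\<integral>x. A (lefts t) i v x \<partial>m i) * (\<integral>x. A (rights t) i v x \<partial>m i)"
  using square_integral_mult[of t "[]" v i v] t v by (simp add: site_mval_def)

text \<open>Expectations under the square of a measure are products of expectations. Hence decorrelation passes to the square, where it
  gives concentration.\<close>

lemma doubly_quenched_of_moments:
  assumes l: "\<And>t. over G t \<Longrightarrow> local_conv (A t) (moment t)"
    and p: "\<And>t. over G t \<Longrightarrow> pair_conv True (A t) (moment t) (A t) (moment t)"
  shows "doubly_quenched_converges G K d V \<sigma> m \<mu>"
  unfolding doubly_quenched_converges_def
proof (intro conjI allI m sq.quenched_of_moments)
  fix t :: "('g \<times> ('j + 'j)) list" assume t: "over G t"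
  let ?s = "lefts t" and ?t = "rights t"
  note lr = carrier_lefts_rights[OF t]
  obtain B where B: "0 < B" "\<And>i v u. v \<in> V i \<Longrightarrow> u \<in> space (m i) \<Longrightarrow> \<bar>A ?s i v u\<bar> \<le> B"
    using arr_bounded[OF A_arr[OF lr(1)]] by blast
  show l2: "sq.local_conv (sq.A t) (sq.moment t)"
    unfolding sq.local_conv_def
  proof (rule tendsto_0_le)
    show "avg (V i) (\<lambda>v. \<bar>(\<integral>z. sq.A t i v z \<partial>m2 i) - sq.moment t\<bar>)
      \<le> B * avg (V i) (\<lambda>v. \<bar>(\<integral>x. A ?t i v x \<partial>m i) - moment ?t\<bar>) +
        \<bar>moment ?t\<bar> * avg (V i) (\<lambda>v. \<bar>(\<integral>x. A ?s i v x \<partial>m i) - moment ?s\<bar>)" for i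
      unfolding avg_cmult[symmetric] avg_add[symmetric]
    proof (rule avg_mono)
      fix v assume v: "v \<in> V i"
      have "\<bar>\<integral>x. A ?s i v x \<partial>m i\<bar> \<le> B"
        by (rule arr_integral_bounded[OF v arr_integrable[OF A_arr[OF lr(1)] v] B(2)[OF v]])
      from product_difference[OF this]
      show "\<bar>(\<integral>z. sq.A t i v z \<partial>m2 i) - sq.moment t\<bar> \<le> B * \<bar>(\<integral>x. A ?t i v x \<partial>m i) - moment ?t\<bar> +
        \<bar>moment ?t\<bar> * \<bar>(\<integral>x. A ?s i v x \<partial>m i) - moment ?s\<bar>"
        unfolding square_integral[OF t v] square_moment[OF t] .
    qed
    show "(\<lambda>i. B * avg (V i) (\<lambda>v. \<bar>(\<integral>x. A ?t i v x \<partial>m i) - moment ?t\<bar>) +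
        \<bar>moment ?t\<bar> * avg (V i) (\<lambda>v. \<bar>(\<integral>x. A ?s i v x \<partial>m i) - moment ?s\<bar>)) \<longlonglongrightarrow> 0"
      using tendsto_add[OF tendsto_mult_left[OF l[OF lr(2), unfolded local_conv_def], of B]
        tendsto_mult_left[OF l[OF lr(1), unfolded local_conv_def], of "\<bar>moment ?t\<bar>"]] by simp
  qed (simp add: avg_nonneg)
  show "sq.mean_conv (sq.A t) (sq.moment t)"
  proof (rule sq.mean_conv_of_pair[OF sq.A_arr[OF t] l2])
    let ?D = "\<lambda>t i. nrm True (V i) (\<lambda>v w. (\<integral>x. A t i v x * A t i w x \<partial>m i) - moment t * moment t)"
    show "sq.pair_conv False (sq.A t) (sq.moment t) (sq.A t) (sq.moment t)"
      unfolding sq.pair_conv_def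
    proof (rule tendsto_0_le)
      show "nrm False (V i) (\<lambda>v w. (\<integral>z. sq.A t i v z * sq.A t i w z \<partial>m2 i) - sq.moment t * sq.moment t)
        \<le> (B * B) * ?D ?t i + \<bar>moment ?t * moment ?t\<bar> * ?D ?s i" for i
      proof (rule order_trans[OF nrm_le_avg])
        show "avg (V i) (\<lambda>v. avg (V i) (\<lambda>w. \<bar>(\<integral>z. sq.A t i v z * sq.A t i w z \<partial>m2 i) - sq.moment t * sq.moment t\<bar>))
          \<le> (B * B) * ?D ?t i + \<bar>moment ?t * moment ?t\<bar> * ?D ?s i"
          unfolding nrm_def if_True avg_cmult[symmetric] avg_add[symmetric]
        proof (intro avg_mono)
          fix v w assume vw: "v \<in> V i" "w \<in> V i"
          have "\<bar>\<integral>x. A ?s i v x * A ?s i w x \<partial>m i\<bar> \<le> B * B"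
          proof (rule arr_integral_bounded[OF vw(1) arr_integrable_mult[OF A_arr[OF lr(1)] A_arr[OF lr(1)] vw]])
            show "\<bar>A ?s i v u * A ?s i w u\<bar> \<le> B * B" if "u \<in> space (m i)" for u
              unfolding abs_mult using B(1) B(2)[OF vw(1) that] B(2)[OF vw(2) that] by (intro mult_mono) auto
          qed
          from product_difference[OF this, of "\<integral>x. A ?t i v x * A ?t i w x \<partial>m i" "moment ?s * moment ?s" "moment ?t * moment ?t"]
          show "\<bar>(\<integral>z. sq.A t i v z * sq.A t i w z \<partial>m2 i) - sq.moment t * sq.moment t\<bar> \<le>
            B * B * \<bar>(\<integral>x. A ?t i v x * A ?t i w x \<partial>m i) - moment ?t * moment ?t\<bar> +
            \<bar>moment ?t * moment ?t\<bar> * \<bar>(\<integral>x. A ?s i v x * A ?s i w x \<partial>m i) - moment ?s * moment ?s\<bar>"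
            unfolding square_integral_mult[OF t t vw] square_moment[OF t] by (simp add: mult_ac)
        qed
      qed
      show "(\<lambda>i. (B * B) * ?D ?t i + \<bar>moment ?t * moment ?t\<bar> * ?D ?s i) \<longlonglongrightarrow> 0"
        using tendsto_add[OF tendsto_mult_left[OF p[OF lr(2), unfolded pair_conv_def], of "B * B"]
          tendsto_mult_left[OF p[OF lr(1), unfolded pair_conv_def], of "\<bar>moment ?t * moment ?t\<bar>"]] by simp
    qed (rule nrm_nonneg)
  qed
qed

text \<open>For a centred monomial \<open>F\<close>, the product of \<open>F\<close> in the two copies has as its covariance at two
  vertices the square of the covariance of \<open>F\<close>. Concentration under the squared measure makes
  the average of these nonnegative numbers small, so most of them are small.\<close>

lemma doubly_quenched_moments:
  assumes q: "doubly_quenched_converges G K d V \<sigma> m \<mu>"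
    and t: "over G t" and t': "over G t'"
  shows "local_conv (A t) (moment t)" "pair_conv True (A t) (moment t) (A t') (moment t')"
proof -
  let ?l = "map (apsnd Inl) :: ('g \<times> 'j) list \<Rightarrow> _" and ?r = "map (apsnd Inr) :: ('g \<times> 'j) list \<Rightarrow> ('g \<times> ('j + 'j)) list"
  have q2: "quenched_converges G (K \<times> K) (avg_prod_metric d) V \<sigma> m2 (config_square (carrier G) K d \<mu>)"
    using q by (simp add: doubly_quenched_converges_def)
  have c: "fst ` set (?l t) \<subseteq> carrier G" "fst ` set (?r t) \<subseteq> carrier G" if "over G t" for t using that by auto
  have l: "local_conv (A t) (moment t)" if t: "over G t" for t
  proof -
    have "(\<integral>z. sq.A (?l t) i v z \<partial>m2 i) = (\<integral>x. A t i v x \<partial>m i)" if "v \<in> V i" for i v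
      using prob_space.prob_space[OF m_prob(1)] that by (simp add: square_integral[OF c(1)[OF t]] lefts_map A_Nil)
    moreover have "sq.moment (?l t) = moment t" by (simp add: square_moment[OF c(1)[OF t]] lefts_map moment_Nil)
    ultimately show ?thesis
      using sq.quenched_moments(1)[OF q2 c(1)[OF t]] by (simp add: local_conv_def sq.local_conv_def cong: avg_cong)
  qed
  then show "local_conv (A t) (moment t)" using t by blast
  let ?F = "\<lambda>t i v x. A t i v x - moment t"
  \<comment> \<open>The product of the two centred copies, written as a polynomial in the coordinates of pairs.\<close>
  let ?F2 = "\<lambda>t i v z. (sq.A (?l t @ ?r t) i v z + (- moment t) * sq.A (?l t) i v z) + ((- moment t) * sq.A (?r t) i v z + moment t * moment t)"
  have c2: "fst ` set (?l t @ ?r t) \<subseteq> carrier G" if "over G t" for t using c[OF that] by auto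
  have F2_arr: "sq.arr (?F2 t)" if "over G t" for t
    by (intro sq.arr_add sq.arr_cmult sq.arr_const sq.A_arr c c2 that)
  have F_arr: "arr (?F t)" if "over G t" for t
    by (intro arr_diff arr_const A_arr that)
  have F2_zip: "?F2 t i v (\<lambda>u\<in>V i. (x u, y u)) = ?F t i v x * ?F t i v y" if "over G t" "v \<in> V i" for t i v x y
    unfolding square_A_zip[OF c(1)[OF that(1)] that(2)] square_A_zip[OF c(2)[OF that(1)] that(2)] square_A_zip[OF c2[OF that(1)] that(2)]
    by (simp add: lefts_append rights_append lefts_map A_Nil algebra_simps)
  have F2_mean: "sq.mean_conv (?F2 t) 0" if t: "over G t" for t
  proof -
    have "sq.mean_conv (?F2 t) ((sq.moment (?l t @ ?r t) + (- moment t) * sq.moment (?l t)) + ((- moment t) * sq.moment (?r t) + moment t * moment t))"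
      by (intro sq.mean_conv_add sq.mean_conv_cmult sq.mean_conv_const sq.quenched_moments(2)[OF q2]
          sq.arr_add sq.arr_cmult sq.arr_const sq.A_arr c c2 t)
    then show ?thesis
      using square_moment[OF c(1)[OF t]] square_moment[OF c(2)[OF t]] square_moment[OF c2[OF t]]
      by (simp add: lefts_append rights_append lefts_map moment_Nil)
  qed
  have F2_int: "(\<integral>z. ?F2 t i v z * ?F2 t' i w z \<partial>m2 i) = (\<integral>x. ?F t i v x * ?F t' i w x \<partial>m i)\<^sup>2"
    if vw: "v \<in> V i" "w \<in> V i" for i v w
  proof -
    obtain B where B: "0 < B" "\<And>i v p. v \<in> V i \<Longrightarrow> p \<in> space (m i) \<Longrightarrow> \<bar>?F t i v p\<bar> \<le> B"
      using arr_bounded[OF F_arr[OF t]] by blast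
    obtain B' where B': "0 < B'" "\<And>i v p. v \<in> V i \<Longrightarrow> p \<in> space (m i) \<Longrightarrow> \<bar>?F t' i v p\<bar> \<le> B'"
      using arr_bounded[OF F_arr[OF t']] by blast
    have meas: "(\<lambda>x. ?F t i v x * ?F t' i w x) \<in> borel_measurable (config (V i) K d)"
      using A_measurable[OF t vw(1)] A_measurable[OF t' vw(2)] by auto
    have bd: "\<bar>?F t i v x * ?F t' i w x\<bar> \<le> B * B'" if "x \<in> PiE (V i) (\<lambda>_. K)" for x
      unfolding abs_mult using B(1) B(2)[OF vw(1), of x] B'(2)[OF vw(2), of x] that m_prob(3)[of i] by (intro mult_mono) auto
    have "(\<integral>z. ?F2 t i v z * ?F2 t' i w z \<partial>m2 i) = (\<integral>x. ?F t i v x * ?F t' i w x \<partial>m i) * (\<integral>x. ?F t i v x * ?F t' i w x \<partial>m i)"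
    proof (rule config_square(2)[OF m meas meas _ bd bd])
      show "(\<lambda>z. ?F2 t i v z * ?F2 t' i w z) \<in> borel_measurable (config (V i) (K \<times> K) (avg_prod_metric d))"
        using sq.A_measurable[OF c(1)[OF t] vw(1)] sq.A_measurable[OF c(2)[OF t] vw(1)] sq.A_measurable[OF c2[OF t] vw(1)]
          sq.A_measurable[OF c(1)[OF t'] vw(2)] sq.A_measurable[OF c(2)[OF t'] vw(2)] sq.A_measurable[OF c2[OF t'] vw(2)]
        by measurable
      show "?F2 t i v (\<lambda>i\<in>V i. (x i, y i)) * ?F2 t' i w (\<lambda>i\<in>V i. (x i, y i)) = ?F t i v x * ?F t' i w x * (?F t i v y * ?F t' i w y)" for x y
        unfolding F2_zip[OF t vw(1)] F2_zip[OF t' vw(2)] by (simp only: mult_ac)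
    qed
    then show ?thesis by (simp add: power2_eq_square)
  qed
  let ?c = "\<lambda>i v w. \<integral>x. ?F t i v x * ?F t' i w x \<partial>m i"
  have pc: "sq.pair_conv False (?F2 t) 0 (?F2 t') 0"
    by (rule sq.mean_conv_pair[OF F2_arr[OF t] F2_arr[OF t'] F2_mean[OF t] F2_mean[OF t']])
  have sq0: "(\<lambda>i. \<bar>avg (V i) (\<lambda>v. avg (V i) (\<lambda>w. (?c i v w)\<^sup>2))\<bar>) \<longlonglongrightarrow> 0"
  proof -
    have "avg (V i) (\<lambda>v. avg (V i) (\<lambda>w. \<integral>z. ?F2 t i v z * ?F2 t' i w z \<partial>m2 i)) = avg (V i) (\<lambda>v. avg (V i) (\<lambda>w. (?c i v w)\<^sup>2))" for i
      by (intro avg_cong F2_int)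
    then show ?thesis using pc unfolding sq.pair_conv_def nrm_def if_False mult_zero_left diff_zero by simp
  qed
  have cov: "(\<lambda>i. avg (V i) (\<lambda>v. avg (V i) (\<lambda>w. \<bar>?c i v w\<bar>))) \<longlonglongrightarrow> 0"
  proof (rule tendsto_0_le)
    show "(\<lambda>i. sqrt \<bar>avg (V i) (\<lambda>v. avg (V i) (\<lambda>w. (?c i v w)\<^sup>2))\<bar>) \<longlonglongrightarrow> 0"
      using tendsto_real_sqrt[OF sq0] by simp
    fix i
    have "(avg (V i) (\<lambda>v. avg (V i) (\<lambda>w. \<bar>?c i v w\<bar>)))\<^sup>2 \<le> avg (V i) (\<lambda>v. (avg (V i) (\<lambda>w. \<bar>?c i v w\<bar>))\<^sup>2)"
      by (rule avg_Jensen) (use V in auto)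
    also have "\<dots> \<le> avg (V i) (\<lambda>v. avg (V i) (\<lambda>w. \<bar>?c i v w\<bar>\<^sup>2))"
      by (intro avg_mono avg_Jensen) (use V in auto)
    finally show "avg (V i) (\<lambda>v. avg (V i) (\<lambda>w. \<bar>?c i v w\<bar>)) \<le> sqrt \<bar>avg (V i) (\<lambda>v. avg (V i) (\<lambda>w. (?c i v w)\<^sup>2))\<bar>"
      by (intro real_le_rsqrt) simp
  qed (simp add: avg_nonneg)
  show "pair_conv True (A t) (moment t) (A t') (moment t')"
    unfolding pair_conv_def
  proof (rule tendsto_0_le)
    let ?E = "\<lambda>t i v. \<integral>x. A t i v x \<partial>m i"
    let ?L = "\<lambda>t i. avg (V i) (\<lambda>v. \<bar>?E t i v - moment t\<bar>)"
    fix i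
    have eq: "(\<integral>x. A t i v x * A t' i w x \<partial>m i) - moment t * moment t' =
       ?c i v w + moment t' * (?E t i v - moment t) + moment t * (?E t' i w - moment t')" if vw: "v \<in> V i" "w \<in> V i" for v w
    proof -
      interpret prob_space "m i" by (rule m_prob)
      have i: "integrable (m i) (A t i v)" "integrable (m i) (A t' i w)" "integrable (m i) (\<lambda>x. A t i v x * A t' i w x)"
        using arr_integrable[OF A_arr] arr_integrable_mult[OF A_arr A_arr] t t' vw by blast+
      have "?c i v w = (\<integral>x. A t i v x * A t' i w x - moment t' * A t i v x - moment t * A t' i w x + moment t * moment t' \<partial>m i)"
        by (intro Bochner_Integration.integral_cong refl) (simp add: algebra_simps)
      also have "\<dots> = (\<integral>x. A t i v x * A t' i w x \<partial>m i) - moment t' * ?E t i v - moment t * ?E t' i w + moment t * moment t'"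
        using i by (simp add: prob_space)
      finally show ?thesis by (simp add: algebra_simps)
    qed
    have "nrm True (V i) (\<lambda>v w. (\<integral>x. A t i v x * A t' i w x \<partial>m i) - moment t * moment t') \<le>
      avg (V i) (\<lambda>v. avg (V i) (\<lambda>w. \<bar>?c i v w\<bar> + \<bar>moment t'\<bar> * \<bar>?E t i v - moment t\<bar> + \<bar>moment t\<bar> * \<bar>?E t' i w - moment t'\<bar>))"
      unfolding nrm_def if_True
    proof (intro avg_mono)
      fix v w assume vw: "v \<in> V i" "w \<in> V i"
      show "\<bar>(\<integral>x. A t i v x * A t' i w x \<partial>m i) - moment t * moment t'\<bar> \<le>
        \<bar>?c i v w\<bar> + \<bar>moment t'\<bar> * \<bar>?E t i v - moment t\<bar> + \<bar>moment t\<bar> * \<bar>?E t' i w - moment t'\<bar>"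
        unfolding eq[OF vw] abs_mult[symmetric] by linarith
    qed
    also have "\<dots> = avg (V i) (\<lambda>v. avg (V i) (\<lambda>w. \<bar>?c i v w\<bar>)) + \<bar>moment t'\<bar> * ?L t i + \<bar>moment t\<bar> * ?L t' i"
      unfolding avg_add avg_cmult using V by (simp add: avg_const)
    finally show "nrm True (V i) (\<lambda>v w. (\<integral>x. A t i v x * A t' i w x \<partial>m i) - moment t * moment t') \<le>
      avg (V i) (\<lambda>v. avg (V i) (\<lambda>w. \<bar>?c i v w\<bar>)) + \<bar>moment t'\<bar> * ?L t i + \<bar>moment t\<bar> * ?L t' i" .
  next
    show "(\<lambda>i. avg (V i) (\<lambda>v. avg (V i) (\<lambda>w. \<bar>?c i v w\<bar>)) + \<bar>moment t'\<bar> * avg (V i) (\<lambda>v. \<bar>(\<integral>x. A t i v x \<partial>m i) - moment t\<bar>)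
       + \<bar>moment t\<bar> * avg (V i) (\<lambda>v. \<bar>(\<integral>x. A t' i v x \<partial>m i) - moment t'\<bar>)) \<longlonglongrightarrow> 0"
      using tendsto_add[OF tendsto_add[OF cov tendsto_mult_left[OF l[OF t, unfolded local_conv_def], of "\<bar>moment t'\<bar>"]]
        tendsto_mult_left[OF l[OF t', unfolded local_conv_def], of "\<bar>moment t\<bar>"]] by simp
  qed (rule nrm_nonneg)
qed

end

section \<open>Arrays that track functions on the limit system\<close>

lemma tendsto_0_eps:
  fixes f :: "nat \<Rightarrow> real"
  assumes "\<And>i. 0 \<le> f i" "\<And>e. e > 0 \<Longrightarrow> \<forall>\<^sub>F i in sequentially. f i < e" shows "f \<longlonglongrightarrow> 0"
proof (rule order_tendstoI)
  fix a :: real assume "a < 0"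
  then show "\<forall>\<^sub>F i in sequentially. a < f i" using assms(1) by (intro always_eventually allI) (meson less_le_trans)
qed (rule assms(2))

locale limit_system =
  fixes G :: "('g, 'm) monoid_scheme" and \<Omega> :: "'o measure" and T :: "'g \<Rightarrow> 'o \<Rightarrow> 'o"
  assumes group: "group G" and countable: "countable (carrier G)" and prob: "prob_space \<Omega>"
    and T_measurable: "\<And>g. g \<in> carrier G \<Longrightarrow> T g \<in> \<Omega> \<rightarrow>\<^sub>M \<Omega>"
    and T_distr: "\<And>g. g \<in> carrier G \<Longrightarrow> distr \<Omega> \<Omega> (T g) = \<Omega>"
    and T_mult: "\<And>g h x. g \<in> carrier G \<Longrightarrow> h \<in> carrier G \<Longrightarrow> x \<in> space \<Omega> \<Longrightarrow> T (g \<otimes>\<^bsub>G\<^esub> h) x = T g (T h x)"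
    and T_one: "\<And>x. x \<in> space \<Omega> \<Longrightarrow> T \<one>\<^bsub>G\<^esub> x = x"
begin

sublocale prob_space \<Omega> by (rule prob)

sublocale L: models "\<lambda>_. {()}" "\<lambda>_. \<Omega>"
  by (rule models.intro) (simp_all add: prob)

text \<open>Functions on the system are arrays over a one-point vertex set, so they share the calculus of bounded arrays.\<close>

definition bdd :: "('o \<Rightarrow> real) \<Rightarrow> bool" where "bdd f = L.arr (\<lambda>_ _. f)"

definition ldist :: "('o \<Rightarrow> real) \<Rightarrow> ('o \<Rightarrow> real) \<Rightarrow> real" where
  "ldist f h = (\<integral>x. \<bar>f x - h x\<bar> \<partial>\<Omega>)"

lemma bddI:
  "f \<in> borel_measurable \<Omega> \<Longrightarrow> (\<And>x. x \<in> space \<Omega> \<Longrightarrow> \<bar>f x\<bar> \<le> B) \<Longrightarrow> bdd f"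
  unfolding bdd_def by (rule L.arrI[where B = B]) auto

lemma bdd_measurable: "bdd f \<Longrightarrow> f \<in> borel_measurable \<Omega>"
  using L.arr_measurable[of "\<lambda>_ _. f" "()" 0] by (simp add: bdd_def)

lemma bdd_bounded: assumes "bdd f" obtains B where "B > 0" "\<And>x. x \<in> space \<Omega> \<Longrightarrow> \<bar>f x\<bar> \<le> B"
  using L.arr_bounded[of "\<lambda>_ _. f"] assms by (auto simp: bdd_def)

lemma bdd_integrable: "bdd f \<Longrightarrow> integrable \<Omega> f"
  using L.arr_integrable[of "\<lambda>_ _. f" "()" 0] by (simp add: bdd_def)

lemma bdd_const: "bdd (\<lambda>_. c)" unfolding bdd_def by (rule L.arr_const)
lemma bdd_add: "bdd f \<Longrightarrow> bdd h \<Longrightarrow> bdd (\<lambda>x. f x + h x)" unfolding bdd_def by (rule L.arr_add)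
lemma bdd_mult: "bdd f \<Longrightarrow> bdd h \<Longrightarrow> bdd (\<lambda>x. f x * h x)" unfolding bdd_def by (rule L.arr_mult)
lemma bdd_cmult: "bdd h \<Longrightarrow> bdd (\<lambda>x. c * h x)" unfolding bdd_def by (rule L.arr_cmult)
lemma bdd_diff: "bdd f \<Longrightarrow> bdd h \<Longrightarrow> bdd (\<lambda>x. f x - h x)" unfolding bdd_def by (rule L.arr_diff)
lemma bdd_abs: "bdd f \<Longrightarrow> bdd (\<lambda>x. \<bar>f x\<bar>)" unfolding bdd_def by (rule L.arr_abs)

lemma T_space: "g \<in> carrier G \<Longrightarrow> x \<in> space \<Omega> \<Longrightarrow> T g x \<in> space \<Omega>"
  using measurable_space[OF T_measurable] .

lemma bdd_T: assumes "bdd f" "g \<in> carrier G" shows "bdd (\<lambda>x. f (T g x))"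
proof -
  obtain B where B: "0 < B" "\<And>x. x \<in> space \<Omega> \<Longrightarrow> \<bar>f x\<bar> \<le> B" using bdd_bounded[OF assms(1)] by blast
  show ?thesis
    using measurable_compose[OF T_measurable[OF assms(2)] bdd_measurable[OF assms(1)]]
    by (rule bddI) (rule B(2)[OF T_space[OF assms(2)]])
qed

lemma integral_T: "g \<in> carrier G \<Longrightarrow> f \<in> borel_measurable \<Omega> \<Longrightarrow> (\<integral>x. f (T g x) \<partial>\<Omega>) = (\<integral>x. f x \<partial>\<Omega>)"
  for f :: "'o \<Rightarrow> real"
  using integral_distr[OF T_measurable, of g f] T_distr[of g] by simp

lemma ldist_nonneg: "0 \<le> ldist f h" by (simp add: ldist_def)

lemma ldist_triangle: "bdd f \<Longrightarrow> bdd h \<Longrightarrow> bdd k \<Longrightarrow> ldist f k \<le> ldist f h + ldist h k"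
  unfolding ldist_def
  by (subst Bochner_Integration.integral_add[symmetric])
    (auto intro!: integral_mono bdd_integrable bdd_add bdd_abs bdd_diff)

lemma ldist_commute: "ldist f h = ldist h f" by (simp add: ldist_def abs_minus_commute)

lemma integral_ldist: assumes "bdd f" "bdd h" shows "\<bar>(\<integral>x. f x \<partial>\<Omega>) - (\<integral>x. h x \<partial>\<Omega>)\<bar> \<le> ldist f h"
proof -
  have "(\<integral>x. f x \<partial>\<Omega>) - (\<integral>x. h x \<partial>\<Omega>) = (\<integral>x. f x - h x \<partial>\<Omega>)" using assms bdd_integrable by simp
  then show ?thesis unfolding ldist_def using integral_abs_bound[of \<Omega> "\<lambda>x. f x - h x"] by simp
qed

lemma ldist_T:
  assumes "bdd f" "bdd h" "g \<in> carrier G" shows "ldist (\<lambda>x. f (T g x)) (\<lambda>x. h (T g x)) = ldist f h"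
  unfolding ldist_def
  using integral_T[OF assms(3), of "\<lambda>x. \<bar>f x - h x\<bar>"] bdd_measurable[OF bdd_abs[OF bdd_diff[OF assms(1,2)]]] by simp

definition lmon :: "('j \<Rightarrow> 'o \<Rightarrow> real) \<Rightarrow> ('g \<times> 'j) list \<Rightarrow> 'o \<Rightarrow> real" where
  "lmon c t x = mval (\<lambda>z. c (snd z) (T (fst z) x)) t"

definition lpol :: "('j \<Rightarrow> 'o \<Rightarrow> real) \<Rightarrow> (real \<times> ('g \<times> 'j) list) list \<Rightarrow> 'o \<Rightarrow> real" where
  "lpol c p x = pval (\<lambda>z. c (snd z) (T (fst z) x)) p"

lemma bdd_lmon: "(\<And>j. bdd (c j)) \<Longrightarrow> over G t \<Longrightarrow> bdd (lmon c t)"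
  unfolding lmon_def [abs_def] by (induction t) (auto intro!: bdd_const bdd_mult bdd_T)

lemma bdd_lpol: "(\<And>j. bdd (c j)) \<Longrightarrow> pover G p \<Longrightarrow> bdd (lpol c p)"
proof (induction p)
  case (Cons a p)
  obtain r t where "a = (r, t)" by (cases a)
  then show ?case using Cons bdd_lmon[of c t]
    by (auto simp: lpol_def [abs_def] lmon_def [abs_def] intro!: bdd_add bdd_cmult)
qed (simp add: lpol_def [abs_def] bdd_const)

end

context models
begin

definition adist :: "(nat \<Rightarrow> 'v \<Rightarrow> 'w \<Rightarrow> real) \<Rightarrow> (nat \<Rightarrow> 'v \<Rightarrow> 'w \<Rightarrow> real) \<Rightarrow> nat \<Rightarrow> real" where
  "adist F H i = avg (V i) (\<lambda>v. \<integral>x. \<bar>F i v x - H i v x\<bar> \<partial>P i)"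

lemma adist_nonneg: "0 \<le> adist F H i" by (simp add: adist_def avg_nonneg)

lemma adist_refl [simp]: "adist F F i = 0" by (simp add: adist_def avg_def)

lemma adist_commute: "adist F H i = adist H F i" by (simp add: adist_def abs_minus_commute)

lemma adist_triangle:
  assumes "arr F" "arr H" "arr K" shows "adist F K i \<le> adist F H i + adist H K i"
  unfolding adist_def avg_add[symmetric]
proof (rule avg_mono)
  fix v assume v: "v \<in> V i"
  have i: "integrable (P i) (\<lambda>x. \<bar>F i v x - H i v x\<bar>)" if "arr F" "arr H" for F H
    using arr_integrable[OF arr_abs[OF arr_diff[OF that]] v] .
  have "(\<integral>x. \<bar>F i v x - K i v x\<bar> \<partial>P i) \<le> (\<integral>x. \<bar>F i v x - H i v x\<bar> + \<bar>H i v x - K i v x\<bar> \<partial>P i)"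
    using i assms by (intro integral_mono Bochner_Integration.integrable_add) auto
  also have "\<dots> = (\<integral>x. \<bar>F i v x - H i v x\<bar> \<partial>P i) + (\<integral>x. \<bar>H i v x - K i v x\<bar> \<partial>P i)"
    using i assms by (intro Bochner_Integration.integral_add) auto
  finally show "(\<integral>x. \<bar>F i v x - K i v x\<bar> \<partial>P i) \<le> (\<integral>x. \<bar>F i v x - H i v x\<bar> \<partial>P i) + (\<integral>x. \<bar>H i v x - K i v x\<bar> \<partial>P i)" .
qed

lemma integral_difference:
  assumes "arr F" "arr H" "v \<in> V i"
  shows "\<bar>(\<integral>x. F i v x \<partial>P i) - (\<integral>x. H i v x \<partial>P i)\<bar> \<le> (\<integral>x. \<bar>F i v x - H i v x\<bar> \<partial>P i)"
proof -
  have "(\<integral>x. F i v x \<partial>P i) - (\<integral>x. H i v x \<partial>P i) = (\<integral>x. F i v x - H i v x \<partial>P i)"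
    using arr_integrable assms by simp
  then show ?thesis using integral_abs_bound[of "P i" "\<lambda>x. F i v x - H i v x"] by simp
qed

lemma adist_le:
  assumes "\<And>v x. v \<in> V i \<Longrightarrow> x \<in> space (P i) \<Longrightarrow> \<bar>F i v x - H i v x\<bar> \<le> R i v x" "arr F" "arr H" "arr R"
  shows "adist F H i \<le> avg (V i) (\<lambda>v. \<integral>x. R i v x \<partial>P i)"
  unfolding adist_def using assms
  by (intro avg_mono integral_mono arr_integrable[of "\<lambda>i v x. \<bar>F i v x - H i v x\<bar>"] arr_integrable[of R] arr_abs arr_diff) auto

lemma local_conv_add:
  assumes "arr F" "arr F'" "local_conv F c" "local_conv F' c'"
  shows "local_conv (\<lambda>i v x. F i v x + F' i v x) (c + c')"
  unfolding local_conv_def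
proof (rule tendsto_0_le)
  show "avg (V i) (\<lambda>v. \<bar>(\<integral>x. F i v x + F' i v x \<partial>P i) - (c + c')\<bar>) \<le>
     avg (V i) (\<lambda>v. \<bar>(\<integral>x. F i v x \<partial>P i) - c\<bar>) + avg (V i) (\<lambda>v. \<bar>(\<integral>x. F' i v x \<partial>P i) - c'\<bar>)" for i
    unfolding avg_add[symmetric] using arr_integrable[OF assms(1)] arr_integrable[OF assms(2)]
    by (intro avg_mono) simp
  show "(\<lambda>i. avg (V i) (\<lambda>v. \<bar>(\<integral>x. F i v x \<partial>P i) - c\<bar>) + avg (V i) (\<lambda>v. \<bar>(\<integral>x. F' i v x \<partial>P i) - c'\<bar>)) \<longlonglongrightarrow> 0"
    using tendsto_add[OF assms(3,4)[unfolded local_conv_def]] by simp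
qed (simp add: avg_nonneg)

lemma local_conv_cmult:
  assumes "local_conv F c" shows "local_conv (\<lambda>i v x. a * F i v x) (a * c)"
  using tendsto_mult_left[OF assms[unfolded local_conv_def], of "\<bar>a\<bar>"]
  by (simp add: local_conv_def avg_cmult[symmetric] flip: abs_mult right_diff_distrib)

lemma local_conv_const: "local_conv (\<lambda>i v x. c) c"
  using prob_space.prob_space[OF P] by (simp add: local_conv_def avg_def)

lemma pair_conv_sym:
  assumes "pair_conv b F c F' c'" shows "pair_conv b F' c' F c"
proof -
  have "nrm b (V i) (\<lambda>v w. (\<integral>x. F' i v x * F i w x \<partial>P i) - c' * c) = nrm b (V i) (\<lambda>v w. (\<integral>x. F i v x * F' i w x \<partial>P i) - c * c')" for i
    unfolding nrm_def by (subst (1 2) avg_swap) (simp add: mult.commute)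
  then show ?thesis using assms by (simp add: pair_conv_def)
qed

lemma pair_conv_add:
  assumes "arr F" "arr F1" "arr F'" "pair_conv b F c F' c'" "pair_conv b F1 c1 F' c'"
  shows "pair_conv b (\<lambda>i v x. F i v x + F1 i v x) (c + c1) F' c'"
  unfolding pair_conv_def
proof (rule tendsto_0_le)
  fix i
  have "nrm b (V i) (\<lambda>v w. (\<integral>x. (F i v x + F1 i v x) * F' i w x \<partial>P i) - (c + c1) * c') =
    nrm b (V i) (\<lambda>v w. ((\<integral>x. F i v x * F' i w x \<partial>P i) - c * c') + ((\<integral>x. F1 i v x * F' i w x \<partial>P i) - c1 * c'))"
    using arr_integrable_mult[OF assms(1,3)] arr_integrable_mult[OF assms(2,3)]
    by (intro nrm_cong) (simp add: distrib_right)
  also have "\<dots> \<le> nrm b (V i) (\<lambda>v w. (\<integral>x. F i v x * F' i w x \<partial>P i) - c * c') + nrm b (V i) (\<lambda>v w. (\<integral>x. F1 i v x * F' i w x \<partial>P i) - c1 * c')"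
    by (rule nrm_add)
  finally show "nrm b (V i) (\<lambda>v w. (\<integral>x. (F i v x + F1 i v x) * F' i w x \<partial>P i) - (c + c1) * c') \<le> \<dots>" .
next
  show "(\<lambda>i. nrm b (V i) (\<lambda>v w. (\<integral>x. F i v x * F' i w x \<partial>P i) - c * c') + nrm b (V i) (\<lambda>v w. (\<integral>x. F1 i v x * F' i w x \<partial>P i) - c1 * c')) \<longlonglongrightarrow> 0"
    using tendsto_add[OF assms(4,5)[unfolded pair_conv_def]] by simp
qed (rule nrm_nonneg)

lemma pair_conv_cmult:
  assumes "pair_conv b F c F' c'" shows "pair_conv b (\<lambda>i v x. a * F i v x) (a * c) F' c'"
  using tendsto_mult_left[OF assms[unfolded pair_conv_def], of "\<bar>a\<bar>"]
  by (simp add: pair_conv_def nrm_cmult[symmetric] right_diff_distrib mult.assoc)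

text \<open>The seminorm is dominated by the mean absolute entry, so replacing a factor by an array close in mean
  changes little, provided the other factor is bounded.\<close>

lemma pair_conv_approx:
  assumes F: "arr F" and F': "arr F'"
    and approx: "\<And>\<eta>. \<eta> > 0 \<Longrightarrow> \<exists>H h. arr H \<and> pair_conv b H h F' c' \<and> \<bar>c - h\<bar> < \<eta> \<and> (\<forall>\<^sub>F i in sequentially. adist F H i < \<eta>)"
  shows "pair_conv b F c F' c'"
  unfolding pair_conv_def
proof (rule tendsto_0_eps)
  fix e :: real assume e: "e > 0"
  obtain B where B: "0 < B" "\<And>i v x. v \<in> V i \<Longrightarrow> x \<in> space (P i) \<Longrightarrow> \<bar>F' i v x\<bar> \<le> B"
    using arr_bounded[OF F'] by blast
  define \<eta> where "\<eta> = e / (3 * (B + \<bar>c'\<bar> + 1))"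
  have \<eta>: "\<eta> > 0" "(B + \<bar>c'\<bar> + 1) * \<eta> = e / 3" using e B(1) by (simp_all add: \<eta>_def field_simps add_pos_nonneg)
  obtain H h where H: "arr H" "pair_conv b H h F' c'" "\<bar>c - h\<bar> < \<eta>" "\<forall>\<^sub>F i in sequentially. adist F H i < \<eta>"
    using approx[OF \<eta>(1)] by blast
  have bound: "nrm b (V i) (\<lambda>v w. (\<integral>x. F i v x * F' i w x \<partial>P i) - c * c') \<le>
    nrm b (V i) (\<lambda>v w. (\<integral>x. H i v x * F' i w x \<partial>P i) - h * c') + (B * adist F H i + \<bar>c'\<bar> * \<bar>c - h\<bar>)" for i
  proof -
    let ?E = "\<lambda>v w. (\<integral>x. (F i v x - H i v x) * F' i w x \<partial>P i) - (c - h) * c'"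
    have "nrm b (V i) (\<lambda>v w. (\<integral>x. F i v x * F' i w x \<partial>P i) - c * c') =
       nrm b (V i) (\<lambda>v w. ((\<integral>x. H i v x * F' i w x \<partial>P i) - h * c') + ?E v w)"
      using arr_integrable_mult[OF F F'] arr_integrable_mult[OF H(1) F']
      by (intro nrm_cong) (simp add: left_diff_distrib)
    also have "\<dots> \<le> nrm b (V i) (\<lambda>v w. (\<integral>x. H i v x * F' i w x \<partial>P i) - h * c') + nrm b (V i) ?E" by (rule nrm_add)
    also have "nrm b (V i) ?E \<le> avg (V i) (\<lambda>v. avg (V i) (\<lambda>w. \<bar>?E v w\<bar>))" by (rule nrm_le_avg)
    also have "\<dots> \<le> avg (V i) (\<lambda>v. avg (V i) (\<lambda>w. B * (\<integral>x. \<bar>F i v x - H i v x\<bar> \<partial>P i) + \<bar>c'\<bar> * \<bar>c - h\<bar>))"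
    proof (intro avg_mono)
      fix v w assume vw: "v \<in> V i" "w \<in> V i"
      have d: "arr (\<lambda>i v x. F i v x - H i v x)" by (intro arr_diff F H)
      have "\<bar>\<integral>x. (F i v x - H i v x) * F' i w x \<partial>P i\<bar> \<le> (\<integral>x. \<bar>(F i v x - H i v x) * F' i w x\<bar> \<partial>P i)"
        by (rule integral_abs_bound)
      also have "\<dots> \<le> (\<integral>x. B * \<bar>F i v x - H i v x\<bar> \<partial>P i)"
      proof (rule integral_mono)
        show "integrable (P i) (\<lambda>x. \<bar>(F i v x - H i v x) * F' i w x\<bar>)"
          using arr_integrable_mult[OF d F' vw] by (rule integrable_abs)
        show "integrable (P i) (\<lambda>x. B * \<bar>F i v x - H i v x\<bar>)"
          using arr_integrable[OF d vw(1)] by auto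
        show "\<bar>(F i v x - H i v x) * F' i w x\<bar> \<le> B * \<bar>F i v x - H i v x\<bar>" if "x \<in> space (P i)" for x
          unfolding abs_mult using B(2)[OF vw(2) that] by (simp add: mult.commute mult_right_mono)
      qed
      also have "\<dots> = B * (\<integral>x. \<bar>F i v x - H i v x\<bar> \<partial>P i)" by simp
      finally show "\<bar>?E v w\<bar> \<le> B * (\<integral>x. \<bar>F i v x - H i v x\<bar> \<partial>P i) + \<bar>c'\<bar> * \<bar>c - h\<bar>"
        using abs_triangle_ineq4[of "\<integral>x. (F i v x - H i v x) * F' i w x \<partial>P i" "(c - h) * c'"]
        by (simp add: abs_mult mult.commute)
    qed
    also have "\<dots> = B * adist F H i + \<bar>c'\<bar> * \<bar>c - h\<bar>"
      using V by (simp add: avg_add avg_cmult avg_const adist_def)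
    finally show ?thesis by simp
  qed
  have "\<forall>\<^sub>F i in sequentially. nrm b (V i) (\<lambda>v w. (\<integral>x. H i v x * F' i w x \<partial>P i) - h * c') < e / 3"
    using H(2) e unfolding pair_conv_def by (intro order_tendstoD(2)[where a = "e / 3"]) auto
  then show "\<forall>\<^sub>F i in sequentially. nrm b (V i) (\<lambda>v w. (\<integral>x. F i v x * F' i w x \<partial>P i) - c * c') < e"
    using H(4)
  proof eventually_elim
    case (elim i)
    have "B * adist F H i \<le> B * \<eta>" "\<bar>c'\<bar> * \<bar>c - h\<bar> \<le> \<bar>c'\<bar> * \<eta>"
      using B(1) elim(2) H(3) by (auto intro!: mult_left_mono)
    then show ?case using bound[of i] elim(1) \<eta> e by (simp add: algebra_simps)
  qed
qed (rule nrm_nonneg)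

end

locale sofic_models = limit_system G \<Omega> T + models V P
  for G :: "('g, 'm) monoid_scheme" and \<Omega> :: "'o measure" and T :: "'g \<Rightarrow> 'o \<Rightarrow> 'o"
    and V :: "nat \<Rightarrow> 'v set" and P :: "nat \<Rightarrow> 'w measure" +
  fixes \<sigma> :: "nat \<Rightarrow> 'g \<Rightarrow> 'v \<Rightarrow> 'v"
  assumes \<sigma>_bij: "\<And>i g. g \<in> carrier G \<Longrightarrow> bij_betw (\<sigma> i g) (V i) (V i)"
    and \<sigma>_mult: "\<And>g h. g \<in> carrier G \<Longrightarrow> h \<in> carrier G \<Longrightarrow>
      (\<lambda>i. avg (V i) (\<lambda>v. of_bool (\<sigma> i g (\<sigma> i h v) \<noteq> \<sigma> i (g \<otimes>\<^bsub>G\<^esub> h) v))) \<longlonglongrightarrow> 0"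
begin

definition amon :: "('j \<Rightarrow> nat \<Rightarrow> 'v \<Rightarrow> 'w \<Rightarrow> real) \<Rightarrow> ('g \<times> 'j) list \<Rightarrow> nat \<Rightarrow> 'v \<Rightarrow> 'w \<Rightarrow> real" where
  "amon X t i v x = mval (\<lambda>z. X (snd z) i (\<sigma> i (fst z) v) x) t"

definition apol :: "('j \<Rightarrow> nat \<Rightarrow> 'v \<Rightarrow> 'w \<Rightarrow> real) \<Rightarrow> (real \<times> ('g \<times> 'j) list) list \<Rightarrow> nat \<Rightarrow> 'v \<Rightarrow> 'w \<Rightarrow> real" where
  "apol X p i v x = pval (\<lambda>z. X (snd z) i (\<sigma> i (fst z) v) x) p"

lemma \<sigma>_in: "g \<in> carrier G \<Longrightarrow> v \<in> V i \<Longrightarrow> \<sigma> i g v \<in> V i"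
  using \<sigma>_bij by (meson bij_betwE)

lemma arr_shift: assumes F: "arr F" and g: "g \<in> carrier G" shows "arr (\<lambda>i v. F i (\<sigma> i g v))"
proof -
  obtain B where B: "0 < B" "\<And>i v x. v \<in> V i \<Longrightarrow> x \<in> space (P i) \<Longrightarrow> \<bar>F i v x\<bar> \<le> B"
    using arr_bounded[OF F] by blast
  show ?thesis by (rule arrI[where B = B]) (auto intro!: arr_measurable F B \<sigma>_in g)
qed

lemma arr_amon: "(\<And>j. arr (X j)) \<Longrightarrow> over G t \<Longrightarrow> arr (amon X t)"
  unfolding amon_def [abs_def]
proof (induction t)
  case (Cons z t)
  have "arr (\<lambda>i v x. X (snd z) i (\<sigma> i (fst z) v) x)" using arr_shift[of "X (snd z)" "fst z"] Cons.prems by auto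
  then show ?case using Cons by (auto intro!: arr_mult)
qed (simp add: arr_const)

lemma arr_apol: "(\<And>j. arr (X j)) \<Longrightarrow> pover G p \<Longrightarrow> arr (apol X p)"
proof (induction p)
  case (Cons a p)
  obtain r t where "a = (r, t)" by (cases a)
  then show ?case using Cons arr_amon[of X t]
    by (auto simp: apol_def [abs_def] amon_def [abs_def] image_Un intro!: arr_add arr_cmult)
qed (simp add: apol_def [abs_def] arr_const)

lemma apol_Cons: "apol X ((r, t) # p) = (\<lambda>i v x. r * amon X t i v x + apol X p i v x)"
  by (simp add: apol_def amon_def fun_eq_iff)

lemma lpol_Cons: "lpol c ((r, t) # p) = (\<lambda>x. r * lmon c t x + lpol c p x)"
  by (simp add: lpol_def lmon_def fun_eq_iff)

lemma pol_Nil: "apol X [] = (\<lambda>i v x. 0)" "lpol c [] = (\<lambda>x. 0)"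
  by (simp_all add: apol_def lpol_def fun_eq_iff)

lemma adist_shift:
  assumes "g \<in> carrier G" shows "adist (\<lambda>i v. F i (\<sigma> i g v)) (\<lambda>i v. H i (\<sigma> i g v)) i = adist F H i"
  unfolding adist_def using avg_reindex[OF \<sigma>_bij[OF assms], where f = "\<lambda>v. \<integral>x. \<bar>F i v x - H i v x\<bar> \<partial>P i"] .

text \<open>The two arrays differ only at vertices where the approximate action fails to be multiplicative.\<close>

lemma adist_\<sigma>_mult:
  assumes F: "arr F" and gh: "g \<in> carrier G" "h \<in> carrier G"
  shows "(adist (\<lambda>i v. F i (\<sigma> i g (\<sigma> i h v))) (\<lambda>i v. F i (\<sigma> i (g \<otimes>\<^bsub>G\<^esub> h) v))) \<longlonglongrightarrow> 0"
proof -
  obtain B where B: "0 < B" "\<And>i v x. v \<in> V i \<Longrightarrow> x \<in> space (P i) \<Longrightarrow> \<bar>F i v x\<bar> \<le> B"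
    using arr_bounded[OF F] by blast
  have arrs: "arr (\<lambda>i v. F i (\<sigma> i g (\<sigma> i h v)))" "arr (\<lambda>i v. F i (\<sigma> i (g \<otimes>\<^bsub>G\<^esub> h) v))"
    using arr_shift[OF arr_shift[OF F gh(1)] gh(2)] arr_shift[OF F] monoid.m_closed[OF group.is_monoid[OF group]] gh by auto
  show ?thesis
  proof (rule tendsto_0_le[OF adist_nonneg])
  show "adist (\<lambda>i v. F i (\<sigma> i g (\<sigma> i h v))) (\<lambda>i v. F i (\<sigma> i (g \<otimes>\<^bsub>G\<^esub> h) v)) i \<le>
     2 * B * avg (V i) (\<lambda>v. of_bool (\<sigma> i g (\<sigma> i h v) \<noteq> \<sigma> i (g \<otimes>\<^bsub>G\<^esub> h) v))" for i
    unfolding adist_def avg_cmult[symmetric]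
  proof (rule avg_mono)
    fix v assume v: "v \<in> V i"
    show "(\<integral>x. \<bar>F i (\<sigma> i g (\<sigma> i h v)) x - F i (\<sigma> i (g \<otimes>\<^bsub>G\<^esub> h) v) x\<bar> \<partial>P i) \<le>
       2 * B * of_bool (\<sigma> i g (\<sigma> i h v) \<noteq> \<sigma> i (g \<otimes>\<^bsub>G\<^esub> h) v)"
    proof (rule integral_le_const)
      show "integrable (P i) (\<lambda>x. \<bar>F i (\<sigma> i g (\<sigma> i h v)) x - F i (\<sigma> i (g \<otimes>\<^bsub>G\<^esub> h) v) x\<bar>)"
        using arr_integrable[OF arr_abs[OF arr_diff[OF arrs]] v] .
      fix x assume x: "x \<in> space (P i)"
      have "\<bar>F i (\<sigma> i g (\<sigma> i h v)) x\<bar> \<le> B" "\<bar>F i (\<sigma> i (g \<otimes>\<^bsub>G\<^esub> h) v) x\<bar> \<le> B"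
        using B(2)[OF _ x] \<sigma>_in v gh monoid.m_closed[OF group.is_monoid[OF group]] by auto
      then show "\<bar>F i (\<sigma> i g (\<sigma> i h v)) x - F i (\<sigma> i (g \<otimes>\<^bsub>G\<^esub> h) v) x\<bar> \<le>
         2 * B * of_bool (\<sigma> i g (\<sigma> i h v) \<noteq> \<sigma> i (g \<otimes>\<^bsub>G\<^esub> h) v)" by auto
    qed
  qed
  show "(\<lambda>i. 2 * B * avg (V i) (\<lambda>v. of_bool (\<sigma> i g (\<sigma> i h v) \<noteq> \<sigma> i (g \<otimes>\<^bsub>G\<^esub> h) v))) \<longlonglongrightarrow> 0"
    using tendsto_mult_left[OF \<sigma>_mult[OF gh], of "2 * B"] by simp
  qed
qed

end

text \<open>Arrays and observables are linked by the local moments alone; concentration of averages is kept separate because it comes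
  from different sources in the applications.\<close>

locale tracking = sofic_models G \<Omega> T V P \<sigma>
  for G :: "('g, 'm) monoid_scheme" and \<Omega> :: "'o measure" and T :: "'g \<Rightarrow> 'o \<Rightarrow> 'o"
    and V :: "nat \<Rightarrow> 'v set" and P :: "nat \<Rightarrow> 'w measure" and \<sigma> :: "nat \<Rightarrow> 'g \<Rightarrow> 'v \<Rightarrow> 'v" +
  fixes c :: "'j \<Rightarrow> 'o \<Rightarrow> real" and X :: "'j \<Rightarrow> nat \<Rightarrow> 'v \<Rightarrow> 'w \<Rightarrow> real"
  assumes c: "\<And>j. bdd (c j)" and X: "\<And>j. arr (X j)"
    and local_monomials: "\<And>t. over G t \<Longrightarrow> local_conv (amon X t) (\<integral>x. lmon c t x \<partial>\<Omega>)"
    and dense: "\<And>f \<eta>. bdd f \<Longrightarrow> \<eta> > 0 \<Longrightarrow> \<exists>p. pover G p \<and> ldist f (lpol c p) < \<eta>"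
begin

text \<open>The same polynomial is evaluated on both sides. This determines the array from the function only up to vanishing
  mean distance.\<close>

definition tracks :: "('o \<Rightarrow> real) \<Rightarrow> (nat \<Rightarrow> 'v \<Rightarrow> 'w \<Rightarrow> real) \<Rightarrow> bool" where
  "tracks f F \<longleftrightarrow> bdd f \<and> arr F \<and>
     (\<forall>\<eta>>0. \<exists>p. pover G p \<and> ldist f (lpol c p) < \<eta> \<and> (\<forall>\<^sub>F i in sequentially. adist F (apol X p) i < \<eta>))"

lemma tracks_bdd: "tracks f F \<Longrightarrow> bdd f" and tracks_arr: "tracks f F \<Longrightarrow> arr F"
  by (simp_all add: tracks_def)

lemmas p_bdd = bdd_lpol[where c = c, OF c] and p_arr = arr_apol[where X = X, OF X]

lemma tracks_pol: "pover G p \<Longrightarrow> tracks (lpol c p) (apol X p)"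
  unfolding tracks_def by (auto intro!: p_bdd p_arr exI[of _ p] simp: ldist_def)

lemma tracks_limit:
  assumes f: "bdd f" and F: "arr F"
    and approx: "\<And>\<eta>. \<eta> > 0 \<Longrightarrow> \<exists>h H. tracks h H \<and> ldist f h < \<eta> \<and> (\<forall>\<^sub>F i in sequentially. adist F H i < \<eta>)"
  shows "tracks f F"
  unfolding tracks_def
proof (intro conjI f F allI impI)
  fix \<eta> :: real assume "\<eta> > 0"
  then have \<eta>: "\<eta> / 2 > 0" by simp
  obtain h H where h: "tracks h H" "ldist f h < \<eta> / 2" "\<forall>\<^sub>F i in sequentially. adist F H i < \<eta> / 2"
    using approx[OF \<eta>] by blast
  obtain p where p: "pover G p" "ldist h (lpol c p) < \<eta> / 2" "\<forall>\<^sub>F i in sequentially. adist H (apol X p) i < \<eta> / 2"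
    using h(1) \<eta> unfolding tracks_def by blast
  have "ldist f (lpol c p) < \<eta>"
    using ldist_triangle[OF f tracks_bdd[OF h(1)] p_bdd[OF p(1)]] h(2) p(2) by simp
  moreover have "\<forall>\<^sub>F i in sequentially. adist F (apol X p) i < \<eta>"
    using h(3) p(3)
  proof eventually_elim
    case (elim i)
    then show ?case using adist_triangle[OF F tracks_arr[OF h(1)] p_arr[OF p(1)], of i] by simp
  qed
  ultimately show "\<exists>p. pover G p \<and> ldist f (lpol c p) < \<eta> \<and> (\<forall>\<^sub>F i in sequentially. adist F (apol X p) i < \<eta>)"
    using p(1) by blast
qed

lemma tracks_const: "tracks (\<lambda>_. r) (\<lambda>_ _ _. r)"
  using tracks_pol[of "[(r, [])]"] by (simp add: lpol_def[abs_def] apol_def[abs_def])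

lemma tracks_add:
  assumes "tracks f F" "tracks f' F'" shows "tracks (\<lambda>x. f x + f' x) (\<lambda>i v x. F i v x + F' i v x)"
  unfolding tracks_def
proof (intro conjI allI impI)
  note b = tracks_bdd[OF assms(1)] tracks_bdd[OF assms(2)] and a = tracks_arr[OF assms(1)] tracks_arr[OF assms(2)]
  show "bdd (\<lambda>x. f x + f' x)" "arr (\<lambda>i v x. F i v x + F' i v x)" by (intro bdd_add arr_add a b)+
  fix \<eta> :: real assume "\<eta> > 0"
  then have \<eta>: "\<eta> / 2 > 0" by simp
  obtain p where p: "pover G p" "ldist f (lpol c p) < \<eta> / 2" "\<forall>\<^sub>F i in sequentially. adist F (apol X p) i < \<eta> / 2"
    using assms(1) \<eta> unfolding tracks_def by blast
  obtain q where q: "pover G q" "ldist f' (lpol c q) < \<eta> / 2" "\<forall>\<^sub>F i in sequentially. adist F' (apol X q) i < \<eta> / 2"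
    using assms(2) \<eta> unfolding tracks_def by blast
  have "ldist (\<lambda>x. f x + f' x) (lpol c (p @ q)) \<le> ldist f (lpol c p) + ldist f' (lpol c q)"
    unfolding ldist_def
    by (subst Bochner_Integration.integral_add[symmetric])
      (auto intro!: integral_mono bdd_integrable bdd_add bdd_abs bdd_diff b p_bdd p q simp: lpol_def[abs_def] pval_append,
       auto intro!: bdd_add bdd_diff b p_bdd[OF p(1), unfolded lpol_def[abs_def]] p_bdd[OF q(1), unfolded lpol_def[abs_def]])
  moreover have "\<forall>\<^sub>F i in sequentially. adist (\<lambda>i v x. F i v x + F' i v x) (apol X (p @ q)) i < \<eta>"
    using p(3) q(3)
  proof eventually_elim
    case (elim i)
    have pq: "apol X (p @ q) = (\<lambda>i v x. apol X p i v x + apol X q i v x)" by (simp add: apol_def fun_eq_iff pval_append)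
    have R: "arr (\<lambda>i v x. \<bar>F i v x - apol X p i v x\<bar>)" "arr (\<lambda>i v x. \<bar>F' i v x - apol X q i v x\<bar>)"
      by (intro arr_abs arr_diff a p_arr p q)+
    have "adist (\<lambda>i v x. F i v x + F' i v x) (apol X (p @ q)) i \<le>
      avg (V i) (\<lambda>v. \<integral>x. \<bar>F i v x - apol X p i v x\<bar> + \<bar>F' i v x - apol X q i v x\<bar> \<partial>P i)"
      unfolding pq by (rule adist_le) (auto intro!: arr_add R a p_arr p q)
    also have "\<dots> = adist F (apol X p) i + adist F' (apol X q) i"
      unfolding adist_def avg_add[symmetric]
      by (intro avg_cong Bochner_Integration.integral_add arr_integrable[OF R(1)] arr_integrable[OF R(2)])
    finally show ?case using elim by simp
  qed
  ultimately show "\<exists>p. pover G p \<and> ldist (\<lambda>x. f x + f' x) (lpol c p) < \<eta> \<and>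
     (\<forall>\<^sub>F i in sequentially. adist (\<lambda>i v x. F i v x + F' i v x) (apol X p) i < \<eta>)"
    using p q by (intro exI[of _ "p @ q"]) (auto simp: image_Un)
qed

end

context limit_system
begin

lemma ldist_le:
  assumes "\<And>x. x \<in> space \<Omega> \<Longrightarrow> \<bar>f x - h x\<bar> \<le> r x" "bdd f" "bdd h" "bdd r"
  shows "ldist f h \<le> (\<integral>x. r x \<partial>\<Omega>)"
  unfolding ldist_def using assms by (intro integral_mono bdd_integrable bdd_abs bdd_diff) auto

lemma ldist_le_const:
  assumes "\<And>x. x \<in> space \<Omega> \<Longrightarrow> \<bar>f x - h x\<bar> \<le> r" "bdd f" "bdd h" shows "ldist f h \<le> r"
  using ldist_le[of f h "\<lambda>_. r"] assms bdd_const[of r] by (simp add: prob_space)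

lemma ldist_AE: assumes "AE x in \<Omega>. f x = h x" "bdd f" "bdd h" shows "ldist f h = 0"
proof -
  have "ldist f h = (\<integral>x. 0 \<partial>\<Omega>)"
    unfolding ldist_def using assms(1) bdd_measurable[OF bdd_abs[OF bdd_diff[OF assms(2,3)]]]
    by (intro integral_cong_AE) auto
  then show ?thesis by simp
qed

end

context models
begin

lemma adist_le_const:
  assumes "\<And>v x. v \<in> V i \<Longrightarrow> x \<in> space (P i) \<Longrightarrow> \<bar>F i v x - H i v x\<bar> \<le> r" "arr F" "arr H"
  shows "adist F H i \<le> r"
  unfolding adist_def
  using assms arr_integrable[OF arr_abs[OF arr_diff[OF assms(2,3)]]]
  by (intro avg_le_const V integral_le_const) auto

end

context tracking
begin

lemma tracks_mult:
  assumes tr: "tracks f F" "tracks f' F'" shows "tracks (\<lambda>z. f z * f' z) (\<lambda>i v z. F i v z * F' i v z)"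
  unfolding tracks_def
proof (intro conjI allI impI)
  note b = tracks_bdd[OF tr(1)] tracks_bdd[OF tr(2)] and a = tracks_arr[OF tr(1)] tracks_arr[OF tr(2)]
  show b': "bdd (\<lambda>z. f z * f' z)" and a': "arr (\<lambda>i v z. F i v z * F' i v z)" by (intro bdd_mult arr_mult a b)+
  fix \<eta> :: real assume \<eta>: "\<eta> > 0"
  obtain B1 where B1: "0 < B1" "\<And>z. z \<in> space \<Omega> \<Longrightarrow> \<bar>f z\<bar> \<le> B1" using bdd_bounded[OF b(1)] by blast
  obtain B2 where B2: "0 < B2" "\<And>i v z. v \<in> V i \<Longrightarrow> z \<in> space (P i) \<Longrightarrow> \<bar>F i v z\<bar> \<le> B2" using arr_bounded[OF a(1)] by blast
  define B where "B = max B1 B2"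
  have B: "0 < B" using B1 by (simp add: B_def)
  have "\<eta> / (2 * B) > 0" using \<eta> B by simp
  then obtain q where q: "pover G q" "ldist f' (lpol c q) < \<eta> / (2 * B)"
      "\<forall>\<^sub>F i in sequentially. adist F' (apol X q) i < \<eta> / (2 * B)"
    using tr(2) unfolding tracks_def by blast
  note bq = p_bdd[OF q(1)] and aq = p_arr[OF q(1)]
  obtain C1 where C1: "0 < C1" "\<And>z. z \<in> space \<Omega> \<Longrightarrow> \<bar>lpol c q z\<bar> \<le> C1" using bdd_bounded[OF bq] by blast
  obtain C2 where C2: "0 < C2" "\<And>i v z. v \<in> V i \<Longrightarrow> z \<in> space (P i) \<Longrightarrow> \<bar>apol X q i v z\<bar> \<le> C2" using arr_bounded[OF aq] by blast
  define D where "D = max C1 C2"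
  have D: "0 < D" using C1 by (simp add: D_def)
  have "\<eta> / (2 * D) > 0" using \<eta> D by simp
  then obtain p where p: "pover G p" "ldist f (lpol c p) < \<eta> / (2 * D)"
      "\<forall>\<^sub>F i in sequentially. adist F (apol X p) i < \<eta> / (2 * D)"
    using tr(1) unfolding tracks_def by blast
  note bp = p_bdd[OF p(1)] and ap = p_arr[OF p(1)]
  have vars: "pover G (pmul p q)" using pvars_pmul[of p q] p(1) q(1) by fastforce
  have key: "\<bar>x * x' - y * y'\<bar> \<le> B * \<bar>x' - y'\<bar> + D * \<bar>x - y\<bar>" if "\<bar>x\<bar> \<le> B" "\<bar>y'\<bar> \<le> D" for x x' y y' :: real
  proof -
    have "\<bar>x * (x' - y')\<bar> \<le> B * \<bar>x' - y'\<bar>" "\<bar>y' * (x - y)\<bar> \<le> D * \<bar>x - y\<bar>"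
      unfolding abs_mult using that by (auto intro: mult_right_mono)
    moreover have "x * x' - y * y' = x * (x' - y') + y' * (x - y)" by (simp add: algebra_simps)
    ultimately show ?thesis by linarith
  qed
  have eta: "B * (\<eta> / (2 * B)) + D * (\<eta> / (2 * D)) = \<eta>" using B D by (simp add: field_simps)
  have leq: "lpol c (pmul p q) = (\<lambda>z. lpol c p z * lpol c q z)" by (simp add: lpol_def fun_eq_iff pval_pmul)
  have aeq: "apol X (pmul p q) = (\<lambda>i v z. apol X p i v z * apol X q i v z)" by (simp add: apol_def fun_eq_iff pval_pmul)
  have i: "integrable \<Omega> (\<lambda>z. \<bar>f' z - lpol c q z\<bar>)" "integrable \<Omega> (\<lambda>z. \<bar>f z - lpol c p z\<bar>)"
    by (intro bdd_integrable bdd_abs bdd_diff b bp bq)+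
  have "ldist (\<lambda>z. f z * f' z) (lpol c (pmul p q)) \<le> (\<integral>z. B * \<bar>f' z - lpol c q z\<bar> + D * \<bar>f z - lpol c p z\<bar> \<partial>\<Omega>)"
    unfolding leq
  proof (rule ldist_le)
    fix z assume z: "z \<in> space \<Omega>"
    have "\<bar>f z\<bar> \<le> B" "\<bar>lpol c q z\<bar> \<le> D" using B1(2)[OF z] C1(2)[OF z] by (auto simp: B_def D_def)
    then show "\<bar>f z * f' z - lpol c p z * lpol c q z\<bar> \<le> B * \<bar>f' z - lpol c q z\<bar> + D * \<bar>f z - lpol c p z\<bar>"
      by (rule key)
  qed (intro b' bdd_mult bdd_add bdd_cmult bdd_abs bdd_diff b bp bq)+
  also have "\<dots> = B * ldist f' (lpol c q) + D * ldist f (lpol c p)"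
    using i by (simp add: ldist_def)
  also have "\<dots> < B * (\<eta> / (2 * B)) + D * (\<eta> / (2 * D))"
    using p(2) q(2) B D by (intro add_strict_mono mult_strict_left_mono)
  finally have "ldist (\<lambda>z. f z * f' z) (lpol c (pmul p q)) < \<eta>" unfolding eta .
  moreover have "\<forall>\<^sub>F i in sequentially. adist (\<lambda>i v z. F i v z * F' i v z) (apol X (pmul p q)) i < \<eta>"
    using p(3) q(3)
  proof eventually_elim
    case (elim i)
    have R: "arr (\<lambda>i v z. B * \<bar>F' i v z - apol X q i v z\<bar>)" "arr (\<lambda>i v z. D * \<bar>F i v z - apol X p i v z\<bar>)"
      by (intro arr_cmult arr_abs arr_diff a ap aq)+
    have "adist (\<lambda>i v z. F i v z * F' i v z) (apol X (pmul p q)) i \<le>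
       avg (V i) (\<lambda>v. \<integral>z. B * \<bar>F' i v z - apol X q i v z\<bar> + D * \<bar>F i v z - apol X p i v z\<bar> \<partial>P i)"
      unfolding aeq
    proof (rule adist_le)
      fix v z assume vz: "v \<in> V i" "z \<in> space (P i)"
      have "\<bar>F i v z\<bar> \<le> B" "\<bar>apol X q i v z\<bar> \<le> D" using B2(2)[OF vz] C2(2)[OF vz] by (auto simp: B_def D_def)
      then show "\<bar>F i v z * F' i v z - apol X p i v z * apol X q i v z\<bar> \<le> B * \<bar>F' i v z - apol X q i v z\<bar> + D * \<bar>F i v z - apol X p i v z\<bar>"
        by (rule key)
    qed (intro a' arr_mult arr_add R ap aq)+
    also have "\<dots> = B * adist F' (apol X q) i + D * adist F (apol X p) i"
      unfolding adist_def avg_add[symmetric] avg_cmult[symmetric]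
      using arr_integrable[OF R(1)] arr_integrable[OF R(2)] by (intro avg_cong) (simp add: Bochner_Integration.integral_add)
    also have "\<dots> < B * (\<eta> / (2 * B)) + D * (\<eta> / (2 * D))"
      using elim B D by (intro add_strict_mono mult_strict_left_mono)
    finally show ?case unfolding eta .
  qed
  ultimately show "\<exists>p. pover G p \<and> ldist (\<lambda>z. f z * f' z) (lpol c p) < \<eta> \<and>
     (\<forall>\<^sub>F i in sequentially. adist (\<lambda>i v z. F i v z * F' i v z) (apol X p) i < \<eta>)"
    using vars by blast
qed

lemma tracks_cmult: "tracks f F \<Longrightarrow> tracks (\<lambda>x. r * f x) (\<lambda>i v x. r * F i v x)"
  by (rule tracks_mult[OF tracks_const])

lemma tracks_diff: "tracks f F \<Longrightarrow> tracks f' F' \<Longrightarrow> tracks (\<lambda>x. f x - f' x) (\<lambda>i v x. F i v x - F' i v x)"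
  using tracks_add[of f F "\<lambda>x. -1 * f' x" "\<lambda>i v x. -1 * F' i v x"] tracks_cmult[of f' F' "-1"] by simp

lemma tracks_sum:
  "finite J \<Longrightarrow> (\<And>j. j \<in> J \<Longrightarrow> tracks (f j) (F j)) \<Longrightarrow> tracks (\<lambda>x. \<Sum>j\<in>J. f j x) (\<lambda>i v x. \<Sum>j\<in>J. F j i v x)"
  by (induction J rule: finite_induct) (auto intro: tracks_const tracks_add)

lemma tracks_polynomial:
  assumes "tracks f F" "real_polynomial_function (g :: real \<Rightarrow> real)"
  shows "tracks (\<lambda>z. g (f z)) (\<lambda>i v z. g (F i v z))"
  using assms(2)
proof (induction g rule: real_polynomial_function.induct)
  case (linear g)
  have "g x = g 1 * x" for x using linear_cmul[OF bounded_linear.linear[OF linear], of x 1] by (simp add: mult.commute)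
  then have "(\<lambda>z. g (f z)) = (\<lambda>z. g 1 * f z)" "(\<lambda>i v z. g (F i v z)) = (\<lambda>i v z. g 1 * F i v z)" by metis+
  then show ?case using tracks_cmult[OF assms(1), of "g 1"] by simp
qed (auto intro: tracks_const tracks_add tracks_mult)

text \<open>The absolute value is a uniform limit of polynomials on bounded intervals.\<close>

lemma tracks_abs:
  assumes tr: "tracks f F" shows "tracks (\<lambda>z. \<bar>f z\<bar>) (\<lambda>i v z. \<bar>F i v z\<bar>)"
proof (rule tracks_limit)
  note b = tracks_bdd[OF tr] and a = tracks_arr[OF tr]
  show b': "bdd (\<lambda>z. \<bar>f z\<bar>)" and a': "arr (\<lambda>i v z. \<bar>F i v z\<bar>)" by (intro bdd_abs arr_abs a b)+
  fix \<eta> :: real assume \<eta>: "\<eta> > 0"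
  obtain B1 where B1: "0 < B1" "\<And>z. z \<in> space \<Omega> \<Longrightarrow> \<bar>f z\<bar> \<le> B1" using bdd_bounded[OF b] by blast
  obtain B2 where B2: "0 < B2" "\<And>i v z. v \<in> V i \<Longrightarrow> z \<in> space (P i) \<Longrightarrow> \<bar>F i v z\<bar> \<le> B2" using arr_bounded[OF a] by blast
  obtain g :: "real \<Rightarrow> real" where g: "real_polynomial_function g" "\<And>x. x \<in> {- max B1 B2..max B1 B2} \<Longrightarrow> \<bar>\<bar>x\<bar> - g x\<bar> < \<eta> / 2"
  proof -
    have "continuous_on {- max B1 B2..max B1 B2} (\<lambda>x :: real. \<bar>x\<bar>)" by (intro continuous_intros)
    then show thesis
      by (rule Stone_Weierstrass_real_polynomial_function[OF compact_Icc _ half_gt_zero[OF \<eta>]]) (rule that)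
  qed
  have g': "\<bar>\<bar>x\<bar> - g x\<bar> \<le> \<eta> / 2" if "\<bar>x\<bar> \<le> max B1 B2" for x using g(2)[of x] that by (simp add: abs_le_iff less_imp_le)
  have trg: "tracks (\<lambda>z. g (f z)) (\<lambda>i v z. g (F i v z))" by (rule tracks_polynomial[OF tr g(1)])
  have "ldist (\<lambda>z. \<bar>f z\<bar>) (\<lambda>z. g (f z)) \<le> \<eta> / 2"
    using B1(2) by (intro ldist_le_const g' b' tracks_bdd[OF trg]) (simp add: le_max_iff_disj)
  moreover have "adist (\<lambda>i v z. \<bar>F i v z\<bar>) (\<lambda>i v z. g (F i v z)) i \<le> \<eta> / 2" for i
    using B2(2) by (intro adist_le_const g' a' tracks_arr[OF trg]) (simp add: le_max_iff_disj)
  ultimately have "ldist (\<lambda>z. \<bar>f z\<bar>) (\<lambda>z. g (f z)) < \<eta>"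
    "\<forall>\<^sub>F i in sequentially. adist (\<lambda>i v z. \<bar>F i v z\<bar>) (\<lambda>i v z. g (F i v z)) i < \<eta>"
    using half_gt_zero[OF \<eta>] field_less_half_sum[OF \<eta>] by (simp_all add: le_less_trans[where y = "\<eta> / 2"] always_eventually)
  with trg show "\<exists>h H. tracks h H \<and> ldist (\<lambda>z. \<bar>f z\<bar>) h < \<eta> \<and> (\<forall>\<^sub>F i in sequentially. adist (\<lambda>i v z. \<bar>F i v z\<bar>) H i < \<eta>)"
    by blast
qed

lemma tracks_min:
  assumes "tracks f F" "tracks f' F'" shows "tracks (\<lambda>z. min (f z) (f' z)) (\<lambda>i v z. min (F i v z) (F' i v z))"
proof -
  have *: "min x y = (1 / 2) * ((x + y) - \<bar>x - y\<bar>)" for x y :: real by (simp add: min_def)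
  show ?thesis unfolding * by (intro tracks_cmult tracks_diff tracks_add tracks_abs assms)
qed

lemma tracks_Min:
  fixes N :: nat
  assumes "\<And>n. n \<le> N \<Longrightarrow> tracks (s n) (S n)"
  shows "\<exists>r R. tracks r R \<and> (\<forall>x. \<forall>n\<le>N. r x \<le> s n x) \<and> (\<forall>i v x. \<exists>n\<le>N. R i v x = S n i v x)"
  using assms
proof (induction N)
  case 0 then show ?case by (intro exI[of _ "s 0"] exI[of _ "S 0"]) auto
next
  case (Suc N)
  then obtain r R where r: "tracks r R" "\<And>x n. n \<le> N \<Longrightarrow> r x \<le> s n x" "\<And>i v x. \<exists>n\<le>N. R i v x = S n i v x"
    by (metis le_SucI)
  let ?r = "\<lambda>x. min (r x) (s (Suc N) x)" and ?R = "\<lambda>i v x. min (R i v x) (S (Suc N) i v x)"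
  have A: "tracks ?r ?R"
    using r(1) Suc.prems by (intro tracks_min) auto
  have B: "\<forall>x. \<forall>n\<le>Suc N. ?r x \<le> s n x"
  proof (intro allI impI)
    fix x n assume "n \<le> Suc N"
    then show "?r x \<le> s n x"
      using r(2)[of n x] by (cases "n = Suc N") auto
  qed
  have C: "\<forall>i v x. \<exists>n\<le>Suc N. ?R i v x = S n i v x"
  proof (intro allI)
    fix i v x
    obtain n where "n \<le> N" "R i v x = S n i v x" using r(3) by blast
    then show "\<exists>n\<le>Suc N. ?R i v x = S n i v x" unfolding min_def by (metis le_SucI le_refl)
  qed
  show ?case by (rule exI[of _ ?r], rule exI[of _ ?R]) (intro conjI A B C)
qed

lemma local_conv_pol:
  assumes "pover G p" shows "local_conv (apol X p) (\<integral>x. lpol c p x \<partial>\<Omega>)"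
  using assms
proof (induction p)
  case Nil then show ?case using local_conv_const[of 0] by (simp add: pol_Nil)
next
  case (Cons a p)
  obtain r t where a: "a = (r, t)" by (cases a)
  have t: "over G t" and p: "pover G p" using Cons.prems a by auto
  have "(\<integral>x. lpol c (a # p) x \<partial>\<Omega>) = r * (\<integral>x. lmon c t x \<partial>\<Omega>) + (\<integral>x. lpol c p x \<partial>\<Omega>)"
    unfolding a lpol_Cons using bdd_integrable[OF bdd_lmon[OF c t]] bdd_integrable[OF p_bdd[OF p]] by simp
  then show ?case unfolding a apol_Cons
    using local_conv_add[OF arr_cmult[OF arr_amon[OF X t]] p_arr[OF p] local_conv_cmult[OF local_monomials[OF t]] Cons.IH[OF p]]
    by (simp add: a)
qed

lemma tracks_local_conv:
  assumes tr: "tracks f F" shows "local_conv F (\<integral>x. f x \<partial>\<Omega>)"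
  unfolding local_conv_def
proof (rule tendsto_0_eps)
  fix e :: real assume "e > 0"
  then have e: "e / 3 > 0" by simp
  obtain p where p: "pover G p" "ldist f (lpol c p) < e / 3" "\<forall>\<^sub>F i in sequentially. adist F (apol X p) i < e / 3"
    using tr e unfolding tracks_def by blast
  let ?h = "\<integral>x. lpol c p x \<partial>\<Omega>"
  have "\<forall>\<^sub>F i in sequentially. avg (V i) (\<lambda>v. \<bar>(\<integral>x. apol X p i v x \<partial>P i) - ?h\<bar>) < e / 3"
    using local_conv_pol[OF p(1)] e unfolding local_conv_def by (intro order_tendstoD(2)[where a = "e / 3"]) auto
  then show "\<forall>\<^sub>F i in sequentially. avg (V i) (\<lambda>v. \<bar>(\<integral>x. F i v x \<partial>P i) - (\<integral>x. f x \<partial>\<Omega>)\<bar>) < e"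
    using p(3)
  proof eventually_elim
    case (elim i)
    have "avg (V i) (\<lambda>v. \<bar>(\<integral>x. F i v x \<partial>P i) - (\<integral>x. f x \<partial>\<Omega>)\<bar>) \<le>
      avg (V i) (\<lambda>v. (\<integral>x. \<bar>F i v x - apol X p i v x\<bar> \<partial>P i) + \<bar>(\<integral>x. apol X p i v x \<partial>P i) - ?h\<bar> + ldist f (lpol c p))"
    proof (rule avg_mono)
      fix v assume v: "v \<in> V i"
      show "\<bar>(\<integral>x. F i v x \<partial>P i) - (\<integral>x. f x \<partial>\<Omega>)\<bar> \<le>
        (\<integral>x. \<bar>F i v x - apol X p i v x\<bar> \<partial>P i) + \<bar>(\<integral>x. apol X p i v x \<partial>P i) - ?h\<bar> + ldist f (lpol c p)"
        using integral_difference[OF tracks_arr[OF tr] p_arr[OF p(1)] v] integral_ldist[OF tracks_bdd[OF tr] p_bdd[OF p(1)]]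
        by linarith
    qed
    also have "\<dots> = adist F (apol X p) i + avg (V i) (\<lambda>v. \<bar>(\<integral>x. apol X p i v x \<partial>P i) - ?h\<bar>) + ldist f (lpol c p)"
      using V by (simp add: avg_add avg_const adist_def)
    finally show ?case using elim p(2) by linarith
  qed
qed (simp add: avg_nonneg)

lemma tracks_integral:
  assumes "tracks f F" shows "(\<lambda>i. avg (V i) (\<lambda>v. \<integral>x. F i v x \<partial>P i)) \<longlonglongrightarrow> (\<integral>x. f x \<partial>\<Omega>)"
proof -
  have "(\<integral>x. avg (V i) (\<lambda>v. F i v x) \<partial>P i) = avg (V i) (\<lambda>v. \<integral>x. F i v x \<partial>P i)" for i
    by (intro integral_avg arr_integrable tracks_arr[OF assms])
  then show ?thesis using local_conv_avg[OF tracks_arr[OF assms] tracks_local_conv[OF assms]] by simp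
qed

text \<open>The correspondence is isometric because the absolute difference is tracked too and expectations of tracked functions
  converge.\<close>

lemma tracks_adist:
  assumes "tracks f F" "tracks h H" shows "adist F H \<longlonglongrightarrow> ldist f h"
  using tracks_integral[OF tracks_abs[OF tracks_diff[OF assms]]] by (simp add: adist_def[abs_def] ldist_def)

lemma tracks_mval:
  assumes "\<And>z. z \<in> set t \<Longrightarrow> tracks (\<lambda>x. \<rho> x z) (\<lambda>i v x. R i v x z)"
  shows "tracks (\<lambda>x. mval (\<rho> x) t) (\<lambda>i v x. mval (R i v x) t)"
  using assms by (induction t) (auto intro!: tracks_const tracks_mult)

lemma tracks_pval:
  assumes "\<And>z. z \<in> pvars p \<Longrightarrow> tracks (\<lambda>x. \<rho> x z) (\<lambda>i v x. R i v x z)"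
  shows "tracks (\<lambda>x. pval (\<rho> x) p) (\<lambda>i v x. pval (R i v x) p)"
  using assms
proof (induction p)
  case (Cons a p)
  obtain r t where a: "a = (r, t)" by (cases a)
  show ?case unfolding a pval_simps using Cons a by (intro tracks_add tracks_cmult tracks_mval Cons.IH) auto
qed (simp add: tracks_const)

text \<open>A translate of a polynomial is a polynomial on the system. On the arrays this holds outside the vertices at which
  multiplicativity fails, whose proportion vanishes.\<close>

lemma tracks_shift:
  assumes tr: "tracks f F" and g: "g \<in> carrier G"
  shows "tracks (\<lambda>x. f (T g x)) (\<lambda>i v. F i (\<sigma> i g v))"
proof (rule tracks_limit)
  note mc = monoid.m_closed[OF group.is_monoid[OF group]]
  show "bdd (\<lambda>x. f (T g x))" "arr (\<lambda>i v. F i (\<sigma> i g v))"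
    using bdd_T[OF tracks_bdd[OF tr] g] arr_shift[OF tracks_arr[OF tr] g] by auto
  have var: "tracks (\<lambda>x. c j (T h (T g x))) (\<lambda>i v. X j i (\<sigma> i h (\<sigma> i g v)))" if h: "h \<in> carrier G" for j h
  proof (rule tracks_limit)
    show b: "bdd (\<lambda>x. c j (T h (T g x)))" using bdd_T[OF bdd_T[OF c h] g] .
    show a: "arr (\<lambda>i v. X j i (\<sigma> i h (\<sigma> i g v)))" using arr_shift[OF arr_shift[OF X h] g] .
    have tr1: "tracks (\<lambda>x. c j (T (h \<otimes>\<^bsub>G\<^esub> g) x)) (\<lambda>i v x. X j i (\<sigma> i (h \<otimes>\<^bsub>G\<^esub> g) v) x)"
      using tracks_pol[of "[(1, [(h \<otimes>\<^bsub>G\<^esub> g, j)])]"] h g mc by (simp add: lpol_def[abs_def] apol_def[abs_def])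
    have "ldist (\<lambda>x. c j (T h (T g x))) (\<lambda>x. c j (T (h \<otimes>\<^bsub>G\<^esub> g) x)) = 0"
      using T_mult[OF h g] by (intro ldist_AE b tracks_bdd[OF tr1]) (auto intro: AE_I2)
    moreover have "(adist (\<lambda>i v. X j i (\<sigma> i h (\<sigma> i g v))) (\<lambda>i v. X j i (\<sigma> i (h \<otimes>\<^bsub>G\<^esub> g) v))) \<longlonglongrightarrow> 0"
      by (rule adist_\<sigma>_mult[OF X h g])
    ultimately show "\<exists>k H. tracks k H \<and> ldist (\<lambda>x. c j (T h (T g x))) k < \<eta> \<and>
       (\<forall>\<^sub>F i in sequentially. adist (\<lambda>i v. X j i (\<sigma> i h (\<sigma> i g v))) H i < \<eta>)" if "\<eta> > 0" for \<eta>
      using tr1 that order_tendstoD(2)[of _ 0 sequentially \<eta>]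
      by (intro exI[of _ "\<lambda>x. c j (T (h \<otimes>\<^bsub>G\<^esub> g) x)"] exI[of _ "\<lambda>i v x. X j i (\<sigma> i (h \<otimes>\<^bsub>G\<^esub> g) v) x"]) auto
  qed
  fix \<eta> :: real assume "\<eta> > 0"
  then obtain p where p: "pover G p" "ldist f (lpol c p) < \<eta>" "\<forall>\<^sub>F i in sequentially. adist F (apol X p) i < \<eta>"
    using tr unfolding tracks_def by blast
  show "\<exists>h H. tracks h H \<and> ldist (\<lambda>x. f (T g x)) h < \<eta> \<and> (\<forall>\<^sub>F i in sequentially. adist (\<lambda>i v. F i (\<sigma> i g v)) H i < \<eta>)"
  proof (intro exI conjI)
    have v1: "tracks (\<lambda>x. c (snd z) (T (fst z) (T g x))) (\<lambda>i v x. X (snd z) i (\<sigma> i (fst z) (\<sigma> i g v)) x)" if "z \<in> pvars p" for z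
      using var[of "fst z" "snd z"] that p(1) by auto
    show "tracks (\<lambda>x. lpol c p (T g x)) (\<lambda>i v. apol X p i (\<sigma> i g v))"
      unfolding lpol_def apol_def[abs_def] by (rule tracks_pval[OF v1])
    show "ldist (\<lambda>x. f (T g x)) (\<lambda>x. lpol c p (T g x)) < \<eta>"
      using p(2) ldist_T[OF tracks_bdd[OF tr] p_bdd[OF p(1)] g] by simp
    show "\<forall>\<^sub>F i in sequentially. adist (\<lambda>i v. F i (\<sigma> i g v)) (\<lambda>i v. apol X p i (\<sigma> i g v)) i < \<eta>"
      using p(3) adist_shift[OF g] by simp
  qed
qed

lemma tracks_family:
  assumes tr: "\<And>j. tracks (c' j) (X' j)" and t: "over G t"
  shows "tracks (lmon c' t) (amon X' t)"
  unfolding lmon_def[abs_def] amon_def[abs_def]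
proof (rule tracks_mval)
  fix z assume "z \<in> set t"
  then show "tracks (\<lambda>x. c' (snd z) (T (fst z) x)) (\<lambda>i v x. X' (snd z) i (\<sigma> i (fst z) v) x)"
    using tracks_shift[OF tr, of "fst z" "snd z"] t by auto
qed

lemma tracks_family_pol:
  assumes tr: "\<And>j. tracks (c' j) (X' j)" and p: "pover G p"
  shows "tracks (lpol c' p) (apol X' p)"
  unfolding lpol_def[abs_def] apol_def[abs_def]
proof (rule tracks_pval)
  fix z assume "z \<in> pvars p"
  then show "tracks (\<lambda>x. c' (snd z) (T (fst z) x)) (\<lambda>i v x. X' (snd z) i (\<sigma> i (fst z) v) x)"
    using tracks_shift[OF tr, of "fst z" "snd z"] p by auto
qed

lemma pair_conv_pol_left:
  assumes "pover G p" "arr F'"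
    and "\<And>t. over G t \<Longrightarrow> pair_conv b (amon X t) (\<integral>x. lmon c t x \<partial>\<Omega>) F' r'"
  shows "pair_conv b (apol X p) (\<integral>x. lpol c p x \<partial>\<Omega>) F' r'"
  using assms(1)
proof (induction p)
  case Nil
  show ?case by (cases b) (simp_all add: pair_conv_def pol_Nil nrm_def avg_def)
next
  case (Cons a p)
  obtain r t where a: "a = (r, t)" by (cases a)
  have t: "over G t" and p: "pover G p" using Cons.prems a by auto
  have "(\<integral>x. lpol c (a # p) x \<partial>\<Omega>) = r * (\<integral>x. lmon c t x \<partial>\<Omega>) + (\<integral>x. lpol c p x \<partial>\<Omega>)"
    unfolding a lpol_Cons using bdd_integrable[OF bdd_lmon[OF c t]] bdd_integrable[OF p_bdd[OF p]] by simp
  then show ?case unfolding a apol_Cons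
    using pair_conv_add[OF arr_cmult[OF arr_amon[OF X t]] p_arr[OF p] assms(2) pair_conv_cmult[OF assms(3)[OF t]] Cons.IH[OF p]]
    by (simp add: a)
qed

lemma pair_conv_tracks_left:
  assumes tr: "tracks f F" and F': "arr F'"
    and mon: "\<And>t. over G t \<Longrightarrow> pair_conv b (amon X t) (\<integral>x. lmon c t x \<partial>\<Omega>) F' r'"
  shows "pair_conv b F (\<integral>x. f x \<partial>\<Omega>) F' r'"
proof (rule pair_conv_approx[OF tracks_arr[OF tr] F'])
  fix \<eta> :: real assume "\<eta> > 0"
  then obtain p where p: "pover G p" "ldist f (lpol c p) < \<eta>" "\<forall>\<^sub>F i in sequentially. adist F (apol X p) i < \<eta>"
    using tr unfolding tracks_def by blast
  then show "\<exists>H h. arr H \<and> pair_conv b H h F' r' \<and> \<bar>(\<integral>x. f x \<partial>\<Omega>) - h\<bar> < \<eta> \<and> (\<forall>\<^sub>F i in sequentially. adist F H i < \<eta>)"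
    using pair_conv_pol_left[OF p(1) F' mon] p_arr[OF p(1)] integral_ldist[OF tracks_bdd[OF tr] p_bdd[OF p(1)]]
    by (intro exI[of _ "apol X p"] exI[of _ "\<integral>x. lpol c p x \<partial>\<Omega>"]) auto
qed

text \<open>Both kinds of decorrelation survive approximation in mean, so they pass from monomials to tracked functions in one
  factor at a time.\<close>

lemma pair_conv_tracks:
  assumes mon: "\<And>s t. over G s \<Longrightarrow> over G t \<Longrightarrow>
      pair_conv b (amon X s) (\<integral>x. lmon c s x \<partial>\<Omega>) (amon X t) (\<integral>x. lmon c t x \<partial>\<Omega>)"
    and tr: "tracks f F" "tracks f' F'"
  shows "pair_conv b F (\<integral>x. f x \<partial>\<Omega>) F' (\<integral>x. f' x \<partial>\<Omega>)"
proof (rule pair_conv_tracks_left[OF tr(1) tracks_arr[OF tr(2)]])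
  fix t :: "('g \<times> 'j) list" assume t: "over G t"
  show "pair_conv b (amon X t) (\<integral>x. lmon c t x \<partial>\<Omega>) F' (\<integral>x. f' x \<partial>\<Omega>)"
    using pair_conv_tracks_left[OF tr(2) arr_amon[OF X t] mon[OF _ t]] by (rule pair_conv_sym)
qed

end

section \<open>Factor maps over models\<close>

text \<open>The distances to a dense sequence are coordinates that are adapted to the metric: each is 1-Lipschitz, and finitely many of them
  locate a point up to a small error.\<close>

locale metric_net =
  fixes K :: "'a set" and d :: "'a \<Rightarrow> 'a \<Rightarrow> real" and l :: "nat \<Rightarrow> 'a"
  assumes metric: "Metric_space K d" and compact: "compact_space (Metric_space.mtopology K d)"
    and l: "\<And>n. l n \<in> K" and net: "\<And>\<epsilon>. \<epsilon> > 0 \<Longrightarrow> \<exists>N. \<forall>x\<in>K. \<exists>n\<le>N. d x (l n) < \<epsilon>"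
begin

sublocale Metric_space K d by (rule metric)

lemma distance_difference: "x \<in> K \<Longrightarrow> y \<in> K \<Longrightarrow> z \<in> K \<Longrightarrow> \<bar>d x z - d y z\<bar> \<le> d x y"
  using triangle[of x y z] triangle[of y x z] by (simp add: commute abs_le_iff)

sublocale coordinates K d "\<lambda>j x. d x (l j)"
proof (rule coordinates.intro[OF metric compact])
  show "continuous_map mtopology euclideanreal (\<lambda>x. d x (l j))" for j
  proof -
    have "continuous_map mtopology Met_TC.mtopology (\<lambda>x. d x (l j))"
      unfolding Met_TC.continuous_map_to_metric
    proof (intro ballI allI impI)
      fix x and \<epsilon> :: real assume x: "x \<in> topspace mtopology" and "0 < \<epsilon>"
      then show "\<exists>U. openin mtopology U \<and> x \<in> U \<and> (\<forall>y\<in>U. d y (l j) \<in> Met_TC.mball (d x (l j)) \<epsilon>)"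
        using distance_difference[OF _ _ l[of j]]
        by (intro exI[of _ "mball x \<epsilon>"]) (fastforce simp: in_mball dist_real_def)
    qed
    then show ?thesis by simp
  qed
  fix x y assume xy: "x \<in> K" "y \<in> K" "x \<noteq> y"
  then have "0 < d x y" by simp
  then obtain n where n: "d x (l n) < d x y / 2" using net[of "d x y / 2"] xy by auto
  have "d x y \<le> d x (l n) + d y (l n)" using triangle[of x "l n" y] xy l by (simp add: commute)
  then show "\<exists>j. d x (l j) \<noteq> d y (l j)" using n by (intro exI[of _ n]) linarith
qed

end

lemma metric_net_exists:
  assumes M: "Metric_space K d" and c: "compact_space (Metric_space.mtopology K d)" and "K \<noteq> {}"
  obtains l where "metric_net K d l"
proof -
  interpret Metric_space K d by fact
  have "mtotally_bounded K"
    using c compactin_imp_mtotally_bounded[of K] by (simp add: compact_space_def)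
  then have "\<exists>F. finite F \<and> F \<subseteq> K \<and> K \<subseteq> (\<Union>x\<in>F. mball x (1 / real (Suc k)))" for k
    unfolding mtotally_bounded_def by simp
  then obtain F where F: "\<And>k. finite (F k)" "\<And>k. F k \<subseteq> K" "\<And>k. K \<subseteq> (\<Union>x\<in>F k. mball x (1 / real (Suc k)))"
    by metis
  define U where "U = (\<Union>k. F k)"
  have "U \<noteq> {}" using F(3)[of 0] \<open>K \<noteq> {}\<close> by (auto simp: U_def)
  have "countable U" unfolding U_def using F(1) by (auto intro: countable_finite)
  have "metric_net K d (from_nat_into U)"
  proof (rule metric_net.intro[OF M c])
    show "from_nat_into U n \<in> K" for n using from_nat_into[OF \<open>U \<noteq> {}\<close>, of n] F(2) by (auto simp: U_def)
    fix \<epsilon> :: real assume "\<epsilon> > 0"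
    then obtain k where k: "1 / real (Suc k) < \<epsilon>" using nat_approx_posE by blast
    have "\<forall>y\<in>F k. \<exists>n. from_nat_into U n = y"
      using from_nat_into_surj[OF \<open>countable U\<close>] by (auto simp: U_def)
    then obtain \<nu> where \<nu>: "\<And>y. y \<in> F k \<Longrightarrow> from_nat_into U (\<nu> y) = y" by metis
    show "\<exists>N. \<forall>x\<in>K. \<exists>n\<le>N. d x (from_nat_into U n) < \<epsilon>"
    proof (rule exI[of _ "Max (\<nu> ` F k)"], rule ballI)
      fix x assume "x \<in> K"
      then obtain y where y: "y \<in> F k" "d y x < 1 / real (Suc k)" using F(3)[of k] by (auto simp: in_mball)
      then show "\<exists>n\<le>Max (\<nu> ` F k). d x (from_nat_into U n) < \<epsilon>"
        using F(1)[of k] \<nu> k by (intro exI[of _ "\<nu> y"]) (auto simp: commute)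
    qed
  qed
  then show ?thesis by (rule that)
qed

text \<open>This merges approximations at all scales into a single one.\<close>

lemma diagonal_index:
  fixes Q :: "nat \<Rightarrow> nat \<Rightarrow> bool"
  assumes "\<And>k. \<forall>\<^sub>F i in sequentially. Q k i"
  obtains \<kappa> where "\<And>k. \<forall>\<^sub>F i in sequentially. k \<le> \<kappa> i" "\<forall>\<^sub>F i in sequentially. Q (\<kappa> i) i"
proof -
  obtain n where n: "\<And>k i. n k \<le> i \<Longrightarrow> Q k i" using assms unfolding eventually_sequentially by metis
  define A where "A i = {k. k \<le> i \<and> n k \<le> i}" for i
  have fin: "finite (A i)" for i unfolding A_def by simp
  show ?thesis
  proof (rule that[of "\<lambda>i. Max (A i)"])
    show "\<forall>\<^sub>F i in sequentially. k \<le> Max (A i)" for k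
      unfolding eventually_sequentially
      by (intro exI[of _ "max k (n k)"] allI impI Max_ge fin) (simp add: A_def)
    show "\<forall>\<^sub>F i in sequentially. Q (Max (A i)) i"
      unfolding eventually_sequentially
    proof (intro exI[of _ "n 0"] allI impI)
      fix i assume "n 0 \<le> i"
      then have "A i \<noteq> {}" by (auto simp: A_def)
      then have "Max (A i) \<in> A i" using fin by (rule Max_in[rotated])
      then show "Q (Max (A i)) i" using n by (simp add: A_def)
    qed
  qed
qed

context tracking
begin

text \<open>The distances of \<open>\<phi>\<close> to the net are approximated by polynomials, and at each vertex one chooses the net point whose own distances
  match the values of these polynomials best. On the system the least mismatch is small in mean, since it is at most
  the mismatch of a net point close to \<open>\<phi>\<close>. The least mismatch is tracked, so it is small over the models too.
  The scale of the approximation is finally made to grow along the sequence.\<close>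

theorem tracking_field:
  fixes L :: "'b set" and e :: "'b \<Rightarrow> 'b \<Rightarrow> real" and l :: "nat \<Rightarrow> 'b"
  assumes net: "metric_net L e l" and \<phi>: "\<phi> \<in> \<Omega> \<rightarrow>\<^sub>M metric_borel L e"
  obtains y where "\<And>i v. v \<in> V i \<Longrightarrow> y i v \<in> P i \<rightarrow>\<^sub>M metric_borel L e"
    and "\<And>j. tracks (\<lambda>z. e (\<phi> z) (l j)) (\<lambda>i v z. e (y i v z) (l j))"
proof -
  interpret L: metric_net L e l by (rule net)
  have \<phi>_in: "\<phi> z \<in> L" if "z \<in> space \<Omega>" for z using measurable_space[OF \<phi> that] by simp
  let ?f = "\<lambda>j z. e (\<phi> z) (l j)"
  have f: "bdd (?f j)" for j
  proof -
    obtain B where "\<forall>x\<in>L. \<bar>e x (l j)\<bar> \<le> B" using L.coordinate_bounded[of j] by blast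
    then show ?thesis using measurable_compose[OF \<phi> L.coordinate_measurable, of j] \<phi>_in by (intro bddI[where B = B]) auto
  qed
  \<comment> \<open>At scale \<open>k\<close> the first \<open>k\<close> distances are compared, and \<open>k * \<epsilon> k\<close> tends to zero.\<close>
  define \<epsilon> where "\<epsilon> k = 1 / (real (Suc k))\<^sup>2" for k
  have \<epsilon>: "\<epsilon> k > 0" for k by (simp add: \<epsilon>_def)
  have ex: "\<exists>p. pover G p \<and> ldist (?f j) (lpol c p) < \<epsilon> k" for k j by (rule dense[OF f \<epsilon>])
  define p where "p k j = (SOME p. pover G p \<and> ldist (?f j) (lpol c p) < \<epsilon> k)" for k j
  have p: "pover G (p k j)" "ldist (?f j) (lpol c (p k j)) < \<epsilon> k" for k j
    using someI_ex[OF ex[of j k]] unfolding p_def by blast+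
  have "\<exists>N. \<forall>x\<in>L. \<exists>n\<le>N. e x (l n) < \<epsilon> k" for k by (rule L.net[OF \<epsilon>])
  then obtain N where N: "\<And>k x. x \<in> L \<Longrightarrow> \<exists>n\<le>N k. e x (l n) < \<epsilon> k" by metis
  \<comment> \<open>The mismatch of the \<open>n\<close>-th net point, on the system and over the models.\<close>
  define s where "s k n z = (\<Sum>j<k. \<bar>e (l n) (l j) - lpol c (p k j) z\<bar>)" for k n z
  define S where "S k n i v z = (\<Sum>j<k. \<bar>e (l n) (l j) - apol X (p k j) i v z\<bar>)" for k n i v z
  have trS: "tracks (s k n) (S k n)" for k n
    unfolding s_def[abs_def] S_def[abs_def] by (intro tracks_sum tracks_abs tracks_diff tracks_const tracks_pol p) simp
  have "\<exists>r R. tracks r R \<and> (\<forall>z. \<forall>n\<le>N k. r z \<le> s k n z) \<and> (\<forall>i v z. \<exists>n\<le>N k. R i v z = S k n i v z)" for k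
    by (rule tracks_Min) (rule trS)
  then obtain r R where rR: "\<And>k. tracks (r k) (R k)" "\<And>k z n. n \<le> N k \<Longrightarrow> r k z \<le> s k n z"
    "\<And>k i v z. \<exists>n\<le>N k. R k i v z = S k n i v z" by metis
  \<comment> \<open>The least optimal index depends measurably on the model.\<close>
  define best where "best k i v z n \<longleftrightarrow> n \<le> N k \<and> (\<forall>m\<le>N k. S k n i v z \<le> S k m i v z)" for k i v z n
  define idx where "idx k i v z = (LEAST n. best k i v z n)" for k i v z
  have best_ex: "best k i v z (idx k i v z)" for k i v z
    unfolding idx_def
  proof (rule LeastI_ex)
    obtain n where "n \<in> {..N k}" "\<forall>m\<in>{..N k}. S k n i v z \<le> S k m i v z"
      using ex_min_if_finite[of "(\<lambda>n. S k n i v z) ` {..N k}"] by (auto simp: not_less)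
    then show "\<exists>n. best k i v z n" by (auto simp: best_def)
  qed
  have S_R: "S k (idx k i v z) i v z \<le> R k i v z" for k i v z
    using best_ex[of k i v z] rR(3)[of k i v z] by (auto simp: best_def)
  have S_meas[measurable]: "S k n i v \<in> borel_measurable (P i)" if "v \<in> V i" for k n i v
    using arr_measurable[OF tracks_arr[OF trS] that] .
  have idx_meas: "idx k i v \<in> P i \<rightarrow>\<^sub>M count_space UNIV" if "v \<in> V i" for k i v
    unfolding idx_def[abs_def] best_def using S_meas[OF that] by measurable
  define Y where "Y k i v z = l (idx k i v z)" for k i v z
  have Y_meas: "Y k i v \<in> P i \<rightarrow>\<^sub>M metric_borel L e" if "v \<in> V i" for k i v
    unfolding Y_def[abs_def] by (rule measurable_compose[OF idx_meas[OF that]]) (simp add: L.l)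
  have e_arr: "arr (\<lambda>i v z. e (y i v z) (l j))"
    if y: "\<And>i v. v \<in> V i \<Longrightarrow> y i v \<in> P i \<rightarrow>\<^sub>M metric_borel L e" for y j
  proof -
    obtain B where B: "\<forall>x\<in>L. \<bar>e x (l j)\<bar> \<le> B" using L.coordinate_bounded[of j] by blast
    show ?thesis
    proof (rule arrI[where B = B])
      show "(\<lambda>z. e (y i v z) (l j)) \<in> borel_measurable (P i)" if "v \<in> V i" for i v
        using measurable_compose[OF y[OF that] L.coordinate_measurable] .
      show "\<bar>e (y i v z) (l j)\<bar> \<le> B" if "v \<in> V i" "z \<in> space (P i)" for i v z
        using B measurable_space[OF y[OF that(1)] that(2)] by simp
    qed
  qed
  have int_r: "(\<integral>z. r k z \<partial>\<Omega>) \<le> 2 / real (Suc k)" for k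
  proof -
    have b: "bdd (\<lambda>z. \<bar>?f j z - lpol c (p k j) z\<bar>)" for j by (intro bdd_abs bdd_diff f p_bdd p)
    have "(\<integral>z. r k z \<partial>\<Omega>) \<le> (\<integral>z. (\<Sum>j<k. \<epsilon> k + \<bar>?f j z - lpol c (p k j) z\<bar>) \<partial>\<Omega>)"
    proof (rule integral_mono)
      show "integrable \<Omega> (r k)" by (rule bdd_integrable[OF tracks_bdd[OF rR(1)]])
      show "integrable \<Omega> (\<lambda>z. \<Sum>j<k. \<epsilon> k + \<bar>?f j z - lpol c (p k j) z\<bar>)"
        by (intro Bochner_Integration.integrable_sum bdd_integrable bdd_add bdd_const b)
      fix z assume z: "z \<in> space \<Omega>"
      obtain n where n: "n \<le> N k" "e (\<phi> z) (l n) < \<epsilon> k" using N[OF \<phi>_in[OF z]] by blast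
      have "r k z \<le> s k n z" by (rule rR(2)[OF n(1)])
      also have "\<dots> \<le> (\<Sum>j<k. \<epsilon> k + \<bar>?f j z - lpol c (p k j) z\<bar>)"
        unfolding s_def
      proof (rule sum_mono)
        fix j
        have "\<bar>e (\<phi> z) (l j) - e (l n) (l j)\<bar> < \<epsilon> k"
          using L.distance_difference[OF \<phi>_in[OF z] L.l L.l, of j n] n(2) by (rule le_less_trans)
        then show "\<bar>e (l n) (l j) - lpol c (p k j) z\<bar> \<le> \<epsilon> k + \<bar>?f j z - lpol c (p k j) z\<bar>" by linarith
      qed
      finally show "r k z \<le> (\<Sum>j<k. \<epsilon> k + \<bar>?f j z - lpol c (p k j) z\<bar>)" .
    qed
    also have "\<dots> = (\<Sum>j<k. \<epsilon> k + ldist (?f j) (lpol c (p k j)))"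
      using bdd_integrable[OF b] bdd_integrable[OF bdd_add[OF bdd_const b]] by (simp add: ldist_def prob_space)
    also have "\<dots> \<le> (\<Sum>j<k. 2 * \<epsilon> k)" using p(2)[of _ k] by (intro sum_mono) (simp add: less_imp_le)
    also have "\<dots> \<le> real (Suc k) * (2 * \<epsilon> k)" using \<epsilon>[of k] by (simp add: mult_right_mono)
    also have "\<dots> = 2 / real (Suc k)" unfolding \<epsilon>_def by (simp add: power2_eq_square del: of_nat_Suc)
    finally show ?thesis .
  qed
  \<comment> \<open>At a growing scale the mismatch must tend to zero and the polynomials must stay close to those of every earlier scale.\<close>
  define Q where "Q k i \<longleftrightarrow> avg (V i) (\<lambda>v. \<integral>z. R k i v z \<partial>P i) < 3 / real (Suc k) \<and>
    (\<forall>k0\<in>{..k}. \<forall>j\<in>{..<k0}. adist (apol X (p k j)) (apol X (p k0 j)) i < ldist (lpol c (p k j)) (lpol c (p k0 j)) + 1 / real (Suc k))" for k i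
  have "\<forall>\<^sub>F i in sequentially. Q k i" for k
    unfolding Q_def
  proof (intro eventually_conj eventually_ball_finite ballI)
    show "\<forall>\<^sub>F i in sequentially. avg (V i) (\<lambda>v. \<integral>z. R k i v z \<partial>P i) < 3 / real (Suc k)"
    proof (rule order_tendstoD(2)[OF tracks_integral[OF rR(1)]])
      have "2 / real (Suc k) < 3 / real (Suc k)" by (intro divide_strict_right_mono) auto
      then show "(\<integral>z. r k z \<partial>\<Omega>) < 3 / real (Suc k)" using int_r[of k] by (rule le_less_trans[rotated])
    qed
    show "\<forall>\<^sub>F i in sequentially. adist (apol X (p k j)) (apol X (p k0 j)) i < ldist (lpol c (p k j)) (lpol c (p k0 j)) + 1 / real (Suc k)" for k0 j
      by (rule order_tendstoD(2)[OF tracks_adist[OF tracks_pol[OF p(1)] tracks_pol[OF p(1)]]]) simp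
  qed auto
  then obtain \<kappa> where \<kappa>: "\<And>k. \<forall>\<^sub>F i in sequentially. k \<le> \<kappa> i" "\<forall>\<^sub>F i in sequentially. Q (\<kappa> i) i"
    using diagonal_index[of Q] by blast
  define y where "y i = Y (\<kappa> i) i" for i
  have y_meas: "y i v \<in> P i \<rightarrow>\<^sub>M metric_borel L e" if "v \<in> V i" for i v
    unfolding y_def by (rule Y_meas[OF that])
  show ?thesis
  proof (rule that[of y, OF y_meas])
    fix j
    show "tracks (?f j) (\<lambda>i v z. e (y i v z) (l j))"
    proof (rule tracks_limit[OF f e_arr[OF y_meas]])
      fix \<eta> :: real assume "\<eta> > 0"
      then obtain k1 where k1: "1 / real (Suc k1) < \<eta> / 6" using nat_approx_posE[of "\<eta> / 6"] by auto
      define k0 where "k0 = max k1 (Suc j)"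
      have "1 / real (Suc k0) \<le> 1 / real (Suc k1)" by (intro divide_left_mono) (auto simp: k0_def)
      then have k0: "6 * (1 / real (Suc k0)) < \<eta>" "j < k0" using k1 by (auto simp: k0_def)
      have \<epsilon>_le: "\<epsilon> k \<le> 1 / real (Suc k)" for k
        unfolding \<epsilon>_def power2_eq_square by (intro divide_left_mono) (auto simp del: of_nat_Suc)
      have "ldist (?f j) (lpol c (p k0 j)) < \<eta>"
      proof -
        have "0 < 1 / real (Suc k0)" by simp
        then show ?thesis using p(2)[of j k0] \<epsilon>_le[of k0] k0(1) by linarith
      qed
      moreover have "\<forall>\<^sub>F i in sequentially. adist (\<lambda>i v z. e (y i v z) (l j)) (apol X (p k0 j)) i < \<eta>"
        using \<kappa>(1)[of k0] \<kappa>(2)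
      proof eventually_elim
        case (elim i)
        define k where "k = \<kappa> i"
        have k: "k0 \<le> k" "Q k i" using elim by (simp_all add: k_def)
        let ?E = "\<lambda>i v z. e (Y k i v z) (l j)"
        have jk: "j < k" using k0(2) k(1) by simp
        have E: "arr ?E" by (rule e_arr[OF Y_meas])
        have "adist (\<lambda>i v z. e (y i v z) (l j)) (apol X (p k0 j)) i = adist ?E (apol X (p k0 j)) i"
          by (simp add: adist_def y_def k_def)
        also have "\<dots> \<le> adist ?E (apol X (p k j)) i + adist (apol X (p k j)) (apol X (p k0 j)) i"
          by (rule adist_triangle[OF E p_arr[OF p(1)] p_arr[OF p(1)]])
        also have "adist ?E (apol X (p k j)) i \<le> avg (V i) (\<lambda>v. \<integral>z. R k i v z \<partial>P i)"
        proof (rule adist_le[OF _ E p_arr[OF p(1)] tracks_arr[OF rR(1)]])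
          fix v z
          have "\<bar>e (l (idx k i v z)) (l j) - apol X (p k j) i v z\<bar> \<le> S k (idx k i v z) i v z"
            unfolding S_def using jk by (intro member_le_sum[of j]) auto
          then show "\<bar>?E i v z - apol X (p k j) i v z\<bar> \<le> R k i v z" using S_R[of k i v z] by (simp add: Y_def)
        qed
        also have "\<dots> < 3 / real (Suc k)" using k(2) by (simp add: Q_def)
        also have "adist (apol X (p k j)) (apol X (p k0 j)) i < ldist (lpol c (p k j)) (lpol c (p k0 j)) + 1 / real (Suc k)"
          using k k0(2) by (simp add: Q_def)
        also have "ldist (lpol c (p k j)) (lpol c (p k0 j)) \<le> ldist (?f j) (lpol c (p k j)) + ldist (?f j) (lpol c (p k0 j))"
          using ldist_triangle[OF p_bdd[OF p(1)[of k j]] f[of j] p_bdd[OF p(1)[of k0 j]]] by (simp add: ldist_commute)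
        also have "\<dots> \<le> 1 / real (Suc k) + 1 / real (Suc k0)"
          using p(2)[of j k] p(2)[of j k0] \<epsilon>_le[of k] \<epsilon>_le[of k0] by linarith
        finally have "adist (\<lambda>i v z. e (y i v z) (l j)) (apol X (p k0 j)) i < 3 / real (Suc k) + (1 / real (Suc k) + 1 / real (Suc k0) + 1 / real (Suc k))"
          by simp
        also have "\<dots> = 5 * (1 / real (Suc k)) + 1 / real (Suc k0)"
        proof -
          have "3 / real (Suc k) = 3 * (1 / real (Suc k))" by simp
          then show ?thesis by linarith
        qed
        also have "1 / real (Suc k) \<le> 1 / real (Suc k0)" using k(1) by (intro divide_left_mono) auto
        finally show ?case using k0(1) by simp
      qed
      ultimately show "\<exists>h H. tracks h H \<and> ldist (?f j) h < \<eta> \<and> (\<forall>\<^sub>F i in sequentially. adist (\<lambda>i v z. e (y i v z) (l j)) H i < \<eta>)"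
        using tracks_pol[OF p(1)] by blast
    qed
  qed
qed

text \<open>Vertex averages are invariant under the permutations, so a variable at a translated vertex costs no more than at
  the vertex itself.\<close>

lemma apol_Lipschitz:
  assumes X': "\<And>j. arr (X' j)"
    and Lip: "\<And>j i u u'. u \<in> space (P i) \<Longrightarrow> u' \<in> space (P i) \<Longrightarrow> avg (V i) (\<lambda>v. \<bar>X' j i v u - X' j i v u'\<bar>) \<le> D i u u'"
    and p: "pover G p"
  shows "\<exists>C\<ge>0. \<forall>i. \<forall>u\<in>space (P i). \<forall>u'\<in>space (P i). avg (V i) (\<lambda>v. \<bar>apol X' p i v u - apol X' p i v u'\<bar>) \<le> C * D i u u'"
proof -
  have mon: "\<exists>C\<ge>0. \<forall>i. \<forall>u\<in>space (P i). \<forall>u'\<in>space (P i). avg (V i) (\<lambda>v. \<bar>amon X' t i v u - amon X' t i v u'\<bar>) \<le> C * D i u u'"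
    if "over G t" for t
    using that
  proof (induction t)
    case Nil then show ?case by (intro exI[of _ 0]) (simp add: amon_def avg_def)
  next
    case (Cons z t)
    obtain g j where z: "z = (g, j)" by (cases z)
    have g: "g \<in> carrier G" and t: "over G t" using Cons.prems z by auto
    obtain C where C: "C \<ge> 0" "\<And>i u u'. u \<in> space (P i) \<Longrightarrow> u' \<in> space (P i) \<Longrightarrow> avg (V i) (\<lambda>v. \<bar>amon X' t i v u - amon X' t i v u'\<bar>) \<le> C * D i u u'"
      using Cons.IH[OF t] by blast
    obtain B where B: "0 < B" "\<And>i v u. v \<in> V i \<Longrightarrow> u \<in> space (P i) \<Longrightarrow> \<bar>X' j i v u\<bar> \<le> B" using arr_bounded[OF X'[of j]] by blast
    obtain B' where B': "0 < B'" "\<And>i v u. v \<in> V i \<Longrightarrow> u \<in> space (P i) \<Longrightarrow> \<bar>amon X' t i v u\<bar> \<le> B'" using arr_bounded[OF arr_amon[where X = X', OF X' t]] by blast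
    have "avg (V i) (\<lambda>v. \<bar>amon X' (z # t) i v u - amon X' (z # t) i v u'\<bar>) \<le> (B * C + B') * D i u u'"
      if u: "u \<in> space (P i)" "u' \<in> space (P i)" for i u u'
    proof -
      have "avg (V i) (\<lambda>v. \<bar>amon X' (z # t) i v u - amon X' (z # t) i v u'\<bar>) \<le>
        avg (V i) (\<lambda>v. B * \<bar>amon X' t i v u - amon X' t i v u'\<bar> + B' * \<bar>X' j i (\<sigma> i g v) u - X' j i (\<sigma> i g v) u'\<bar>)"
      proof (rule avg_mono)
        fix v assume v: "v \<in> V i"
        let ?x = "X' j i (\<sigma> i g v) u" and ?x' = "X' j i (\<sigma> i g v) u'" and ?a = "amon X' t i v u" and ?a' = "amon X' t i v u'"
        have "\<bar>?x\<bar> \<le> B" "\<bar>?a'\<bar> \<le> B'" using B(2)[OF \<sigma>_in[OF g v] u(1)] B'(2)[OF v u(2)] .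
        then have "\<bar>?x * (?a - ?a')\<bar> \<le> B * \<bar>?a - ?a'\<bar>" "\<bar>?a' * (?x - ?x')\<bar> \<le> B' * \<bar>?x - ?x'\<bar>"
          unfolding abs_mult by (auto intro: mult_right_mono)
        moreover have "?x * ?a - ?x' * ?a' = ?x * (?a - ?a') + ?a' * (?x - ?x')" by (simp add: algebra_simps)
        ultimately show "\<bar>amon X' (z # t) i v u - amon X' (z # t) i v u'\<bar> \<le> B * \<bar>?a - ?a'\<bar> + B' * \<bar>?x - ?x'\<bar>"
          unfolding amon_def by (simp add: z)
      qed
      also have "\<dots> = B * avg (V i) (\<lambda>v. \<bar>amon X' t i v u - amon X' t i v u'\<bar>) + B' * avg (V i) (\<lambda>v. \<bar>X' j i v u - X' j i v u'\<bar>)"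
        unfolding avg_add avg_cmult using avg_reindex[OF \<sigma>_bij[OF g], where f = "\<lambda>v. \<bar>X' j i v u - X' j i v u'\<bar>"] by simp
      also have "\<dots> \<le> B * (C * D i u u') + B' * D i u u'"
        using B(1) B'(1) C(2)[OF u] Lip[OF u] by (intro add_mono mult_left_mono) auto
      finally show ?thesis by (simp add: algebra_simps)
    qed
    then show ?case using B(1) B'(1) C(1) by (intro exI[of _ "B * C + B'"]) auto
  qed
  show ?thesis using p
  proof (induction p)
    case Nil then show ?case by (intro exI[of _ 0]) (simp add: pol_Nil avg_def)
  next
    case (Cons a p)
    obtain r t where a: "a = (r, t)" by (cases a)
    have t: "over G t" and p: "pover G p" using Cons.prems a by auto
    obtain C where C: "C \<ge> 0" "\<And>i u u'. u \<in> space (P i) \<Longrightarrow> u' \<in> space (P i) \<Longrightarrow> avg (V i) (\<lambda>v. \<bar>amon X' t i v u - amon X' t i v u'\<bar>) \<le> C * D i u u'"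
      using mon[OF t] by blast
    obtain C' where C': "C' \<ge> 0" "\<And>i u u'. u \<in> space (P i) \<Longrightarrow> u' \<in> space (P i) \<Longrightarrow> avg (V i) (\<lambda>v. \<bar>apol X' p i v u - apol X' p i v u'\<bar>) \<le> C' * D i u u'"
      using Cons.IH[OF p] by blast
    have "avg (V i) (\<lambda>v. \<bar>apol X' (a # p) i v u - apol X' (a # p) i v u'\<bar>) \<le> (\<bar>r\<bar> * C + C') * D i u u'"
      if u: "u \<in> space (P i)" "u' \<in> space (P i)" for i u u'
    proof -
      have "avg (V i) (\<lambda>v. \<bar>apol X' (a # p) i v u - apol X' (a # p) i v u'\<bar>) \<le>
        avg (V i) (\<lambda>v. \<bar>r\<bar> * \<bar>amon X' t i v u - amon X' t i v u'\<bar> + \<bar>apol X' p i v u - apol X' p i v u'\<bar>)"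
      proof (rule avg_mono)
        fix v
        have "r * amon X' t i v u + apol X' p i v u - (r * amon X' t i v u' + apol X' p i v u') =
          r * (amon X' t i v u - amon X' t i v u') + (apol X' p i v u - apol X' p i v u')" by (simp add: algebra_simps)
        then show "\<bar>apol X' (a # p) i v u - apol X' (a # p) i v u'\<bar> \<le> \<bar>r\<bar> * \<bar>amon X' t i v u - amon X' t i v u'\<bar> + \<bar>apol X' p i v u - apol X' p i v u'\<bar>"
          unfolding a apol_Cons abs_mult[symmetric] by simp
      qed
      also have "\<dots> = \<bar>r\<bar> * avg (V i) (\<lambda>v. \<bar>amon X' t i v u - amon X' t i v u'\<bar>) + avg (V i) (\<lambda>v. \<bar>apol X' p i v u - apol X' p i v u'\<bar>)"
        by (simp add: avg_add avg_cmult)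
      also have "\<dots> \<le> \<bar>r\<bar> * (C * D i u u') + C' * D i u u'"
        using C(2)[OF u] C'(2)[OF u] by (intro add_mono mult_left_mono) auto
      finally show ?thesis by (simp add: algebra_simps)
    qed
    then show ?case using C(1) C'(1) by (intro exI[of _ "\<bar>r\<bar> * C + C'"]) auto
  qed
qed

text \<open>The distances of \<open>u\<close> to finitely many net points are close in mean to polynomials in \<open>X'\<close>, and these vary in a Lipschitz way
  with \<open>D\<close>. Markov's inequality confines the error to a set of small measure.\<close>

theorem asymptotically_determined:
  fixes K :: "'b set" and d :: "'b \<Rightarrow> 'b \<Rightarrow> real" and l :: "nat \<Rightarrow> 'b"
  assumes net: "metric_net K d l" and u: "\<And>i v. v \<in> V i \<Longrightarrow> u i v \<in> P i \<rightarrow>\<^sub>M metric_borel K d"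
    and tr_u: "\<And>j. tracks (\<lambda>z. d (\<phi> z) (l j)) (\<lambda>i v z. d (u i v z) (l j))"
    and tr': "\<And>j. tracks (c' j) (X' j)"
    and dense': "\<And>f \<eta>. bdd f \<Longrightarrow> \<eta> > 0 \<Longrightarrow> \<exists>p. pover G p \<and> ldist f (lpol c' p) < \<eta>"
    and Lip: "\<And>j i z z'. z \<in> space (P i) \<Longrightarrow> z' \<in> space (P i) \<Longrightarrow> avg (V i) (\<lambda>v. \<bar>X' j i v z - X' j i v z'\<bar>) \<le> D i z z'"
    and \<epsilon>: "\<epsilon> > 0" and \<delta>: "\<delta> > 0"
  shows "\<exists>\<delta>'>0. \<forall>\<^sub>F i in sequentially. \<exists>Good\<in>sets (P i). measure (P i) Good > 1 - \<epsilon> \<and>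
    (\<forall>z\<in>Good. \<forall>z'\<in>Good. D i z z' < \<delta>' \<longrightarrow> avg (V i) (\<lambda>v. d (u i v z) (u i v z')) < \<delta>)"
proof -
  interpret K: metric_net K d l by (rule net)
  obtain N where N: "\<And>x. x \<in> K \<Longrightarrow> \<exists>n\<le>N. d x (l n) < \<delta> / 8" using K.net[of "\<delta> / 8"] \<delta> by auto
  \<comment> \<open>The \<open>N + 1\<close> errors add up to less than \<open>\<epsilon> * \<delta> / 8\<close>, so their sum exceeds \<open>\<delta> / 8\<close> with probability less than \<open>\<epsilon>\<close>.\<close>
  define \<eta> where "\<eta> = \<epsilon> * \<delta> / (16 * real (Suc N))"
  have \<eta>: "\<eta> > 0" using \<epsilon> \<delta> by (simp add: \<eta>_def)
  have "\<exists>p. pover G p \<and> ldist (\<lambda>z. d (\<phi> z) (l j)) (lpol c' p) < \<eta>" for j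
    by (rule dense'[OF tracks_bdd[OF tr_u] \<eta>])
  then obtain p where p: "\<And>j. pover G (p j)" "\<And>j. ldist (\<lambda>z. d (\<phi> z) (l j)) (lpol c' (p j)) < \<eta>" by metis
  define W where "W j = apol X' (p j)" for j
  have trW: "tracks (lpol c' (p j)) (W j)" for j unfolding W_def by (rule tracks_family_pol[OF tr' p(1)])
  have "\<exists>C\<ge>0. \<forall>i. \<forall>z\<in>space (P i). \<forall>z'\<in>space (P i). avg (V i) (\<lambda>v. \<bar>W j i v z - W j i v z'\<bar>) \<le> C * D i z z'" for j
    unfolding W_def by (rule apol_Lipschitz[OF tracks_arr[OF tr'] Lip p(1)])
  then obtain C where C: "\<And>j. C j \<ge> 0"
    "\<And>j i z z'. z \<in> space (P i) \<Longrightarrow> z' \<in> space (P i) \<Longrightarrow> avg (V i) (\<lambda>v. \<bar>W j i v z - W j i v z'\<bar>) \<le> C j * D i z z'" by metis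
  let ?U = "\<lambda>j i v z. d (u i v z) (l j)"
  define Z where "Z i z = (\<Sum>j\<le>N. avg (V i) (\<lambda>v. \<bar>?U j i v z - W j i v z\<bar>))" for i z
  have A: "arr (\<lambda>i v z. \<bar>?U j i v z - W j i v z\<bar>)" for j by (intro arr_abs arr_diff tracks_arr[OF tr_u] tracks_arr[OF trW])
  have int_Z: "integrable (P i) (Z i)" for i
    unfolding Z_def[abs_def] by (intro Bochner_Integration.integrable_sum avg_integrable arr_integrable[OF A])
  have E_Z: "(\<integral>z. Z i z \<partial>P i) = (\<Sum>j\<le>N. adist (?U j) (W j) i)" for i
    unfolding Z_def adist_def
    by (subst Bochner_Integration.integral_sum) (intro avg_integrable arr_integrable[OF A] | simp add: integral_avg arr_integrable[OF A])+
  have Z_nonneg: "0 \<le> Z i z" for i z unfolding Z_def by (intro sum_nonneg avg_nonneg) simp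
  have "(\<lambda>i. \<integral>z. Z i z \<partial>P i) \<longlonglongrightarrow> (\<Sum>j\<le>N. ldist (\<lambda>z. d (\<phi> z) (l j)) (lpol c' (p j)))"
    unfolding E_Z by (intro tendsto_sum tracks_adist tr_u trW)
  moreover have "(\<Sum>j\<le>N. ldist (\<lambda>z. d (\<phi> z) (l j)) (lpol c' (p j))) < \<epsilon> * \<delta> / 8"
  proof -
    have "(\<Sum>j\<le>N. ldist (\<lambda>z. d (\<phi> z) (l j)) (lpol c' (p j))) \<le> (\<Sum>j\<le>N. \<eta>)" using p(2) by (intro sum_mono less_imp_le)
    also have "\<dots> = \<epsilon> * \<delta> / 16" unfolding \<eta>_def by (simp add: field_simps del: of_nat_Suc)
    also have "\<dots> < \<epsilon> * \<delta> / 8" using \<epsilon> \<delta> by simp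
    finally show ?thesis .
  qed
  ultimately have ev: "\<forall>\<^sub>F i in sequentially. (\<integral>z. Z i z \<partial>P i) < \<epsilon> * \<delta> / 8" by (rule order_tendstoD(2))
  define \<delta>' where "\<delta>' = \<delta> / (4 * ((\<Sum>j\<le>N. C j) + 1))"
  have sumC: "0 \<le> (\<Sum>j\<le>N. C j)" using C(1) by (intro sum_nonneg)
  have \<delta>': "\<delta>' > 0" using \<delta> sumC by (simp add: \<delta>'_def add_nonneg_pos)
  show ?thesis
  proof (intro exI[of _ \<delta>'] conjI \<delta>')
    show "\<forall>\<^sub>F i in sequentially. \<exists>Good\<in>sets (P i). measure (P i) Good > 1 - \<epsilon> \<and>
      (\<forall>z\<in>Good. \<forall>z'\<in>Good. D i z z' < \<delta>' \<longrightarrow> avg (V i) (\<lambda>v. d (u i v z) (u i v z')) < \<delta>)"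
      using ev
    proof eventually_elim
      case (elim i)
      interpret Pi: prob_space "P i" by (rule P)
      have Z_meas[measurable]: "Z i \<in> borel_measurable (P i)" using int_Z[of i] by auto
      define Good where "Good = {z \<in> space (P i). Z i z < \<delta> / 8}"
      have Good: "Good \<in> sets (P i)" unfolding Good_def by measurable
      have "measure (P i) {z \<in> space (P i). \<delta> / 8 \<le> \<bar>Z i z\<bar>} \<le> (\<integral>z. \<bar>Z i z\<bar> \<partial>P i) / (\<delta> / 8)"
        using \<delta> by (intro Markov[OF int_Z]) auto
      also have "\<dots> < \<epsilon>" using elim Z_nonneg \<delta> by (simp add: field_simps)
      also have "{z \<in> space (P i). \<delta> / 8 \<le> \<bar>Z i z\<bar>} = space (P i) - Good" using Z_nonneg by (auto simp: Good_def)
      finally have meas: "measure (P i) Good > 1 - \<epsilon>" using Pi.prob_compl[OF Good] by simp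
      have "avg (V i) (\<lambda>v. d (u i v z) (u i v z')) < \<delta>" if "z \<in> Good" "z' \<in> Good" and D: "D i z z' < \<delta>'" for z z'
      proof -
        have z: "z \<in> space (P i)" "z' \<in> space (P i)" "Z i z < \<delta> / 8" "Z i z' < \<delta> / 8" using that by (auto simp: Good_def)
        have "avg (V i) (\<lambda>v. d (u i v z) (u i v z')) \<le>
          avg (V i) (\<lambda>v. \<delta> / 4 + ((\<Sum>j\<le>N. \<bar>?U j i v z' - W j i v z'\<bar>) + (\<Sum>j\<le>N. \<bar>W j i v z - W j i v z'\<bar>) + (\<Sum>j\<le>N. \<bar>?U j i v z - W j i v z\<bar>)))"
        proof (rule avg_mono)
          fix v assume v: "v \<in> V i"
          have uK: "u i v z \<in> K" "u i v z' \<in> K" using measurable_space[OF u[OF v]] z by auto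
          obtain n where n: "n \<le> N" "d (u i v z) (l n) < \<delta> / 8" using N[OF uK(1)] by blast
          have "d (u i v z) (u i v z') \<le> d (u i v z) (l n) + d (u i v z') (l n)"
            using K.triangle[OF uK(1) K.l uK(2), of n] by (simp add: K.commute)
          also have "\<dots> \<le> \<delta> / 4 + \<bar>?U n i v z' - ?U n i v z\<bar>" using n(2) by linarith
          also have "\<bar>?U n i v z' - ?U n i v z\<bar> \<le> (\<Sum>j\<le>N. \<bar>?U j i v z' - ?U j i v z\<bar>)"
            using n(1) by (intro member_le_sum[of n]) auto
          also have "\<dots> \<le> (\<Sum>j\<le>N. \<bar>?U j i v z' - W j i v z'\<bar> + \<bar>W j i v z - W j i v z'\<bar> + \<bar>?U j i v z - W j i v z\<bar>)"
            by (intro sum_mono) linarith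
          finally show "d (u i v z) (u i v z') \<le> \<delta> / 4 + ((\<Sum>j\<le>N. \<bar>?U j i v z' - W j i v z'\<bar>) + (\<Sum>j\<le>N. \<bar>W j i v z - W j i v z'\<bar>) + (\<Sum>j\<le>N. \<bar>?U j i v z - W j i v z\<bar>))"
            by (simp add: sum.distrib)
        qed
        also have "\<dots> = \<delta> / 4 + (Z i z' + (\<Sum>j\<le>N. avg (V i) (\<lambda>v. \<bar>W j i v z - W j i v z'\<bar>)) + Z i z)"
          unfolding avg_add avg_sum Z_def using V by (simp add: avg_const)
        also have "(\<Sum>j\<le>N. avg (V i) (\<lambda>v. \<bar>W j i v z - W j i v z'\<bar>)) \<le> (\<Sum>j\<le>N. C j * D i z z')"
          by (intro sum_mono C(2) z)
        also have "\<dots> = (\<Sum>j\<le>N. C j) * D i z z'" by (simp add: sum_distrib_right)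
        also have "\<dots> \<le> (\<Sum>j\<le>N. C j) * \<delta>'" using D sumC by (intro mult_left_mono) auto
        also have "\<dots> \<le> \<delta> / 4" using \<delta> sumC unfolding \<delta>'_def by (simp add: field_simps)
        finally show ?thesis using z(3,4) \<delta> by linarith
      qed
      then show ?case using Good meas by blast
    qed
  qed
qed

end

section \<open>Density of polynomials\<close>

context limit_system
begin

lemma bdd_indicator: "A \<in> sets \<Omega> \<Longrightarrow> bdd (indicator A)"
  by (rule bddI[where B = 1]) (auto simp: indicator_def)

text \<open>The sets whose indicators are limits of polynomials form a sigma-algebra containing the null sets.
  It is therefore enough to know that the coordinates generate the measurable sets up to null sets.\<close>

lemma polynomials_dense:
  assumes c: "\<And>j. bdd (c j)"
    and gen: "\<And>N. space N = space \<Omega> \<Longrightarrow> sets N \<subseteq> sets \<Omega> \<Longrightarrow>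
      (\<And>A A'. A \<in> sets N \<Longrightarrow> A' \<in> sets \<Omega> \<Longrightarrow> (AE z in \<Omega>. z \<in> A \<longleftrightarrow> z \<in> A') \<Longrightarrow> A' \<in> sets N) \<Longrightarrow>
      (\<And>j g. g \<in> carrier G \<Longrightarrow> (\<lambda>z. c j (T g z)) \<in> borel_measurable N) \<Longrightarrow> sets \<Omega> \<subseteq> sets N"
    and f: "bdd f" and \<eta>: "\<eta> > 0"
  shows "\<exists>p. pover G p \<and> ldist f (lpol c p) < \<eta>"
proof -
  define Cl where "Cl f \<longleftrightarrow> bdd f \<and> (\<forall>\<eta>>0. \<exists>p. pover G p \<and> ldist f (lpol c p) < \<eta>)" for f
  note pb = bdd_lpol[where c = c, OF c]
  have Cl_limit: "Cl f" if f: "bdd f" and h: "\<And>\<eta>. \<eta> > 0 \<Longrightarrow> \<exists>h. Cl h \<and> ldist f h < \<eta>" for f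
    unfolding Cl_def
  proof (intro conjI f allI impI)
    fix \<eta> :: real assume "\<eta> > 0"
    then have \<eta>: "\<eta> / 2 > 0" by simp
    obtain h where h: "Cl h" "ldist f h < \<eta> / 2" using h[OF \<eta>] by blast
    then obtain p where p: "pover G p" "ldist h (lpol c p) < \<eta> / 2" using \<eta> unfolding Cl_def by blast
    have "ldist f (lpol c p) < \<eta>" using ldist_triangle[OF f _ pb[OF p(1)], of h] h p(2) by (simp add: Cl_def)
    then show "\<exists>p. pover G p \<and> ldist f (lpol c p) < \<eta>" using p(1) by blast
  qed
  have Cl_pol: "Cl (lpol c p)" if "pover G p" for p
    unfolding Cl_def using that pb[OF that] by (auto intro!: exI[of _ p] simp: ldist_def)
  have Cl_const: "Cl (\<lambda>_. r)" for r using Cl_pol[of "[(r, [])]"] by (simp add: lpol_def[abs_def])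
  have Cl_add: "Cl (\<lambda>z. f z + h z)" if fh: "Cl f" "Cl h" for f h
    unfolding Cl_def
  proof (intro conjI allI impI)
    have b: "bdd f" "bdd h" using fh by (auto simp: Cl_def)
    show "bdd (\<lambda>z. f z + h z)" by (intro bdd_add b)
    fix \<eta> :: real assume "\<eta> > 0"
    then have \<eta>: "\<eta> / 2 > 0" by simp
    obtain p where p: "pover G p" "ldist f (lpol c p) < \<eta> / 2" using fh(1) \<eta> unfolding Cl_def by blast
    obtain q where q: "pover G q" "ldist h (lpol c q) < \<eta> / 2" using fh(2) \<eta> unfolding Cl_def by blast
    have pq: "pover G (p @ q)" using p q by auto
    have bb: "bdd (\<lambda>z. \<bar>f z - lpol c p z\<bar>)" "bdd (\<lambda>z. \<bar>h z - lpol c q z\<bar>)"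
      by (intro bdd_abs bdd_diff b pb p q)+
    have "ldist (\<lambda>z. f z + h z) (lpol c (p @ q)) \<le> (\<integral>z. \<bar>f z - lpol c p z\<bar> + \<bar>h z - lpol c q z\<bar> \<partial>\<Omega>)"
    proof (rule ldist_le)
      show "\<bar>f z + h z - lpol c (p @ q) z\<bar> \<le> \<bar>f z - lpol c p z\<bar> + \<bar>h z - lpol c q z\<bar>" for z
        by (simp add: lpol_def pval_append)
    qed (intro bdd_add b bb pb[OF pq])+
    also have "\<dots> = ldist f (lpol c p) + ldist h (lpol c q)"
      using bb[THEN bdd_integrable] by (simp add: ldist_def)
    finally show "\<exists>p. pover G p \<and> ldist (\<lambda>z. f z + h z) (lpol c p) < \<eta>"
      using p(2) q(2) pq by (intro exI[of _ "p @ q"]) simp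
  qed
  have Cl_mult: "Cl (\<lambda>z. f z * h z)" if fh: "Cl f" "Cl h" for f h
    unfolding Cl_def
  proof (intro conjI allI impI)
    have b: "bdd f" "bdd h" using fh by (auto simp: Cl_def)
    show b': "bdd (\<lambda>z. f z * h z)" by (intro bdd_mult b)
    fix \<eta> :: real assume \<eta>: "\<eta> > 0"
    obtain B where B: "0 < B" "\<And>z. z \<in> space \<Omega> \<Longrightarrow> \<bar>f z\<bar> \<le> B" using bdd_bounded[OF b(1)] by blast
    have "\<eta> / (2 * B) > 0" using \<eta> B by simp
    then obtain q where q: "pover G q" "ldist h (lpol c q) < \<eta> / (2 * B)" using fh(2) unfolding Cl_def by blast
    obtain D where D: "0 < D" "\<And>z. z \<in> space \<Omega> \<Longrightarrow> \<bar>lpol c q z\<bar> \<le> D" using bdd_bounded[OF pb[OF q(1)]] by blast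
    have "\<eta> / (2 * D) > 0" using \<eta> D by simp
    then obtain p where p: "pover G p" "ldist f (lpol c p) < \<eta> / (2 * D)" using fh(1) unfolding Cl_def by blast
    have pq: "pover G (pmul p q)" using p(1) q(1) pvars_pmul[of p q] by blast
    have bb: "bdd (\<lambda>z. \<bar>f z - lpol c p z\<bar>)" "bdd (\<lambda>z. \<bar>h z - lpol c q z\<bar>)"
      by (intro bdd_abs bdd_diff b pb p q)+
    have "ldist (\<lambda>z. f z * h z) (lpol c (pmul p q)) \<le> (\<integral>z. B * \<bar>h z - lpol c q z\<bar> + D * \<bar>f z - lpol c p z\<bar> \<partial>\<Omega>)"
    proof (rule ldist_le)
      fix z assume z: "z \<in> space \<Omega>"
      have "\<bar>f z * (h z - lpol c q z)\<bar> \<le> B * \<bar>h z - lpol c q z\<bar>" "\<bar>lpol c q z * (f z - lpol c p z)\<bar> \<le> D * \<bar>f z - lpol c p z\<bar>"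
        unfolding abs_mult using B(2)[OF z] D(2)[OF z] by (auto intro: mult_right_mono)
      moreover have "f z * h z - lpol c (pmul p q) z = f z * (h z - lpol c q z) + lpol c q z * (f z - lpol c p z)"
        by (simp add: lpol_def pval_pmul algebra_simps)
      ultimately show "\<bar>f z * h z - lpol c (pmul p q) z\<bar> \<le> B * \<bar>h z - lpol c q z\<bar> + D * \<bar>f z - lpol c p z\<bar>" by linarith
    qed (intro b' pb[OF pq] bdd_add bdd_cmult bb)+
    also have "\<dots> = B * ldist h (lpol c q) + D * ldist f (lpol c p)"
      using bb[THEN bdd_integrable] by (simp add: ldist_def)
    also have "\<dots> < B * (\<eta> / (2 * B)) + D * (\<eta> / (2 * D))"
      using p(2) q(2) B(1) D(1) by (intro add_strict_mono mult_strict_left_mono)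
    also have "\<dots> = \<eta>" using B(1) D(1) by (simp add: field_simps)
    finally show "\<exists>p. pover G p \<and> ldist (\<lambda>z. f z * h z) (lpol c p) < \<eta>" using pq by blast
  qed
  have Cl_cmult: "Cl (\<lambda>z. r * f z)" if "Cl f" for f r by (rule Cl_mult[OF Cl_const that])
  have Cl_polynomial: "Cl (\<lambda>z. k (h z))" if h: "Cl h" and k: "real_polynomial_function k" for h and k :: "real \<Rightarrow> real"
    using k
  proof (induction k rule: real_polynomial_function.induct)
    case (linear k)
    have "k x = k 1 * x" for x using linear_cmul[OF bounded_linear.linear[OF linear], of x 1] by (simp add: mult.commute)
    then have "(\<lambda>z. k (h z)) = (\<lambda>z. k 1 * h z)" by (rule ext)
    then show ?case using Cl_cmult[OF h] by (simp only:)
  qed (auto intro: Cl_const Cl_add Cl_mult)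
  have Cl_sum: "Cl (\<lambda>z. \<Sum>j\<in>J. f j z)" if "finite J" "\<And>j. j \<in> J \<Longrightarrow> Cl (f j)" for J and f :: "'k \<Rightarrow> 'o \<Rightarrow> real"
    using that by (induction J rule: finite_induct) (auto intro: Cl_const Cl_add)
  have Cl_cong: "Cl h" if "Cl f" "AE z in \<Omega>. h z = f z" "bdd h" for f h
  proof (rule Cl_limit[OF that(3)])
    have "ldist h f = 0" using that by (intro ldist_AE) (auto simp: Cl_def)
    then show "\<exists>k. Cl k \<and> ldist h k < \<eta>" if "\<eta> > 0" for \<eta> using that \<open>Cl f\<close> by auto
  qed
  define \<S> where "\<S> = {A \<in> sets \<Omega>. Cl (indicator A)}"
  have compl: "space \<Omega> - A \<in> \<S>" if "A \<in> \<S>" for A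
  proof -
    have A: "A \<in> sets \<Omega>" "Cl (indicator A)" using that by (auto simp: \<S>_def)
    have "Cl (\<lambda>z. 1 + (-1) * indicator A z)" by (intro Cl_add Cl_const Cl_cmult A)
    then have "Cl (indicator (space \<Omega> - A))"
      by (rule Cl_cong) (use A(1) in \<open>auto intro!: AE_I2 bdd_indicator simp: indicator_def\<close>)
    then show ?thesis using A(1) by (auto simp: \<S>_def)
  qed
  have dy: "Dynkin_system (space \<Omega>) \<S>"
  proof (rule Dynkin_systemI)
    show "A \<subseteq> space \<Omega>" if "A \<in> \<S>" for A using that sets.sets_into_space by (auto simp: \<S>_def)
    show "space \<Omega> \<in> \<S>"
      using Cl_cong[OF Cl_const[of 1], of "indicator (space \<Omega>)"] by (auto simp: \<S>_def intro!: AE_I2 bdd_indicator)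
    show "space \<Omega> - A \<in> \<S>" if "A \<in> \<S>" for A by (rule compl[OF that])
    fix A :: "nat \<Rightarrow> 'o set" assume disj: "disjoint_family A" and A: "range A \<subseteq> \<S>"
    have Am: "A n \<in> sets \<Omega>" "Cl (indicator (A n))" for n using A by (auto simp: \<S>_def)
    have U: "(\<Union>n. A n) \<in> sets \<Omega>" using Am by auto
    have "Cl (indicator (\<Union>n. A n))"
    proof (rule Cl_limit[OF bdd_indicator[OF U]])
      fix \<eta> :: real assume "\<eta> > 0"
      have "(\<lambda>n. (\<Sum>i<n. prob (A i))) \<longlonglongrightarrow> prob (\<Union>n. A n)"
        using finite_measure_UNION[OF _ disj] Am(1) by (auto simp: sums_def)
      then have "(\<lambda>n. prob (\<Union>n. A n) - (\<Sum>i<n. prob (A i))) \<longlonglongrightarrow> 0" using LIM_zero tendsto_diff[OF tendsto_const, of _ "prob (\<Union>n. A n)"] by fastforce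
      then have "\<forall>\<^sub>F n in sequentially. prob (\<Union>n. A n) - (\<Sum>i<n. prob (A i)) < \<eta>"
        by (rule order_tendstoD(2)) fact
      then obtain n where n: "prob (\<Union>n. A n) - (\<Sum>i<n. prob (A i)) < \<eta>"
        unfolding eventually_sequentially by blast
      have C: "Cl (\<lambda>z. \<Sum>i<n. indicator (A i) z)" by (intro Cl_sum Am) simp
      have eq: "(\<Sum>i<n. indicator (A i) z) = (indicator (\<Union>i<n. A i) z :: real)" for z
        by (rule indicator_UN_disjoint[symmetric]) (auto intro: disjoint_family_on_mono[OF subset_UNIV disj])
      have Un: "(\<Union>i<n. A i) \<in> sets \<Omega>" using Am by auto
      have "ldist (indicator (\<Union>n. A n)) (\<lambda>z. \<Sum>i<n. indicator (A i) z) = (\<integral>z. indicator (\<Union>n. A n) z - (\<Sum>i<n. indicator (A i) z) \<partial>\<Omega>)"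
        unfolding ldist_def eq by (intro Bochner_Integration.integral_cong refl) (auto simp: indicator_def)
      also have "\<dots> = prob (\<Union>n. A n) - (\<Sum>i<n. prob (A i))"
        using Am(1) U by (simp add: bdd_integrable[OF bdd_indicator] Bochner_Integration.integral_sum)
      finally show "\<exists>h. Cl h \<and> ldist (indicator (\<Union>n. A n)) h < \<eta>" using C n by auto
    qed
    then show "(\<Union>n. A n) \<in> \<S>" using U by (simp add: \<S>_def)
  qed
  have "Int_stable \<S>"
  proof (rule Int_stableI)
    fix A B assume "A \<in> \<S>" "B \<in> \<S>"
    then have "A \<inter> B \<in> sets \<Omega>" "Cl (\<lambda>z. indicator A z * indicator B z)" by (auto simp: \<S>_def intro: Cl_mult)
    moreover have "indicator (A \<inter> B) = (\<lambda>z. indicator A z * indicator B z :: real)"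
      by (simp add: fun_eq_iff indicator_inter_arith)
    ultimately show "A \<inter> B \<in> \<S>" by (simp add: \<S>_def)
  qed
  then have sa: "sigma_algebra (space \<Omega>) \<S>" using Dynkin_system.sigma_algebra_eq_Int_stable[OF dy] by simp
  define N where "N = sigma (space \<Omega>) \<S>"
  have N: "space N = space \<Omega>" "sets N = \<S>"
    unfolding N_def using sigma_algebra.sigma_sets_eq[OF sa] sigma_algebra.axioms(1)[OF sa]
    by (auto simp: space_measure_of_conv sets_measure_of_conv \<S>_def dest: sets.sets_into_space)
  have coord: "(\<lambda>z. c j (T g z)) \<in> borel_measurable N" if g: "g \<in> carrier G" for j g
  proof (rule borel_measurableI_less)
    fix r :: real
    let ?h = "\<lambda>z. c j (T g z)"
    define q where "q = [(1 :: real, [(g, j)])]"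
    have q: "pover G q" "lpol c q = ?h" using g by (auto simp: q_def lpol_def)
    have hb: "bdd ?h" using bdd_T[OF c g] .
    have [measurable]: "?h \<in> borel_measurable \<Omega>" by (rule bdd_measurable[OF hb])
    have S: "{z \<in> space \<Omega>. ?h z < r} \<in> sets \<Omega>" by measurable
    obtain B where B: "0 < B" "\<And>z. z \<in> space \<Omega> \<Longrightarrow> \<bar>?h z\<bar> \<le> B" using bdd_bounded[OF hb] by blast
    \<comment> \<open>Continuous functions that increase to the indicator of the half-line below \<open>r\<close>.\<close>
    define \<phi> where "\<phi> n x = min 1 (max 0 (real n * (r - x)))" for n x
    have \<phi>_cont: "continuous_on {-B..B} (\<phi> n)" for n unfolding \<phi>_def[abs_def] by (intro continuous_intros)
    have \<phi>b: "bdd (\<lambda>z. \<phi> n (?h z))" for n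
      unfolding \<phi>_def by (rule bddI[where B = 1]) auto
    have "Cl (\<lambda>z. \<phi> n (?h z))" for n
    proof (rule Cl_limit[OF \<phi>b])
      fix \<eta> :: real assume \<eta>: "\<eta> > 0"
      obtain k :: "real \<Rightarrow> real" where k: "real_polynomial_function k" "\<And>x. x \<in> {-B..B} \<Longrightarrow> \<bar>\<phi> n x - k x\<bar> < \<eta> / 2"
        using Stone_Weierstrass_real_polynomial_function[OF compact_Icc \<phi>_cont half_gt_zero[OF \<eta>]] by blast
      have Ck: "Cl (\<lambda>z. k (?h z))" using Cl_polynomial[OF Cl_pol[OF q(1)] k(1)] unfolding q(2) .
      then have bk: "bdd (\<lambda>z. k (?h z))" by (simp add: Cl_def)
      have "ldist (\<lambda>z. \<phi> n (?h z)) (\<lambda>z. k (?h z)) \<le> \<eta> / 2"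
      proof (rule ldist_le_const[OF _ \<phi>b bk])
        fix z assume "z \<in> space \<Omega>"
        then have "?h z \<in> {-B..B}" using B(2)[of z] by (simp add: abs_le_iff)
        then show "\<bar>\<phi> n (?h z) - k (?h z)\<bar> \<le> \<eta> / 2" using k(2)[of "?h z"] by (simp add: less_imp_le)
      qed
      then show "\<exists>h. Cl h \<and> ldist (\<lambda>z. \<phi> n (?h z)) h < \<eta>" using Ck \<eta> by (intro exI[of _ "\<lambda>z. k (?h z)"]) auto
    qed
    moreover have lim: "(\<lambda>n. ldist (indicator {z \<in> space \<Omega>. ?h z < r}) (\<lambda>z. \<phi> n (?h z))) \<longlonglongrightarrow> (\<integral>z. 0 \<partial>\<Omega>)"
      unfolding ldist_def
    proof (rule integral_dominated_convergence[where w = "\<lambda>_. 1"])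
      show "AE z in \<Omega>. (\<lambda>n. \<bar>indicat_real {z \<in> space \<Omega>. ?h z < r} z - \<phi> n (?h z)\<bar>) \<longlonglongrightarrow> 0"
      proof (rule AE_I2)
        fix z assume z: "z \<in> space \<Omega>"
        show "(\<lambda>n. \<bar>indicat_real {z \<in> space \<Omega>. ?h z < r} z - \<phi> n (?h z)\<bar>) \<longlonglongrightarrow> 0"
        proof (cases "?h z < r")
          case True
          obtain n0 where n0: "1 / (r - ?h z) < real n0" using reals_Archimedean2 by blast
          have "\<bar>indicat_real {z \<in> space \<Omega>. ?h z < r} z - \<phi> n (?h z)\<bar> = 0" if "n \<ge> n0" for n
          proof -
            have "1 / (r - ?h z) < real n" using n0 that by linarith
            then have "1 < real n * (r - ?h z)" using True by (simp add: field_simps)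
            then show ?thesis using True z by (simp add: \<phi>_def)
          qed
          then have "\<forall>\<^sub>F n in sequentially. \<bar>indicat_real {z \<in> space \<Omega>. ?h z < r} z - \<phi> n (?h z)\<bar> = 0"
            unfolding eventually_sequentially by blast
          then show ?thesis by (rule tendsto_eventually)
        next
          case False
          then have "\<phi> n (?h z) = 0" for n by (simp add: \<phi>_def mult_nonneg_nonpos)
          then show ?thesis using False by simp
        qed
      qed
      show "AE z in \<Omega>. norm \<bar>indicat_real {z \<in> space \<Omega>. ?h z < r} z - \<phi> n (?h z)\<bar> \<le> 1" for n
        by (rule AE_I2) (auto simp: indicator_def \<phi>_def)
    qed (use S bdd_measurable[OF \<phi>b] in auto)
    ultimately have "Cl (indicator {z \<in> space \<Omega>. ?h z < r})"
    proof (intro Cl_limit[OF bdd_indicator[OF S]])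
      fix \<eta> :: real assume "\<eta> > 0"
      then obtain n where "ldist (indicator {z \<in> space \<Omega>. ?h z < r}) (\<lambda>z. \<phi> n (?h z)) < \<eta>"
        using order_tendstoD(2)[OF lim, of \<eta>] unfolding eventually_sequentially by auto
      then show "\<exists>k. Cl k \<and> ldist (indicator {z \<in> space \<Omega>. ?h z < r}) k < \<eta>"
        using \<open>\<And>n. Cl (\<lambda>z. \<phi> n (?h z))\<close> by blast
    qed
    then show "{z \<in> space N. ?h z < r} \<in> sets N" using S by (simp add: N \<S>_def)
  qed
  have full: "sets \<Omega> \<subseteq> sets N"
  proof (rule gen[OF N(1) _ _ coord])
    show "sets N \<subseteq> sets \<Omega>" by (auto simp: N \<S>_def)
    fix A A' assume A: "A \<in> sets N" "A' \<in> sets \<Omega>" and "AE z in \<Omega>. z \<in> A \<longleftrightarrow> z \<in> A'"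
    then have ae: "AE z in \<Omega>. indicat_real A' z = indicator A z" by (auto simp: indicator_def)
    show "A' \<in> sets N" using Cl_cong[OF _ ae bdd_indicator[OF A(2)]] A by (simp add: N \<S>_def)
  qed
  have "Cl f"
  proof (rule Cl_limit[OF f])
    fix \<eta> :: real assume \<eta>: "\<eta> > 0"
    obtain B where B: "0 < B" "\<And>z. z \<in> space \<Omega> \<Longrightarrow> \<bar>f z\<bar> \<le> B" using bdd_bounded[OF f] by blast
    obtain n where n: "1 / real (Suc n) < \<eta>" using nat_approx_posE[OF \<eta>] by blast
    define a where "a = real (Suc n)"
    have a: "a > 0" by (simp add: a_def)
    define J where "J = {\<lfloor>- (a * B)\<rfloor>..\<lfloor>a * B\<rfloor>}"
    have [measurable]: "f \<in> borel_measurable \<Omega>" by (rule bdd_measurable[OF f])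
    let ?A = "\<lambda>k. {z \<in> space \<Omega>. \<lfloor>a * f z\<rfloor> = k}"
    have A: "?A k \<in> sets \<Omega>" for k by measurable
    define h where "h z = (\<Sum>k\<in>J. (of_int k / a) * indicator (?A k) z)" for z
    have Ch: "Cl h" unfolding h_def[abs_def]
    proof (rule Cl_sum)
      show "finite J" by (simp add: J_def)
      show "Cl (\<lambda>z. (of_int k / a) * indicator (?A k) z)" for k
        using subsetD[OF full A[of k]] by (intro Cl_cmult) (simp add: N \<S>_def)
    qed
    have "\<bar>f z - h z\<bar> \<le> 1 / a" if z: "z \<in> space \<Omega>" for z
    proof -
      have "- B \<le> f z" "f z \<le> B" using B(2)[OF z] by linarith+
      then have "- (a * B) \<le> a * f z" "a * f z \<le> a * B"
        using mult_left_mono[of "- B" "f z" a] mult_left_mono[of "f z" B a] a by simp_all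
      then have J: "\<lfloor>a * f z\<rfloor> \<in> J" unfolding J_def by (auto intro: floor_mono)
      have "h z = (\<Sum>k\<in>J. if k = \<lfloor>a * f z\<rfloor> then of_int k / a else 0)"
        unfolding h_def by (intro sum.cong refl) (use z in \<open>auto simp: indicator_def\<close>)
      also have "\<dots> = of_int \<lfloor>a * f z\<rfloor> / a" using J by (simp add: J_def)
      finally have "f z - h z = (a * f z - of_int \<lfloor>a * f z\<rfloor>) / a" using a by (simp add: field_simps)
      moreover have "\<bar>a * f z - of_int \<lfloor>a * f z\<rfloor>\<bar> \<le> 1" by linarith
      ultimately show ?thesis using a by (simp add: divide_right_mono)
    qed
    then have "ldist f h \<le> 1 / a" using Ch by (intro ldist_le_const f) (auto simp: Cl_def)
    then show "\<exists>h. Cl h \<and> ldist f h < \<eta>" using Ch n by (intro exI[of _ h]) (auto simp: a_def)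
  qed
  then show ?thesis using \<eta> unfolding Cl_def by blast
qed

end

section \<open>Ergodic averages\<close>

text \<open>A function that is almost everywhere below its mean would have a smaller mean, so the function is almost everywhere at
  least its mean.\<close>

lemma (in prob_space) AE_const_of_01:
  fixes f :: "'a \<Rightarrow> real"
  assumes f: "integrable M f" and 01: "prob {x \<in> space M. f x < expectation f} = 0 \<or> prob {x \<in> space M. f x < expectation f} = 1"
  shows "AE x in M. f x = expectation f"
proof -
  have [measurable]: "f \<in> borel_measurable M" using f by auto
  let ?A = "{x \<in> space M. f x < expectation f}"
  have A: "?A \<in> events" by measurable
  have "AE x in M. expectation f \<le> f x"
  proof (rule ccontr)
    assume no: "\<not> (AE x in M. expectation f \<le> f x)"
    have "prob ?A \<noteq> 0"
    proof
      assume "prob ?A = 0"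
      then have "AE x in M. x \<notin> ?A" using A by (intro AE_not_in) (simp add: null_sets_def emeasure_eq_measure)
      then have "AE x in M. expectation f \<le> f x" using AE_space by eventually_elim (auto simp: not_less)
      with no show False by blast
    qed
    then have "prob ?A = 1" using 01 by blast
    then have "AE x in M. x \<in> ?A" using prob_eq_1[OF A] by simp
    then have "AE x in M. f x < expectation f" by auto
    then have "expectation f < expectation (\<lambda>_. expectation f)"
      using f by (intro integral_less_AE_space) (auto simp: emeasure_space_1)
    then show False by (simp add: prob_space)
  qed
  moreover have "expectation (\<lambda>x. f x - expectation f) = 0" using f by (simp add: prob_space)
  ultimately have "AE x in M. f x - expectation f = 0"
    using f by (subst integral_nonneg_eq_0_iff_AE[symmetric]) auto
  then show ?thesis by auto
qed

context limit_system
begin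

text \<open>Midpoints in place of all convex combinations: they are what the parallelogram law requires.\<close>

inductive_set orbit_hull :: "('o \<Rightarrow> real) \<Rightarrow> ('o \<Rightarrow> real) set" for f where
  base: "f \<in> orbit_hull f"
| shift: "h \<in> orbit_hull f \<Longrightarrow> g \<in> carrier G \<Longrightarrow> (\<lambda>x. h (T g x)) \<in> orbit_hull f"
| mid: "h \<in> orbit_hull f \<Longrightarrow> k \<in> orbit_hull f \<Longrightarrow> (\<lambda>x. (h x + k x) / 2) \<in> orbit_hull f"

lemma orbit_hull_bound:
  assumes "h \<in> orbit_hull f" and B: "\<And>x. x \<in> space \<Omega> \<Longrightarrow> \<bar>f x\<bar> \<le> B" and "x \<in> space \<Omega>" shows "\<bar>h x\<bar> \<le> B"
  using assms(1,3)
proof (induction arbitrary: x rule: orbit_hull.induct)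
  case (mid h k)
  have "\<bar>h x\<bar> \<le> B" "\<bar>k x\<bar> \<le> B" using mid by auto
  then have "\<bar>h x + k x\<bar> \<le> 2 * B" by linarith
  then show ?case by simp
qed (auto intro: B T_space)

lemma orbit_hull_bdd: assumes "bdd f" "h \<in> orbit_hull f" shows "bdd h"
  using assms(2)
proof (induction rule: orbit_hull.induct)
  case (mid h k)
  then show ?case using bdd_cmult[OF bdd_add, of h k "1 / 2"] by simp
qed (auto intro: assms bdd_T)

lemma orbit_hull_integral: assumes "bdd f" "h \<in> orbit_hull f" shows "(\<integral>x. h x \<partial>\<Omega>) = (\<integral>x. f x \<partial>\<Omega>)"
  using assms(2)
proof (induction rule: orbit_hull.induct)
  case (shift h g)
  then show ?case using integral_T bdd_measurable orbit_hull_bdd[OF assms(1)] by simp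
next
  case (mid h k)
  then show ?case using bdd_integrable orbit_hull_bdd[OF assms(1)] by simp
qed simp

lemma bdd_square: "bdd f \<Longrightarrow> bdd (\<lambda>x. (f x)\<^sup>2)"
  unfolding power2_eq_square by (intro bdd_mult)

lemma integral_abs_le_sqrt': assumes "bdd f" shows "(\<integral>x. \<bar>f x\<bar> \<partial>\<Omega>) \<le> sqrt (\<integral>x. (f x)\<^sup>2 \<partial>\<Omega>)"
  using bdd_bounded[OF assms] L.integral_abs_le_sqrt[of f] bdd_measurable[OF assms] by metis

text \<open>A form of the mean ergodic theorem. By the parallelogram law, elements of the hull that nearly minimise the \<open>L\<^sup>2\<close> norm are close to
  each other, hence to their translates. A minimising sequence therefore converges to an invariant function, and this is
  the mean by ergodicity.\<close>

lemma orbit_hull_near_constant: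
  assumes erg: "ergodic G \<Omega> T" and f: "bdd f" and \<eta>: "\<eta> > 0"
  shows "\<exists>h\<in>orbit_hull f. ldist h (\<lambda>_. \<integral>x. f x \<partial>\<Omega>) < \<eta>"
proof -
  define q where "q h = (\<integral>x. (h x)\<^sup>2 \<partial>\<Omega>)" for h :: "'o \<Rightarrow> real"
  note hb = orbit_hull_bdd[OF f]
  have q_nonneg: "0 \<le> q h" for h by (simp add: q_def)
  define I where "I = Inf (q ` orbit_hull f)"
  have bb: "bdd_below (q ` orbit_hull f)" using q_nonneg by (intro bdd_belowI[of _ 0]) auto
  have ne: "q ` orbit_hull f \<noteq> {}" using orbit_hull.base by blast
  have I_le: "I \<le> q h" if "h \<in> orbit_hull f" for h unfolding I_def using that bb by (intro cInf_lower) auto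
  have near: "ldist h k \<le> sqrt (4 * e)" if hk: "h \<in> orbit_hull f" "k \<in> orbit_hull f" "q h \<le> I + e" "q k \<le> I + e" for h k e
  proof -
    have b: "bdd h" "bdd k" using hb hk by auto
    have i: "integrable \<Omega> (\<lambda>x. (h x)\<^sup>2)" "integrable \<Omega> (\<lambda>x. (k x)\<^sup>2)" "integrable \<Omega> (\<lambda>x. ((h x + k x) / 2)\<^sup>2)"
      using bdd_square[OF b(1)] bdd_square[OF b(2)] bdd_square[OF hb[OF orbit_hull.mid[OF hk(1,2)]]] by (auto intro: bdd_integrable)
    have "(\<integral>x. (h x - k x)\<^sup>2 \<partial>\<Omega>) = (\<integral>x. 2 * (h x)\<^sup>2 + 2 * (k x)\<^sup>2 - 4 * ((h x + k x) / 2)\<^sup>2 \<partial>\<Omega>)"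
      by (intro Bochner_Integration.integral_cong refl) (simp add: power2_eq_square field_simps)
    also have "\<dots> = 2 * q h + 2 * q k - 4 * q (\<lambda>x. (h x + k x) / 2)"
      unfolding q_def using i by simp
    also have "\<dots> \<le> 4 * e" using hk I_le[OF orbit_hull.mid[OF hk(1,2)]] by simp
    finally have "sqrt (\<integral>x. (h x - k x)\<^sup>2 \<partial>\<Omega>) \<le> sqrt (4 * e)" by (rule real_sqrt_le_mono)
    with integral_abs_le_sqrt'[OF bdd_diff[OF b]] show ?thesis unfolding ldist_def by (rule order_trans)
  qed
  have "\<exists>h\<in>orbit_hull f. q h < I + (1 / 4) ^ n / 4" for n
    using cInf_lessD[OF ne, of "I + (1 / 4) ^ n / 4"] unfolding I_def by auto
  then obtain h where h: "\<And>n. h n \<in> orbit_hull f" "\<And>n. q (h n) < I + (1 / 4) ^ n / 4" by metis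
  note hbd = hb[OF h(1)]
  have [measurable]: "h n \<in> borel_measurable \<Omega>" for n using bdd_measurable[OF hbd] .
  have sq: "sqrt (4 * ((1 / 4) ^ n / 4)) = (1 / 2) ^ n" for n
    by (rule real_sqrt_unique) (simp_all add: power_mult_distrib[symmetric] power2_eq_square)
  have step: "ldist (h (Suc n)) (h n) \<le> (1 / 2) ^ n" for n
  proof -
    have "(1 / 4 :: real) ^ Suc n \<le> (1 / 4) ^ n" by simp
    then have "q (h (Suc n)) \<le> I + (1 / 4) ^ n / 4" using h(2)[of "Suc n"] by linarith
    then show ?thesis using near[OF h(1) h(1) _ less_imp_le[OF h(2)], of "Suc n" n] sq by simp
  qed
  have shift: "ldist (\<lambda>x. h n (T g x)) (h n) \<le> (1 / 2) ^ n" if g: "g \<in> carrier G" for n g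
  proof -
    have "q (\<lambda>x. h n (T g x)) = q (h n)" unfolding q_def using integral_T[OF g, of "\<lambda>x. (h n x)\<^sup>2"] by simp
    then show ?thesis using near[OF orbit_hull.shift[OF h(1) g] h(1) _ less_imp_le[OF h(2)], of n] h(2)[of n] sq by simp
  qed
  obtain B where B: "0 < B" "\<And>x. x \<in> space \<Omega> \<Longrightarrow> \<bar>f x\<bar> \<le> B" using bdd_bounded[OF f] by blast
  have hB: "\<bar>h n x\<bar> \<le> B" if "x \<in> space \<Omega>" for n x by (rule orbit_hull_bound[OF h(1) B(2) that])
  have conv: "AE x in \<Omega>. convergent (\<lambda>n. h n x)"
  proof -
    have "(\<integral>\<^sup>+x. (\<Sum>n. ennreal \<bar>h (Suc n) x - h n x\<bar>) \<partial>\<Omega>) = (\<Sum>n. \<integral>\<^sup>+x. ennreal \<bar>h (Suc n) x - h n x\<bar> \<partial>\<Omega>)"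
      by (rule nn_integral_suminf) measurable
    also have "\<dots> = (\<Sum>n. ennreal (ldist (h (Suc n)) (h n)))"
      unfolding ldist_def using bdd_integrable[OF bdd_abs[OF bdd_diff[OF hbd hbd]]]
      by (intro suminf_cong nn_integral_eq_integral) auto
    also have "\<dots> \<le> (\<Sum>n. ennreal ((1 / 2) ^ n))" using step by (intro suminf_le ennreal_leI) auto
    also have "\<dots> = ennreal (\<Sum>n. (1 / 2) ^ n)" by (intro suminf_ennreal2) (auto intro: summable_geometric)
    also have "\<dots> < \<infinity>" by simp
    finally have "AE x in \<Omega>. (\<Sum>n. ennreal \<bar>h (Suc n) x - h n x\<bar>) \<noteq> \<infinity>"
      by (intro nn_integral_PInf_AE) auto
    then show ?thesis
    proof eventually_elim
      case (elim x)
      then have "summable (\<lambda>n. \<bar>h (Suc n) x - h n x\<bar>)" by (intro summable_suminf_not_top) auto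
      then have "summable (\<lambda>n. h (Suc n) x - h n x)" by (rule summable_rabs_cancel)
      then have "convergent (\<lambda>n. h n x - h 0 x)"
        unfolding summable_iff_convergent sum_lessThan_telescope[of "\<lambda>n. h n x"] .
      from convergent_add[OF this convergent_const[of "h 0 x"]] show ?case by simp
    qed
  qed
  define k where "k x = max (- B) (min B (lim (\<lambda>n. h n x)))" for x
  have [measurable]: "k \<in> borel_measurable \<Omega>" unfolding k_def[abs_def] by measurable
  have kB: "\<bar>k x\<bar> \<le> B" for x using B(1) by (auto simp: k_def)
  have k: "bdd k" using kB by (intro bddI[where B = B]) auto
  have hk: "AE x in \<Omega>. (\<lambda>n. h n x) \<longlonglongrightarrow> k x"
    using conv AE_space
  proof eventually_elim
    case (elim x)
    then have l: "(\<lambda>n. h n x) \<longlonglongrightarrow> lim (\<lambda>n. h n x)" by (simp add: convergent_LIMSEQ_iff)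
    have "lim (\<lambda>n. h n x) \<le> B" "- B \<le> lim (\<lambda>n. h n x)"
      using LIMSEQ_le_const2[OF l] LIMSEQ_le_const[OF l] hB[OF elim(2)] by (auto simp: abs_le_iff minus_le_iff)
    then show ?case using l by (simp add: k_def)
  qed
  have lim: "(\<lambda>n. ldist (h n) k) \<longlonglongrightarrow> 0"
  proof -
    have "(\<lambda>n. ldist (h n) k) \<longlonglongrightarrow> (\<integral>x. 0 \<partial>\<Omega>)"
      unfolding ldist_def
    proof (rule integral_dominated_convergence[where w = "\<lambda>_. 2 * B"])
      show "AE x in \<Omega>. (\<lambda>n. \<bar>h n x - k x\<bar>) \<longlonglongrightarrow> 0"
        using hk by eventually_elim (simp add: LIM_zero tendsto_rabs_zero)
      show "AE x in \<Omega>. norm \<bar>h n x - k x\<bar> \<le> 2 * B" for n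
        using AE_space
      proof eventually_elim
        case (elim x) then show ?case using hB[OF elim, of n] kB[of x] by simp
      qed
    qed auto
    then show ?thesis by simp
  qed
  have inv: "AE x in \<Omega>. k (T g x) = k x" if g: "g \<in> carrier G" for g
  proof -
    have kT: "bdd (\<lambda>x. k (T g x))" by (rule bdd_T[OF k g])
    have "ldist (\<lambda>x. k (T g x)) k \<le> 2 * ldist (h n) k + (1 / 2) ^ n" for n
    proof -
      have "ldist (\<lambda>x. k (T g x)) k \<le> ldist (\<lambda>x. k (T g x)) (\<lambda>x. h n (T g x)) + ldist (\<lambda>x. h n (T g x)) k"
        by (rule ldist_triangle[OF kT bdd_T[OF hbd g] k])
      also have "ldist (\<lambda>x. h n (T g x)) k \<le> ldist (\<lambda>x. h n (T g x)) (h n) + ldist (h n) k"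
        by (rule ldist_triangle[OF bdd_T[OF hbd g] hbd k])
      also have "ldist (\<lambda>x. k (T g x)) (\<lambda>x. h n (T g x)) = ldist (h n) k" using ldist_T[OF k hbd g] by (simp add: ldist_commute)
      finally show ?thesis using shift[OF g, of n] by simp
    qed
    moreover have "(\<lambda>n. 2 * ldist (h n) k + (1 / 2) ^ n) \<longlonglongrightarrow> 2 * 0 + 0"
      by (intro tendsto_intros lim LIMSEQ_power_zero) simp
    ultimately have "ldist (\<lambda>x. k (T g x)) k \<le> 2 * 0 + 0" by (intro LIMSEQ_le_const) auto
    then have "(\<integral>x. \<bar>k (T g x) - k x\<bar> \<partial>\<Omega>) = 0" using ldist_nonneg[of "\<lambda>x. k (T g x)" k] unfolding ldist_def by linarith
    then have "AE x in \<Omega>. \<bar>k (T g x) - k x\<bar> = 0"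
      using bdd_integrable[OF bdd_abs[OF bdd_diff[OF kT k]]] by (subst (asm) integral_nonneg_eq_0_iff_AE) auto
    then show ?thesis by auto
  qed
  define m where "m = expectation k"
  \<comment> \<open>The sublevel sets of \<open>k\<close> are invariant only up to null sets; imposing the inequality along the orbit gives a strictly invariant set.\<close>
  define A where "A = {x \<in> space \<Omega>. \<forall>g\<in>carrier G. k (T g x) < m}"
  have A_sets: "A \<in> sets \<Omega>"
  proof -
    have "A = (\<Inter>g\<in>carrier G. {x \<in> space \<Omega>. k (T g x) < m})"
      using group.is_monoid[OF group] by (auto simp: A_def dest: monoid.one_closed)
    moreover have "{x \<in> space \<Omega>. k (T g x) < m} \<in> sets \<Omega>" if "g \<in> carrier G" for g
      using T_measurable[OF that] by measurable
    moreover have "carrier G \<noteq> {}" using group.is_monoid[OF group] by (auto dest: monoid.one_closed)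
    ultimately show ?thesis
      using sets.countable_INT'[OF countable, of "\<lambda>g. {x \<in> space \<Omega>. k (T g x) < m}" \<Omega>]
      by (simp add: image_subset_iff)
  qed
  have A_inv: "T g -` A \<inter> space \<Omega> = A" if g: "g \<in> carrier G" for g
  proof -
    interpret G: group G by (rule group)
    have "(\<forall>h\<in>carrier G. k (T h (T g x)) < m) \<longleftrightarrow> (\<forall>h\<in>carrier G. k (T h x) < m)" if x: "x \<in> space \<Omega>" for x
    proof
      assume L: "\<forall>h\<in>carrier G. k (T h (T g x)) < m"
      show "\<forall>h\<in>carrier G. k (T h x) < m"
      proof
        fix h assume h: "h \<in> carrier G"
        have "T h x = T (h \<otimes>\<^bsub>G\<^esub> inv\<^bsub>G\<^esub> g) (T g x)"
          using T_mult[of "h \<otimes>\<^bsub>G\<^esub> inv\<^bsub>G\<^esub> g" g x] g h x by (simp add: G.m_assoc)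
        then show "k (T h x) < m" using L g h by simp
      qed
    next
      assume R: "\<forall>h\<in>carrier G. k (T h x) < m"
      show "\<forall>h\<in>carrier G. k (T h (T g x)) < m" using R T_mult[OF _ g x] g by (metis G.m_closed)
    qed
    then show ?thesis using T_space[OF g] by (auto simp: A_def)
  qed
  have "AE x in \<Omega>. \<forall>g\<in>carrier G. k (T g x) = k x" using inv countable by (simp add: AE_ball_countable)
  then have "AE x in \<Omega>. x \<in> A \<longleftrightarrow> x \<in> {x \<in> space \<Omega>. k x < m}"
    using AE_space
  proof eventually_elim
    case (elim x) then show ?case using group.is_monoid[OF group] by (auto simp: A_def dest: monoid.one_closed)
  qed
  then have "prob A = prob {x \<in> space \<Omega>. k x < m}" by (intro measure_eq_AE A_sets) auto
  moreover have "prob A = 0 \<or> prob A = 1" using erg A_sets A_inv unfolding ergodic_def by blast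
  ultimately have "AE x in \<Omega>. k x = m"
    using AE_const_of_01[OF bdd_integrable[OF k]] unfolding m_def by simp
  then have km: "ldist k (\<lambda>_. m) = 0" by (intro ldist_AE k bdd_const)
  have "m = (\<integral>x. f x \<partial>\<Omega>)"
  proof -
    have "\<bar>(\<integral>x. f x \<partial>\<Omega>) - m\<bar> \<le> ldist (h n) k" for n
      using integral_ldist[OF hbd k, of n] orbit_hull_integral[OF f h(1), of n] by (simp add: m_def)
    then have "\<bar>(\<integral>x. f x \<partial>\<Omega>) - m\<bar> \<le> 0" by (intro LIMSEQ_le_const[OF lim]) auto
    then show ?thesis by simp
  qed
  moreover obtain n where "ldist (h n) k < \<eta>"
    using order_tendstoD(2)[OF lim \<eta>] unfolding eventually_sequentially by blast
  ultimately have "ldist (h n) (\<lambda>_. \<integral>x. f x \<partial>\<Omega>) < \<eta>"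
    using ldist_triangle[OF hbd k bdd_const, of n m] km by simp
  then show ?thesis using h(1) by blast
qed

end

text \<open>Vertex averages are invariant under the permutations. The averages of \<open>F\<close> are therefore also the averages of an array that tracks an element
  of the hull of \<open>f\<close>, and by ergodicity this element may be taken close to a constant.\<close>

lemma (in tracking) ergodic_mean_conv:
  assumes erg: "ergodic G \<Omega> T" and tr: "tracks f F" shows "mean_conv F (\<integral>x. f x \<partial>\<Omega>)"
proof -
  have lift: "\<exists>H. tracks h H \<and> (\<forall>i x. avg (V i) (\<lambda>v. H i v x) = avg (V i) (\<lambda>v. F i v x))" if "h \<in> orbit_hull f" for h
    using that
  proof (induction rule: orbit_hull.induct)
    case base then show ?case using tr by blast
  next
    case (shift h g)
    then obtain H where H: "tracks h H" "\<And>i x. avg (V i) (\<lambda>v. H i v x) = avg (V i) (\<lambda>v. F i v x)" by blast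
    have "avg (V i) (\<lambda>v. H i (\<sigma> i g v) x) = avg (V i) (\<lambda>v. F i v x)" for i x
      using avg_reindex[OF \<sigma>_bij[OF shift.hyps(2)], where f = "\<lambda>v. H i v x"] H(2) by simp
    then show ?case using tracks_shift[OF H(1) shift.hyps(2)] by blast
  next
    case (mid h k)
    then obtain H H' where H: "tracks h H" "\<And>i x. avg (V i) (\<lambda>v. H i v x) = avg (V i) (\<lambda>v. F i v x)"
      "tracks k H'" "\<And>i x. avg (V i) (\<lambda>v. H' i v x) = avg (V i) (\<lambda>v. F i v x)" by blast
    have "tracks (\<lambda>x. (1 / 2) * (h x + k x)) (\<lambda>i v x. (1 / 2) * (H i v x + H' i v x))" by (intro tracks_cmult tracks_add H)
    moreover have "avg (V i) (\<lambda>v. (1 / 2) * (H i v x + H' i v x)) = avg (V i) (\<lambda>v. F i v x)" for i x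
      unfolding avg_cmult avg_add H(2,4) by simp
    ultimately show ?case by (intro exI[of _ "\<lambda>i v x. (1 / 2) * (H i v x + H' i v x)"]) simp
  qed
  let ?r = "\<integral>x. f x \<partial>\<Omega>"
  show ?thesis unfolding mean_conv_def
  proof (rule tendsto_0_eps)
    fix e :: real assume "e > 0"
    then obtain h where h: "h \<in> orbit_hull f" "ldist h (\<lambda>_. ?r) < e" using orbit_hull_near_constant[OF erg tracks_bdd[OF tr]] by blast
    obtain H where H: "tracks h H" "\<And>i x. avg (V i) (\<lambda>v. H i v x) = avg (V i) (\<lambda>v. F i v x)" using lift[OF h(1)] by blast
    have d: "arr (\<lambda>i v x. \<bar>H i v x - ?r\<bar>)" by (intro arr_abs arr_diff arr_const tracks_arr[OF H(1)])
    have "\<forall>\<^sub>F i in sequentially. adist H (\<lambda>_ _ _. ?r) i < e"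
      by (rule order_tendstoD(2)[OF tracks_adist[OF H(1) tracks_const] h(2)])
    then show "\<forall>\<^sub>F i in sequentially. (\<integral>x. \<bar>avg (V i) (\<lambda>v. F i v x) - ?r\<bar> \<partial>P i) < e"
    proof eventually_elim
      case (elim i)
      have "(\<integral>x. \<bar>avg (V i) (\<lambda>v. F i v x) - ?r\<bar> \<partial>P i) \<le> (\<integral>x. avg (V i) (\<lambda>v. \<bar>H i v x - ?r\<bar>) \<partial>P i)"
      proof (rule integral_mono)
        have "integrable (P i) (\<lambda>x. avg (V i) (\<lambda>v. F i v x - ?r))"
          by (intro avg_integrable arr_integrable[of "\<lambda>i v x. F i v x - ?r"] arr_diff arr_const tracks_arr[OF tr])
        then show "integrable (P i) (\<lambda>x. \<bar>avg (V i) (\<lambda>v. F i v x) - ?r\<bar>)" using V by (simp add: avg_diff avg_const)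
        show "integrable (P i) (\<lambda>x. avg (V i) (\<lambda>v. \<bar>H i v x - ?r\<bar>))" by (intro avg_integrable arr_integrable[OF d])
        show "\<bar>avg (V i) (\<lambda>v. F i v x) - ?r\<bar> \<le> avg (V i) (\<lambda>v. \<bar>H i v x - ?r\<bar>)" for x
          using avg_abs[of "V i" "\<lambda>v. H i v x - ?r"] V H(2) by (simp add: avg_diff avg_const)
      qed
      also have "\<dots> = adist H (\<lambda>_ _ _. ?r) i" unfolding adist_def by (intro integral_avg arr_integrable[OF d])
      finally show ?case using elim by simp
    qed
  qed simp
qed

section \<open>Covering numbers\<close>

definition covers :: "real \<Rightarrow> real \<Rightarrow> 'b set \<Rightarrow> ('b \<Rightarrow> 'b \<Rightarrow> real) \<Rightarrow> 'b measure \<Rightarrow> 'b set \<Rightarrow> bool" where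
  "covers \<epsilon> \<delta> Y d \<nu> F \<longleftrightarrow> F \<subseteq> Y \<and> finite F \<and> measure \<nu> {y \<in> Y. \<exists>x\<in>F. d x y < \<delta>} > 1 - \<epsilon>"

lemma cov_le: "covers \<epsilon> \<delta> Y d \<nu> F \<Longrightarrow> cov \<epsilon> \<delta> Y d \<nu> \<le> card F"
  unfolding cov_def covers_def by (rule Least_le) auto

lemma cov_attained:
  assumes "covers \<epsilon> \<delta> Y d \<nu> F0" obtains F where "covers \<epsilon> \<delta> Y d \<nu> F" "card F = cov \<epsilon> \<delta> Y d \<nu>"
proof -
  have "\<exists>k F. F \<subseteq> Y \<and> finite F \<and> card F = k \<and> measure \<nu> {y \<in> Y. \<exists>x\<in>F. d x y < \<delta>} > 1 - \<epsilon>"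
    using assms unfolding covers_def by blast
  from LeastI_ex[OF this] show ?thesis using that unfolding cov_def covers_def by blast
qed

lemma continuous_map_distance:
  assumes M: "Metric_space K d" and a: "a \<in> K"
  shows "continuous_map (Metric_space.mtopology K d) euclideanreal (d a)"
proof -
  interpret Metric_space K d by fact
  have "continuous_map mtopology Met_TC.mtopology (d a)"
    unfolding Met_TC.continuous_map_to_metric
  proof (intro ballI allI impI)
    fix x and \<epsilon> :: real assume x: "x \<in> topspace mtopology" and "0 < \<epsilon>"
    have "\<bar>d a x - d a y\<bar> \<le> d x y" if "y \<in> K" for y
      using triangle[of a x y] triangle[of a y x] a x that by (simp add: commute abs_le_iff)
    then show "\<exists>U. openin mtopology U \<and> x \<in> U \<and> (\<forall>y\<in>U. d a y \<in> Met_TC.mball (d a x) \<epsilon>)"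
      using x \<open>0 < \<epsilon>\<close> by (intro exI[of _ "mball x \<epsilon>"]) (fastforce simp: in_mball dist_real_def)
  qed
  then show ?thesis by simp
qed

lemma (in coordinates) continuous_measurable_state:
  assumes f: "continuous_map (Metric_space.mtopology K d) euclideanreal f" shows "f \<in> borel_measurable (metric_borel K d)"
proof (rule borel_measurableI)
  fix S :: "real set" assume "open S"
  then have "openin (Metric_space.mtopology K d) {x \<in> K. f x \<in> S}"
    using f by (simp add: continuous_map_def)
  moreover have "f -` S \<inter> space (metric_borel K d) = {x \<in> K. f x \<in> S}" by auto
  ultimately show "f -` S \<inter> space (metric_borel K d) \<in> sets (metric_borel K d)"
    by (auto simp: sets_metric_borel)
qed

lemma avg_metric_avg: "avg_metric V d x y = avg V (\<lambda>v. d (x v) (y v))"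
  by (simp add: avg_metric_def avg_def)

context metric_net
begin

abbreviation conf where "conf V \<equiv> PiE V (\<lambda>_. K)"

lemma avg_metric_commute: "avg_metric V d x y = avg_metric V d y x"
  by (simp add: avg_metric_def commute)

lemma avg_metric_triangle:
  assumes "x \<in> conf V" "y \<in> conf V" "z \<in> conf V" shows "avg_metric V d x z \<le> avg_metric V d x y + avg_metric V d y z"
  unfolding avg_metric_avg avg_add[symmetric] using assms by (intro avg_mono triangle) auto

lemma avg_metric_measurable:
  assumes "x \<in> conf V" shows "avg_metric V d x \<in> borel_measurable (config V K d)"
  unfolding avg_metric_avg[abs_def]
proof (rule avg_measurable)
  fix v assume v: "v \<in> V"
  have "d (x v) \<in> borel_measurable (metric_borel K d)"
    using assms v by (intro continuous_measurable_state continuous_map_distance metric) auto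
  then show "(\<lambda>y. d (x v) (y v)) \<in> borel_measurable (config V K d)"
    by (rule measurable_compose[OF measurable_component_singleton[OF v]])
qed

lemma ball_measurable:
  assumes "F \<subseteq> conf V" "finite F" shows "{y \<in> conf V. \<exists>x\<in>F. avg_metric V d x y < \<delta>} \<in> sets (config V K d)"
proof -
  have "{y \<in> conf V. avg_metric V d x y < \<delta>} \<in> sets (config V K d)" if "x \<in> F" for x
  proof -
    have [measurable]: "avg_metric V d x \<in> borel_measurable (config V K d)" using assms that by (intro avg_metric_measurable) auto
    have "{y \<in> space (config V K d). avg_metric V d x y < \<delta>} \<in> sets (config V K d)" by measurable
    then show ?thesis by (simp add: space_config)
  qed
  then have "(\<Union>x\<in>F. {y \<in> conf V. avg_metric V d x y < \<delta>}) \<in> sets (config V K d)" using assms(2) by auto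
  also have "(\<Union>x\<in>F. {y \<in> conf V. avg_metric V d x y < \<delta>}) = {y \<in> conf V. \<exists>x\<in>F. avg_metric V d x y < \<delta>}" by auto
  finally show ?thesis .
qed

lemma covers_exists:
  assumes V: "finite V" "V \<noteq> {}" and m: "m \<in> space (prob_algebra (config V K d))" and "\<epsilon> > 0" "\<delta> > 0"
  shows "\<exists>F. covers \<epsilon> \<delta> (conf V) (avg_metric V d) m F"
proof -
  obtain N where N: "\<And>x. x \<in> K \<Longrightarrow> \<exists>n\<le>N. d x (l n) < \<delta> / 2" using net[of "\<delta> / 2"] \<open>\<delta> > 0\<close> by auto
  define F where "F = PiE V (\<lambda>_. l ` {..N})"
  have "\<exists>x\<in>F. avg_metric V d x y < \<delta>" if y: "y \<in> conf V" for y
  proof -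
    have "\<exists>n\<le>N. d (y v) (l n) < \<delta> / 2" if "v \<in> V" for v using N y that by auto
    then obtain \<nu> where \<nu>: "\<And>v. v \<in> V \<Longrightarrow> \<nu> v \<le> N \<and> d (y v) (l (\<nu> v)) < \<delta> / 2" by metis
    have "avg_metric V d (\<lambda>v\<in>V. l (\<nu> v)) y \<le> \<delta> / 2"
      unfolding avg_metric_avg using \<nu> by (intro avg_le_const V) (simp add: commute less_imp_le)
    moreover have "(\<lambda>v\<in>V. l (\<nu> v)) \<in> F" using \<nu> by (auto simp: F_def)
    ultimately show ?thesis using \<open>\<delta> > 0\<close> by (intro bexI[of _ "\<lambda>v\<in>V. l (\<nu> v)"]) auto
  qed
  then have "{y \<in> conf V. \<exists>x\<in>F. avg_metric V d x y < \<delta>} = conf V" by blast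
  moreover have "measure m (conf V) = 1"
    using prob_space_square[OF m] prob_space.prob_space[of m] by (simp add: space_config)
  moreover have "F \<subseteq> conf V" unfolding F_def by (rule PiE_mono) (use l in auto)
  moreover have "finite F" unfolding F_def using V(1) by (simp add: finite_PiE)
  ultimately have "covers \<epsilon> \<delta> (conf V) (avg_metric V d) m F"
    unfolding covers_def using \<open>\<epsilon> > 0\<close> by simp
  then show ?thesis by blast
qed

lemma cov_pos:
  assumes V: "finite V" "V \<noteq> {}" and m: "m \<in> space (prob_algebra (config V K d))" and "\<epsilon> > 0" "\<epsilon> \<le> 1" "\<delta> > 0"
  shows "cov \<epsilon> \<delta> (conf V) (avg_metric V d) m \<ge> 1"
proof -
  obtain F where F: "covers \<epsilon> \<delta> (conf V) (avg_metric V d) m F" "card F = cov \<epsilon> \<delta> (conf V) (avg_metric V d) m"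
    using covers_exists[OF V m assms(4,6)] cov_attained by blast
  have "F \<noteq> {}" using F(1) assms(5) by (auto simp: covers_def)
  then show ?thesis using F by (metis One_nat_def Suc_leI card_gt_0_iff covers_def)
qed

lemma cov_antimono:
  assumes V: "finite V" "V \<noteq> {}" and m: "m \<in> space (prob_algebra (config V K d))" and "\<epsilon> > 0" "\<epsilon> \<le> \<epsilon>'" "\<delta> > 0" "\<delta> \<le> \<delta>'"
  shows "cov \<epsilon>' \<delta>' (conf V) (avg_metric V d) m \<le> cov \<epsilon> \<delta> (conf V) (avg_metric V d) m"
proof -
  interpret m: prob_space m using prob_space_square[OF m] by simp
  obtain F where F: "covers \<epsilon> \<delta> (conf V) (avg_metric V d) m F" "card F = cov \<epsilon> \<delta> (conf V) (avg_metric V d) m"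
    using covers_exists[OF V m assms(4,6)] cov_attained by blast
  have "measure m {y \<in> conf V. \<exists>x\<in>F. avg_metric V d x y < \<delta>} \<le> measure m {y \<in> conf V. \<exists>x\<in>F. avg_metric V d x y < \<delta>'}"
    using F(1) ball_measurable prob_space_square(2)[OF m] \<open>\<delta> \<le> \<delta>'\<close>
    by (intro m.finite_measure_mono) (auto simp: covers_def intro: less_le_trans)
  then have "covers \<epsilon>' \<delta>' (conf V) (avg_metric V d) m F" using F(1) \<open>\<epsilon> \<le> \<epsilon>'\<close> by (auto simp: covers_def)
  from cov_le[OF this] show ?thesis using F(2) by simp
qed

end

lemma distr_config:
  assumes "prob_space P" "X \<in> P \<rightarrow>\<^sub>M N" shows "distr P N X \<in> space (prob_algebra N)"
  using prob_space.prob_space_distr[OF assms] by (simp add: space_prob_algebra)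

text \<open>A representative is chosen for each pair of balls that meets the good set. Two good points of the same pair of balls are closer than
  \<open>\<delta>' / 2\<close> in either coordinate, and the exceptional sets of the two covers and of the determination add up
  to \<open>3 * \<epsilon>\<close>.\<close>

lemma cov_determined:
  fixes P :: "'w measure"
  assumes n1: "metric_net K1 d1 l1" and n2: "metric_net K2 d2 l2" and n3: "metric_net K3 d3 l3"
    and V: "finite V" "V \<noteq> {}" and P: "prob_space P"
    and X: "X \<in> P \<rightarrow>\<^sub>M config V K1 d1" and Y: "Y \<in> P \<rightarrow>\<^sub>M config V K2 d2" and Z: "Z \<in> P \<rightarrow>\<^sub>M config V K3 d3"
    and Good: "Good \<in> sets P" "measure P Good > 1 - \<epsilon>"
    and det: "\<And>z z'. z \<in> Good \<Longrightarrow> z' \<in> Good \<Longrightarrow>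
      avg_metric V d1 (X z) (X z') + avg_metric V d2 (Y z) (Y z') < \<delta>' \<Longrightarrow> avg_metric V d3 (Z z) (Z z') < \<delta>"
    and \<epsilon>: "\<epsilon> > 0" and \<delta>': "\<delta>' > 0"
  shows "cov (3 * \<epsilon>) \<delta> (PiE V (\<lambda>_. K3)) (avg_metric V d3) (distr P (config V K3 d3) Z) \<le>
    cov \<epsilon> (\<delta>' / 4) (PiE V (\<lambda>_. K1)) (avg_metric V d1) (distr P (config V K1 d1) X) *
    cov \<epsilon> (\<delta>' / 4) (PiE V (\<lambda>_. K2)) (avg_metric V d2) (distr P (config V K2 d2) Y)"
proof -
  interpret n1: metric_net K1 d1 l1 by fact
  interpret n2: metric_net K2 d2 l2 by fact
  interpret n3: metric_net K3 d3 l3 by fact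
  interpret P: prob_space P by fact
  let ?m1 = "distr P (config V K1 d1) X" and ?m2 = "distr P (config V K2 d2) Y" and ?m3 = "distr P (config V K3 d3) Z"
  have \<delta>4: "\<delta>' / 4 > 0" using \<delta>' by simp
  obtain F1 where F1: "covers \<epsilon> (\<delta>' / 4) (n1.conf V) (avg_metric V d1) ?m1 F1" "card F1 = cov \<epsilon> (\<delta>' / 4) (n1.conf V) (avg_metric V d1) ?m1"
    using n1.covers_exists[OF V distr_config[OF P X] \<epsilon> \<delta>4] cov_attained by blast
  obtain F2 where F2: "covers \<epsilon> (\<delta>' / 4) (n2.conf V) (avg_metric V d2) ?m2 F2" "card F2 = cov \<epsilon> (\<delta>' / 4) (n2.conf V) (avg_metric V d2) ?m2"
    using n2.covers_exists[OF V distr_config[OF P Y] \<epsilon> \<delta>4] cov_attained by blast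
  define S where "S = (\<lambda>(p, q). {z \<in> Good. avg_metric V d1 p (X z) < \<delta>' / 4 \<and> avg_metric V d2 q (Y z) < \<delta>' / 4})"
  define rep where "rep pq = (SOME z. z \<in> S pq)" for pq
  define I where "I = {pq \<in> F1 \<times> F2. S pq \<noteq> {}}"
  have rep: "rep pq \<in> S pq" if "pq \<in> I" for pq using that unfolding rep_def I_def by (auto intro: someI_ex)
  have sp: "z \<in> Good \<Longrightarrow> z \<in> space P" for z using Good(1) sets.sets_into_space by blast
  have Xs: "X z \<in> n1.conf V" and Ys: "Y z \<in> n2.conf V" and Zs: "Z z \<in> n3.conf V" if "z \<in> space P" for z
    using measurable_space[OF X that] measurable_space[OF Y that] measurable_space[OF Z that]
    by (simp_all add: n1.space_config n2.space_config n3.space_config)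
  define F where "F = (\<lambda>pq. Z (rep pq)) ` I"
  have fin: "finite (F1 \<times> F2)" "finite I" using F1(1) F2(1) by (auto simp: covers_def I_def)
  have "card F \<le> card I" unfolding F_def by (rule card_image_le[OF fin(2)])
  also have "\<dots> \<le> card (F1 \<times> F2)" by (rule card_mono[OF fin(1)]) (auto simp: I_def)
  finally have cardF: "card F \<le> card F1 * card F2" by (simp add: card_cartesian_product)
  define A1 where "A1 = {x \<in> n1.conf V. \<exists>p\<in>F1. avg_metric V d1 p x < \<delta>' / 4}"
  define A2 where "A2 = {x \<in> n2.conf V. \<exists>p\<in>F2. avg_metric V d2 p x < \<delta>' / 4}"
  define A3 where "A3 = {x \<in> n3.conf V. \<exists>p\<in>F. avg_metric V d3 p x < \<delta>}"
  have "Z (rep pq) \<in> n3.conf V" if "pq \<in> I" for pq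
    by (intro Zs sp) (use rep[OF that] in \<open>simp add: S_def split: prod.splits\<close>)
  then have FZ: "F \<subseteq> n3.conf V" "finite F" using fin unfolding F_def by blast+
  have As: "A1 \<in> sets (config V K1 d1)" "A2 \<in> sets (config V K2 d2)" "A3 \<in> sets (config V K3 d3)"
    using F1(1) F2(1) FZ n1.ball_measurable[of F1 V] n2.ball_measurable[of F2 V] n3.ball_measurable[of F V]
    unfolding A1_def A2_def A3_def covers_def by blast+
  let ?B1 = "X -` A1 \<inter> space P" and ?B2 = "Y -` A2 \<inter> space P" and ?B3 = "Z -` A3 \<inter> space P"
  have Bs: "?B1 \<in> sets P" "?B2 \<in> sets P" "?B3 \<in> sets P"
    using measurable_sets[OF X As(1)] measurable_sets[OF Y As(2)] measurable_sets[OF Z As(3)] .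
  have m: "P.prob ?B1 > 1 - \<epsilon>" "P.prob ?B2 > 1 - \<epsilon>"
    using F1(1) F2(1) measure_distr[OF X As(1)] measure_distr[OF Y As(2)] by (auto simp: covers_def A1_def A2_def)
  have "Good \<inter> ?B1 \<inter> ?B2 \<subseteq> ?B3"
  proof
    fix z assume z: "z \<in> Good \<inter> ?B1 \<inter> ?B2"
    then obtain p q where pq: "p \<in> F1" "avg_metric V d1 p (X z) < \<delta>' / 4" "q \<in> F2" "avg_metric V d2 q (Y z) < \<delta>' / 4"
      by (auto simp: A1_def A2_def)
    then have "z \<in> S (p, q)" using z by (simp add: S_def)
    then have I: "(p, q) \<in> I" using pq by (auto simp: I_def)
    let ?z = "rep (p, q)"
    have r: "?z \<in> Good" "avg_metric V d1 p (X ?z) < \<delta>' / 4" "avg_metric V d2 q (Y ?z) < \<delta>' / 4"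
      using rep[OF I] by (auto simp: S_def)
    have pqs: "p \<in> n1.conf V" "q \<in> n2.conf V" using pq F1(1) F2(1) by (auto simp: covers_def)
    have "avg_metric V d1 (X ?z) (X z) < \<delta>' / 2"
      using n1.avg_metric_triangle[OF Xs[OF sp[OF r(1)]] pqs(1) Xs[of z]] z r(2) pq(2) n1.avg_metric_commute[of V p "X ?z"] by simp
    moreover have "avg_metric V d2 (Y ?z) (Y z) < \<delta>' / 2"
      using n2.avg_metric_triangle[OF Ys[OF sp[OF r(1)]] pqs(2) Ys[of z]] z r(3) pq(4) n2.avg_metric_commute[of V q "Y ?z"] by simp
    ultimately have "avg_metric V d3 (Z ?z) (Z z) < \<delta>" using z r(1) by (intro det) auto
    then show "z \<in> ?B3" using z I Zs[of z] by (auto simp: A3_def F_def)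
  qed
  then have "space P - ?B3 \<subseteq> (space P - Good) \<union> (space P - ?B1) \<union> (space P - ?B2)" by blast
  then have "P.prob (space P - ?B3) \<le> P.prob ((space P - Good) \<union> (space P - ?B1) \<union> (space P - ?B2))"
    using Bs Good by (intro P.finite_measure_mono) auto
  also have "\<dots> \<le> P.prob ((space P - Good) \<union> (space P - ?B1)) + P.prob (space P - ?B2)"
    using Bs Good by (intro measure_Un_le) auto
  also have "P.prob ((space P - Good) \<union> (space P - ?B1)) \<le> P.prob (space P - Good) + P.prob (space P - ?B1)"
    using Bs Good by (intro measure_Un_le) auto
  finally have "P.prob ?B3 > 1 - 3 * \<epsilon>"
    using P.prob_compl[OF Bs(1)] P.prob_compl[OF Bs(2)] P.prob_compl[OF Bs(3)] P.prob_compl[OF Good(1)] m Good(2) by linarith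
  then have "covers (3 * \<epsilon>) \<delta> (n3.conf V) (avg_metric V d3) ?m3 F"
    using FZ measure_distr[OF Z As(3)] by (simp add: covers_def A3_def)
  from cov_le[OF this] cardF show ?thesis unfolding F1(2) F2(2) by (rule order_trans)
qed

text \<open>By Markov's inequality the fibre of the covered set has measure above \<open>1 - \<alpha>\<close> over a set of first coordinates of measure above
  \<open>1 - \<alpha>\<close>. Each of these first coordinates sees in \<open>F\<close> a cover of the second factor, and the covers seen by
  points at distance at least \<open>2 * \<delta>\<close> are disjoint. A maximal separated set of such points covers the first factor.\<close>

lemma cov_product_lower:
  assumes n1: "metric_net K1 d1 l1" and n2: "metric_net K2 d2 l2" and V: "finite V" "V \<noteq> {}"
    and m1: "m1 \<in> space (prob_algebra (config V K1 d1))" and m2: "m2 \<in> space (prob_algebra (config V K2 d2))"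
    and F: "finite F" "F \<subseteq> PiE V (\<lambda>_. K1) \<times> PiE V (\<lambda>_. K2)"
    and \<alpha>: "0 < \<alpha>" "\<alpha> \<le> 1" and \<delta>: "\<delta> > 0"
    and S: "measure (m1 \<Otimes>\<^sub>M m2) {z \<in> space (m1 \<Otimes>\<^sub>M m2). \<exists>p\<in>F. avg_metric V d1 (fst p) (fst z) < \<delta> \<and> avg_metric V d2 (snd p) (snd z) < \<delta>} > 1 - \<alpha>\<^sup>2"
  shows "cov \<alpha> (2 * \<delta>) (PiE V (\<lambda>_. K1)) (avg_metric V d1) m1 * cov \<alpha> \<delta> (PiE V (\<lambda>_. K2)) (avg_metric V d2) m2 \<le> card F"
proof -
  interpret n1: metric_net K1 d1 l1 by fact
  interpret n2: metric_net K2 d2 l2 by fact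
  note p1 = prob_space_square[OF m1] and p2 = prob_space_square[OF m2]
  interpret m1: prob_space m1 by (rule p1)
  interpret m2: prob_space m2 by (rule p2)
  interpret pair_prob_space m1 m2 ..
  let ?D1 = "avg_metric V d1" and ?D2 = "avg_metric V d2" and ?Y1 = "n1.conf V" and ?Y2 = "n2.conf V"
  have sp: "space m1 = ?Y1" "space m2 = ?Y2" using p1(3) p2(3) by (simp_all add: n1.space_config n2.space_config)
  have FY: "fst p \<in> ?Y1" "snd p \<in> ?Y2" if "p \<in> F" for p
    using subsetD[OF F(2) that] by (simp_all add: mem_Times_iff)
  define S where "S = {z \<in> space (m1 \<Otimes>\<^sub>M m2). \<exists>p\<in>F. ?D1 (fst p) (fst z) < \<delta> \<and> ?D2 (snd p) (snd z) < \<delta>}"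
  have meas1: "?D1 x \<in> borel_measurable m1" if "x \<in> ?Y1" for x
    using n1.avg_metric_measurable[OF that] measurable_cong_sets[OF p1(2) refl] by blast
  have meas2: "?D2 x \<in> borel_measurable m2" if "x \<in> ?Y2" for x
    using n2.avg_metric_measurable[OF that] measurable_cong_sets[OF p2(2) refl] by blast
  have S_sets: "S \<in> sets (m1 \<Otimes>\<^sub>M m2)"
  proof -
    have "{z \<in> space (m1 \<Otimes>\<^sub>M m2). ?D1 (fst p) (fst z) < \<delta> \<and> ?D2 (snd p) (snd z) < \<delta>} \<in> sets (m1 \<Otimes>\<^sub>M m2)" if "p \<in> F" for p
    proof -
      have p: "fst p \<in> ?Y1" "snd p \<in> ?Y2" using FY[OF that] .
      note [measurable] = measurable_compose[OF measurable_fst meas1[OF p(1)]] measurable_compose[OF measurable_snd meas2[OF p(2)]]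
      show ?thesis by measurable
    qed
    then have "(\<Union>p\<in>F. {z \<in> space (m1 \<Otimes>\<^sub>M m2). ?D1 (fst p) (fst z) < \<delta> \<and> ?D2 (snd p) (snd z) < \<delta>}) \<in> sets (m1 \<Otimes>\<^sub>M m2)"
      using F(1) by auto
    also have "(\<Union>p\<in>F. {z \<in> space (m1 \<Otimes>\<^sub>M m2). ?D1 (fst p) (fst z) < \<delta> \<and> ?D2 (snd p) (snd z) < \<delta>}) = S" by (auto simp: S_def)
    finally show ?thesis .
  qed
  let ?s = "\<lambda>x. measure m2 (Pair x -` S)"
  have s_meas[measurable]: "?s \<in> borel_measurable m1"
    using m2.measurable_emeasure_Pair[OF S_sets] by (simp add: measure_def)
  have "emeasure (m1 \<Otimes>\<^sub>M m2) S = (\<integral>\<^sup>+x. emeasure m2 (Pair x -` S) \<partial>m1)" by (rule m2.emeasure_pair_measure_alt[OF S_sets])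
  then have "ennreal (prob S) = (\<integral>\<^sup>+x. ennreal (?s x) \<partial>m1)" by (simp add: emeasure_eq_measure m2.emeasure_eq_measure)
  also have "\<dots> = ennreal (\<integral>x. ?s x \<partial>m1)"
    by (intro nn_integral_eq_integral m1.integrable_const_bound[where B = 1]) auto
  finally have int_s: "(\<integral>x. ?s x \<partial>m1) = prob S" by simp
  define X0 where "X0 = {x \<in> space m1. ?s x > 1 - \<alpha>}"
  have X0: "X0 \<in> sets m1" unfolding X0_def by measurable
  have X0_big: "measure m1 X0 > 1 - \<alpha>"
  proof -
    have i: "integrable m1 ?s" by (intro m1.integrable_const_bound[where B = 1]) auto
    have "\<alpha> * measure m1 (space m1 - X0) = (\<integral>x. \<alpha> * indicator (space m1 - X0) x \<partial>m1)" using X0 by simp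
    also have "\<dots> \<le> (\<integral>x. 1 - ?s x \<partial>m1)"
    proof (rule integral_mono)
      show "integrable m1 (\<lambda>x. \<alpha> * indicat_real (space m1 - X0) x)" using X0 by (intro integrable_mult_right integrable_real_indicator) (auto simp: m1.emeasure_eq_measure)
    qed (use i \<alpha> in \<open>auto simp: indicator_def X0_def\<close>)
    also have "\<dots> = 1 - prob S" using i int_s by (simp add: m1.prob_space)
    also have "\<dots> < \<alpha>\<^sup>2" using S unfolding S_def by simp
    finally have "measure m1 (space m1 - X0) < \<alpha>" using \<alpha>(1) by (simp add: power2_eq_square)
    then show ?thesis using m1.prob_compl[OF X0] by simp
  qed
  define b where "b = cov \<alpha> \<delta> ?Y2 ?D2 m2"
  have b1: "b \<ge> 1" unfolding b_def by (rule n2.cov_pos[OF V m2 \<alpha> \<delta>])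
  define N where "N x = {p \<in> F. ?D1 (fst p) x < \<delta>}" for x
  have N_fin: "finite (N x)" for x using F(1) by (simp add: N_def)
  have N_card: "b \<le> card (N x)" if x: "x \<in> X0" for x
  proof -
    have "covers \<alpha> \<delta> ?Y2 ?D2 m2 (snd ` N x)"
      unfolding covers_def
    proof (intro conjI)
      show "snd ` N x \<subseteq> ?Y2" "finite (snd ` N x)" using FY N_fin by (force simp: N_def, simp)
      have "Pair x -` S = {y \<in> ?Y2. \<exists>p\<in>F. ?D1 (fst p) x < \<delta> \<and> ?D2 (snd p) y < \<delta>}"
        using x sp by (simp add: S_def X0_def space_pair_measure set_eq_iff)
      also have "\<dots> = {y \<in> ?Y2. \<exists>q\<in>snd ` N x. ?D2 q y < \<delta>}" unfolding N_def by blast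
      finally have "Pair x -` S = {y \<in> ?Y2. \<exists>q\<in>snd ` N x. ?D2 q y < \<delta>}" .
      then show "1 - \<alpha> < measure m2 {y \<in> ?Y2. \<exists>q\<in>snd ` N x. ?D2 q y < \<delta>}" using x by (simp add: X0_def)
    qed
    from cov_le[OF this] show ?thesis using card_image_le[OF N_fin, of snd x] by (simp add: b_def)
  qed
  define sep where "sep E \<longleftrightarrow> finite E \<and> E \<subseteq> X0 \<and> (\<forall>x\<in>E. \<forall>y\<in>E. x \<noteq> y \<longrightarrow> 2 * \<delta> \<le> ?D1 x y)" for E
  have sep_card: "card E * b \<le> card F" if E: "sep E" for E
  proof -
    have disj: "N x \<inter> N y = {}" if xy: "x \<in> E" "y \<in> E" "x \<noteq> y" for x y
    proof (rule ccontr)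
      assume "N x \<inter> N y \<noteq> {}"
      then obtain p where p: "p \<in> F" "?D1 (fst p) x < \<delta>" "?D1 (fst p) y < \<delta>" by (auto simp: N_def)
      have "x \<in> X0" "y \<in> X0" using E xy by (auto simp: sep_def)
      then have "x \<in> ?Y1" "y \<in> ?Y1" "fst p \<in> ?Y1" using sp FY(1)[OF p(1)] by (simp_all add: X0_def)
      then have "?D1 x y \<le> ?D1 (fst p) x + ?D1 (fst p) y"
        using n1.avg_metric_triangle[of x V "fst p" y] by (simp add: n1.avg_metric_commute)
      then have "?D1 x y < 2 * \<delta>" using p by simp
      moreover have "2 * \<delta> \<le> ?D1 x y" using E xy unfolding sep_def by blast
      ultimately show False by simp
    qed
    have "card E * b = (\<Sum>x\<in>E. b)" by simp
    also have "\<dots> \<le> (\<Sum>x\<in>E. card (N x))" using E N_card by (intro sum_mono) (auto simp: sep_def)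
    also have "\<dots> = card (\<Union>x\<in>E. N x)" using E N_fin disj by (intro card_UN_disjoint[symmetric]) (auto simp: sep_def)
    also have "\<dots> \<le> card F" by (rule card_mono[OF F(1)]) (auto simp: N_def)
    finally show ?thesis .
  qed
  have bound: "card E \<le> card F" if "sep E" for E
    using sep_card[OF that] b1 by (metis le_trans mult.right_neutral mult_le_mono2)
  have "sep {}" by (simp add: sep_def)
  have "\<exists>E. sep E \<and> (\<forall>E'. sep E' \<longrightarrow> card E' \<le> card E)"
    by (rule ex_has_greatest_nat[of _ "{}" _ "Suc (card F)"]) (use \<open>sep {}\<close> bound in \<open>auto simp: less_Suc_eq_le\<close>)
  then obtain E where E: "sep E" "\<And>E'. sep E' \<Longrightarrow> card E' \<le> card E" by blast
  have cover: "\<exists>x\<in>E. ?D1 x y < 2 * \<delta>" if y: "y \<in> X0" for y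
  proof (rule ccontr)
    assume no: "\<not> (\<exists>x\<in>E. ?D1 x y < 2 * \<delta>)"
    have yV: "y \<in> ?Y1" using y sp by (simp add: X0_def)
    have "d1 (y v) (y v) = 0" if "v \<in> V" for v using n1.zero[of "y v" "y v"] PiE_mem[OF yV that] by simp
    then have "?D1 y y = 0" by (simp add: avg_metric_def)
    then have yE: "y \<notin> E" using no \<delta> by force
    have far: "2 * \<delta> \<le> ?D1 x y" "2 * \<delta> \<le> ?D1 y x" if "x \<in> E" for x
      using no that n1.avg_metric_commute[of V y x] by (auto simp: not_less)
    have "sep (insert y E)" using E(1) y far unfolding sep_def by simp
    then have "card (insert y E) \<le> card E" by (rule E(2))
    then show False using yE E(1) by (simp add: sep_def)
  qed
  have "covers \<alpha> (2 * \<delta>) ?Y1 ?D1 m1 E"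
    unfolding covers_def
  proof (intro conjI)
    show EY: "E \<subseteq> ?Y1" "finite E" using E(1) sp by (auto simp: sep_def X0_def)
    have "measure m1 X0 \<le> measure m1 {y \<in> ?Y1. \<exists>x\<in>E. ?D1 x y < 2 * \<delta>}"
      using cover sp n1.ball_measurable[OF EY] p1(2) by (intro m1.finite_measure_mono) (auto simp: X0_def)
    then show "1 - \<alpha> < measure m1 {y \<in> ?Y1. \<exists>x\<in>E. ?D1 x y < 2 * \<delta>}" using X0_big by simp
  qed
  then have "cov \<alpha> (2 * \<delta>) ?Y1 ?D1 m1 * b \<le> card E * b" by (intro mult_right_mono cov_le) auto
  also have "\<dots> \<le> card F" by (rule sep_card[OF E(1)])
  finally show ?thesis by (simp add: b_def)
qed

section \<open>Processes observed on the limit system\<close>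

text \<open>The flag distinguishes the two modes of convergence, which share most of the proof.\<close>

definition conv ::
  "bool \<Rightarrow> ('g, 'm) monoid_scheme \<Rightarrow> 'a set \<Rightarrow> ('a \<Rightarrow> 'a \<Rightarrow> real) \<Rightarrow>
    (nat \<Rightarrow> 'v set) \<Rightarrow> (nat \<Rightarrow> 'g \<Rightarrow> 'v \<Rightarrow> 'v) \<Rightarrow> (nat \<Rightarrow> ('v \<Rightarrow> 'a) measure) \<Rightarrow> ('g \<Rightarrow> 'a) measure \<Rightarrow> bool" where
  "conv b = (if b then doubly_quenched_converges else quenched_converges)"

lemma conv_prob: "conv b G K d V \<sigma> m \<mu> \<Longrightarrow> m i \<in> space (prob_algebra (config (V i) K d))"
  by (auto simp: conv_def doubly_quenched_converges_def quenched_converges_def split: if_splits)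

context double_models
begin

lemma conv_moments:
  assumes c: "conv b G K d V \<sigma> m \<mu>" and t: "over G t" and s: "over G s"
  shows "local_conv (A t) (moment t)" "pair_conv b (A t) (moment t) (A s) (moment s)"
proof -
  show "local_conv (A t) (moment t)"
    using c quenched_moments(1)[OF _ t] doubly_quenched_moments(1)[OF _ t t] by (auto simp: conv_def split: if_splits)
  show "pair_conv b (A t) (moment t) (A s) (moment s)"
  proof (cases b)
    case True then show ?thesis using c doubly_quenched_moments(2)[OF _ t s] by (simp add: conv_def)
  next
    case False
    then have q: "quenched_converges G K d V \<sigma> m \<mu>" using c by (simp add: conv_def)
    show ?thesis using False mean_conv_pair[OF A_arr[OF t] A_arr[OF s] quenched_moments(2)[OF q t] quenched_moments(2)[OF q s]] by simp
  qed
qed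

lemma conv_of_moments:
  assumes l: "\<And>t. over G t \<Longrightarrow> local_conv (A t) (moment t)"
    and p: "\<And>t. b \<Longrightarrow> over G t \<Longrightarrow> pair_conv True (A t) (moment t) (A t) (moment t)"
    and q: "\<And>t. \<not> b \<Longrightarrow> over G t \<Longrightarrow> mean_conv (A t) (moment t)"
  shows "conv b G K d V \<sigma> m \<mu>"
  using doubly_quenched_of_moments[OF l p] quenched_of_moments[OF l q] by (simp add: conv_def)

end

text \<open>The map \<open>\<Xi>\<close> sends a point to its name in a process. For a product system this includes the processes of
  the factors.\<close>

locale represented = limit_system G \<Omega> T + net: metric_net K d l
  for G :: "('g, 'm) monoid_scheme" and \<Omega> :: "'o measure" and T :: "'g \<Rightarrow> 'o \<Rightarrow> 'o"
    and K :: "'a set" and d :: "'a \<Rightarrow> 'a \<Rightarrow> real" and l :: "nat \<Rightarrow> 'a" +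
  fixes \<Xi> :: "'o \<Rightarrow> 'g \<Rightarrow> 'a" and lam :: "('g \<Rightarrow> 'a) measure"
  assumes \<Xi>: "\<Xi> \<in> \<Omega> \<rightarrow>\<^sub>M config (carrier G) K d" and \<Xi>_distr: "distr \<Omega> (config (carrier G) K d) \<Xi> = lam"
    and \<Xi>_equiv: "\<And>g. g \<in> carrier G \<Longrightarrow> AE x in \<Omega>. \<Xi> (T g x) = shift G g (\<Xi> x)"
begin

sublocale pc: process_coordinates K d "\<lambda>j x. d x (l j)" G
  by (intro process_coordinates.intro net.coordinates_axioms process_coordinates_axioms.intro group countable)

definition \<phi> :: "'o \<Rightarrow> 'a" where "\<phi> x = \<Xi> x \<one>\<^bsub>G\<^esub>"

definition obs :: "nat \<Rightarrow> 'o \<Rightarrow> real" where "obs j x = d (\<phi> x) (l j)"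

lemma one_carrier: "\<one>\<^bsub>G\<^esub> \<in> carrier G"
  using group.is_monoid[OF group] by (rule monoid.one_closed)

lemma \<phi>_measurable: "\<phi> \<in> \<Omega> \<rightarrow>\<^sub>M metric_borel K d"
  unfolding \<phi>_def[abs_def] using measurable_compose[OF \<Xi> measurable_component_singleton[OF one_carrier]] .

lemma \<phi>_in: "x \<in> space \<Omega> \<Longrightarrow> \<phi> x \<in> K"
  using measurable_space[OF \<phi>_measurable] by simp

lemma \<Xi>_\<phi>: "AE x in \<Omega>. \<forall>g\<in>carrier G. \<Xi> x g = \<phi> (T g x)"
proof -
  have "AE x in \<Omega>. \<Xi> x g = \<phi> (T g x)" if g: "g \<in> carrier G" for g
    using \<Xi>_equiv[OF g]
  proof eventually_elim
    case (elim x)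
    then show ?case using one_carrier g group.is_monoid[OF group] by (simp add: \<phi>_def shift_def monoid.l_one)
  qed
  then show ?thesis using countable by (simp add: AE_ball_countable)
qed

lemma obs_bdd: "bdd (obs j)"
proof -
  obtain B where "\<forall>x\<in>K. \<bar>d x (l j)\<bar> \<le> B" using net.coordinate_bounded[of j] by blast
  then show ?thesis unfolding obs_def[abs_def]
    using measurable_compose[OF \<phi>_measurable net.coordinate_measurable, of j] \<phi>_in by (intro bddI[where B = B]) auto
qed

lemma lam_prob: "lam \<in> space (prob_algebra (config (carrier G) K d))"
  using distr_config[OF prob \<Xi>] \<Xi>_distr by simp

lemma integral_lmon:
  assumes t: "over G t"
  shows "(\<integral>u. lmon obs t u \<partial>\<Omega>) = (\<integral>x. mval (\<lambda>z. pc.coord z x) t \<partial>lam)"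
proof -
  have m: "(\<lambda>x. mval (\<lambda>z. pc.coord z x) t) \<in> borel_measurable (config (carrier G) K d)"
    by (intro pc.continuous_measurable pc.mval_coord_continuous t)
  have "(\<integral>x. mval (\<lambda>z. pc.coord z x) t \<partial>lam) = (\<integral>u. mval (\<lambda>z. pc.coord z (\<Xi> u)) t \<partial>\<Omega>)"
    unfolding \<Xi>_distr[symmetric] by (rule integral_distr[OF \<Xi> m])
  also have "\<dots> = (\<integral>u. lmon obs t u \<partial>\<Omega>)"
  proof (rule integral_cong_AE)
    show "AE u in \<Omega>. mval (\<lambda>z. pc.coord z (\<Xi> u)) t = lmon obs t u"
      using \<Xi>_\<phi>
    proof eventually_elim
      case (elim u)
      then show ?case unfolding lmon_def obs_def pc.coord_def using t by (intro mval_cong) auto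
    qed
  qed (use measurable_compose[OF \<Xi> m] bdd_measurable[OF bdd_lmon[OF obs_bdd t]] in auto)
  finally show ?thesis by simp
qed

text \<open>The name of a point is almost everywhere the family of its observables along the orbit, and null modifications preserve
  measurability by hypothesis.\<close>

lemma generated_measurable:
  assumes N: "space N = space \<Omega>" "sets N \<subseteq> sets \<Omega>"
    and null: "\<And>A A'. A \<in> sets N \<Longrightarrow> A' \<in> sets \<Omega> \<Longrightarrow> (AE x in \<Omega>. x \<in> A \<longleftrightarrow> x \<in> A') \<Longrightarrow> A' \<in> sets N"
    and meas: "\<And>j g. g \<in> carrier G \<Longrightarrow> (\<lambda>x. obs j (T g x)) \<in> borel_measurable N"
  shows "\<Xi> \<in> N \<rightarrow>\<^sub>M config (carrier G) K d"
proof -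
  have sp: "\<Xi> x \<in> PiE (carrier G) (\<lambda>_. K)" if "x \<in> space \<Omega>" for x
    using measurable_space[OF \<Xi> that] by (simp add: net.space_config)
  have "(\<lambda>x. \<lambda>g\<in>carrier G. \<Xi> x g) \<in> N \<rightarrow>\<^sub>M config (carrier G) K d"
  proof (rule measurable_restrict, rule net.measurable_metric_borelI)
    fix g j assume g: "g \<in> carrier G"
    show "\<Xi> x g \<in> K" if "x \<in> space N" for x using sp that g N(1) by auto
    show "(\<lambda>x. d (\<Xi> x g) (l j)) \<in> borel_measurable N"
    proof (rule borel_measurableI_less)
      fix r
      have "{x \<in> space N. obs j (T g x) < r} \<in> sets N" using meas[OF g] by measurable
      moreover have "{x \<in> space \<Omega>. d (\<Xi> x g) (l j) < r} \<in> sets \<Omega>"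
        using measurable_compose[OF \<Xi> net.config_coordinate_measurable[OF g], of j] by measurable
      moreover have "AE x in \<Omega>. x \<in> {x \<in> space N. obs j (T g x) < r} \<longleftrightarrow> x \<in> {x \<in> space \<Omega>. d (\<Xi> x g) (l j) < r}"
        using \<Xi>_\<phi> by eventually_elim (use g N(1) in \<open>auto simp: obs_def\<close>)
      ultimately show "{x \<in> space N. d (\<Xi> x g) (l j) < r} \<in> sets N" unfolding N(1) by (rule null)
    qed
  qed
  also have "(\<lambda>x. \<lambda>g\<in>carrier G. \<Xi> x g) \<in> N \<rightarrow>\<^sub>M config (carrier G) K d \<longleftrightarrow> \<Xi> \<in> N \<rightarrow>\<^sub>M config (carrier G) K d"
    by (intro measurable_cong) (simp add: PiE_restrict[OF sp] N(1))
  finally show ?thesis .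
qed

end

lemma (in sofic_models) represented_arr:
  assumes net: "metric_net K d l" and y: "\<And>i v. v \<in> V i \<Longrightarrow> y i v \<in> P i \<rightarrow>\<^sub>M metric_borel K d"
  shows "arr (\<lambda>i v z. d (y i v z) (l j))"
proof -
  interpret net: metric_net K d l by fact
  obtain B where B: "\<forall>x\<in>K. \<bar>d x (l j)\<bar> \<le> B" using net.coordinate_bounded[of j] by blast
  show ?thesis
  proof (rule arrI[where B = B])
    show "(\<lambda>z. d (y i v z) (l j)) \<in> borel_measurable (P i)" if "v \<in> V i" for i v
      using measurable_compose[OF y[OF that] net.coordinate_measurable] .
    show "\<bar>d (y i v z) (l j)\<bar> \<le> B" if "v \<in> V i" "z \<in> space (P i)" for i v z
      using B measurable_space[OF y[OF that(1)] that(2)] by simp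
  qed
qed

context tracking
begin

text \<open>The permutation of the unit is nearly idempotent, so it moves few vertices.\<close>

lemma tracks_base: "tracks (c j) (X j)"
proof (rule tracks_limit[OF c X])
  have one: "\<one>\<^bsub>G\<^esub> \<in> carrier G" using group.is_monoid[OF group] by (rule monoid.one_closed)
  have tr: "tracks (\<lambda>x. c j (T \<one>\<^bsub>G\<^esub> x)) (\<lambda>i v x. X j i (\<sigma> i \<one>\<^bsub>G\<^esub> v) x)"
    using tracks_pol[of "[(1, [(\<one>\<^bsub>G\<^esub>, j)])]"] one by (simp add: lpol_def[abs_def] apol_def[abs_def])
  have "ldist (c j) (\<lambda>x. c j (T \<one>\<^bsub>G\<^esub> x)) = 0"
    by (intro ldist_AE AE_I2 c tracks_bdd[OF tr]) (simp add: T_one)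
  moreover have "(adist (X j) (\<lambda>i v x. X j i (\<sigma> i \<one>\<^bsub>G\<^esub> v) x)) \<longlonglongrightarrow> 0"
  proof -
    have "adist (\<lambda>i v. X j i (\<sigma> i \<one>\<^bsub>G\<^esub> (\<sigma> i \<one>\<^bsub>G\<^esub> v))) (\<lambda>i v. X j i (\<sigma> i \<one>\<^bsub>G\<^esub> v)) = adist (X j) (\<lambda>i v x. X j i (\<sigma> i \<one>\<^bsub>G\<^esub> v) x)"
    proof
      fix i
      show "adist (\<lambda>i v. X j i (\<sigma> i \<one>\<^bsub>G\<^esub> (\<sigma> i \<one>\<^bsub>G\<^esub> v))) (\<lambda>i v. X j i (\<sigma> i \<one>\<^bsub>G\<^esub> v)) i = adist (X j) (\<lambda>i v x. X j i (\<sigma> i \<one>\<^bsub>G\<^esub> v) x) i"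
      using adist_shift[OF one, of "\<lambda>i v. X j i (\<sigma> i \<one>\<^bsub>G\<^esub> v)" "X j" i] by (simp add: adist_commute)
    qed
    then show ?thesis
      using adist_\<sigma>_mult[OF X one one, of j] monoid.l_one[OF group.is_monoid[OF group] one] by simp
  qed
  ultimately show "\<exists>h H. tracks h H \<and> ldist (c j) h < \<eta> \<and> (\<forall>\<^sub>F i in sequentially. adist (X j) H i < \<eta>)" if "\<eta> > 0" for \<eta>
    using tr that order_tendstoD(2)[of "adist (X j) (\<lambda>i v x. X j i (\<sigma> i \<one>\<^bsub>G\<^esub> v) x)" 0 sequentially \<eta>]
    by (intro exI[of _ "\<lambda>x. c j (T \<one>\<^bsub>G\<^esub> x)"] exI[of _ "\<lambda>i v x. X j i (\<sigma> i \<one>\<^bsub>G\<^esub> v) x"]) auto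
qed

text \<open>The input beyond local convergence that makes fields converge. In the quenched case it is stated for all tracked
  functions, because it may come either from the monomials or from ergodicity.\<close>

definition mixes :: "bool \<Rightarrow> bool" where
  "mixes b \<longleftrightarrow> (if b
     then \<forall>s t. over G s \<longrightarrow> over G t \<longrightarrow>
       pair_conv True (amon X s) (\<integral>x. lmon c s x \<partial>\<Omega>) (amon X t) (\<integral>x. lmon c t x \<partial>\<Omega>)
     else \<forall>f F. tracks f F \<longrightarrow> mean_conv F (\<integral>x. f x \<partial>\<Omega>))"

lemma mixesI:
  assumes mon: "\<And>s t. over G s \<Longrightarrow> over G t \<Longrightarrow>
      pair_conv b (amon X s) (\<integral>x. lmon c s x \<partial>\<Omega>) (amon X t) (\<integral>x. lmon c t x \<partial>\<Omega>)"
  shows "mixes b"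
proof (cases b)
  case True then show ?thesis using mon by (simp add: mixes_def)
next
  case False
  have "mean_conv F (\<integral>x. f x \<partial>\<Omega>)" if "tracks f F" for f F
    using mean_conv_of_pair[OF tracks_arr[OF that] tracks_local_conv[OF that]] pair_conv_tracks[OF mon that that] False by simp
  then show ?thesis using False by (simp add: mixes_def)
qed

text \<open>Translates of the field track translates of the map, so the local moments of the field are those of the process.\<close>

lemma conv_field:
  fixes K :: "'b set" and y :: "nat \<Rightarrow> 'v \<Rightarrow> 'w \<Rightarrow> 'b"
  assumes rep: "represented G \<Omega> T K d l \<Xi> lam"
    and y: "\<And>i v. v \<in> V i \<Longrightarrow> y i v \<in> P i \<rightarrow>\<^sub>M metric_borel K d"
    and tr: "\<And>j. tracks (represented.obs G d l \<Xi> j) (\<lambda>i v z. d (y i v z) (l j))"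
    and mix: "mixes b"
  shows "conv b G K d V \<sigma> (\<lambda>i. distr (P i) (config (V i) K d) (\<lambda>z. \<lambda>v\<in>V i. y i v z)) lam"
proof -
  interpret R: represented G \<Omega> T K d l \<Xi> lam by fact
  let ?Y = "\<lambda>i z. \<lambda>v\<in>V i. y i v z"
  let ?m = "\<lambda>i. distr (P i) (config (V i) K d) (?Y i)"
  have Y: "?Y i \<in> P i \<rightarrow>\<^sub>M config (V i) K d" for i by (intro measurable_restrict y)
  have m: "?m i \<in> space (prob_algebra (config (V i) K d))" for i by (rule distr_config[OF P Y])
  interpret D: double_models K d "\<lambda>j x. d x (l j)" G V \<sigma> ?m lam
    by (intro double_models.intro process_models.intro R.pc.process_coordinates_axioms process_models_axioms.intro V \<sigma>_in m R.lam_prob)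
  let ?X' = "\<lambda>j i v z. d (y i v z) (l j)"
  have A: "D.A t i v (?Y i z) = amon ?X' t i v z" if "over G t" "v \<in> V i" for t i v z
    unfolding site_mval_def amon_def using that \<sigma>_in by (intro mval_cong) auto
  have mom: "D.moment t = (\<integral>z. lmon R.obs t z \<partial>\<Omega>)" if "over G t" for t
    unfolding D.moment_def R.integral_lmon[OF that] ..
  have trm: "tracks (lmon R.obs t) (amon ?X' t)" if "over G t" for t by (rule tracks_family[OF tr that])
  have E1: "(\<integral>x. D.A t i v x \<partial>?m i) = (\<integral>z. amon ?X' t i v z \<partial>P i)" if "over G t" "v \<in> V i" for t i v
    by (subst integral_distr[OF Y D.A_measurable[OF that]]) (simp add: A[OF that])
  have E2: "(\<integral>x. D.A t i v x * D.A s i w x \<partial>?m i) = (\<integral>z. amon ?X' t i v z * amon ?X' s i w z \<partial>P i)"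
    if "over G t" "over G s" "v \<in> V i" "w \<in> V i" for t s i v w
    using that by (subst integral_distr[OF Y borel_measurable_times[OF D.A_measurable D.A_measurable]]) (simp_all add: A)
  show ?thesis
  proof (rule D.conv_of_moments)
    fix t :: "('g \<times> nat) list" assume t: "over G t"
    have "avg (V i) (\<lambda>v. \<bar>(\<integral>x. D.A t i v x \<partial>?m i) - D.moment t\<bar>) = avg (V i) (\<lambda>v. \<bar>(\<integral>z. amon ?X' t i v z \<partial>P i) - (\<integral>z. lmon R.obs t z \<partial>\<Omega>)\<bar>)" for i
      by (intro avg_cong) (simp only: E1[OF t] mom[OF t])
    then show "D.local_conv (D.A t) (D.moment t)"
      using tracks_local_conv[OF trm[OF t]] unfolding D.local_conv_def local_conv_def by simp
    show "D.pair_conv True (D.A t) (D.moment t) (D.A t) (D.moment t)" if b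
    proof -
      have "pair_conv True (amon ?X' t) (\<integral>z. lmon R.obs t z \<partial>\<Omega>) (amon ?X' t) (\<integral>z. lmon R.obs t z \<partial>\<Omega>)"
        using mix that unfolding mixes_def by (intro pair_conv_tracks[OF _ trm[OF t] trm[OF t]]) simp
      moreover have "nrm True (V i) (\<lambda>v w. (\<integral>x. D.A t i v x * D.A t i w x \<partial>?m i) - D.moment t * D.moment t) =
        nrm True (V i) (\<lambda>v w. (\<integral>z. amon ?X' t i v z * amon ?X' t i w z \<partial>P i) - (\<integral>z. lmon R.obs t z \<partial>\<Omega>) * (\<integral>z. lmon R.obs t z \<partial>\<Omega>))" for i
        by (intro nrm_cong) (simp only: E2[OF t t] mom[OF t])
      ultimately show ?thesis unfolding D.pair_conv_def pair_conv_def by simp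
    qed
    show "D.mean_conv (D.A t) (D.moment t)" if "\<not> b"
    proof -
      have "mean_conv (amon ?X' t) (\<integral>z. lmon R.obs t z \<partial>\<Omega>)"
        using mix that trm[OF t] by (auto simp: mixes_def)
      moreover have "(\<integral>x. \<bar>avg (V i) (\<lambda>v. D.A t i v x) - D.moment t\<bar> \<partial>?m i) =
        (\<integral>z. \<bar>avg (V i) (\<lambda>v. amon ?X' t i v z) - (\<integral>z. lmon R.obs t z \<partial>\<Omega>)\<bar> \<partial>P i)" for i
      proof -
        have "(\<lambda>x. \<bar>avg (V i) (\<lambda>v. D.A t i v x) - D.moment t\<bar>) \<in> borel_measurable (config (V i) K d)"
          by (intro borel_measurable_abs borel_measurable_diff avg_measurable D.A_measurable t) auto
        then have "(\<integral>x. \<bar>avg (V i) (\<lambda>v. D.A t i v x) - D.moment t\<bar> \<partial>?m i) = (\<integral>z. \<bar>avg (V i) (\<lambda>v. D.A t i v (?Y i z)) - D.moment t\<bar> \<partial>P i)"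
          by (rule integral_distr[OF Y])
        moreover have "avg (V i) (\<lambda>v. D.A t i v (?Y i z)) = avg (V i) (\<lambda>v. amon ?X' t i v z)" for z
          by (intro avg_cong A[OF t])
        ultimately show ?thesis by (simp add: mom[OF t])
      qed
      ultimately show ?thesis unfolding D.mean_conv_def mean_conv_def by simp
    qed
  qed
qed

end

section \<open>Products of model measures\<close>

lemma mval_sum:
  "mval \<rho> t = mval (\<lambda>z. \<rho> (fst z, Inl (snd z))) (lefts t) * mval (\<lambda>z. \<rho> (fst z, Inr (snd z))) (rights t)"
proof (induction t)
  case (Cons a t)
  obtain g s where "a = (g, s)" by (cases a)
  then show ?case using Cons by (cases s) simp_all
qed simp

locale model_product = A: models V P + B: models V Q
  for V :: "nat \<Rightarrow> 'v set" and P :: "nat \<Rightarrow> 'w measure" and Q :: "nat \<Rightarrow> 'u measure"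
begin

abbreviation PQ where "PQ \<equiv> \<lambda>i. P i \<Otimes>\<^sub>M Q i"

lemma prob_PQ: "prob_space (PQ i)"
proof -
  interpret M1: prob_space "P i" by (rule A.P)
  interpret M2: prob_space "Q i" by (rule B.P)
  interpret M: pair_prob_space "P i" "Q i" ..
  show ?thesis by (rule M.prob_space_axioms)
qed

sublocale AB: models V PQ
  by (rule models.intro) (simp_all add: A.V prob_PQ)

abbreviation ten where "ten F H \<equiv> \<lambda>i v x. F i v (fst x) * H i v (snd x)"

lemma integral_ten:
  assumes F: "A.arr F" "A.arr F'" and H: "B.arr H" "B.arr H'" and vw: "v \<in> V i" "w \<in> V i"
  shows "(\<integral>u. ten F H i v u * ten F' H' i w u \<partial>PQ i) = (\<integral>u. F i v u * F' i w u \<partial>P i) * (\<integral>u. H i v u * H' i w u \<partial>Q i)"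
proof -
  obtain C where C: "0 < C" "\<And>i v u. v \<in> V i \<Longrightarrow> u \<in> space (P i) \<Longrightarrow> \<bar>F i v u\<bar> \<le> C" using A.arr_bounded[OF F(1)] by blast
  obtain C' where C': "0 < C'" "\<And>i v u. v \<in> V i \<Longrightarrow> u \<in> space (P i) \<Longrightarrow> \<bar>F' i v u\<bar> \<le> C'" using A.arr_bounded[OF F(2)] by blast
  obtain D where D: "0 < D" "\<And>i v u. v \<in> V i \<Longrightarrow> u \<in> space (Q i) \<Longrightarrow> \<bar>H i v u\<bar> \<le> D" using B.arr_bounded[OF H(1)] by blast
  obtain D' where D': "0 < D'" "\<And>i v u. v \<in> V i \<Longrightarrow> u \<in> space (Q i) \<Longrightarrow> \<bar>H' i v u\<bar> \<le> D'" using B.arr_bounded[OF H(2)] by blast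
  have "(\<integral>z. (F i v (fst z) * F' i w (fst z)) * (H i v (snd z) * H' i w (snd z)) \<partial>PQ i) =
    (\<integral>u. F i v u * F' i w u \<partial>P i) * (\<integral>u. H i v u * H' i w u \<partial>Q i)"
  proof (rule integral_pair_mult[OF A.P B.P, where B = "C * C'" and B' = "D * D'" and f = "\<lambda>u. F i v u * F' i w u" and g = "\<lambda>u. H i v u * H' i w u"])
    show "\<bar>F i v x * F' i w x\<bar> \<le> C * C'" if "x \<in> space (P i)" for x
      unfolding abs_mult using C(1) C(2)[OF vw(1) that] C'(2)[OF vw(2) that] by (intro mult_mono) auto
    show "\<bar>H i v x * H' i w x\<bar> \<le> D * D'" if "x \<in> space (Q i)" for x
      unfolding abs_mult using D(1) D(2)[OF vw(1) that] D'(2)[OF vw(2) that] by (intro mult_mono) auto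
  qed (intro borel_measurable_times A.arr_measurable B.arr_measurable F H vw)+
  then show ?thesis by (simp add: mult_ac)
qed

lemma integral_ten1:
  assumes F: "A.arr F" and H: "B.arr H" and v: "v \<in> V i"
  shows "(\<integral>x. ten F H i v x \<partial>PQ i) = (\<integral>x. F i v x \<partial>P i) * (\<integral>x. H i v x \<partial>Q i)"
  using integral_ten[OF F A.arr_const[of 1] H B.arr_const[of 1] v v] by simp

lemma local_conv_ten:
  assumes F: "A.arr F" and H: "B.arr H" and "A.local_conv F r" "B.local_conv H s"
  shows "AB.local_conv (ten F H) (r * s)"
  unfolding AB.local_conv_def
proof -
  obtain C where C: "0 < C" "\<And>i v x. v \<in> V i \<Longrightarrow> x \<in> space (P i) \<Longrightarrow> \<bar>F i v x\<bar> \<le> C" using A.arr_bounded[OF F] by blast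
  show "(\<lambda>i. avg (V i) (\<lambda>v. \<bar>(\<integral>x. ten F H i v x \<partial>PQ i) - r * s\<bar>)) \<longlonglongrightarrow> 0"
  proof (rule tendsto_0_le)
    show "avg (V i) (\<lambda>v. \<bar>(\<integral>x. ten F H i v x \<partial>PQ i) - r * s\<bar>) \<le>
      C * avg (V i) (\<lambda>v. \<bar>(\<integral>x. H i v x \<partial>Q i) - s\<bar>) + \<bar>s\<bar> * avg (V i) (\<lambda>v. \<bar>(\<integral>x. F i v x \<partial>P i) - r\<bar>)" for i
      unfolding avg_cmult[symmetric] avg_add[symmetric]
    proof (rule avg_mono)
      fix v assume v: "v \<in> V i"
      have "\<bar>\<integral>x. F i v x \<partial>P i\<bar> \<le> C" by (rule A.arr_integral_bounded[OF v A.arr_integrable[OF F v] C(2)[OF v]])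
      from product_difference[OF this]
      show "\<bar>(\<integral>x. ten F H i v x \<partial>PQ i) - r * s\<bar> \<le> C * \<bar>(\<integral>x. H i v x \<partial>Q i) - s\<bar> + \<bar>s\<bar> * \<bar>(\<integral>x. F i v x \<partial>P i) - r\<bar>"
        unfolding integral_ten1[OF F H v] .
    qed
    show "(\<lambda>i. C * avg (V i) (\<lambda>v. \<bar>(\<integral>x. H i v x \<partial>Q i) - s\<bar>) + \<bar>s\<bar> * avg (V i) (\<lambda>v. \<bar>(\<integral>x. F i v x \<partial>P i) - r\<bar>)) \<longlonglongrightarrow> 0"
      using tendsto_add[OF tendsto_mult_left[OF assms(4)[unfolded B.local_conv_def], of C]
        tendsto_mult_left[OF assms(3)[unfolded A.local_conv_def], of "\<bar>s\<bar>"]] by simp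
  qed (simp add: avg_nonneg)
qed

text \<open>Independence turns joint expectations into products, and a product of two decorrelated families is decorrelated. The
  corresponding statement for averages over all pairs of vertices fails.\<close>

lemma pair_conv_ten:
  assumes F: "A.arr F" "A.arr F'" and H: "B.arr H" "B.arr H'"
    and p: "A.pair_conv True F r F' r'" "B.pair_conv True H s H' s'"
  shows "AB.pair_conv True (ten F H) (r * s) (ten F' H') (r' * s')"
  unfolding AB.pair_conv_def
proof -
  obtain C where C: "0 < C" "\<And>i v x. v \<in> V i \<Longrightarrow> x \<in> space (P i) \<Longrightarrow> \<bar>F i v x\<bar> \<le> C" using A.arr_bounded[OF F(1)] by blast
  obtain C' where C': "0 < C'" "\<And>i v x. v \<in> V i \<Longrightarrow> x \<in> space (P i) \<Longrightarrow> \<bar>F' i v x\<bar> \<le> C'" using A.arr_bounded[OF F(2)] by blast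
  let ?N1 = "\<lambda>i. nrm True (V i) (\<lambda>v w. (\<integral>x. F i v x * F' i w x \<partial>P i) - r * r')"
  let ?N2 = "\<lambda>i. nrm True (V i) (\<lambda>v w. (\<integral>x. H i v x * H' i w x \<partial>Q i) - s * s')"
  show "(\<lambda>i. nrm True (V i) (\<lambda>v w. (\<integral>x. ten F H i v x * ten F' H' i w x \<partial>PQ i) - r * s * (r' * s'))) \<longlonglongrightarrow> 0"
  proof (rule tendsto_0_le[OF nrm_nonneg])
    show "nrm True (V i) (\<lambda>v w. (\<integral>x. ten F H i v x * ten F' H' i w x \<partial>PQ i) - r * s * (r' * s')) \<le>
      (C * C') * ?N2 i + \<bar>s * s'\<bar> * ?N1 i" for i
      unfolding nrm_def if_True avg_cmult[symmetric] avg_add[symmetric]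
    proof (intro avg_mono)
      fix v w assume vw: "v \<in> V i" "w \<in> V i"
      have "\<bar>\<integral>x. F i v x * F' i w x \<partial>P i\<bar> \<le> C * C'"
      proof (rule A.arr_integral_bounded[OF vw(1) A.arr_integrable_mult[OF F vw]])
        show "\<bar>F i v x * F' i w x\<bar> \<le> C * C'" if "x \<in> space (P i)" for x
          unfolding abs_mult using C(1) C(2)[OF vw(1) that] C'(2)[OF vw(2) that] by (intro mult_mono) auto
      qed
      from product_difference[OF this, of "\<integral>x. H i v x * H' i w x \<partial>Q i" "r * r'" "s * s'"]
      show "\<bar>(\<integral>x. ten F H i v x * ten F' H' i w x \<partial>PQ i) - r * s * (r' * s')\<bar> \<le>
        C * C' * \<bar>(\<integral>x. H i v x * H' i w x \<partial>Q i) - s * s'\<bar> + \<bar>s * s'\<bar> * \<bar>(\<integral>x. F i v x * F' i w x \<partial>P i) - r * r'\<bar>"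
        unfolding integral_ten[OF F H vw] by (simp add: mult_ac)
    qed
    show "(\<lambda>i. (C * C') * ?N2 i + \<bar>s * s'\<bar> * ?N1 i) \<longlonglongrightarrow> 0"
      using tendsto_add[OF tendsto_mult_left[OF p(2)[unfolded B.pair_conv_def], of "C * C'"]
        tendsto_mult_left[OF p(1)[unfolded A.pair_conv_def], of "\<bar>s * s'\<bar>"]] by simp
  qed
qed

end

section \<open>Growth rates\<close>

definition lrate :: "nat \<Rightarrow> nat \<Rightarrow> ereal" where
  "lrate k n = log_nat k / ereal (real n)"

lemma log_nat_mono: "k \<le> k' \<Longrightarrow> log_nat k \<le> log_nat k'"
  by (auto simp: log_nat_def)

lemma lrate_mono: "k \<le> k' \<Longrightarrow> n > 0 \<Longrightarrow> lrate k n \<le> lrate k' n"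
  unfolding lrate_def by (intro ereal_divide_right_mono log_nat_mono) auto

lemma lrate_real: "k \<ge> 1 \<Longrightarrow> n > 0 \<Longrightarrow> lrate k n = ereal (ln (real k) / real n)"
  by (simp add: lrate_def log_nat_def)

lemma lrate_nonneg: "k \<ge> 1 \<Longrightarrow> n > 0 \<Longrightarrow> 0 \<le> lrate k n"
  by (simp add: lrate_real)

lemma lrate_mult: "k \<ge> 1 \<Longrightarrow> k' \<ge> 1 \<Longrightarrow> n > 0 \<Longrightarrow> lrate (k * k') n = lrate k n + lrate k' n"
  by (simp add: lrate_real ln_mult add_divide_distrib)

text \<open>Pass to a subsequence that realises the limit superior of the first sequence.\<close>

lemma limsup_add_liminf_le:
  fixes a b :: "nat \<Rightarrow> ereal"
  assumes "\<And>i. 0 \<le> a i" "\<And>i. 0 \<le> b i" shows "limsup a + liminf b \<le> limsup (\<lambda>i. a i + b i)"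
proof -
  obtain r :: "nat \<Rightarrow> nat" where r: "strict_mono r" "(a \<circ> r) \<longlonglongrightarrow> limsup a" using limsup_subseq_lim by blast
  have "liminf (a \<circ> r) = limsup a" using r(2) by (simp add: lim_imp_Liminf)
  moreover have "liminf b \<le> liminf (b \<circ> r)" by (rule liminf_subseq_mono[OF r(1)])
  ultimately have "limsup a + liminf b \<le> liminf (a \<circ> r) + liminf (b \<circ> r)" by (intro add_mono) auto
  also have "\<dots> \<le> liminf (\<lambda>i. (a \<circ> r) i + (b \<circ> r) i)"
  proof (rule ereal_liminf_add_mono)
    have "0 \<le> liminf (a \<circ> r)" "0 \<le> liminf (b \<circ> r)" using assms by (auto intro!: Liminf_bounded)
    then show "\<not> (liminf (a \<circ> r) = \<infinity> \<and> liminf (b \<circ> r) = - \<infinity> \<or> liminf (a \<circ> r) = - \<infinity> \<and> liminf (b \<circ> r) = \<infinity>)" by auto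
  qed
  also have "\<dots> \<le> limsup ((\<lambda>i. a i + b i) \<circ> r)" by (simp add: comp_def Liminf_le_Limsup)
  also have "\<dots> \<le> limsup (\<lambda>i. a i + b i)" by (rule limsup_subseq_mono[OF r(1)])
  finally show ?thesis .
qed

definition rate where
  "rate L K d V m \<epsilon> \<delta> = L (\<lambda>i. lrate (cov \<epsilon> \<delta> (PiE (V i) (\<lambda>_. K)) (avg_metric (V i) d) (m i)) (card (V i)))"
  for L :: "(nat \<Rightarrow> ereal) \<Rightarrow> ereal"

lemma cov_rate_rate: "cov_rate L K d V m = (SUP \<delta>\<in>{0<..}. SUP \<epsilon>\<in>{0<..}. rate L K d V m \<epsilon> \<delta>)"
  by (simp add: cov_rate_def rate_def lrate_def)

lemma rate_le_cov_rate: "\<epsilon> > 0 \<Longrightarrow> \<delta> > 0 \<Longrightarrow> rate L K d V m \<epsilon> \<delta> \<le> cov_rate L K d V m"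
  unfolding cov_rate_rate by (rule SUP_upper2[of \<delta>], simp, rule SUP_upper2[of \<epsilon>], auto)

context metric_net
begin

lemma rate_antimono:
  fixes V :: "nat \<Rightarrow> 'v set"
  assumes V: "\<And>i. finite (V i)" "\<And>i. V i \<noteq> {}" and m: "\<And>i. m i \<in> space (prob_algebra (config (V i) K d))"
    and L: "\<And>f g. (\<And>i. f i \<le> g i) \<Longrightarrow> L f \<le> L g"
    and "\<epsilon> > 0" "\<epsilon> \<le> \<epsilon>'" "\<delta> > 0" "\<delta> \<le> \<delta>'"
  shows "rate L K d V m \<epsilon>' \<delta>' \<le> rate L K d V m \<epsilon> \<delta>"
  unfolding rate_def
  by (intro L lrate_mono cov_antimono V m assms) (simp add: card_gt_0_iff V)

lemma cov_rate_diagonal: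
  fixes V :: "nat \<Rightarrow> 'v set"
  assumes V: "\<And>i. finite (V i)" "\<And>i. V i \<noteq> {}" and m: "\<And>i. m i \<in> space (prob_algebra (config (V i) K d))"
    and L: "\<And>f g. (\<And>i. f i \<le> g i) \<Longrightarrow> L f \<le> L g"
  shows "cov_rate L K d V m = (SUP n. rate L K d V m (1 / real (n + 2)) (1 / real (n + 2)))"
    and "incseq (\<lambda>n. rate L K d V m (1 / real (n + 2)) (1 / real (n + 2)))"
proof -
  note anti = rate_antimono[OF V m L]
  show "cov_rate L K d V m = (SUP n. rate L K d V m (1 / real (n + 2)) (1 / real (n + 2)))"
  proof (rule antisym)
    show "cov_rate L K d V m \<le> (SUP n. rate L K d V m (1 / real (n + 2)) (1 / real (n + 2)))"
      unfolding cov_rate_rate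
    proof (intro SUP_least)
      fix \<delta> \<epsilon> :: real assume "\<delta> \<in> {0<..}" "\<epsilon> \<in> {0<..}"
      then have "min \<delta> \<epsilon> > 0" by simp
      then obtain n where n: "1 / real (Suc n) < min \<delta> \<epsilon>" using nat_approx_posE by blast
      have "1 / real (n + 2) \<le> 1 / real (Suc n)" by (intro divide_left_mono) auto
      then have "rate L K d V m \<epsilon> \<delta> \<le> rate L K d V m (1 / real (n + 2)) (1 / real (n + 2))" using n by (intro anti) auto
      then show "rate L K d V m \<epsilon> \<delta> \<le> (SUP n. rate L K d V m (1 / real (n + 2)) (1 / real (n + 2)))" by (rule SUP_upper2[rotated]) simp
    qed
    show "(SUP n. rate L K d V m (1 / real (n + 2)) (1 / real (n + 2))) \<le> cov_rate L K d V m"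
      by (intro SUP_least rate_le_cov_rate) auto
  qed
  show "incseq (\<lambda>n. rate L K d V m (1 / real (n + 2)) (1 / real (n + 2)))"
    by (intro incseq_SucI anti divide_left_mono) auto
qed

lemma lrate_cov_nonneg:
  assumes "finite V" "V \<noteq> {}" "m \<in> space (prob_algebra (config V K d))" "\<epsilon> > 0" "\<epsilon> \<le> 1" "\<delta> > 0"
  shows "0 \<le> lrate (cov \<epsilon> \<delta> (conf V) (avg_metric V d) m) (card V)"
  using cov_pos[OF assms] assms by (intro lrate_nonneg) (auto simp: card_gt_0_iff)

lemma rate_nonneg:
  fixes V :: "nat \<Rightarrow> 'v set"
  assumes V: "\<And>i. finite (V i)" "\<And>i. V i \<noteq> {}" and m: "\<And>i. m i \<in> space (prob_algebra (config (V i) K d))"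
    and "\<epsilon> > 0" "\<epsilon> \<le> 1" "\<delta> > 0"
  shows "0 \<le> rate limsup K d V m \<epsilon> \<delta>" "0 \<le> rate liminf K d V m \<epsilon> \<delta>"
proof -
  have "0 \<le> liminf (\<lambda>i. lrate (cov \<epsilon> \<delta> (conf (V i)) (avg_metric (V i) d) (m i)) (card (V i)))"
    using lrate_cov_nonneg[OF V m assms(4-6)] by (intro Liminf_bounded always_eventually allI) auto
  then show "0 \<le> rate liminf K d V m \<epsilon> \<delta>" "0 \<le> rate limsup K d V m \<epsilon> \<delta>"
    unfolding rate_def using Liminf_le_Limsup[of sequentially] by (auto intro: order_trans)
qed

end

section \<open>Weak mixing and ergodic products\<close>

lemma prod_action_simp: "prod_action T S g x = (T g (fst x), S g (snd x))"
  by (simp add: prod_action_def case_prod_unfold)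

lemma ergodicD:
  assumes "ergodic G M T" "A \<in> sets M" "\<And>g. g \<in> carrier G \<Longrightarrow> T g -` A \<inter> space M = A"
  shows "measure M A = 0 \<or> measure M A = 1"
  using assms unfolding ergodic_def by simp

lemma ergodic_invariant_function_const:
  assumes M: "prob_space M" and erg: "ergodic G M T" and TM: "\<And>g. g \<in> carrier G \<Longrightarrow> T g \<in> M \<rightarrow>\<^sub>M M"
    and f: "integrable M f" and inv: "\<And>g x. g \<in> carrier G \<Longrightarrow> x \<in> space M \<Longrightarrow> f (T g x) = (f x :: real)"
  shows "AE x in M. f x = (\<integral>x. f x \<partial>M)"
proof -
  interpret prob_space M by fact
  let ?A = "{x \<in> space M. f x < expectation f}"
  have [measurable]: "f \<in> borel_measurable M" using f by auto
  have "?A \<in> events" by measurable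
  moreover have "T g -` ?A \<inter> space M = ?A" if "g \<in> carrier G" for g
    using inv[OF that] measurable_space[OF TM[OF that]] by auto
  ultimately have "prob ?A = 0 \<or> prob ?A = 1" by (rule ergodicD[OF erg])
  then show ?thesis by (rule AE_const_of_01[OF f])
qed

text \<open>Let \<open>\<xi>\<close> be the centred indicator of an invariant set. Its correlation kernel \<open>w (x, x')\<close> over the second factor is
  invariant on the square of the first, hence constant by weak mixing. Its mean is the square norm of the average of \<open>\<xi>\<close> over
  the first factor, which is an invariant function with mean zero on an ergodic system. So \<open>w\<close> vanishes; integrating
  it over \<open>B \<times> B\<close> shows that the set is independent of every rectangle, and therefore of itself.\<close>

theorem ergodic_product:
  assumes M: "prob_space M" and N: "prob_space N"
    and TM: "\<And>g. g \<in> carrier G \<Longrightarrow> T g \<in> M \<rightarrow>\<^sub>M M \<and> distr M M (T g) = M"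
    and SN: "\<And>g. g \<in> carrier G \<Longrightarrow> S g \<in> N \<rightarrow>\<^sub>M N \<and> distr N N (S g) = N"
    and wm: "weakly_mixing G M T" and erg: "ergodic G N S"
  shows "ergodic G (M \<Otimes>\<^sub>M N) (prod_action T S)"
  unfolding ergodic_def
proof (intro ballI impI)
  fix A assume A: "A \<in> sets (M \<Otimes>\<^sub>M N)" and inv: "\<forall>g\<in>carrier G. prod_action T S g -` A \<inter> space (M \<Otimes>\<^sub>M N) = A"
  interpret M: prob_space M by fact
  interpret N: prob_space N by fact
  interpret MN: pair_prob_space M N ..
  interpret MM: pair_prob_space M M ..
  interpret MMN: pair_prob_space "M \<Otimes>\<^sub>M M" N ..
  define a where "a = MN.prob A"
  define \<xi> where "\<xi> x y = indicat_real A (x, y) - a" for x y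
  have \<xi>_meas[measurable]: "case_prod \<xi> \<in> borel_measurable (M \<Otimes>\<^sub>M N)" using A by (simp add: \<xi>_def case_prod_unfold)
  have a01: "0 \<le> a" "a \<le> 1" by (auto simp: a_def)
  have \<xi>1: "\<bar>\<xi> x y\<bar> \<le> 1" for x y using a01 by (auto simp: \<xi>_def indicator_def)
  have \<xi>_x[measurable]: "(\<lambda>y. \<xi> x y) \<in> borel_measurable N" if "x \<in> space M" for x
    using measurable_compose[OF measurable_Pair1'[OF that] \<xi>_meas] by simp
  have \<xi>_y[measurable]: "(\<lambda>x. \<xi> x y) \<in> borel_measurable M" if "y \<in> space N" for y
    using measurable_compose[OF measurable_Pair2'[OF that] \<xi>_meas] by simp
  have A_iff: "(T g x, S g y) \<in> A \<longleftrightarrow> (x, y) \<in> A" if "g \<in> carrier G" "x \<in> space M" "y \<in> space N" for g x y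
  proof -
    have "(x, y) \<in> prod_action T S g -` A \<inter> space (M \<Otimes>\<^sub>M N) \<longleftrightarrow> (x, y) \<in> A" using inv that(1) by simp
    then show ?thesis using that by (simp add: space_pair_measure prod_action_simp)
  qed
  have \<xi>_inv: "\<xi> (T g x) (S g y) = \<xi> x y" if "g \<in> carrier G" "x \<in> space M" "y \<in> space N" for g x y
    using A_iff[OF that] by (simp add: \<xi>_def indicator_def)
  define p where "p y = (\<integral>x. \<xi> x y \<partial>M)" for y
  define w where "w z = (\<integral>y. \<xi> (fst z) y * \<xi> (snd z) y \<partial>N)" for z
  have int_\<xi>: "integrable (M \<Otimes>\<^sub>M N) (case_prod \<xi>)" by (rule MN.integrable_const_bound[where B = 1]) (use \<xi>1 in auto)
  have p_meas[measurable]: "p \<in> borel_measurable N"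
    unfolding p_def[abs_def] using MN.borel_measurable_lebesgue_integral by measurable
  have p1: "\<bar>p y\<bar> \<le> 1" if "y \<in> space N" for y
  proof -
    have "\<bar>p y\<bar> \<le> (\<integral>x. \<bar>\<xi> x y\<bar> \<partial>M)" unfolding p_def by (rule integral_abs_bound)
    also have "\<dots> \<le> 1" using \<xi>1 \<xi>_y[OF that] by (intro M.integral_le_const M.integrable_const_bound[where B = 1]) auto
    finally show ?thesis .
  qed
  have int_p: "integrable N p" by (rule N.integrable_const_bound[where B = 1]) (use p1 in auto)
  have "(\<integral>y. p y \<partial>N) = (\<integral>z. case_prod \<xi> z \<partial>(M \<Otimes>\<^sub>M N))"
    unfolding p_def using MN.integral_snd[OF int_\<xi>] .
  also have "\<dots> = 0" using A by (simp add: \<xi>_def case_prod_unfold a_def MN.prob_space MN.emeasure_eq_measure)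
  finally have Ep: "(\<integral>y. p y \<partial>N) = 0" .
  have p_inv: "p (S g y) = p y" if g: "g \<in> carrier G" and y: "y \<in> space N" for g y
  proof -
    have "p (S g y) = (\<integral>x. \<xi> x (S g y) \<partial>distr M M (T g))" using TM[OF g] by (simp add: p_def)
    also have "\<dots> = (\<integral>x. \<xi> (T g x) (S g y) \<partial>M)"
      using TM[OF g] SN[OF g] y by (intro integral_distr \<xi>_y) (auto dest: measurable_space)
    also have "\<dots> = p y" unfolding p_def by (intro Bochner_Integration.integral_cong refl \<xi>_inv g y)
    finally show ?thesis .
  qed
  have p0: "AE y in N. p y = 0"
  proof -
    have "AE y in N. p y = (\<integral>y. p y \<partial>N)"
    proof (rule ergodic_invariant_function_const[OF N erg])
      show "S g \<in> N \<rightarrow>\<^sub>M N" if "g \<in> carrier G" for g using SN[OF that] by (rule conjunct1)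
      show "p (S g x) = p x" if "g \<in> carrier G" "x \<in> space N" for g x by (rule p_inv[OF that])
    qed (rule int_p)
    then show ?thesis unfolding Ep .
  qed
  have w3: "(\<lambda>z. \<xi> (fst (fst z)) (snd z) * \<xi> (snd (fst z)) (snd z)) \<in> borel_measurable ((M \<Otimes>\<^sub>M M) \<Otimes>\<^sub>M N)"
  proof (rule borel_measurable_times)
    have "(\<lambda>z. (fst (fst z), snd z)) \<in> (M \<Otimes>\<^sub>M M) \<Otimes>\<^sub>M N \<rightarrow>\<^sub>M M \<Otimes>\<^sub>M N"
      by (intro measurable_Pair measurable_compose[OF measurable_fst measurable_fst] measurable_snd)
    from measurable_compose[OF this \<xi>_meas]
    show "(\<lambda>z. \<xi> (fst (fst z)) (snd z)) \<in> borel_measurable ((M \<Otimes>\<^sub>M M) \<Otimes>\<^sub>M N)" by simp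
    have "(\<lambda>z. (snd (fst z), snd z)) \<in> (M \<Otimes>\<^sub>M M) \<Otimes>\<^sub>M N \<rightarrow>\<^sub>M M \<Otimes>\<^sub>M N"
      by (intro measurable_Pair measurable_compose[OF measurable_fst measurable_snd] measurable_snd)
    from measurable_compose[OF this \<xi>_meas]
    show "(\<lambda>z. \<xi> (snd (fst z)) (snd z)) \<in> borel_measurable ((M \<Otimes>\<^sub>M M) \<Otimes>\<^sub>M N)" by simp
  qed
  have \<xi>\<xi>: "\<bar>\<xi> x y * \<xi> x' y\<bar> \<le> 1" for x x' y using \<xi>1[of x y] \<xi>1[of x' y] by (simp add: abs_mult mult_le_one)
  have w_meas[measurable]: "w \<in> borel_measurable (M \<Otimes>\<^sub>M M)"
    unfolding w_def[abs_def] using w3 by (intro N.borel_measurable_lebesgue_integral) (simp add: case_prod_unfold)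
  have w1: "\<bar>w z\<bar> \<le> 1" if "z \<in> space (M \<Otimes>\<^sub>M M)" for z
  proof -
    have z: "fst z \<in> space M" "snd z \<in> space M" using that by (auto simp: space_pair_measure)
    have "\<bar>w z\<bar> \<le> (\<integral>y. \<bar>\<xi> (fst z) y * \<xi> (snd z) y\<bar> \<partial>N)" unfolding w_def by (rule integral_abs_bound)
    also have "\<dots> \<le> 1" using \<xi>\<xi> \<xi>_x[OF z(1)] \<xi>_x[OF z(2)] by (intro N.integral_le_const N.integrable_const_bound[where B = 1]) auto
    finally show ?thesis .
  qed
  have int_w: "integrable (M \<Otimes>\<^sub>M M) w" by (rule MM.integrable_const_bound[where B = 1]) (use w1 in auto)
  have w_inv: "w (prod_action T T g z) = w z" if g: "g \<in> carrier G" and z: "z \<in> space (M \<Otimes>\<^sub>M M)" for g z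
  proof -
    have zs: "fst z \<in> space M" "snd z \<in> space M" using z by (auto simp: space_pair_measure)
    have Tz: "T g (fst z) \<in> space M" "T g (snd z) \<in> space M" using TM[OF g] zs by (auto dest: measurable_space)
    have "w (prod_action T T g z) = (\<integral>y. \<xi> (T g (fst z)) y * \<xi> (T g (snd z)) y \<partial>distr N N (S g))"
      using SN[OF g] by (simp add: w_def prod_action_simp)
    also have "\<dots> = (\<integral>y. \<xi> (T g (fst z)) (S g y) * \<xi> (T g (snd z)) (S g y) \<partial>N)"
      using SN[OF g] by (intro integral_distr borel_measurable_times \<xi>_x Tz) auto
    also have "\<dots> = w z" unfolding w_def by (intro Bochner_Integration.integral_cong refl) (simp add: \<xi>_inv g zs)
    finally show ?thesis .
  qed
  \<comment> \<open>Integrating the kernel against a product of indicators gives the square norm of an average of the fibres.\<close>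
  have square: "(\<integral>z. indicator B (fst z) * indicator B (snd z) * w z \<partial>(M \<Otimes>\<^sub>M M)) = (\<integral>y. (\<integral>x. indicator B x * \<xi> x y \<partial>M)\<^sup>2 \<partial>N)"
    if B: "B \<in> sets M" for B
  proof -
    let ?k = "\<lambda>z y. indicat_real B (fst z) * indicat_real B (snd z) * (\<xi> (fst z) y * \<xi> (snd z) y)"
    have m: "case_prod ?k \<in> borel_measurable ((M \<Otimes>\<^sub>M M) \<Otimes>\<^sub>M N)"
      using w3 B by (auto simp: case_prod_unfold intro!: borel_measurable_times)
    have k1: "\<bar>?k z y\<bar> \<le> 1" for z y using \<xi>\<xi>[of "fst z" y "snd z"] by (auto simp: indicator_def)
    have i: "integrable ((M \<Otimes>\<^sub>M M) \<Otimes>\<^sub>M N) (case_prod ?k)"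
      by (rule MMN.integrable_const_bound[where B = 1, OF _ m]) (use k1 in \<open>auto simp del: abs_mult\<close>)
    have "(\<integral>z. indicator B (fst z) * indicator B (snd z) * w z \<partial>(M \<Otimes>\<^sub>M M)) = (\<integral>z. (\<integral>y. ?k z y \<partial>N) \<partial>(M \<Otimes>\<^sub>M M))"
      unfolding w_def by simp
    also have "\<dots> = (\<integral>y. (\<integral>z. ?k z y \<partial>(M \<Otimes>\<^sub>M M)) \<partial>N)" using MMN.Fubini_integral[OF i] by simp
    also have "\<dots> = (\<integral>y. (\<integral>x. indicator B x * \<xi> x y \<partial>M)\<^sup>2 \<partial>N)"
    proof (intro Bochner_Integration.integral_cong refl)
      fix y assume y: "y \<in> space N"
      have "(\<integral>z. (indicator B (fst z) * \<xi> (fst z) y) * (indicator B (snd z) * \<xi> (snd z) y) \<partial>(M \<Otimes>\<^sub>M M)) =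
        (\<integral>x. indicator B x * \<xi> x y \<partial>M) * (\<integral>x. indicator B x * \<xi> x y \<partial>M)"
        using \<xi>_y[OF y] B \<xi>1 by (intro integral_pair_mult[OF M M, where B = 1 and B' = 1]) (auto simp: indicator_def)
      then show "(\<integral>z. ?k z y \<partial>(M \<Otimes>\<^sub>M M)) = (\<integral>x. indicator B x * \<xi> x y \<partial>M)\<^sup>2" by (simp add: power2_eq_square mult_ac)
    qed
    finally show ?thesis .
  qed
  have w_mean: "(\<integral>z. w z \<partial>(M \<Otimes>\<^sub>M M)) = 0"
  proof -
    have "(\<integral>z. w z \<partial>(M \<Otimes>\<^sub>M M)) = (\<integral>z. indicator (space M) (fst z) * indicator (space M) (snd z) * w z \<partial>(M \<Otimes>\<^sub>M M))"
      by (intro Bochner_Integration.integral_cong refl) (auto simp: space_pair_measure)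
    also have "\<dots> = (\<integral>y. (\<integral>x. indicator (space M) x * \<xi> x y \<partial>M)\<^sup>2 \<partial>N)" by (rule square) auto
    also have "\<dots> = (\<integral>y. (p y)\<^sup>2 \<partial>N)"
      unfolding p_def by (intro Bochner_Integration.integral_cong refl arg_cong[where f = "\<lambda>x. x\<^sup>2"]) auto
    also have "\<dots> = (\<integral>y. 0 \<partial>N)" using p0 by (intro integral_cong_AE) auto
    finally show ?thesis by simp
  qed
  have w0: "AE z in M \<Otimes>\<^sub>M M. w z = 0"
  proof -
    have "AE z in M \<Otimes>\<^sub>M M. w z = (\<integral>z. w z \<partial>(M \<Otimes>\<^sub>M M))"
    proof (rule ergodic_invariant_function_const[OF MM.prob_space_axioms wm[unfolded weakly_mixing_def]])
      show "prod_action T T g \<in> M \<Otimes>\<^sub>M M \<rightarrow>\<^sub>M M \<Otimes>\<^sub>M M" if "g \<in> carrier G" for g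
        unfolding prod_action_def case_prod_unfold using TM[OF that]
        by (intro measurable_Pair measurable_compose[OF measurable_fst] measurable_compose[OF measurable_snd]) auto
      show "w (prod_action T T g z) = w z" if "g \<in> carrier G" "z \<in> space (M \<Otimes>\<^sub>M M)" for g z by (rule w_inv[OF that])
    qed (rule int_w)
    then show ?thesis unfolding w_mean .
  qed
  have rect: "MN.prob (A \<inter> (B \<times> C)) = a * MN.prob (B \<times> C)" if B: "B \<in> sets M" and C: "C \<in> sets N" for B C
  proof -
    let ?\<psi> = "\<lambda>y. \<integral>x. indicator B x * \<xi> x y \<partial>M"
    have m1: "(\<lambda>z. indicat_real B (fst z) * \<xi> (fst z) (snd z)) \<in> borel_measurable (M \<Otimes>\<^sub>M N)"
      using B \<xi>_meas by (auto simp: case_prod_unfold intro!: borel_measurable_times)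
    have \<psi>_meas[measurable]: "?\<psi> \<in> borel_measurable N"
    proof (rule M.borel_measurable_lebesgue_integral)
      show "(\<lambda>(y, x). indicat_real B x * \<xi> x y) \<in> borel_measurable (N \<Otimes>\<^sub>M M)"
        using measurable_compose[OF measurable_pair_swap' m1] by (simp add: case_prod_unfold)
    qed
    have "(\<integral>y. (?\<psi> y)\<^sup>2 \<partial>N) = (\<integral>z. indicator B (fst z) * indicator B (snd z) * w z \<partial>(M \<Otimes>\<^sub>M M))" using square[OF B] by simp
    also have "\<dots> = (\<integral>z. 0 \<partial>(M \<Otimes>\<^sub>M M))" using w0 B by (intro integral_cong_AE) auto
    finally have z: "(\<integral>y. (?\<psi> y)\<^sup>2 \<partial>N) = 0" by simp
    have \<psi>1: "\<bar>?\<psi> y\<bar> \<le> 1" if "y \<in> space N" for y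
    proof -
      have "\<bar>?\<psi> y\<bar> \<le> (\<integral>x. \<bar>indicator B x * \<xi> x y\<bar> \<partial>M)" by (rule integral_abs_bound)
      also have "\<dots> \<le> 1" using \<xi>1 \<xi>_y[OF that] B by (intro M.integral_le_const M.integrable_const_bound[where B = 1]) (auto simp: indicator_def)
      finally show ?thesis .
    qed
    have "integrable N (\<lambda>y. (?\<psi> y)\<^sup>2)" using \<psi>1 by (intro N.integrable_const_bound[where B = 1]) (auto simp: abs_square_le_1)
    then have \<psi>0: "AE y in N. ?\<psi> y = 0" using z by (subst (asm) integral_nonneg_eq_0_iff_AE) auto
    have m2: "(\<lambda>z. indicat_real B (fst z) * \<xi> (fst z) (snd z) * indicator C (snd z)) \<in> borel_measurable (M \<Otimes>\<^sub>M N)"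
      by (rule borel_measurable_times[OF m1 measurable_compose[OF measurable_snd borel_measurable_indicator[OF C]]])
    have i: "integrable (M \<Otimes>\<^sub>M N) (\<lambda>(x, y). indicat_real B x * \<xi> x y * indicator C y)"
      unfolding case_prod_unfold
    proof (rule MN.integrable_const_bound[where B = 1, OF _ m2])
      have "\<bar>indicat_real B x * \<xi> x y * indicator C y\<bar> \<le> 1" for x y using \<xi>1[of x y] by (simp add: indicator_def)
      then show "AE z in M \<Otimes>\<^sub>M N. norm (indicat_real B (fst z) * \<xi> (fst z) (snd z) * indicator C (snd z)) \<le> 1" by simp
    qed
    have iC: "integrable (M \<Otimes>\<^sub>M N) (indicat_real (A \<inter> (B \<times> C)))" "integrable (M \<Otimes>\<^sub>M N) (indicat_real (B \<times> C))"
      using A B C by (auto simp: MN.emeasure_eq_measure)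
    have "MN.prob (A \<inter> (B \<times> C)) - a * MN.prob (B \<times> C) = (\<integral>z. indicator (A \<inter> (B \<times> C)) z - a * indicator (B \<times> C) z \<partial>(M \<Otimes>\<^sub>M N))"
      using iC A B C by simp
    also have "\<dots> = (\<integral>z. (case z of (x, y) \<Rightarrow> indicat_real B x * \<xi> x y * indicator C y) \<partial>(M \<Otimes>\<^sub>M N))"
      by (intro Bochner_Integration.integral_cong refl) (auto simp: \<xi>_def indicator_def)
    also have "\<dots> = (\<integral>y. (\<integral>x. indicat_real B x * \<xi> x y * indicator C y \<partial>M) \<partial>N)" using MN.integral_snd[OF i] by simp
    also have "\<dots> = (\<integral>y. ?\<psi> y * indicator C y \<partial>N)" by simp
    also have "\<dots> = (\<integral>y. 0 \<partial>N)" using \<psi>0 C by (intro integral_cong_AE) auto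
    finally show ?thesis by simp
  qed
  have all: "MN.prob (A \<inter> E) = a * MN.prob E" if "E \<in> sets (M \<Otimes>\<^sub>M N)" for E
  proof -
    let ?G = "{B \<times> C | B C. B \<in> sets M \<and> C \<in> sets N}"
    have E: "E \<in> sigma_sets (space M \<times> space N) ?G" using that by (simp add: sets_pair_measure)
    have sG: "sigma_sets (space M \<times> space N) ?G = sets (M \<Otimes>\<^sub>M N)" by (simp add: sets_pair_measure)
    from Int_stable_pair_measure_generator pair_measure_closed E show ?thesis
    proof (induction rule: sigma_sets_induct_disjoint)
      case (basic E) then show ?case using rect by auto
    next
      case (compl E)
      then have Em: "E \<in> sets (M \<Otimes>\<^sub>M N)" by (simp add: sG)
      have "A \<inter> (space M \<times> space N - E) = A - (A \<inter> E)"
        using sets.sets_into_space[OF A] by (auto simp: space_pair_measure)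
      then have "MN.prob (A \<inter> (space M \<times> space N - E)) = a - MN.prob (A \<inter> E)"
        using A Em by (simp add: MN.finite_measure_Diff a_def)
      moreover have "MN.prob (space M \<times> space N - E) = 1 - MN.prob E"
        using MN.prob_compl[OF Em] by (simp add: space_pair_measure)
      ultimately show ?case using compl.IH by (simp only: right_diff_distrib mult_1_right)
    next
      case (union F)
      then have Fm: "range F \<subseteq> sets (M \<Otimes>\<^sub>M N)" by (auto simp: sG)
      have "(\<lambda>i. MN.prob (A \<inter> F i)) sums MN.prob (\<Union>i. A \<inter> F i)"
        using Fm A union.hyps(1) by (intro MN.finite_measure_UNION) (auto simp: disjoint_family_on_def)
      moreover have "(\<lambda>i. a * MN.prob (F i)) sums (a * MN.prob (\<Union>i. F i))"
        using Fm union.hyps(1) by (intro sums_mult MN.finite_measure_UNION) auto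
      ultimately have "MN.prob (\<Union>i. A \<inter> F i) = a * MN.prob (\<Union>i. F i)"
        unfolding union.IH by (rule sums_unique2)
      then show ?case by (simp only: Int_UN_distrib)
    qed simp
  qed
  have "a = a * a" using all[OF A] by (simp add: a_def)
  then show "MN.prob A = 0 \<or> MN.prob A = 1" by (auto simp: a_def)
qed

lemma ergodic_swap:
  fixes M :: "'x measure" and N :: "'y measure"
  assumes M: "prob_space M" and N: "prob_space N" and erg: "ergodic G (N \<Otimes>\<^sub>M M) (prod_action S T)"
  shows "ergodic G (M \<Otimes>\<^sub>M N) (prod_action T S)"
  unfolding ergodic_def
proof (intro ballI impI)
  fix A assume A: "A \<in> sets (M \<Otimes>\<^sub>M N)" and inv: "\<forall>g\<in>carrier G. prod_action T S g -` A \<inter> space (M \<Otimes>\<^sub>M N) = A"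
  interpret M: prob_space M by fact
  interpret N: prob_space N by fact
  interpret NM: pair_prob_space N M ..
  let ?s = "\<lambda>(y, x). (x, y)"
  let ?B = "?s -` A \<inter> space (N \<Otimes>\<^sub>M M)"
  have B: "?B \<in> sets (N \<Otimes>\<^sub>M M)" using measurable_sets[OF measurable_pair_swap' A] .
  have "prod_action S T g -` ?B \<inter> space (N \<Otimes>\<^sub>M M) = ?B" if g: "g \<in> carrier G" for g
  proof -
    have i: "(T g x, S g y) \<in> A \<and> x \<in> space M \<and> y \<in> space N \<longleftrightarrow> (x, y) \<in> A" for x y
    proof -
      have "(x, y) \<in> prod_action T S g -` A \<inter> space (M \<Otimes>\<^sub>M N) \<longleftrightarrow> (x, y) \<in> A" using inv g by simp
      then show ?thesis by (simp add: space_pair_measure prod_action_simp)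
    qed
    have sub: "(x, y) \<in> A \<Longrightarrow> x \<in> space M \<and> y \<in> space N" for x y
      using sets.sets_into_space[OF A] by (auto simp: space_pair_measure)
    show ?thesis
    proof (rule Set.set_eqI)
      fix z :: "'y \<times> 'x"
      obtain y x where z: "z = (y, x)" by (cases z)
      have "z \<in> prod_action S T g -` ?B \<inter> space (N \<Otimes>\<^sub>M M) \<longleftrightarrow>
        (T g x, S g y) \<in> A \<and> S g y \<in> space N \<and> T g x \<in> space M \<and> x \<in> space M \<and> y \<in> space N"
        by (auto simp: z space_pair_measure prod_action_simp)
      also have "\<dots> \<longleftrightarrow> (x, y) \<in> A" using i[of x y] sub[of "T g x" "S g y"] by blast
      also have "\<dots> \<longleftrightarrow> z \<in> ?B" using sub[of x y] by (auto simp: z space_pair_measure)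
      finally show "z \<in> prod_action S T g -` ?B \<inter> space (N \<Otimes>\<^sub>M M) \<longleftrightarrow> z \<in> ?B" .
    qed
  qed
  then have "NM.prob ?B = 0 \<or> NM.prob ?B = 1" by (rule ergodicD[OF erg B])
  moreover have "measure (M \<Otimes>\<^sub>M N) A = NM.prob ?B"
  proof -
    have "M \<Otimes>\<^sub>M N = distr (N \<Otimes>\<^sub>M M) (M \<Otimes>\<^sub>M N) ?s"
      using pair_sigma_finite.distr_pair_swap[of M N] M.sigma_finite_measure_axioms N.sigma_finite_measure_axioms
      by (simp add: pair_sigma_finite_def)
    then show ?thesis using measure_distr[OF measurable_pair_swap' A] by metis
  qed
  ultimately show "measure (M \<Otimes>\<^sub>M N) A = 0 \<or> measure (M \<Otimes>\<^sub>M N) A = 1" by simp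
qed

section \<open>Sofic sequences and joint models\<close>

locale sofic_sequence =
  fixes G :: "('g, 'm) monoid_scheme" and V :: "nat \<Rightarrow> 'v set" and \<sigma> :: "nat \<Rightarrow> 'g \<Rightarrow> 'v \<Rightarrow> 'v"
  assumes V: "\<And>i. finite (V i)" "\<And>i. V i \<noteq> {}"
    and \<sigma>_bij: "\<And>i g. g \<in> carrier G \<Longrightarrow> bij_betw (\<sigma> i g) (V i) (V i)"
    and \<sigma>_mult: "\<And>g h. g \<in> carrier G \<Longrightarrow> h \<in> carrier G \<Longrightarrow>
      (\<lambda>i. avg (V i) (\<lambda>v. of_bool (\<sigma> i g (\<sigma> i h v) \<noteq> \<sigma> i (g \<otimes>\<^bsub>G\<^esub> h) v))) \<longlonglongrightarrow> 0"
begin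

lemma \<sigma>_in: "g \<in> carrier G \<Longrightarrow> v \<in> V i \<Longrightarrow> \<sigma> i g v \<in> V i"
  using \<sigma>_bij bij_betwE by blast

lemma sofic_modelsI:
  assumes "limit_system G \<Omega> T" and "\<And>i. prob_space (P i)" shows "sofic_models G \<Omega> T V P \<sigma>"
  by (intro sofic_models.intro assms(1) models.intro sofic_models_axioms.intro V assms(2) \<sigma>_bij \<sigma>_mult)

end

lemma sofic_approximation_subsequence:
  assumes S: "sofic_approximation G V \<sigma>" and r: "strict_mono r"
  shows "sofic_sequence G (V \<circ> r) (\<sigma> \<circ> r)"
proof (rule sofic_sequence.intro)
  show V: "finite ((V \<circ> r) i)" "(V \<circ> r) i \<noteq> {}" for i
    using S by (simp_all add: sofic_approximation_def)
  show "bij_betw ((\<sigma> \<circ> r) i g) ((V \<circ> r) i) ((V \<circ> r) i)" if "g \<in> carrier G" for i g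
    using S that by (simp add: sofic_approximation_def)
  fix g h assume gh: "g \<in> carrier G" "h \<in> carrier G"
  let ?f = "\<lambda>n. real (card {v \<in> V n. \<sigma> n g (\<sigma> n h v) = \<sigma> n (g \<otimes>\<^bsub>G\<^esub> h) v}) / real (card (V n))"
  have "?f \<longlonglongrightarrow> 1" using S gh by (simp add: sofic_approximation_def)
  from LIMSEQ_subseq_LIMSEQ[OF this r] have "(\<lambda>i. 1 - (?f \<circ> r) i) \<longlonglongrightarrow> 1 - 1" by (intro tendsto_diff tendsto_const)
  moreover have "1 - (?f \<circ> r) i = avg ((V \<circ> r) i) (\<lambda>v. of_bool ((\<sigma> \<circ> r) i g ((\<sigma> \<circ> r) i h v) \<noteq> (\<sigma> \<circ> r) i (g \<otimes>\<^bsub>G\<^esub> h) v))" for i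
  proof -
    let ?W = "V (r i)" and ?E = "\<lambda>v. \<sigma> (r i) g (\<sigma> (r i) h v) = \<sigma> (r i) (g \<otimes>\<^bsub>G\<^esub> h) v"
    have W: "finite ?W" "?W \<noteq> {}" using V[of i] by simp_all
    have "card {v \<in> ?W. ?E v} + card {v \<in> ?W. \<not> ?E v} = card ?W"
      using W by (subst card_Un_disjoint[symmetric]) (auto intro: arg_cong[where f = card])
    then have "real (card {v \<in> ?W. \<not> ?E v}) = real (card ?W) - real (card {v \<in> ?W. ?E v})" by linarith
    moreover have "(\<Sum>v\<in>?W. of_bool (\<not> ?E v) :: real) = real (card {v \<in> ?W. \<not> ?E v})"
      using W by (simp add: sum.If_cases of_bool_def Int_def)
    ultimately show ?thesis using W by (simp add: avg_def diff_divide_distrib)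
  qed
  ultimately show "(\<lambda>i. avg ((V \<circ> r) i) (\<lambda>v. of_bool ((\<sigma> \<circ> r) i g ((\<sigma> \<circ> r) i h v) \<noteq> (\<sigma> \<circ> r) i (g \<otimes>\<^bsub>G\<^esub> h) v))) \<longlonglongrightarrow> 0"
    by simp
qed

context represented
begin

lemma conv_observed:
  assumes so: "sofic_sequence G V \<sigma>" and cv: "conv b G K d V \<sigma> m lam"
  shows "models V m"
    and "over G t \<Longrightarrow> models.arr V m (site_mval (\<lambda>j x. d x (l j)) \<sigma> t)"
    and "over G t \<Longrightarrow> models.local_conv V m (site_mval (\<lambda>j x. d x (l j)) \<sigma> t) (\<integral>z. lmon obs t z \<partial>\<Omega>)"
    and "over G s \<Longrightarrow> over G t \<Longrightarrow>
      models.pair_conv V m b (site_mval (\<lambda>j x. d x (l j)) \<sigma> s) (\<integral>z. lmon obs s z \<partial>\<Omega>)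
        (site_mval (\<lambda>j x. d x (l j)) \<sigma> t) (\<integral>z. lmon obs t z \<partial>\<Omega>)"
proof -
  interpret so: sofic_sequence G V \<sigma> by fact
  interpret D: double_models K d "\<lambda>j x. d x (l j)" G V \<sigma> m lam
    by (intro double_models.intro process_models.intro pc.process_coordinates_axioms process_models_axioms.intro
      so.V so.\<sigma>_in conv_prob[OF cv] lam_prob)
  have mom: "D.moment t = (\<integral>z. lmon obs t z \<partial>\<Omega>)" if "over G t" for t
    unfolding D.moment_def integral_lmon[OF that] ..
  show "models V m" by (rule D.models_axioms)
  show "over G t \<Longrightarrow> models.arr V m (site_mval (\<lambda>j x. d x (l j)) \<sigma> t)" by (rule D.A_arr)
  show "over G t \<Longrightarrow> models.local_conv V m (site_mval (\<lambda>j x. d x (l j)) \<sigma> t) (\<integral>z. lmon obs t z \<partial>\<Omega>)"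
    using D.conv_moments(1)[OF cv] mom by simp
  show "over G s \<Longrightarrow> over G t \<Longrightarrow>
      models.pair_conv V m b (site_mval (\<lambda>j x. d x (l j)) \<sigma> s) (\<integral>z. lmon obs s z \<partial>\<Omega>)
        (site_mval (\<lambda>j x. d x (l j)) \<sigma> t) (\<integral>z. lmon obs t z \<partial>\<Omega>)"
    using D.conv_moments(2)[OF cv] mom by simp
qed

text \<open>Composed with the name map, \<open>\<Psi>\<close> agrees with \<open>\<xi>\<close> almost everywhere, and the sigma-algebra is closed under null
  modifications.\<close>

lemma factor_measurable:
  assumes N: "space N = space \<Omega>" "sets N \<subseteq> sets \<Omega>"
    and null: "\<And>A A'. A \<in> sets N \<Longrightarrow> A' \<in> sets \<Omega> \<Longrightarrow> (AE x in \<Omega>. x \<in> A \<longleftrightarrow> x \<in> A') \<Longrightarrow> A' \<in> sets N"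
    and meas: "\<And>j g. g \<in> carrier G \<Longrightarrow> (\<lambda>x. obs j (T g x)) \<in> borel_measurable N"
    and \<Psi>: "\<Psi> \<in> config (carrier G) K d \<rightarrow>\<^sub>M R" and \<xi>: "\<xi> \<in> \<Omega> \<rightarrow>\<^sub>M R" and inv: "AE x in \<Omega>. \<Psi> (\<Xi> x) = \<xi> x"
  shows "\<xi> \<in> N \<rightarrow>\<^sub>M R"
proof (rule measurableI)
  show "\<xi> x \<in> space R" if "x \<in> space N" for x using measurable_space[OF \<xi>] that N(1) by simp
  fix B assume B: "B \<in> sets R"
  have c: "(\<lambda>x. \<Psi> (\<Xi> x)) \<in> N \<rightarrow>\<^sub>M R"
    using measurable_compose[OF generated_measurable[OF N null meas] \<Psi>] .
  show "\<xi> -` B \<inter> space N \<in> sets N"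
  proof (rule null)
    show "(\<lambda>x. \<Psi> (\<Xi> x)) -` B \<inter> space N \<in> sets N" by (rule measurable_sets[OF c B])
    show "\<xi> -` B \<inter> space N \<in> sets \<Omega>" unfolding N(1) by (rule measurable_sets[OF \<xi> B])
    show "AE x in \<Omega>. x \<in> (\<lambda>x. \<Psi> (\<Xi> x)) -` B \<inter> space N \<longleftrightarrow> x \<in> \<xi> -` B \<inter> space N"
      using inv by eventually_elim simp
  qed
qed

end

text \<open>A cover of the third field pulls back to a cover of the pair. Three exceptional sets of measure less than \<open>\<alpha>\<^sup>2 / 3\<close> leave
  the mass that the packing bound requires.\<close>

lemma cov_pair_determined:
  fixes K1 :: "'a set" and K2 :: "'b set" and K3 :: "'c set" and V :: "'v set"
  assumes n1: "metric_net K1 d1 l1" and n2: "metric_net K2 d2 l2" and n3: "metric_net K3 d3 l3"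
    and V: "finite V" "V \<noteq> {}"
    and m1: "m1 \<in> space (prob_algebra (config V K1 d1))" and m2: "m2 \<in> space (prob_algebra (config V K2 d2))"
    and Z: "Z \<in> m1 \<Otimes>\<^sub>M m2 \<rightarrow>\<^sub>M config V K3 d3"
    and G1: "G1 \<in> sets (m1 \<Otimes>\<^sub>M m2)" "measure (m1 \<Otimes>\<^sub>M m2) G1 > 1 - \<alpha>\<^sup>2 / 3"
    and G2: "G2 \<in> sets (m1 \<Otimes>\<^sub>M m2)" "measure (m1 \<Otimes>\<^sub>M m2) G2 > 1 - \<alpha>\<^sup>2 / 3"
    and det1: "\<And>z z'. z \<in> G1 \<Longrightarrow> z' \<in> G1 \<Longrightarrow> avg_metric V d3 (Z z) (Z z') < \<delta>' \<Longrightarrow> avg_metric V d1 (fst z) (fst z') < \<delta>"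
    and det2: "\<And>z z'. z \<in> G2 \<Longrightarrow> z' \<in> G2 \<Longrightarrow> avg_metric V d3 (Z z) (Z z') < \<delta>' \<Longrightarrow> avg_metric V d2 (snd z) (snd z') < \<delta>"
    and \<alpha>: "0 < \<alpha>" "\<alpha> \<le> 1" and \<delta>: "\<delta> > 0" and \<delta>': "\<delta>' > 0"
  shows "cov \<alpha> (2 * \<delta>) (PiE V (\<lambda>_. K1)) (avg_metric V d1) m1 * cov \<alpha> \<delta> (PiE V (\<lambda>_. K2)) (avg_metric V d2) m2 \<le>
    cov (\<alpha>\<^sup>2 / 3) (\<delta>' / 2) (PiE V (\<lambda>_. K3)) (avg_metric V d3) (distr (m1 \<Otimes>\<^sub>M m2) (config V K3 d3) Z)"
proof -
  interpret n1: metric_net K1 d1 l1 by fact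
  interpret n2: metric_net K2 d2 l2 by fact
  interpret n3: metric_net K3 d3 l3 by fact
  note q1 = prob_space_square[OF m1] and q2 = prob_space_square[OF m2]
  interpret m1: prob_space m1 by (rule q1)
  interpret m2: prob_space m2 by (rule q2)
  interpret P: pair_prob_space m1 m2 ..
  let ?P = "m1 \<Otimes>\<^sub>M m2" let ?m3 = "distr ?P (config V K3 d3) Z" let ?\<alpha> = "\<alpha>\<^sup>2 / 3"
  have \<alpha>3: "?\<alpha> > 0" and \<delta>2: "\<delta>' / 2 > 0" using \<alpha> \<delta>' by simp_all
  obtain F3 where F3: "covers ?\<alpha> (\<delta>' / 2) (n3.conf V) (avg_metric V d3) ?m3 F3" "card F3 = cov ?\<alpha> (\<delta>' / 2) (n3.conf V) (avg_metric V d3) ?m3"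
    using n3.covers_exists[OF V distr_config[OF P.prob_space_axioms Z] \<alpha>3 \<delta>2] cov_attained by blast
  define S where "S x = {z \<in> G1 \<inter> G2. avg_metric V d3 x (Z z) < \<delta>' / 2}" for x
  define rep where "rep x = (SOME z. z \<in> S x)" for x
  define I where "I = {x \<in> F3. S x \<noteq> {}}"
  have rep: "rep x \<in> S x" if "x \<in> I" for x using that unfolding rep_def I_def by (auto intro: someI_ex)
  have sp: "z \<in> G1 \<Longrightarrow> z \<in> space ?P" for z using G1(1) sets.sets_into_space by blast
  have Zs: "Z z \<in> n3.conf V" if "z \<in> space ?P" for z using measurable_space[OF Z that] by (simp add: n3.space_config)
  have F3': "F3 \<subseteq> n3.conf V" "finite F3" using F3(1) by (simp_all add: covers_def)
  have I: "finite I" "card I \<le> card F3" using F3'(2) by (auto simp: I_def intro!: card_mono)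
  define F where "F = rep ` I"
  have "rep x \<in> space ?P" if "x \<in> I" for x by (rule sp) (use rep[OF that] in \<open>simp add: S_def\<close>)
  then have "F \<subseteq> space ?P" unfolding F_def by blast
  then have FP: "finite F" "F \<subseteq> n1.conf V \<times> n2.conf V"
    using I(1) by (simp_all add: F_def space_pair_measure q1(3) q2(3) n1.space_config n2.space_config)
  have cF: "card F \<le> card F3" using card_image_le[OF I(1), of rep] I(2) by (simp add: F_def)
  define A3 where "A3 = {x \<in> n3.conf V. \<exists>p\<in>F3. avg_metric V d3 p x < \<delta>' / 2}"
  have A3: "A3 \<in> sets (config V K3 d3)" unfolding A3_def by (rule n3.ball_measurable[OF F3'])
  let ?B = "Z -` A3 \<inter> space ?P"
  have B: "?B \<in> sets ?P" by (rule measurable_sets[OF Z A3])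
  have mB: "P.prob ?B > 1 - ?\<alpha>" using F3(1) measure_distr[OF Z A3] by (simp add: covers_def A3_def)
  let ?U = "{z \<in> space ?P. \<exists>p\<in>F. avg_metric V d1 (fst p) (fst z) < \<delta> \<and> avg_metric V d2 (snd p) (snd z) < \<delta>}"
  have sub: "G1 \<inter> G2 \<inter> ?B \<subseteq> ?U"
  proof
    fix z assume z: "z \<in> G1 \<inter> G2 \<inter> ?B"
    then obtain x where x: "x \<in> F3" "avg_metric V d3 x (Z z) < \<delta>' / 2" by (auto simp: A3_def)
    then have "z \<in> S x" using z by (simp add: S_def)
    then have xI: "x \<in> I" using x by (auto simp: I_def)
    let ?z = "rep x"
    have r: "?z \<in> G1" "?z \<in> G2" "avg_metric V d3 x (Z ?z) < \<delta>' / 2" using rep[OF xI] by (auto simp: S_def)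
    have "avg_metric V d3 (Z ?z) (Z z) < \<delta>'"
      using n3.avg_metric_triangle[OF Zs[OF sp[OF r(1)]] subsetD[OF F3'(1) x(1)] Zs[of z]] z r(3) x(2)
        n3.avg_metric_commute[of V x "Z ?z"] by simp
    then have "avg_metric V d1 (fst ?z) (fst z) < \<delta>" "avg_metric V d2 (snd ?z) (snd z) < \<delta>"
      using z r by (auto intro!: det1 det2)
    then show "z \<in> ?U" using z xI by (auto simp: F_def)
  qed
  have U: "?U \<in> sets ?P"
  proof -
    have "?U = (\<Union>p\<in>F. {z \<in> space ?P. avg_metric V d1 (fst p) (fst z) < \<delta> \<and> avg_metric V d2 (snd p) (snd z) < \<delta>})" by blast
    moreover have "{z \<in> space ?P. avg_metric V d1 (fst p) (fst z) < \<delta> \<and> avg_metric V d2 (snd p) (snd z) < \<delta>} \<in> sets ?P" if "p \<in> F" for p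
    proof -
      have p: "fst p \<in> n1.conf V" "snd p \<in> n2.conf V" using subsetD[OF FP(2) that] unfolding mem_Times_iff by blast+
      have "avg_metric V d1 (fst p) \<in> borel_measurable m1" "avg_metric V d2 (snd p) \<in> borel_measurable m2"
        using n1.avg_metric_measurable[OF p(1)] n2.avg_metric_measurable[OF p(2)]
        unfolding measurable_cong_sets[OF q1(2) refl] measurable_cong_sets[OF q2(2) refl] .
      from measurable_compose[OF measurable_fst this(1)] measurable_compose[OF measurable_snd this(2)]
      have [measurable]: "(\<lambda>z. avg_metric V d1 (fst p) (fst z)) \<in> borel_measurable ?P"
        "(\<lambda>z. avg_metric V d2 (snd p) (snd z)) \<in> borel_measurable ?P" .
      show ?thesis by measurable
    qed
    ultimately show ?thesis using FP(1) by auto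
  qed
  have "space ?P - ?U \<subseteq> (space ?P - G1) \<union> (space ?P - G2) \<union> (space ?P - ?B)" using sub by blast
  then have "P.prob (space ?P - ?U) \<le> P.prob ((space ?P - G1) \<union> (space ?P - G2) \<union> (space ?P - ?B))"
    using B G1 G2 by (intro P.finite_measure_mono) auto
  also have "\<dots> \<le> P.prob ((space ?P - G1) \<union> (space ?P - G2)) + P.prob (space ?P - ?B)"
    using B G1 G2 by (intro measure_Un_le) auto
  also have "P.prob ((space ?P - G1) \<union> (space ?P - G2)) \<le> P.prob (space ?P - G1) + P.prob (space ?P - G2)"
    using G1 G2 by (intro measure_Un_le) auto
  finally have "P.prob ?U > 1 - \<alpha>\<^sup>2"
    using P.prob_compl[OF U] P.prob_compl[OF G1(1)] P.prob_compl[OF G2(1)] P.prob_compl[OF B] mB G1(2) G2(2) by linarith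
  from cov_product_lower[OF n1 n2 V m1 m2 FP \<alpha> \<delta> this] cF show ?thesis unfolding F3(2) by (rule order_trans)
qed

section \<open>Two systems and their product\<close>

locale two_systems = s1: represented G M T K1 d1 l1 \<Phi>1 \<mu> + s2: represented G N S K2 d2 l2 \<Phi>2 \<nu>
    + s3: represented G "M \<Otimes>\<^sub>M N" "prod_action T S" K3 d3 l3 \<Phi>3 \<theta>
  for G :: "('g, 'm) monoid_scheme" and M :: "'x measure" and T :: "'g \<Rightarrow> 'x \<Rightarrow> 'x"
    and K1 :: "'a set" and d1 l1 \<Phi>1 \<mu>
    and N :: "'y measure" and S :: "'g \<Rightarrow> 'y \<Rightarrow> 'y" and K2 :: "'b set" and d2 l2 \<Phi>2 \<nu>
    and K3 :: "'c set" and d3 l3 \<Phi>3 \<theta> +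
  fixes \<Psi>1 :: "('g \<Rightarrow> 'a) \<Rightarrow> 'x" and \<Psi>2 :: "('g \<Rightarrow> 'b) \<Rightarrow> 'y" and \<Psi>3 :: "('g \<Rightarrow> 'c) \<Rightarrow> 'x \<times> 'y"
  assumes \<Psi>1: "\<Psi>1 \<in> config (carrier G) K1 d1 \<rightarrow>\<^sub>M M" "AE x in M. \<Psi>1 (\<Phi>1 x) = x"
    and \<Psi>2: "\<Psi>2 \<in> config (carrier G) K2 d2 \<rightarrow>\<^sub>M N" "AE y in N. \<Psi>2 (\<Phi>2 y) = y"
    and \<Psi>3: "\<Psi>3 \<in> config (carrier G) K3 d3 \<rightarrow>\<^sub>M M \<Otimes>\<^sub>M N" "AE z in M \<Otimes>\<^sub>M N. \<Psi>3 (\<Phi>3 z) = z"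
begin

abbreviation \<Omega> where "\<Omega> \<equiv> M \<Otimes>\<^sub>M N"
abbreviation TS where "TS \<equiv> prod_action T S"

lemma distr_first: "distr \<Omega> M fst = M" by (rule s2.distr_pair_fst)

lemma distr_second: "distr \<Omega> N snd = N"
proof (rule measure_eqI)
  fix A assume "A \<in> sets (distr \<Omega> N snd)"
  then have A: "A \<in> sets N" by simp
  then have "snd -` A \<inter> space \<Omega> = space M \<times> A" using sets.sets_into_space[OF A] by (auto simp: space_pair_measure)
  then show "emeasure (distr \<Omega> N snd) A = emeasure N A"
    using A by (simp add: emeasure_distr s2.emeasure_pair_measure_Times s1.emeasure_space_1)
qed simp

lemma AE_first: assumes "AE x in M. Q x" shows "AE z in \<Omega>. Q (fst z)"
proof -
  have "AE x in distr \<Omega> M fst. Q x" using assms unfolding distr_first .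
  then show ?thesis by (rule AE_distrD[OF measurable_fst])
qed

lemma AE_second: assumes "AE y in N. Q y" shows "AE x in \<Omega>. Q (snd x)"
proof -
  have "AE y in distr \<Omega> N snd. Q y" using assms unfolding distr_second .
  then show ?thesis by (rule AE_distrD[OF measurable_snd])
qed

sublocale r1: represented G \<Omega> TS K1 d1 l1 "\<lambda>x. \<Phi>1 (fst x)" \<mu>
proof (intro represented.intro represented_axioms.intro s3.limit_system_axioms s1.net.metric_net_axioms)
  show m: "(\<lambda>x. \<Phi>1 (fst x)) \<in> \<Omega> \<rightarrow>\<^sub>M config (carrier G) K1 d1" by (rule measurable_compose[OF measurable_fst s1.\<Xi>])
  have "distr (distr \<Omega> M fst) (config (carrier G) K1 d1) \<Phi>1 = distr \<Omega> (config (carrier G) K1 d1) (\<Phi>1 \<circ> fst)"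
    by (rule distr_distr[OF s1.\<Xi> measurable_fst])
  then show "distr \<Omega> (config (carrier G) K1 d1) (\<lambda>x. \<Phi>1 (fst x)) = \<mu>"
    using s1.\<Xi>_distr distr_first by (simp add: comp_def)
  show "AE x in \<Omega>. \<Phi>1 (fst (TS g x)) = shift G g (\<Phi>1 (fst x))" if "g \<in> carrier G" for g
    using AE_first[OF s1.\<Xi>_equiv[OF that]] by (simp add: prod_action_simp)
qed

sublocale r2: represented G \<Omega> TS K2 d2 l2 "\<lambda>x. \<Phi>2 (snd x)" \<nu>
proof (intro represented.intro represented_axioms.intro s3.limit_system_axioms s2.net.metric_net_axioms)
  show m: "(\<lambda>x. \<Phi>2 (snd x)) \<in> \<Omega> \<rightarrow>\<^sub>M config (carrier G) K2 d2" by (rule measurable_compose[OF measurable_snd s2.\<Xi>])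
  have "distr (distr \<Omega> N snd) (config (carrier G) K2 d2) \<Phi>2 = distr \<Omega> (config (carrier G) K2 d2) (\<Phi>2 \<circ> snd)"
    by (rule distr_distr[OF s2.\<Xi> measurable_snd])
  then show "distr \<Omega> (config (carrier G) K2 d2) (\<lambda>x. \<Phi>2 (snd x)) = \<nu>"
    using s2.\<Xi>_distr distr_second by (simp add: comp_def)
  show "AE x in \<Omega>. \<Phi>2 (snd (TS g x)) = shift G g (\<Phi>2 (snd x))" if "g \<in> carrier G" for g
    using AE_second[OF s2.\<Xi>_equiv[OF that]] by (simp add: prod_action_simp)
qed

abbreviation obs12 where "obs12 \<equiv> case_sum r1.obs r2.obs"

lemma dense3:
  assumes "s3.bdd f" "\<eta> > 0" shows "\<exists>p. pover G p \<and> s3.ldist f (s3.lpol s3.obs p) < \<eta>"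
proof (rule s3.polynomials_dense[OF s3.obs_bdd _ assms])
  fix N' :: "('x \<times> 'y) measure"
  assume N': "space N' = space \<Omega>" "sets N' \<subseteq> sets \<Omega>"
    "\<And>A A'. A \<in> sets N' \<Longrightarrow> A' \<in> sets \<Omega> \<Longrightarrow> (AE x in \<Omega>. x \<in> A \<longleftrightarrow> x \<in> A') \<Longrightarrow> A' \<in> sets N'"
    "\<And>j g. g \<in> carrier G \<Longrightarrow> (\<lambda>x. s3.obs j (TS g x)) \<in> borel_measurable N'"
  have "(\<lambda>x. x) \<in> N' \<rightarrow>\<^sub>M \<Omega>" by (rule s3.factor_measurable[OF N' \<Psi>3(1) measurable_ident_sets[OF refl] \<Psi>3(2)])
  from measurable_sets[OF this] show "sets \<Omega> \<subseteq> sets N'"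
    using sets.sets_into_space[of _ \<Omega>] by (auto simp: N'(1) Int_absorb2)
qed

lemma dense12:
  assumes "s3.bdd f" "\<eta> > 0" shows "\<exists>p. pover G p \<and> s3.ldist f (s3.lpol obs12 p) < \<eta>"
proof (rule s3.polynomials_dense[OF _ _ assms])
  show "s3.bdd (obs12 j)" for j using r1.obs_bdd r2.obs_bdd by (cases j) simp_all
  fix N' :: "('x \<times> 'y) measure"
  assume N': "space N' = space \<Omega>" "sets N' \<subseteq> sets \<Omega>"
    "\<And>A A'. A \<in> sets N' \<Longrightarrow> A' \<in> sets \<Omega> \<Longrightarrow> (AE x in \<Omega>. x \<in> A \<longleftrightarrow> x \<in> A') \<Longrightarrow> A' \<in> sets N'"
    and m: "\<And>j g. g \<in> carrier G \<Longrightarrow> (\<lambda>x. obs12 j (TS g x)) \<in> borel_measurable N'"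
  have m1: "(\<lambda>x. r1.obs j (TS g x)) \<in> borel_measurable N'" if "g \<in> carrier G" for j g using m[OF that, of "Inl j"] by simp
  have m2: "(\<lambda>x. r2.obs j (TS g x)) \<in> borel_measurable N'" if "g \<in> carrier G" for j g using m[OF that, of "Inr j"] by simp
  have "fst \<in> N' \<rightarrow>\<^sub>M M" by (rule r1.factor_measurable[OF N' m1 \<Psi>1(1) measurable_fst AE_first[OF \<Psi>1(2)]])
  moreover have "snd \<in> N' \<rightarrow>\<^sub>M N" by (rule r2.factor_measurable[OF N' m2 \<Psi>2(1) measurable_snd AE_second[OF \<Psi>2(2)]])
  ultimately have "(\<lambda>x. (fst x, snd x)) \<in> N' \<rightarrow>\<^sub>M \<Omega>" by (rule measurable_Pair)
  from measurable_sets[OF this] show "sets \<Omega> \<subseteq> sets N'"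
    using sets.sets_into_space[of _ \<Omega>] by (auto simp: N'(1) Int_absorb2)
qed

lemma integral_lmon12:
  assumes t: "over G t"
  shows "(\<integral>z. s3.lmon obs12 t z \<partial>\<Omega>) = (\<integral>x. s1.lmon s1.obs (lefts t) x \<partial>M) * (\<integral>y. s2.lmon s2.obs (rights t) y \<partial>N)"
proof -
  have b1: "s1.bdd (s1.lmon s1.obs (lefts t))" by (intro s1.bdd_lmon s1.obs_bdd carrier_lefts_rights t)
  have b2: "s2.bdd (s2.lmon s2.obs (rights t))" by (intro s2.bdd_lmon s2.obs_bdd carrier_lefts_rights t)
  obtain B1 where B1: "\<And>x. x \<in> space M \<Longrightarrow> \<bar>s1.lmon s1.obs (lefts t) x\<bar> \<le> B1" using s1.bdd_bounded[OF b1] by blast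
  obtain B2 where B2: "\<And>y. y \<in> space N \<Longrightarrow> \<bar>s2.lmon s2.obs (rights t) y\<bar> \<le> B2" using s2.bdd_bounded[OF b2] by blast
  have o1: "r1.obs j (TS g z) = s1.obs j (T g (fst z))" for j g z
    unfolding r1.obs_def s1.obs_def r1.\<phi>_def s1.\<phi>_def prod_action_simp fst_conv ..
  have o2: "r2.obs j (TS g z) = s2.obs j (S g (snd z))" for j g z
    unfolding r2.obs_def s2.obs_def r2.\<phi>_def s2.\<phi>_def prod_action_simp snd_conv ..
  have eq: "s3.lmon obs12 t z = s1.lmon s1.obs (lefts t) (fst z) * s2.lmon s2.obs (rights t) (snd z)" for z
    unfolding s3.lmon_def s1.lmon_def s2.lmon_def mval_sum[of _ t] fst_conv snd_conv sum.case o1 o2 ..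
  show ?thesis unfolding eq
    by (rule integral_pair_mult[OF s1.prob s2.prob s1.bdd_measurable[OF b1] s2.bdd_measurable[OF b2] B1 B2])
qed

text \<open>The names of both factors are tracked by fields over the given models. These fields are good models of the factors, and
  together they determine the given models because the two factors generate the product.\<close>

lemma factor_models:
  assumes so: "sofic_sequence G V \<sigma>" and cv: "conv b G K3 d3 V \<sigma> m3 \<theta>"
  obtains m1 m2 where "conv b G K1 d1 V \<sigma> m1 \<mu>" "conv b G K2 d2 V \<sigma> m2 \<nu>"
    and "\<And>\<epsilon> \<delta>. \<epsilon> > 0 \<Longrightarrow> \<delta> > 0 \<Longrightarrow> \<exists>\<delta>'>0. \<forall>\<^sub>F i in sequentially.
      cov (3 * \<epsilon>) \<delta> (PiE (V i) (\<lambda>_. K3)) (avg_metric (V i) d3) (m3 i) \<le>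
      cov \<epsilon> \<delta>' (PiE (V i) (\<lambda>_. K1)) (avg_metric (V i) d1) (m1 i) *
      cov \<epsilon> \<delta>' (PiE (V i) (\<lambda>_. K2)) (avg_metric (V i) d2) (m2 i)"
proof -
  interpret so: sofic_sequence G V \<sigma> by fact
  note co = s3.conv_observed[OF so cv] and pr = prob_space_square[OF conv_prob[OF cv]]
  have mset: "f \<in> m3 i \<rightarrow>\<^sub>M R" if "f \<in> config (V i) K3 d3 \<rightarrow>\<^sub>M R" for f i and R :: "'r measure"
    using that measurable_cong_sets[OF pr(2) refl] by blast
  interpret sm: sofic_models G \<Omega> TS V m3 \<sigma> by (rule so.sofic_modelsI[OF s3.limit_system_axioms pr(1)])
  let ?u = "\<lambda>(i :: nat) v x. x v :: 'c"
  have u: "?u i v \<in> m3 i \<rightarrow>\<^sub>M metric_borel K3 d3" if "v \<in> V i" for i v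
    by (rule mset measurable_component_singleton that)+
  let ?X = "\<lambda>j i v x. d3 (x v) (l3 j)"
  have amon: "sm.amon ?X t = site_mval (\<lambda>j x. d3 x (l3 j)) \<sigma> t" for t
    by (simp add: sm.amon_def site_mval_def fun_eq_iff)
  interpret tr: tracking G \<Omega> TS V m3 \<sigma> s3.obs ?X
  proof (intro tracking.intro sm.sofic_models_axioms tracking_axioms.intro s3.obs_bdd dense3)
    show "sm.arr (?X j)" for j by (rule sm.represented_arr[OF s3.net.metric_net_axioms u])
    show "sm.local_conv (sm.amon ?X t) (\<integral>z. s3.lmon s3.obs t z \<partial>\<Omega>)" if "over G t" for t
      unfolding amon by (rule co(3)[OF that])
  qed
  have mix: "tr.mixes b" by (rule tr.mixesI) (unfold amon, rule co(4))
  obtain y1 where y1: "\<And>i v. v \<in> V i \<Longrightarrow> y1 i v \<in> m3 i \<rightarrow>\<^sub>M metric_borel K1 d1"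
    and tr1: "\<And>j. tr.tracks (\<lambda>z. d1 (r1.\<phi> z) (l1 j)) (\<lambda>i v x. d1 (y1 i v x) (l1 j))"
    using tr.tracking_field[OF s1.net.metric_net_axioms r1.\<phi>_measurable] by blast
  obtain y2 where y2: "\<And>i v. v \<in> V i \<Longrightarrow> y2 i v \<in> m3 i \<rightarrow>\<^sub>M metric_borel K2 d2"
    and tr2: "\<And>j. tr.tracks (\<lambda>z. d2 (r2.\<phi> z) (l2 j)) (\<lambda>i v x. d2 (y2 i v x) (l2 j))"
    using tr.tracking_field[OF s2.net.metric_net_axioms r2.\<phi>_measurable] by blast
  have tr1': "tr.tracks (r1.obs j) (\<lambda>i v x. d1 (y1 i v x) (l1 j))" for j unfolding r1.obs_def[abs_def] by (rule tr1)
  have tr2': "tr.tracks (r2.obs j) (\<lambda>i v x. d2 (y2 i v x) (l2 j))" for j unfolding r2.obs_def[abs_def] by (rule tr2)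
  let ?Y1 = "\<lambda>i x. \<lambda>v\<in>V i. y1 i v x" and ?Y2 = "\<lambda>i x. \<lambda>v\<in>V i. y2 i v x"
  let ?m1 = "\<lambda>i. distr (m3 i) (config (V i) K1 d1) (?Y1 i)" and ?m2 = "\<lambda>i. distr (m3 i) (config (V i) K2 d2) (?Y2 i)"
  have Y: "?Y1 i \<in> m3 i \<rightarrow>\<^sub>M config (V i) K1 d1" "?Y2 i \<in> m3 i \<rightarrow>\<^sub>M config (V i) K2 d2" for i
    by (intro measurable_restrict y1, assumption) (intro measurable_restrict y2, assumption)
  have "conv b G K1 d1 V \<sigma> ?m1 \<mu>" by (rule tr.conv_field[OF r1.represented_axioms y1 tr1' mix])
  moreover have "conv b G K2 d2 V \<sigma> ?m2 \<nu>" by (rule tr.conv_field[OF r2.represented_axioms y2 tr2' mix])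
  moreover have "\<exists>\<delta>'>0. \<forall>\<^sub>F i in sequentially.
      cov (3 * \<epsilon>) \<delta> (PiE (V i) (\<lambda>_. K3)) (avg_metric (V i) d3) (m3 i) \<le>
      cov \<epsilon> \<delta>' (PiE (V i) (\<lambda>_. K1)) (avg_metric (V i) d1) (?m1 i) *
      cov \<epsilon> \<delta>' (PiE (V i) (\<lambda>_. K2)) (avg_metric (V i) d2) (?m2 i)" if \<epsilon>: "\<epsilon> > 0" and \<delta>: "\<delta> > 0" for \<epsilon> \<delta>
  proof -
    let ?D = "\<lambda>i x x'. avg_metric (V i) d1 (?Y1 i x) (?Y1 i x') + avg_metric (V i) d2 (?Y2 i x) (?Y2 i x')"
    let ?X' = "case_sum (\<lambda>j i v x. d1 (y1 i v x) (l1 j)) (\<lambda>j i v x. d2 (y2 i v x) (l2 j))"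
    have tr': "tr.tracks (obs12 j) (?X' j)" for j using tr1' tr2' by (cases j) simp_all
    have tru: "tr.tracks (\<lambda>z. d3 (s3.\<phi> z) (l3 j)) (\<lambda>i v x. d3 (?u i v x) (l3 j))" for j
      using tr.tracks_base[of j] by (simp add: s3.obs_def[abs_def])
    have Lip: "avg (V i) (\<lambda>v. \<bar>?X' j i v x - ?X' j i v x'\<bar>) \<le> ?D i x x'" if x: "x \<in> space (m3 i)" "x' \<in> space (m3 i)" for j i x x'
    proof -
      have in1: "y1 i v x \<in> K1" "y1 i v x' \<in> K1" and in2: "y2 i v x \<in> K2" "y2 i v x' \<in> K2" if "v \<in> V i" for v
        using measurable_space[OF y1[OF that]] measurable_space[OF y2[OF that]] x by simp_all
      have "avg (V i) (\<lambda>v. \<bar>?X' j i v x - ?X' j i v x'\<bar>) \<le> avg (V i) (\<lambda>v. d1 (y1 i v x) (y1 i v x') + d2 (y2 i v x) (y2 i v x'))"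
      proof (rule avg_mono)
        fix v assume v: "v \<in> V i"
        show "\<bar>?X' j i v x - ?X' j i v x'\<bar> \<le> d1 (y1 i v x) (y1 i v x') + d2 (y2 i v x) (y2 i v x')"
        proof (cases j)
          case (Inl k)
          show ?thesis
            unfolding Inl sum.case
            using s1.net.distance_difference[OF in1[OF v] s1.net.l, of k] s2.net.nonneg[of "y2 i v x" "y2 i v x'"] by linarith
        next
          case (Inr k)
          show ?thesis
            unfolding Inr sum.case
            using s2.net.distance_difference[OF in2[OF v] s2.net.l, of k] s1.net.nonneg[of "y1 i v x" "y1 i v x'"] by linarith
        qed
      qed
      also have "\<dots> = ?D i x x'"
        unfolding avg_add avg_metric_avg by (intro arg_cong2[where f = "(+)"] avg_cong) simp_all
      finally show ?thesis .
    qed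
    obtain \<delta>' where \<delta>': "\<delta>' > 0" and good: "\<forall>\<^sub>F i in sequentially. \<exists>Good\<in>sets (m3 i). measure (m3 i) Good > 1 - \<epsilon> \<and>
      (\<forall>x\<in>Good. \<forall>x'\<in>Good. ?D i x x' < \<delta>' \<longrightarrow> avg (V i) (\<lambda>v. d3 (?u i v x) (?u i v x')) < \<delta>)"
      using tr.asymptotically_determined[where u = ?u and \<phi> = s3.\<phi> and D = ?D and c' = obs12 and X' = ?X',
        OF s3.net.metric_net_axioms u tru tr' dense12 Lip \<epsilon> \<delta>] by blast
    show ?thesis
    proof (intro exI[of _ "\<delta>' / 4"] conjI eventually_mono[OF good])
      fix i assume "\<exists>Good\<in>sets (m3 i). measure (m3 i) Good > 1 - \<epsilon> \<and>
        (\<forall>x\<in>Good. \<forall>x'\<in>Good. ?D i x x' < \<delta>' \<longrightarrow> avg (V i) (\<lambda>v. d3 (?u i v x) (?u i v x')) < \<delta>)"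
      then obtain Good where Good: "Good \<in> sets (m3 i)" "measure (m3 i) Good > 1 - \<epsilon>"
        and det: "\<And>x x'. x \<in> Good \<Longrightarrow> x' \<in> Good \<Longrightarrow> ?D i x x' < \<delta>' \<Longrightarrow> avg_metric (V i) d3 x x' < \<delta>"
        unfolding avg_metric_avg by blast
      have "cov (3 * \<epsilon>) \<delta> (PiE (V i) (\<lambda>_. K3)) (avg_metric (V i) d3) (distr (m3 i) (config (V i) K3 d3) (\<lambda>x. x)) \<le>
        cov \<epsilon> (\<delta>' / 4) (PiE (V i) (\<lambda>_. K1)) (avg_metric (V i) d1) (?m1 i) *
        cov \<epsilon> (\<delta>' / 4) (PiE (V i) (\<lambda>_. K2)) (avg_metric (V i) d2) (?m2 i)"
        by (rule cov_determined[OF s1.net.metric_net_axioms s2.net.metric_net_axioms s3.net.metric_net_axioms so.V pr(1) Y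
          mset[OF measurable_ident_sets[OF refl]] Good det \<epsilon> \<delta>'])
      moreover have "distr (m3 i) (config (V i) K3 d3) (\<lambda>x. x) = m3 i" by (rule distr_id2[OF pr(2)[symmetric]])
      ultimately show "cov (3 * \<epsilon>) \<delta> (PiE (V i) (\<lambda>_. K3)) (avg_metric (V i) d3) (m3 i) \<le>
        cov \<epsilon> (\<delta>' / 4) (PiE (V i) (\<lambda>_. K1)) (avg_metric (V i) d1) (?m1 i) *
        cov \<epsilon> (\<delta>' / 4) (PiE (V i) (\<lambda>_. K2)) (avg_metric (V i) d2) (?m2 i)" by simp
    qed (use \<delta>' in simp)
  qed
  ultimately show ?thesis by (rule that)
qed

text \<open>Over products of good models the observables of the factors have the local moments of the product system by independence. The field that tracks
  the third process is a good model, and it determines both coordinates because the third process generates the product.\<close>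

lemma product_models:
  assumes so: "sofic_sequence G V \<sigma>" and cv1: "conv b G K1 d1 V \<sigma> m1 \<mu>" and cv2: "conv b G K2 d2 V \<sigma> m2 \<nu>"
    and b: "b \<or> ergodic G \<Omega> TS"
  obtains m3 where "conv b G K3 d3 V \<sigma> m3 \<theta>"
    and "\<And>\<alpha> \<delta>. 0 < \<alpha> \<Longrightarrow> \<alpha> \<le> 1 \<Longrightarrow> \<delta> > 0 \<Longrightarrow> \<exists>\<delta>'>0. \<forall>\<^sub>F i in sequentially.
      cov \<alpha> (2 * \<delta>) (PiE (V i) (\<lambda>_. K1)) (avg_metric (V i) d1) (m1 i) *
      cov \<alpha> \<delta> (PiE (V i) (\<lambda>_. K2)) (avg_metric (V i) d2) (m2 i) \<le>
      cov (\<alpha>\<^sup>2 / 3) \<delta>' (PiE (V i) (\<lambda>_. K3)) (avg_metric (V i) d3) (m3 i)"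
proof -
  interpret so: sofic_sequence G V \<sigma> by fact
  note co1 = s1.conv_observed[OF so cv1] and pr1 = prob_space_square[OF conv_prob[OF cv1]]
  note co2 = s2.conv_observed[OF so cv2] and pr2 = prob_space_square[OF conv_prob[OF cv2]]
  interpret mp: model_product V m1 m2 by (intro model_product.intro co1(1) co2(1))
  interpret sm: sofic_models G \<Omega> TS V mp.PQ \<sigma> by (rule so.sofic_modelsI[OF s3.limit_system_axioms mp.prob_PQ])
  let ?u1 = "\<lambda>(i :: nat) v z. fst z v :: 'a" and ?u2 = "\<lambda>(i :: nat) v z. snd z v :: 'b"
  have u1: "?u1 i v \<in> mp.PQ i \<rightarrow>\<^sub>M metric_borel K1 d1" if "v \<in> V i" for i v
  proof (rule measurable_compose[OF measurable_fst])
    show "(\<lambda>x. x v) \<in> m1 i \<rightarrow>\<^sub>M metric_borel K1 d1"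
      unfolding measurable_cong_sets[OF pr1(2) refl] by (rule measurable_component_singleton[OF that])
  qed
  have u2: "?u2 i v \<in> mp.PQ i \<rightarrow>\<^sub>M metric_borel K2 d2" if "v \<in> V i" for i v
  proof (rule measurable_compose[OF measurable_snd])
    show "(\<lambda>x. x v) \<in> m2 i \<rightarrow>\<^sub>M metric_borel K2 d2"
      unfolding measurable_cong_sets[OF pr2(2) refl] by (rule measurable_component_singleton[OF that])
  qed
  let ?X = "case_sum (\<lambda>j i v z. d1 (fst z v) (l1 j)) (\<lambda>j i v z. d2 (snd z v) (l2 j))"
  let ?A1 = "site_mval (\<lambda>j x. d1 x (l1 j)) \<sigma>" and ?A2 = "site_mval (\<lambda>j x. d2 x (l2 j)) \<sigma>"
  have amon: "sm.amon ?X t = mp.ten (?A1 (lefts t)) (?A2 (rights t))" for t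
    unfolding sm.amon_def site_mval_def fun_eq_iff by (subst mval_sum) simp
  interpret tr: tracking G \<Omega> TS V mp.PQ \<sigma> obs12 ?X
  proof (intro tracking.intro sm.sofic_models_axioms tracking_axioms.intro dense12)
    show "s3.bdd (obs12 j)" for j using r1.obs_bdd r2.obs_bdd by (cases j) simp_all
    show "mp.AB.arr (?X j)" for j
      using sm.represented_arr[OF s1.net.metric_net_axioms u1] sm.represented_arr[OF s2.net.metric_net_axioms u2]
      by (cases j) simp_all
    show "mp.AB.local_conv (sm.amon ?X t) (\<integral>z. s3.lmon obs12 t z \<partial>\<Omega>)" if t: "over G t" for t
      unfolding amon integral_lmon12[OF t]
      by (intro mp.local_conv_ten co1(2,3) co2(2,3) carrier_lefts_rights t)
  qed
  have mix: "tr.mixes b"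
  proof (cases b)
    case True
    have "mp.AB.pair_conv True (sm.amon ?X s) (\<integral>z. s3.lmon obs12 s z \<partial>\<Omega>) (sm.amon ?X t) (\<integral>z. s3.lmon obs12 t z \<partial>\<Omega>)"
      if s: "over G s" and t: "over G t" for s t
      unfolding amon integral_lmon12[OF t] integral_lmon12[OF s]
      using True by (intro mp.pair_conv_ten co1(2) co2(2) carrier_lefts_rights t s
        co1(4)[unfolded True[THEN eqTrueI]] co2(4)[unfolded True[THEN eqTrueI]])
    then show ?thesis using True tr.mixesI[of True] by simp
  next
    case False
    then have "ergodic G \<Omega> TS" using b by simp
    then show ?thesis using False tr.ergodic_mean_conv by (simp add: tr.mixes_def)
  qed
  obtain y3 where y3: "\<And>i v. v \<in> V i \<Longrightarrow> y3 i v \<in> mp.PQ i \<rightarrow>\<^sub>M metric_borel K3 d3"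
    and tr3: "\<And>j. tr.tracks (\<lambda>z. d3 (s3.\<phi> z) (l3 j)) (\<lambda>i v x. d3 (y3 i v x) (l3 j))"
    using tr.tracking_field[OF s3.net.metric_net_axioms s3.\<phi>_measurable] by blast
  have tr3': "tr.tracks (s3.obs j) (\<lambda>i v x. d3 (y3 i v x) (l3 j))" for j unfolding s3.obs_def[abs_def] by (rule tr3)
  let ?Y3 = "\<lambda>i x. \<lambda>v\<in>V i. y3 i v x"
  let ?m3 = "\<lambda>i. distr (mp.PQ i) (config (V i) K3 d3) (?Y3 i)"
  have Y: "?Y3 i \<in> mp.PQ i \<rightarrow>\<^sub>M config (V i) K3 d3" for i by (intro measurable_restrict y3)
  have "conv b G K3 d3 V \<sigma> ?m3 \<theta>" by (rule tr.conv_field[OF s3.represented_axioms y3 tr3' mix])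
  moreover have "\<exists>\<delta>'>0. \<forall>\<^sub>F i in sequentially.
      cov \<alpha> (2 * \<delta>) (PiE (V i) (\<lambda>_. K1)) (avg_metric (V i) d1) (m1 i) *
      cov \<alpha> \<delta> (PiE (V i) (\<lambda>_. K2)) (avg_metric (V i) d2) (m2 i) \<le>
      cov (\<alpha>\<^sup>2 / 3) \<delta>' (PiE (V i) (\<lambda>_. K3)) (avg_metric (V i) d3) (?m3 i)" if \<alpha>: "0 < \<alpha>" "\<alpha> \<le> 1" and \<delta>: "\<delta> > 0" for \<alpha> \<delta>
  proof -
    let ?D = "\<lambda>i z z'. avg_metric (V i) d3 (?Y3 i z) (?Y3 i z')"
    have \<alpha>3: "\<alpha>\<^sup>2 / 3 > 0" using \<alpha> by simp
    have Lip: "avg (V i) (\<lambda>v. \<bar>d3 (y3 i v x) (l3 j) - d3 (y3 i v x') (l3 j)\<bar>) \<le> ?D i x x'"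
      if x: "x \<in> space (mp.PQ i)" "x' \<in> space (mp.PQ i)" for j i x x'
      unfolding avg_metric_avg
    proof (rule avg_mono)
      fix v assume v: "v \<in> V i"
      show "\<bar>d3 (y3 i v x) (l3 j) - d3 (y3 i v x') (l3 j)\<bar> \<le> d3 (?Y3 i x v) (?Y3 i x' v)"
        using s3.net.distance_difference[OF _ _ s3.net.l, of "y3 i v x" "y3 i v x'" j]
          measurable_space[OF y3[OF v] x(1)] measurable_space[OF y3[OF v] x(2)] v by simp
    qed
    have tru1: "tr.tracks (\<lambda>z. d1 (r1.\<phi> z) (l1 j)) (\<lambda>i v x. d1 (?u1 i v x) (l1 j))" for j
      using tr.tracks_base[of "Inl j"] by (simp add: r1.obs_def[abs_def])
    have tru2: "tr.tracks (\<lambda>z. d2 (r2.\<phi> z) (l2 j)) (\<lambda>i v x. d2 (?u2 i v x) (l2 j))" for j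
      using tr.tracks_base[of "Inr j"] by (simp add: r2.obs_def[abs_def])
    obtain \<delta>1 where \<delta>1: "\<delta>1 > 0" and good1: "\<forall>\<^sub>F i in sequentially. \<exists>Good\<in>sets (mp.PQ i). measure (mp.PQ i) Good > 1 - \<alpha>\<^sup>2 / 3 \<and>
      (\<forall>x\<in>Good. \<forall>x'\<in>Good. ?D i x x' < \<delta>1 \<longrightarrow> avg (V i) (\<lambda>v. d1 (?u1 i v x) (?u1 i v x')) < \<delta>)"
      using tr.asymptotically_determined[where u = ?u1 and \<phi> = r1.\<phi> and D = ?D and c' = s3.obs and X' = "\<lambda>j i v x. d3 (y3 i v x) (l3 j)",
        OF s1.net.metric_net_axioms u1 tru1 tr3' dense3 Lip \<alpha>3 \<delta>] by blast
    obtain \<delta>2 where \<delta>2: "\<delta>2 > 0" and good2: "\<forall>\<^sub>F i in sequentially. \<exists>Good\<in>sets (mp.PQ i). measure (mp.PQ i) Good > 1 - \<alpha>\<^sup>2 / 3 \<and>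
      (\<forall>x\<in>Good. \<forall>x'\<in>Good. ?D i x x' < \<delta>2 \<longrightarrow> avg (V i) (\<lambda>v. d2 (?u2 i v x) (?u2 i v x')) < \<delta>)"
      using tr.asymptotically_determined[where u = ?u2 and \<phi> = r2.\<phi> and D = ?D and c' = s3.obs and X' = "\<lambda>j i v x. d3 (y3 i v x) (l3 j)",
        OF s2.net.metric_net_axioms u2 tru2 tr3' dense3 Lip \<alpha>3 \<delta>] by blast
    have \<delta>12: "min \<delta>1 \<delta>2 > 0" using \<delta>1 \<delta>2 by simp
    show ?thesis
    proof (intro exI[of _ "min \<delta>1 \<delta>2 / 2"] conjI eventually_mono[OF eventually_conj[OF good1 good2]], goal_cases)
      case (2 i)
      then obtain G1 G2 where G1: "G1 \<in> sets (mp.PQ i)" "measure (mp.PQ i) G1 > 1 - \<alpha>\<^sup>2 / 3"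
        and det1: "\<And>x x'. x \<in> G1 \<Longrightarrow> x' \<in> G1 \<Longrightarrow> ?D i x x' < \<delta>1 \<Longrightarrow> avg_metric (V i) d1 (fst x) (fst x') < \<delta>"
        and G2: "G2 \<in> sets (mp.PQ i)" "measure (mp.PQ i) G2 > 1 - \<alpha>\<^sup>2 / 3"
        and det2: "\<And>x x'. x \<in> G2 \<Longrightarrow> x' \<in> G2 \<Longrightarrow> ?D i x x' < \<delta>2 \<Longrightarrow> avg_metric (V i) d2 (snd x) (snd x') < \<delta>"
        unfolding avg_metric_avg by blast
      show ?case
        by (rule cov_pair_determined[OF s1.net.metric_net_axioms s2.net.metric_net_axioms s3.net.metric_net_axioms so.V
          conv_prob[OF cv1] conv_prob[OF cv2] Y G1 G2 det1 det2 \<alpha> \<delta> \<delta>12]) simp_all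
    qed (use \<delta>12 in simp)
  qed
  ultimately show ?thesis by (rule that)
qed

end

section \<open>Entropies of products\<close>

lemma quenched_subsequence:
  assumes q: "quenched_converges G K d V \<sigma> m \<mu>" and r: "strict_mono r"
  shows "quenched_converges G K d (V \<circ> r) (\<sigma> \<circ> r) (m \<circ> r) \<mu>"
  unfolding quenched_converges_def
proof (intro conjI allI impI)
  show "(m \<circ> r) i \<in> space (prob_algebra (config ((V \<circ> r) i) K d))" for i
    using q by (simp add: quenched_converges_def)
  fix \<O> assume "openin (process_topology G K d) \<O> \<and> \<mu> \<in> \<O>"
  then have l: "(\<lambda>i. real (card {v \<in> V i. distr (m i) (config (carrier G) K d) (pullback_name G (\<sigma> i) v) \<in> \<O>}) / real (card (V i))) \<longlonglongrightarrow> 1"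
    "(\<lambda>i. measure (m i) (good_models G K d (V i) (\<sigma> i) \<O>)) \<longlonglongrightarrow> 1"
    using q by (simp_all add: quenched_converges_def)
  show "(\<lambda>i. real (card {v \<in> (V \<circ> r) i. distr ((m \<circ> r) i) (config (carrier G) K d) (pullback_name G ((\<sigma> \<circ> r) i) v) \<in> \<O>}) / real (card ((V \<circ> r) i))) \<longlonglongrightarrow> 1"
    using LIMSEQ_subseq_LIMSEQ[OF l(1) r] by (simp add: comp_def)
  show "(\<lambda>i. measure ((m \<circ> r) i) (good_models G K d ((V \<circ> r) i) ((\<sigma> \<circ> r) i) \<O>)) \<longlonglongrightarrow> 1"
    using LIMSEQ_subseq_LIMSEQ[OF l(2) r] by (simp add: comp_def)
qed

lemma conv_subsequence:
  assumes c: "conv b G K d V \<sigma> m \<mu>" and r: "strict_mono r"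
  shows "conv b G K d (V \<circ> r) (\<sigma> \<circ> r) (m \<circ> r) \<mu>"
proof (cases b)
  case True
  then have "doubly_quenched_converges G K d V \<sigma> m \<mu>" using c by (simp add: conv_def)
  then have "quenched_converges G (K \<times> K) (avg_prod_metric d) V \<sigma> (\<lambda>i. config_square (V i) K d (m i)) (config_square (carrier G) K d \<mu>)"
    by (simp add: doubly_quenched_converges_def)
  from quenched_subsequence[OF this r] show ?thesis
    using True conv_prob[OF c] by (simp add: conv_def doubly_quenched_converges_def comp_def)
next
  case False
  then show ?thesis using c quenched_subsequence[OF _ r] by (simp add: conv_def)
qed

definition upper_entropy where
  "upper_entropy b G V \<sigma> K d \<mu> = Sup {cov_rate limsup K d (V \<circ> r) m | r m. strict_mono r \<and> conv b G K d (V \<circ> r) (\<sigma> \<circ> r) m \<mu>}"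

definition lower_entropy where
  "lower_entropy b G V \<sigma> K d \<mu> = Sup {cov_rate liminf K d V m | m. conv b G K d V \<sigma> m \<mu>}"

lemma entropy_conv:
  "upper_entropy True = h_dq" "upper_entropy False = h_q" "lower_entropy True = lower_h_dq" "lower_entropy False = lower_h_q"
  by (simp_all add: fun_eq_iff upper_entropy_def lower_entropy_def h_dq_def h_q_def lower_h_dq_def lower_h_q_def conv_def)

lemma upper_entropy_upper:
  "strict_mono r \<Longrightarrow> conv b G K d (V \<circ> r) (\<sigma> \<circ> r) m \<mu> \<Longrightarrow> cov_rate limsup K d (V \<circ> r) m \<le> upper_entropy b G V \<sigma> K d \<mu>"
  unfolding upper_entropy_def by (rule Sup_upper) blast

lemma limsup_mono: "(\<And>i. f i \<le> g i) \<Longrightarrow> limsup f \<le> limsup g" for f g :: "nat \<Rightarrow> ereal"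
  by (intro Limsup_mono always_eventually allI)

lemma liminf_mono: "(\<And>i. f i \<le> g i) \<Longrightarrow> liminf f \<le> liminf g" for f g :: "nat \<Rightarrow> ereal"
  by (intro Liminf_mono always_eventually allI)

lemma Sup_add_le:
  fixes A B :: "ereal set"
  assumes "A \<noteq> {}" "B \<noteq> {}" and A: "\<And>a. a \<in> A \<Longrightarrow> 0 \<le> a" and B: "\<And>b. b \<in> B \<Longrightarrow> 0 \<le> b"
    and le: "\<And>a b. a \<in> A \<Longrightarrow> b \<in> B \<Longrightarrow> a + b \<le> c"
  shows "Sup A + Sup B \<le> c"
proof -
  have "0 \<le> Sup B" using assms(2) B by (meson Sup_upper2 ex_in_conv)
  then have "Sup A + Sup B = (SUP a\<in>A. a + Sup B)" using assms(1) by (subst SUP_ereal_add_left) auto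
  also have "\<dots> \<le> c"
  proof (rule SUP_least)
    fix a assume a: "a \<in> A"
    have "a + Sup B = (SUP b\<in>B. a + b)" using assms(2) A[OF a] by (subst SUP_ereal_add_right) auto
    also have "\<dots> \<le> c" using le[OF a] by (rule SUP_least)
    finally show "a + Sup B \<le> c" .
  qed
  finally show ?thesis .
qed

lemma (in metric_net) cov_rate_nonneg:
  fixes V :: "nat \<Rightarrow> 'v set"
  assumes V: "\<And>i. finite (V i)" "\<And>i. V i \<noteq> {}" and m: "\<And>i. m i \<in> space (prob_algebra (config (V i) K d))"
  shows "0 \<le> cov_rate limsup K d V m" "0 \<le> cov_rate liminf K d V m"
proof -
  have "0 \<le> rate limsup K d V m 1 1" by (rule rate_nonneg(1)[OF V m]) simp_all
  then show "0 \<le> cov_rate limsup K d V m" by (rule order_trans) (rule rate_le_cov_rate, simp_all)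
  have "0 \<le> rate liminf K d V m 1 1" by (rule rate_nonneg(2)[OF V m]) simp_all
  then show "0 \<le> cov_rate liminf K d V m" by (rule order_trans) (rule rate_le_cov_rate, simp_all)
qed

context two_systems
begin

lemma entropy_subadditive:
  assumes sa: "sofic_approximation G V \<sigma>"
  shows "upper_entropy b G V \<sigma> K3 d3 \<theta> \<le> upper_entropy b G V \<sigma> K1 d1 \<mu> \<oplus>\<^sub>- upper_entropy b G V \<sigma> K2 d2 \<nu>"
    (is "_ \<le> ?h1 \<oplus>\<^sub>- ?h2")
  unfolding upper_entropy_def[of b G V \<sigma> K3]
proof (rule Sup_least)
  fix h assume "h \<in> {cov_rate limsup K3 d3 (V \<circ> r) m | r m. strict_mono r \<and> conv b G K3 d3 (V \<circ> r) (\<sigma> \<circ> r) m \<theta>}"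
  then obtain r m3 where r: "strict_mono r" and c3: "conv b G K3 d3 (V \<circ> r) (\<sigma> \<circ> r) m3 \<theta>" and h: "h = cov_rate limsup K3 d3 (V \<circ> r) m3"
    by blast
  define W where "W = V \<circ> r"
  have so: "sofic_sequence G W (\<sigma> \<circ> r)" unfolding W_def by (rule sofic_approximation_subsequence[OF sa r])
  interpret so: sofic_sequence G W "\<sigma> \<circ> r" by (rule so)
  note c3 = c3[folded W_def]
  obtain m1 m2 where c1: "conv b G K1 d1 W (\<sigma> \<circ> r) m1 \<mu>" and c2: "conv b G K2 d2 W (\<sigma> \<circ> r) m2 \<nu>"
    and le: "\<And>\<epsilon> \<delta>. \<epsilon> > 0 \<Longrightarrow> \<delta> > 0 \<Longrightarrow> \<exists>\<delta>'>0. \<forall>\<^sub>F i in sequentially.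
      cov (3 * \<epsilon>) \<delta> (PiE (W i) (\<lambda>_. K3)) (avg_metric (W i) d3) (m3 i) \<le>
      cov \<epsilon> \<delta>' (PiE (W i) (\<lambda>_. K1)) (avg_metric (W i) d1) (m1 i) *
      cov \<epsilon> \<delta>' (PiE (W i) (\<lambda>_. K2)) (avg_metric (W i) d2) (m2 i)"
    using factor_models[OF so c3] by blast
  note p1 = conv_prob[OF c1] and p2 = conv_prob[OF c2] and p3 = conv_prob[OF c3]
  note up = upper_entropy_upper[OF r c1[unfolded W_def], folded W_def] upper_entropy_upper[OF r c2[unfolded W_def], folded W_def]
  have cW: "card (W i) > 0" for i using so.V[of i] by (simp add: card_gt_0_iff)
  have "cov_rate limsup K3 d3 W m3 \<le> cov_rate limsup K1 d1 W m1 + cov_rate limsup K2 d2 W m2"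
    unfolding cov_rate_rate[of _ K3]
  proof (intro SUP_least)
    fix \<delta> \<epsilon> :: real assume "\<delta> \<in> {0<..}" "\<epsilon> \<in> {0<..}"
    then have \<delta>: "\<delta> > 0" and \<epsilon>: "\<epsilon> > 0" by auto
    define e where "e = min \<epsilon> 1 / 3"
    have e: "e > 0" "e \<le> 1" "3 * e \<le> \<epsilon>" "3 * e > 0" using \<epsilon> by (auto simp: e_def)
    obtain \<delta>' where \<delta>': "\<delta>' > 0" and ev: "\<forall>\<^sub>F i in sequentially.
      cov (3 * e) \<delta> (PiE (W i) (\<lambda>_. K3)) (avg_metric (W i) d3) (m3 i) \<le>
      cov e \<delta>' (PiE (W i) (\<lambda>_. K1)) (avg_metric (W i) d1) (m1 i) *
      cov e \<delta>' (PiE (W i) (\<lambda>_. K2)) (avg_metric (W i) d2) (m2 i)"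
      using le[OF e(1) \<delta>] by blast
    let ?a = "\<lambda>i. lrate (cov e \<delta>' (PiE (W i) (\<lambda>_. K1)) (avg_metric (W i) d1) (m1 i)) (card (W i))"
    let ?b = "\<lambda>i. lrate (cov e \<delta>' (PiE (W i) (\<lambda>_. K2)) (avg_metric (W i) d2) (m2 i)) (card (W i))"
    have "rate limsup K3 d3 W m3 \<epsilon> \<delta> \<le> rate limsup K3 d3 W m3 (3 * e) \<delta>"
      by (rule s3.net.rate_antimono[OF so.V p3 limsup_mono e(4) e(3) \<delta> order_refl])
    also have "\<dots> \<le> limsup (\<lambda>i. ?a i + ?b i)"
      unfolding rate_def
    proof (rule Limsup_mono, rule eventually_mono[OF ev])
      fix i assume i: "cov (3 * e) \<delta> (PiE (W i) (\<lambda>_. K3)) (avg_metric (W i) d3) (m3 i) \<le>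
        cov e \<delta>' (PiE (W i) (\<lambda>_. K1)) (avg_metric (W i) d1) (m1 i) *
        cov e \<delta>' (PiE (W i) (\<lambda>_. K2)) (avg_metric (W i) d2) (m2 i)"
      show "lrate (cov (3 * e) \<delta> (PiE (W i) (\<lambda>_. K3)) (avg_metric (W i) d3) (m3 i)) (card (W i)) \<le> ?a i + ?b i"
        using lrate_mono[OF i cW]
        unfolding lrate_mult[OF s1.net.cov_pos[OF so.V p1 e(1,2) \<delta>'] s2.net.cov_pos[OF so.V p2 e(1,2) \<delta>'] cW] .
    qed
    also have "\<dots> \<le> limsup ?a + limsup ?b" by (rule ereal_limsup_add_mono)
    also have "\<dots> \<le> cov_rate limsup K1 d1 W m1 + cov_rate limsup K2 d2 W m2"
      using rate_le_cov_rate[OF e(1) \<delta>', of limsup K1 d1 W m1] rate_le_cov_rate[OF e(1) \<delta>', of limsup K2 d2 W m2]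
      unfolding rate_def by (rule add_mono)
    finally show "rate limsup K3 d3 W m3 \<epsilon> \<delta> \<le> cov_rate limsup K1 d1 W m1 + cov_rate limsup K2 d2 W m2" .
  qed
  also have "\<dots> \<le> ?h1 + ?h2" using up by (rule add_mono)
  finally have "h \<le> ?h1 + ?h2" by (simp add: h W_def)
  moreover have "0 \<le> cov_rate limsup K1 d1 W m1" by (rule s1.net.cov_rate_nonneg(1)[OF so.V p1])
  then have "0 \<le> ?h1" using up(1) by (rule order_trans)
  moreover have "0 \<le> cov_rate limsup K2 d2 W m2" by (rule s2.net.cov_rate_nonneg(1)[OF so.V p2])
  then have "0 \<le> ?h2" using up(2) by (rule order_trans)
  ultimately show "h \<le> ?h1 \<oplus>\<^sub>- ?h2" by (auto simp: plus_minf_def)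
qed

text \<open>The models of the second system are restricted to the subsequence over which the models of the first are given, and
  a limit inferior does not decrease on a subsequence.\<close>

lemma cov_rates_add:
  assumes sa: "sofic_approximation G V \<sigma>" and b: "b \<or> ergodic G \<Omega> TS" and r: "strict_mono r"
    and c1: "conv b G K1 d1 (V \<circ> r) (\<sigma> \<circ> r) m1 \<mu>" and c2: "conv b G K2 d2 V \<sigma> m2 \<nu>"
  shows "cov_rate limsup K1 d1 (V \<circ> r) m1 + cov_rate liminf K2 d2 V m2 \<le> upper_entropy b G V \<sigma> K3 d3 \<theta>"
proof -
  define W where "W = V \<circ> r"
  define m2' where "m2' = m2 \<circ> r"
  have so: "sofic_sequence G W (\<sigma> \<circ> r)" unfolding W_def by (rule sofic_approximation_subsequence[OF sa r])
  interpret so: sofic_sequence G W "\<sigma> \<circ> r" by (rule so)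
  note c1 = c1[folded W_def] and c2' = conv_subsequence[OF c2 r, folded W_def m2'_def]
  have cW: "card (W i) > 0" for i using so.V[of i] by (simp add: card_gt_0_iff)
  obtain m3 where c3: "conv b G K3 d3 W (\<sigma> \<circ> r) m3 \<theta>"
    and le: "\<And>\<alpha> \<delta>. 0 < \<alpha> \<Longrightarrow> \<alpha> \<le> 1 \<Longrightarrow> \<delta> > 0 \<Longrightarrow> \<exists>\<delta>'>0. \<forall>\<^sub>F i in sequentially.
      cov \<alpha> (2 * \<delta>) (PiE (W i) (\<lambda>_. K1)) (avg_metric (W i) d1) (m1 i) *
      cov \<alpha> \<delta> (PiE (W i) (\<lambda>_. K2)) (avg_metric (W i) d2) (m2' i) \<le>
      cov (\<alpha>\<^sup>2 / 3) \<delta>' (PiE (W i) (\<lambda>_. K3)) (avg_metric (W i) d3) (m3 i)"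
    using product_models[OF so c1 c2' b] by blast
  note p1 = conv_prob[OF c1] and p2 = conv_prob[OF c2'] and p3 = conv_prob[OF c3]
  have up: "cov_rate limsup K3 d3 W m3 \<le> upper_entropy b G V \<sigma> K3 d3 \<theta>"
    using upper_entropy_upper[OF r c3[unfolded W_def]] by (simp add: W_def)
  have main: "rate limsup K1 d1 W m1 \<alpha> \<alpha> + rate liminf K2 d2 W m2' \<alpha> \<alpha> \<le> cov_rate limsup K3 d3 W m3"
    if \<alpha>: "0 < \<alpha>" "\<alpha> \<le> 1" for \<alpha>
  proof -
    let ?\<delta> = "\<alpha> / 2"
    have \<delta>: "?\<delta> > 0" "?\<delta> \<le> \<alpha>" and \<alpha>3: "\<alpha>\<^sup>2 / 3 > 0" using \<alpha> by simp_all
    obtain \<delta>' where \<delta>': "\<delta>' > 0" and ev: "\<forall>\<^sub>F i in sequentially.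
      cov \<alpha> (2 * ?\<delta>) (PiE (W i) (\<lambda>_. K1)) (avg_metric (W i) d1) (m1 i) *
      cov \<alpha> ?\<delta> (PiE (W i) (\<lambda>_. K2)) (avg_metric (W i) d2) (m2' i) \<le>
      cov (\<alpha>\<^sup>2 / 3) \<delta>' (PiE (W i) (\<lambda>_. K3)) (avg_metric (W i) d3) (m3 i)"
      using le[OF \<alpha> \<delta>(1)] by blast
    let ?a = "\<lambda>i. lrate (cov \<alpha> \<alpha> (PiE (W i) (\<lambda>_. K1)) (avg_metric (W i) d1) (m1 i)) (card (W i))"
    let ?b = "\<lambda>i. lrate (cov \<alpha> ?\<delta> (PiE (W i) (\<lambda>_. K2)) (avg_metric (W i) d2) (m2' i)) (card (W i))"
    have nn: "0 \<le> ?a i" "0 \<le> ?b i" for i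
      using s1.net.lrate_cov_nonneg[OF so.V p1 \<alpha> \<alpha>(1)] s2.net.lrate_cov_nonneg[OF so.V p2 \<alpha> \<delta>(1)] by simp_all
    have "rate liminf K2 d2 W m2' \<alpha> \<alpha> \<le> rate liminf K2 d2 W m2' \<alpha> ?\<delta>"
      by (rule s2.net.rate_antimono[OF so.V p2 liminf_mono \<alpha>(1) order_refl \<delta>])
    then have "rate limsup K1 d1 W m1 \<alpha> \<alpha> + rate liminf K2 d2 W m2' \<alpha> \<alpha> \<le> limsup ?a + liminf ?b"
      unfolding rate_def by (rule add_left_mono)
    also have "\<dots> \<le> limsup (\<lambda>i. ?a i + ?b i)" by (rule limsup_add_liminf_le[OF nn])
    also have "\<dots> \<le> rate limsup K3 d3 W m3 (\<alpha>\<^sup>2 / 3) \<delta>'"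
      unfolding rate_def
    proof (rule Limsup_mono, rule eventually_mono[OF ev])
      fix i assume i: "cov \<alpha> (2 * ?\<delta>) (PiE (W i) (\<lambda>_. K1)) (avg_metric (W i) d1) (m1 i) *
        cov \<alpha> ?\<delta> (PiE (W i) (\<lambda>_. K2)) (avg_metric (W i) d2) (m2' i) \<le>
        cov (\<alpha>\<^sup>2 / 3) \<delta>' (PiE (W i) (\<lambda>_. K3)) (avg_metric (W i) d3) (m3 i)"
      have two: "2 * ?\<delta> = \<alpha>" by simp
      show "?a i + ?b i \<le> lrate (cov (\<alpha>\<^sup>2 / 3) \<delta>' (PiE (W i) (\<lambda>_. K3)) (avg_metric (W i) d3) (m3 i)) (card (W i))"
        using lrate_mono[OF i[unfolded two] cW]
        unfolding lrate_mult[OF s1.net.cov_pos[OF so.V p1 \<alpha> \<alpha>(1)] s2.net.cov_pos[OF so.V p2 \<alpha> \<delta>(1)] cW] .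
    qed
    also have "\<dots> \<le> cov_rate limsup K3 d3 W m3" by (rule rate_le_cov_rate[OF \<alpha>3 \<delta>'])
    finally show ?thesis .
  qed
  have diag1: "cov_rate limsup K1 d1 W m1 = (SUP n. rate limsup K1 d1 W m1 (1 / real (n + 2)) (1 / real (n + 2)))"
    by (rule s1.net.cov_rate_diagonal(1)[OF so.V p1 limsup_mono])
  have diag2: "cov_rate liminf K2 d2 W m2' = (SUP n. rate liminf K2 d2 W m2' (1 / real (n + 2)) (1 / real (n + 2)))"
    by (rule s2.net.cov_rate_diagonal(1)[OF so.V p2 liminf_mono])
  have "cov_rate liminf K2 d2 V m2 \<le> cov_rate liminf K2 d2 W m2'"
    unfolding cov_rate_rate
  proof (intro SUP_mono')
    fix \<delta> \<epsilon> :: real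
    show "rate liminf K2 d2 V m2 \<epsilon> \<delta> \<le> rate liminf K2 d2 W m2' \<epsilon> \<delta>"
      using liminf_subseq_mono[OF r, of "\<lambda>i. lrate (cov \<epsilon> \<delta> (PiE (V i) (\<lambda>_. K2)) (avg_metric (V i) d2) (m2 i)) (card (V i))"]
      by (simp add: rate_def W_def m2'_def comp_def)
  qed
  then have "cov_rate limsup K1 d1 W m1 + cov_rate liminf K2 d2 V m2 \<le> cov_rate limsup K1 d1 W m1 + cov_rate liminf K2 d2 W m2'"
    by (rule add_left_mono)
  also have "\<dots> = (SUP n. rate limsup K1 d1 W m1 (1 / real (n + 2)) (1 / real (n + 2)) + rate liminf K2 d2 W m2' (1 / real (n + 2)) (1 / real (n + 2)))"
    unfolding diag1 diag2
    by (intro SUP_ereal_add_pos[symmetric] s1.net.cov_rate_diagonal(2)[OF so.V p1 limsup_mono] s2.net.cov_rate_diagonal(2)[OF so.V p2 liminf_mono]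
      s1.net.rate_nonneg(1)[OF so.V p1] s2.net.rate_nonneg(2)[OF so.V p2]) auto
  also have "\<dots> \<le> cov_rate limsup K3 d3 W m3" by (intro SUP_least main) auto
  also note up
  finally show ?thesis by (simp add: W_def)
qed

lemma entropy_superadditive:
  assumes sa: "sofic_approximation G V \<sigma>" and b: "b \<or> ergodic G \<Omega> TS"
    and eq: "upper_entropy b G V \<sigma> K2 d2 \<nu> = lower_entropy b G V \<sigma> K2 d2 \<nu>"
  shows "upper_entropy b G V \<sigma> K1 d1 \<mu> \<oplus>\<^sub>- upper_entropy b G V \<sigma> K2 d2 \<nu> \<le> upper_entropy b G V \<sigma> K3 d3 \<theta>"
proof -
  let ?A = "{cov_rate limsup K1 d1 (V \<circ> r) m | r m. strict_mono r \<and> conv b G K1 d1 (V \<circ> r) (\<sigma> \<circ> r) m \<mu>}"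
  let ?B = "{cov_rate liminf K2 d2 V m | m. conv b G K2 d2 V \<sigma> m \<nu>}"
  show ?thesis
  proof (cases "?A = {} \<or> ?B = {}")
    case True
    then have "Sup ?A = -\<infinity> \<or> Sup ?B = -\<infinity>"
    proof
      assume "?A = {}"
      then show ?thesis by (simp only: Sup_empty bot_ereal_def simp_thms)
    next
      assume "?B = {}"
      then show ?thesis by (simp only: Sup_empty bot_ereal_def simp_thms)
    qed
    then show ?thesis unfolding eq by (auto simp: plus_minf_def upper_entropy_def lower_entropy_def)
  next
    case False
    have V: "finite (V i)" "V i \<noteq> {}" for i using sa by (simp_all add: sofic_approximation_def)
    have "Sup ?A + Sup ?B \<le> upper_entropy b G V \<sigma> K3 d3 \<theta>"
    proof (rule Sup_add_le)
      show "?A \<noteq> {}" "?B \<noteq> {}" using False by blast+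
      show "0 \<le> a" if "a \<in> ?A" for a
      proof -
        obtain r m where a: "a = cov_rate limsup K1 d1 (V \<circ> r) m" and c: "conv b G K1 d1 (V \<circ> r) (\<sigma> \<circ> r) m \<mu>" using \<open>a \<in> ?A\<close> by blast
        show ?thesis unfolding a by (rule s1.net.cov_rate_nonneg(1)[OF _ _ conv_prob[OF c]]) (simp_all add: V)
      qed
      show "0 \<le> a" if "a \<in> ?B" for a
      proof -
        obtain m where a: "a = cov_rate liminf K2 d2 V m" and c: "conv b G K2 d2 V \<sigma> m \<nu>" using \<open>a \<in> ?B\<close> by blast
        show ?thesis unfolding a by (rule s2.net.cov_rate_nonneg(2)[OF V conv_prob[OF c]])
      qed
      show "a + c \<le> upper_entropy b G V \<sigma> K3 d3 \<theta>" if "a \<in> ?A" "c \<in> ?B" for a c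
        using that cov_rates_add[OF sa b] by blast
    qed
    then show ?thesis
      unfolding eq unfolding upper_entropy_def[of b G V \<sigma> K1] lower_entropy_def by (auto simp: plus_minf_def)
  qed
qed

lemma entropy_additive:
  assumes "sofic_approximation G V \<sigma>" "b \<or> ergodic G \<Omega> TS"
    and "upper_entropy b G V \<sigma> K2 d2 \<nu> = lower_entropy b G V \<sigma> K2 d2 \<nu>"
  shows "upper_entropy b G V \<sigma> K3 d3 \<theta> = upper_entropy b G V \<sigma> K1 d1 \<mu> \<oplus>\<^sub>- upper_entropy b G V \<sigma> K2 d2 \<nu>"
  by (rule antisym[OF entropy_subadditive[OF assms(1)] entropy_superadditive[OF assms]])

end

lemma G_system_limit_system:
  assumes "group G" "countable (carrier G)" "G_system G M T" shows "limit_system G M T"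
  using assms by (intro limit_system.intro) (auto simp: G_system_def)

lemma G_system_product:
  assumes M: "G_system G M T" and N: "G_system G N S" and G: "group G" "countable (carrier G)"
  shows "limit_system G (M \<Otimes>\<^sub>M N) (prod_action T S)"
proof (intro limit_system.intro G)
  interpret M: prob_space M using M by (simp add: G_system_def)
  interpret N: prob_space N using N by (simp add: G_system_def)
  interpret MN: pair_prob_space M N ..
  show "prob_space (M \<Otimes>\<^sub>M N)" by (rule MN.prob_space_axioms)
  fix g assume g: "g \<in> carrier G"
  have Tg: "T g \<in> M \<rightarrow>\<^sub>M M" "distr M M (T g) = M" and Sg: "S g \<in> N \<rightarrow>\<^sub>M N" "distr N N (S g) = N"
    using M N g by (simp_all add: G_system_def)
  show "prod_action T S g \<in> M \<Otimes>\<^sub>M N \<rightarrow>\<^sub>M M \<Otimes>\<^sub>M N"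
    unfolding prod_action_def case_prod_unfold
    by (intro measurable_Pair measurable_compose[OF measurable_fst Tg(1)] measurable_compose[OF measurable_snd Sg(1)])
  have "distr M M (T g) \<Otimes>\<^sub>M distr N N (S g) = distr (M \<Otimes>\<^sub>M N) (M \<Otimes>\<^sub>M N) (\<lambda>(x, y). (T g x, S g y))"
    by (rule pair_measure_distr[OF Tg(1) Sg(1)]) (simp add: Sg(2) N.sigma_finite_measure_axioms)
  then show "distr (M \<Otimes>\<^sub>M N) (M \<Otimes>\<^sub>M N) (prod_action T S g) = M \<Otimes>\<^sub>M N"
    unfolding Tg(2) Sg(2) prod_action_def by simp
next
  show "prod_action T S (g \<otimes>\<^bsub>G\<^esub> h) z = prod_action T S g (prod_action T S h z)"
    if "g \<in> carrier G" "h \<in> carrier G" "z \<in> space (M \<Otimes>\<^sub>M N)" for g h z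
    using that M N by (auto simp: G_system_def prod_action_def space_pair_measure)
  show "prod_action T S \<one>\<^bsub>G\<^esub> z = z" if "z \<in> space (M \<Otimes>\<^sub>M N)" for z
    using that M N by (auto simp: G_system_def prod_action_def space_pair_measure)
qed

lemma represents_system_represented:
  assumes L: "limit_system G M T" and R: "represents_system G K d \<mu> M T"
  obtains l \<Phi> \<Psi> where "represented G M T K d l \<Phi> \<mu>" "\<Psi> \<in> config (carrier G) K d \<rightarrow>\<^sub>M M" "AE x in M. \<Psi> (\<Phi> x) = x"
proof -
  interpret L: limit_system G M T by fact
  from R have met: "Metric_space K d" and comp: "compact_space (Metric_space.mtopology K d)"
    and \<mu>: "\<mu> \<in> space (prob_algebra (config (carrier G) K d))"
    by (simp_all add: represents_system_def metric_process_def)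
  from R obtain \<Phi> \<Psi> where \<Phi>: "\<Phi> \<in> M \<rightarrow>\<^sub>M \<mu>" "distr M \<mu> \<Phi> = \<mu>" and \<Psi>: "\<Psi> \<in> \<mu> \<rightarrow>\<^sub>M M" "AE x in M. \<Psi> (\<Phi> x) = x"
    and eqv: "\<And>g. g \<in> carrier G \<Longrightarrow> AE x in M. \<Phi> (T g x) = shift G g (\<Phi> x)"
    unfolding represents_system_def isomorphic_systems_def by blast
  note q = prob_space_square[OF \<mu>]
  have one: "\<one>\<^bsub>G\<^esub> \<in> carrier G" using group.is_monoid[OF L.group] by (rule monoid.one_closed)
  have "K \<noteq> {}"
  proof
    assume "K = {}"
    then have "PiE (carrier G) (\<lambda>_. K) = {}" using one by (auto simp: PiE_eq_empty_iff)
    then have "space \<mu> = {}" using q(3) by (simp add: space_PiM metric_borel_def space_measure_of_conv)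
    then show False using prob_space.not_empty[OF q(1)] by simp
  qed
  then obtain l where net: "metric_net K d l" using metric_net_exists[OF met comp] by blast
  have \<Phi>': "\<Phi> \<in> M \<rightarrow>\<^sub>M config (carrier G) K d" using \<Phi>(1) measurable_cong_sets[OF refl q(2)] by blast
  show ?thesis
  proof (rule that)
    have "distr M (config (carrier G) K d) \<Phi> = distr M \<mu> \<Phi>" by (rule distr_cong) (simp_all add: q(2))
    then show "represented G M T K d l \<Phi> \<mu>"
      using \<Phi>(2) eqv by (intro represented.intro represented_axioms.intro L net \<Phi>') simp_all
    show "\<Psi> \<in> config (carrier G) K d \<rightarrow>\<^sub>M M" using \<Psi>(1) measurable_cong_sets[OF q(2) refl] by blast
    show "AE x in M. \<Psi> (\<Phi> x) = x" by (rule \<Psi>(2))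
  qed
qed

theorem theoremC:
  fixes G :: "('g, 'm) monoid_scheme"
    and V :: "nat \<Rightarrow> 'v set" and \<sigma> :: "nat \<Rightarrow> 'g \<Rightarrow> 'v \<Rightarrow> 'v"
    and M :: "'x measure" and T :: "'g \<Rightarrow> 'x \<Rightarrow> 'x"
    and N :: "'y measure" and S :: "'g \<Rightarrow> 'y \<Rightarrow> 'y"
    and K\<^sub>1 :: "'a set" and d\<^sub>1 :: "'a \<Rightarrow> 'a \<Rightarrow> real" and \<mu> :: "('g \<Rightarrow> 'a) measure"
    and K\<^sub>2 :: "'b set" and d\<^sub>2 :: "'b \<Rightarrow> 'b \<Rightarrow> real" and \<nu> :: "('g \<Rightarrow> 'b) measure"
    and K\<^sub>3 :: "'c set" and d\<^sub>3 :: "'c \<Rightarrow> 'c \<Rightarrow> real" and \<theta> :: "('g \<Rightarrow> 'c) measure"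
  assumes "group G" and "countable (carrier G)"
    and "sofic_approximation G V \<sigma>"
    and "G_system G M T" and "G_system G N S"
    and "represents_system G K\<^sub>1 d\<^sub>1 \<mu> M T"
    and "represents_system G K\<^sub>2 d\<^sub>2 \<nu> N S"
    and "represents_system G K\<^sub>3 d\<^sub>3 \<theta> (M \<Otimes>\<^sub>M N) (prod_action T S)"
  shows
    "h_dq G V \<sigma> K\<^sub>3 d\<^sub>3 \<theta> \<le> h_dq G V \<sigma> K\<^sub>1 d\<^sub>1 \<mu> \<oplus>\<^sub>- h_dq G V \<sigma> K\<^sub>2 d\<^sub>2 \<nu>
     \<and> h_q G V \<sigma> K\<^sub>3 d\<^sub>3 \<theta> \<le> h_q G V \<sigma> K\<^sub>1 d\<^sub>1 \<mu> \<oplus>\<^sub>- h_q G V \<sigma> K\<^sub>2 d\<^sub>2 \<nu>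
     \<and> (h_dq G V \<sigma> K\<^sub>2 d\<^sub>2 \<nu> = lower_h_dq G V \<sigma> K\<^sub>2 d\<^sub>2 \<nu> \<longrightarrow>
          h_dq G V \<sigma> K\<^sub>3 d\<^sub>3 \<theta> = h_dq G V \<sigma> K\<^sub>1 d\<^sub>1 \<mu> \<oplus>\<^sub>- h_dq G V \<sigma> K\<^sub>2 d\<^sub>2 \<nu>)
     \<and> (ergodic G (M \<Otimes>\<^sub>M N) (prod_action T S) \<longrightarrow>
          h_q G V \<sigma> K\<^sub>2 d\<^sub>2 \<nu> = lower_h_q G V \<sigma> K\<^sub>2 d\<^sub>2 \<nu> \<longrightarrow>
          h_q G V \<sigma> K\<^sub>3 d\<^sub>3 \<theta> = h_q G V \<sigma> K\<^sub>1 d\<^sub>1 \<mu> \<oplus>\<^sub>- h_q G V \<sigma> K\<^sub>2 d\<^sub>2 \<nu>)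
     \<and> (ergodic G M T \<and> ergodic G N S \<and> (weakly_mixing G M T \<or> weakly_mixing G N S) \<longrightarrow>
          ergodic G (M \<Otimes>\<^sub>M N) (prod_action T S) \<and>
          (h_q G V \<sigma> K\<^sub>2 d\<^sub>2 \<nu> = lower_h_q G V \<sigma> K\<^sub>2 d\<^sub>2 \<nu> \<longrightarrow>
           h_q G V \<sigma> K\<^sub>3 d\<^sub>3 \<theta> = h_q G V \<sigma> K\<^sub>1 d\<^sub>1 \<mu> \<oplus>\<^sub>- h_q G V \<sigma> K\<^sub>2 d\<^sub>2 \<nu>))"
proof -
  note G = assms(1,2) and sa = assms(3) and M = assms(4) and N = assms(5)
  note LM = G_system_limit_system[OF G M] and LN = G_system_limit_system[OF G N] and LMN = G_system_product[OF M N G]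
  obtain l\<^sub>1 \<Phi>\<^sub>1 \<Psi>\<^sub>1 where r1: "represented G M T K\<^sub>1 d\<^sub>1 l\<^sub>1 \<Phi>\<^sub>1 \<mu>" "\<Psi>\<^sub>1 \<in> config (carrier G) K\<^sub>1 d\<^sub>1 \<rightarrow>\<^sub>M M" "AE x in M. \<Psi>\<^sub>1 (\<Phi>\<^sub>1 x) = x"
    by (rule represents_system_represented[OF LM assms(6)])
  obtain l\<^sub>2 \<Phi>\<^sub>2 \<Psi>\<^sub>2 where r2: "represented G N S K\<^sub>2 d\<^sub>2 l\<^sub>2 \<Phi>\<^sub>2 \<nu>" "\<Psi>\<^sub>2 \<in> config (carrier G) K\<^sub>2 d\<^sub>2 \<rightarrow>\<^sub>M N" "AE x in N. \<Psi>\<^sub>2 (\<Phi>\<^sub>2 x) = x"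
    by (rule represents_system_represented[OF LN assms(7)])
  obtain l\<^sub>3 \<Phi>\<^sub>3 \<Psi>\<^sub>3 where r3: "represented G (M \<Otimes>\<^sub>M N) (prod_action T S) K\<^sub>3 d\<^sub>3 l\<^sub>3 \<Phi>\<^sub>3 \<theta>"
      "\<Psi>\<^sub>3 \<in> config (carrier G) K\<^sub>3 d\<^sub>3 \<rightarrow>\<^sub>M M \<Otimes>\<^sub>M N" "AE x in M \<Otimes>\<^sub>M N. \<Psi>\<^sub>3 (\<Phi>\<^sub>3 x) = x"
    by (rule represents_system_represented[OF LMN assms(8)])
  have TS: "two_systems G M T K\<^sub>1 d\<^sub>1 l\<^sub>1 \<Phi>\<^sub>1 \<mu> N S K\<^sub>2 d\<^sub>2 l\<^sub>2 \<Phi>\<^sub>2 \<nu> K\<^sub>3 d\<^sub>3 l\<^sub>3 \<Phi>\<^sub>3 \<theta> \<Psi>\<^sub>1 \<Psi>\<^sub>2 \<Psi>\<^sub>3"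
    by (intro two_systems.intro two_systems_axioms.intro r1 r2 r3)
  note sub = two_systems.entropy_subadditive[OF TS sa] and add = two_systems.entropy_additive[OF TS sa]
  have sub_dq: "h_dq G V \<sigma> K\<^sub>3 d\<^sub>3 \<theta> \<le> h_dq G V \<sigma> K\<^sub>1 d\<^sub>1 \<mu> \<oplus>\<^sub>- h_dq G V \<sigma> K\<^sub>2 d\<^sub>2 \<nu>"
    using sub[of True] unfolding entropy_conv .
  have sub_q: "h_q G V \<sigma> K\<^sub>3 d\<^sub>3 \<theta> \<le> h_q G V \<sigma> K\<^sub>1 d\<^sub>1 \<mu> \<oplus>\<^sub>- h_q G V \<sigma> K\<^sub>2 d\<^sub>2 \<nu>"
    using sub[of False] unfolding entropy_conv .
  have add_dq: "h_dq G V \<sigma> K\<^sub>3 d\<^sub>3 \<theta> = h_dq G V \<sigma> K\<^sub>1 d\<^sub>1 \<mu> \<oplus>\<^sub>- h_dq G V \<sigma> K\<^sub>2 d\<^sub>2 \<nu>"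
    if "h_dq G V \<sigma> K\<^sub>2 d\<^sub>2 \<nu> = lower_h_dq G V \<sigma> K\<^sub>2 d\<^sub>2 \<nu>"
    using add[of True] that unfolding entropy_conv by blast
  have add_q: "h_q G V \<sigma> K\<^sub>3 d\<^sub>3 \<theta> = h_q G V \<sigma> K\<^sub>1 d\<^sub>1 \<mu> \<oplus>\<^sub>- h_q G V \<sigma> K\<^sub>2 d\<^sub>2 \<nu>"
    if "ergodic G (M \<Otimes>\<^sub>M N) (prod_action T S)" "h_q G V \<sigma> K\<^sub>2 d\<^sub>2 \<nu> = lower_h_q G V \<sigma> K\<^sub>2 d\<^sub>2 \<nu>"
    using add[of False] that unfolding entropy_conv by blast
  have PM: "prob_space M" "\<And>g. g \<in> carrier G \<Longrightarrow> T g \<in> M \<rightarrow>\<^sub>M M \<and> distr M M (T g) = M"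
    and PN: "prob_space N" "\<And>g. g \<in> carrier G \<Longrightarrow> S g \<in> N \<rightarrow>\<^sub>M N \<and> distr N N (S g) = N"
    using M N by (simp_all add: G_system_def)
  have erg: "ergodic G (M \<Otimes>\<^sub>M N) (prod_action T S)"
    if e: "ergodic G M T" "ergodic G N S" and w: "weakly_mixing G M T \<or> weakly_mixing G N S"
    using w
  proof
    assume "weakly_mixing G M T"
    from ergodic_product[OF PM(1) PN(1) PM(2) PN(2) this e(2)] show ?thesis .
  next
    assume "weakly_mixing G N S"
    from ergodic_swap[OF PM(1) PN(1) ergodic_product[OF PN(1) PM(1) PN(2) PM(2) this e(1)]] show ?thesis .
  qed
  show ?thesis using sub_dq sub_q add_dq add_q erg by blast
qed

end
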